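(* Let $G$, $H_0$, $V=vUv^*$, $H=H_0+V$, $R(\kappa)=(H+\kappa^2)^{-1}$ be as in the context, and assume that $V$ satisfies the assumption $(\mathrm A_\beta)$ of the context for some integer $\beta\ge2$. Assume that the threshold $0$ is a regular point, i.e. $\mathcal E=\mathsf E=\{0\}$. Let $G_0$ and, if $\beta\ge3$, $G_1$ be the coefficients of $\kappa^0$ and $\kappa^1$ in the asymptotic expansion $R(\kappa)=\sum_{j=0}^{\beta-2}\kappa^jG_j+\mathcal O(\kappa^{\beta-1})$ in $\mathcal B^\beta$ as $\kappa\to0$, $\mathop{\mathrm{Re}}\kappa>0$. Then $$G_0=G_{0,0}-G_{0,0}vM_0^\dagger v^*G_{0,0},\qquad G_1=-\widetilde{\mathcal P},$$ where $\widetilde{\mathcal P}$ is the orthogonal non-resonance projection, which is uniquely determined (independent of the choice of orthonormal non-resonance basis) because $\mathcal E=\{0\}$.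
   Context: Graph. Let $(K,E_0)$ be a connected, finite, undirected, simple graph (no loops, no multiple edges), and for $\alpha=1,\dots,N$ let $(L_\alpha,E_\alpha)$ be a copy of the discrete half-line, $L_\alpha=\{1,2,\dots\}$, $E_\alpha=\{\{n,n+1\}: n\in L_\alpha\}$. Fix vertices $x_1,\dots,x_N\in K$ (not necessarily distinct). Let $G=K\cup L_1\cup\dots\cup L_N$ (disjoint union), with edges those of $E_0,E_1,\dots,E_N$ together with $\{x_\alpha,1^{(\alpha)}\}$, $\alpha=1,\dots,N$, where $1^{(\alpha)}$ is the point $1\in L_\alpha$. Free operator. For $u\colon K\to\mathbb C$ set $(h_0u)[x]=\sum_{y\in K,\{x,y\}\in E_0}(u[x]-u[y])+\sum_{\alpha=1}^Ns_\alpha[x]u[x]$, where $s_\alpha[x]=1$ if $x=x_\alpha$ and $0$ otherwise. For $u\colon L_\alpha\to\mathbb C$ set $(h_\alpha u)[1]=2u[1]-u[2]$ and $(h_\alpha u)[n]=2u[n]-u[n+1]-u[n-1]$ for $n\ge2$. Let $H_0=h_0\oplus h_1\oplus\dots\oplus h_N$, acting on all functions on $G$ decomposed as functions on $K,L_1,\dots,L_N$; on $\mathcal H=\ell^2(G)$ it is bounded and self-adjoint. The operator $h_0$ is invertible. Spaces. For $s\in\mathbb R$, $\mathcal L^s=\ell^{1,s}(G)$ is the space of $u\colon G\to\mathbb C$ with $\sum_{x\in K}|u[x]|+\sum_{\alpha}\sum_{n\in L_\alpha}(1+n^2)^{s/2}|u[n]|<\infty$; its dual $(\mathcal L^s)^*=\ell^{\infty,-s}(G)$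 is the space of $u$ with $\sup_{x\in K}|u[x]|<\infty$ and $\sup_{n\in L_\alpha}(1+n^2)^{-s/2}|u[n]|<\infty$ for all $\alpha$. Put $\mathcal B^s=\mathcal B(\mathcal L^s,(\mathcal L^s)^* )$. $\langle u,w\rangle=\sum_{x\in G}\overline{u[x]}w[x]$ whenever this converges absolutely, and $|\Psi\rangle\langle\Phi|$ is the operator $u\mapsto\langle\Phi,u\rangle\Psi$. $(\Phi\cdot\Psi)[x]=\Phi[x]\Psi[x]$ is the pointwise product. Assumption $(\mathrm A_\beta)$, $\beta\ge1$: $V\in\mathcal B(\mathcal H)$ is self-adjoint, and there exist a Hilbert space $\mathcal K$, an injective operator $v\in\mathcal B(\mathcal K,\mathcal L^\beta)$ and a self-adjoint unitary operator $U\in\mathcal B(\mathcal K)$ such that $V=vUv^*\in\mathcal B((\mathcal L^\beta)^*,\mathcal L^\beta)$; such $\mathcal K,v,U$ are fixed. Put $H=H_0+V$ and $R(\kappa)=(H+\kappa^2)^{-1}$ for $-\kappa^2\notin\sigma(H)$. Operators. $G_{0,0}=g_{0,0}\oplus g_{1,0}\oplus\dots\oplus g_{N,0}$, where $g_{0,0}=h_0^{-1}$ on functions on $K$ and, for $\alpha\ge1$, $g_{\alpha,0}$ has kernel $g_{\alpha,0}[n,m]=\min\{n,m\}$ on $L_\alpha$. $M_0=U+v^*G_{0,0}v\in\mathcal B(\mathcal K)$ (self-adjoint), and $M_0^\dagger$ is its pseudo-inverse: zero on $\mathop{\mathrm{Ker}}M_0$ and the inverse of $M_0|_{(\mathop{\mathrm{Ker}}M_0)^\perp}$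 on $(\mathop{\mathrm{Ker}}M_0)^\perp$. Eigenspaces. Let $\mathbf n^{(\alpha)}[x]=m$ if $x=m\in L_\alpha$ and $0$ otherwise; $\mathbf 1^{(\alpha)}[x]=1$ if $x\in L_\alpha$ and $0$ otherwise; $\mathbb C\mathbf n=\bigoplus_\alpha\mathbb C\mathbf n^{(\alpha)}$, $\mathbb C\mathbf 1=\bigoplus_\alpha\mathbb C\mathbf 1^{(\alpha)}$. Define $\widetilde{\mathcal E}=\{\Psi\in(\mathcal L^\beta)^*: H\Psi=0\}$, $\mathcal E=\widetilde{\mathcal E}\cap(\mathbb C\mathbf 1\oplus\mathcal L^{\beta-2})$, $\mathsf E=\widetilde{\mathcal E}\cap\mathcal L^{\beta-2}$. Non-resonance projection. A set $\{\Psi_\gamma\}\subset\widetilde{\mathcal E}$ is an orthonormal non-resonance basis if the classes $[\Psi_\gamma]$ form a basis of $\widetilde{\mathcal E}/\mathcal E$, for every $\gamma$ and every $\Psi\in\mathsf E$ one has $\overline\Psi\cdot\Psi_\gamma\in\mathcal L^0$ and $\langle\Psi,\Psi_\gamma\rangle=0$, and there is an orthonormal system $\{c^{(\gamma)}\}\subset\mathbb C^N$ such that $\Psi_\gamma-\sum_\alpha c_\alpha^{(\gamma)}\mathbf n^{(\alpha)}\in\mathbb C\mathbf 1\oplus\mathcal L^{\beta-2}$ for every $\gamma$. The associated orthogonal non-resonance projection is $\widetilde{\mathcal P}=\sum_\gamma|\Psi_\gamma\rangle\langle\Psi_\gamma|$. *)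

theory Defs
  imports "HOL-Analysis.Analysis" "HOL-Library.Function_Algebras" "HOL-Library.Landau_Symbols"
begin

section \<open>Complex Hilbert spaces\<close>

class complex_vector = ab_group_add +
  fixes scaleC :: "complex \<Rightarrow> 'a \<Rightarrow> 'a"  (infixr "*\<^sub>C" 75)
  assumes scaleC_add_right: "c *\<^sub>C (x + y) = c *\<^sub>C x + c *\<^sub>C y"
    and scaleC_add_left: "(c + d) *\<^sub>C x = c *\<^sub>C x + d *\<^sub>C x"
    and scaleC_scaleC: "c *\<^sub>C d *\<^sub>C x = (c * d) *\<^sub>C x"
    and scaleC_one: "1 *\<^sub>C x = x"

text \<open>Inner products are antilinear in the first and linear in the second argument.\<close>

class complex_hilbert = complex_vector + banach +
  fixes cinner :: "'a \<Rightarrow> 'a \<Rightarrow> complex"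
  assumes scaleC_of_real: "complex_of_real r *\<^sub>C x = r *\<^sub>R x"
    and cinner_commute: "cinner x y = cnj (cinner y x)"
    and cinner_add_right: "cinner x (y + z) = cinner x y + cinner x z"
    and cinner_scaleC_right: "cinner x (c *\<^sub>C y) = c * cinner x y"
    and cinner_self_nonneg: "0 \<le> Re (cinner x x)"
    and norm_eq_sqrt_cinner: "norm x = sqrt (Re (cinner x x))"

instantiation complex :: complex_hilbert
begin

definition scaleC_complex :: "complex \<Rightarrow> complex \<Rightarrow> complex" where
  "scaleC_complex c x = c * x"

definition cinner_complex :: "complex \<Rightarrow> complex \<Rightarrow> complex" where
  "cinner_complex x y = cnj x * y"

instance
  by standard
    (auto simp: scaleC_complex_def cinner_complex_def algebra_simps scaleR_conv_of_real
      cmod_def power2_eq_square)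

end

instantiation "fun" :: (type, complex_vector) complex_vector
begin

definition scaleC_fun :: "complex \<Rightarrow> ('a \<Rightarrow> 'b) \<Rightarrow> 'a \<Rightarrow> 'b" where
  "scaleC_fun c f = (\<lambda>x. c *\<^sub>C f x)"

instance
  by standard
    (auto simp: scaleC_fun_def fun_eq_iff scaleC_add_right scaleC_add_left scaleC_scaleC scaleC_one)

end

definition linear_on :: "'a::complex_vector set \<Rightarrow> ('a \<Rightarrow> 'b::complex_vector) \<Rightarrow> bool" where
  "linear_on S T \<longleftrightarrow>
     (\<forall>u\<in>S. \<forall>w\<in>S. T (u + w) = T u + T w) \<and> (\<forall>c. \<forall>u\<in>S. T (c *\<^sub>C u) = c *\<^sub>C T u)"

text \<open>\<open>bounded_op S p T q A\<close> says that \<open>A\<close> is a bounded operator from the space with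
  carrier \<open>S\<close> and norm \<open>p\<close> to the one with carrier \<open>T\<close> and norm \<open>q\<close>;
  values of \<open>A\<close> outside \<open>S\<close> are irrelevant.\<close>

definition bounded_op ::
  "'a::complex_vector set \<Rightarrow> ('a \<Rightarrow> real) \<Rightarrow> 'b::complex_vector set \<Rightarrow> ('b \<Rightarrow> real) \<Rightarrow> ('a \<Rightarrow> 'b) \<Rightarrow> bool"
  where
  "bounded_op S p T q A \<longleftrightarrow>
     A ` S \<subseteq> T \<and> linear_on S A \<and> (\<exists>C. \<forall>u\<in>S. q (A u) \<le> C * p u)"

section \<open>The graph and the free operator\<close>

text \<open>The finite graph is the type \<open>'a\<close> with a symmetric, irreflexive edge relation, and the
  rays are indexed by the finite type \<open>'n\<close>, so that the number of rays is \<open>CARD('n)\<close>.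
  The vertex \<open>Ray \<alpha> n\<close> is the point \<open>n + 1\<close> of the half-line \<open>{1, 2, \<dots>}\<close>.
  The edges joining the rays to the finite graph do not enter the free operator, which is a
  direct sum.\<close>

datatype ('a, 'n) vertex = Core 'a | Ray 'n nat

type_synonym ('a, 'n) gfun = "('a, 'n) vertex \<Rightarrow> complex"

definition direct_sum ::
  "(('a \<Rightarrow> complex) \<Rightarrow> 'a \<Rightarrow> complex) \<Rightarrow> ((nat \<Rightarrow> complex) \<Rightarrow> nat \<Rightarrow> complex)
     \<Rightarrow> ('a, 'n) gfun \<Rightarrow> ('a, 'n) gfun" where
  "direct_sum A B u z =
     (case z of Core x \<Rightarrow> A (\<lambda>y. u (Core y)) x | Ray \<alpha> n \<Rightarrow> B (\<lambda>m. u (Ray \<alpha> m)) n)"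

definition core_op ::
  "('a::finite \<times> 'a) set \<Rightarrow> ('n::finite \<Rightarrow> 'a) \<Rightarrow> ('a \<Rightarrow> complex) \<Rightarrow> 'a \<Rightarrow> complex" where
  "core_op E att u x =
     (\<Sum>y\<in>E `` {x}. u x - u y) + (\<Sum>\<alpha>\<in>UNIV. (if x = att \<alpha> then 1 else 0) * u x)"

fun ray_op :: "(nat \<Rightarrow> complex) \<Rightarrow> nat \<Rightarrow> complex" where
  "ray_op u 0 = 2 * u 0 - u 1"
| "ray_op u (Suc n) = 2 * u (Suc n) - u (Suc (Suc n)) - u n"

definition free_op ::
  "('a::finite \<times> 'a) set \<Rightarrow> ('n::finite \<Rightarrow> 'a) \<Rightarrow> ('a, 'n) gfun \<Rightarrow> ('a, 'n) gfun" where
  "free_op E att = direct_sum (core_op E att) ray_op"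

definition hamiltonian ::
  "('a::finite \<times> 'a) set \<Rightarrow> ('n::finite \<Rightarrow> 'a) \<Rightarrow> (('a, 'n) gfun \<Rightarrow> ('a, 'n) gfun)
     \<Rightarrow> ('a, 'n) gfun \<Rightarrow> ('a, 'n) gfun" where
  "hamiltonian E att V u = free_op E att u + V u"

text \<open>The kernel of \<open>ray_green\<close> is \<open>min n m\<close> in the coordinates of \<open>{1, 2, \<dots>}\<close>.\<close>

definition ray_green :: "(nat \<Rightarrow> complex) \<Rightarrow> nat \<Rightarrow> complex" where
  "ray_green u n = (\<Sum>\<^sub>\<infinity>m. of_nat (min (Suc n) (Suc m)) * u m)"

definition free_green ::
  "('a::finite \<times> 'a) set \<Rightarrow> ('n::finite \<Rightarrow> 'a) \<Rightarrow> ('a, 'n) gfun \<Rightarrow> ('a, 'n) gfun" where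
  "free_green E att = direct_sum (inv (core_op E att)) ray_green"

section \<open>Function spaces\<close>

definition pairing :: "('x \<Rightarrow> complex) \<Rightarrow> ('x \<Rightarrow> complex) \<Rightarrow> complex" where
  "pairing u w = (\<Sum>\<^sub>\<infinity>x. cnj (u x) * w x)"

fun weight :: "real \<Rightarrow> ('a, 'n) vertex \<Rightarrow> real" where
  "weight s (Core x) = 1"
| "weight s (Ray \<alpha> n) = (1 + (real (Suc n))\<^sup>2) powr (s / 2)"

definition l1_space :: "real \<Rightarrow> ('a, 'n) gfun set" where
  "l1_space s = {u. (\<lambda>x. weight s x * cmod (u x)) summable_on UNIV}"

definition l1_norm :: "real \<Rightarrow> ('a, 'n) gfun \<Rightarrow> real" where
  "l1_norm s u = (\<Sum>\<^sub>\<infinity>x. weight s x * cmod (u x))"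

text \<open>\<open>linf_space s\<close> is the dual of \<open>l1_space s\<close>, that is, the weighted space
  with exponent \<open>- s\<close>.\<close>

definition linf_space :: "real \<Rightarrow> ('a, 'n) gfun set" where
  "linf_space s = {u. bdd_above (range (\<lambda>x. weight (- s) x * cmod (u x)))}"

definition linf_norm :: "real \<Rightarrow> ('a, 'n) gfun \<Rightarrow> real" where
  "linf_norm s u = (SUP x. weight (- s) x * cmod (u x))"

definition l2_space :: "('a, 'n) gfun set" where
  "l2_space = {u. (\<lambda>x. (cmod (u x))\<^sup>2) summable_on UNIV}"

definition l2_norm :: "('a, 'n) gfun \<Rightarrow> real" where
  "l2_norm u = sqrt (\<Sum>\<^sub>\<infinity>x. (cmod (u x))\<^sup>2)"

abbreviation bounded_l1_linf :: "real \<Rightarrow> (('a, 'n) gfun \<Rightarrow> ('a, 'n) gfun) \<Rightarrow> bool" where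
  "bounded_l1_linf s \<equiv> bounded_op (l1_space s) (l1_norm s) (linf_space s) (linf_norm s)"

abbreviation bounded_l2 :: "(('a, 'n) gfun \<Rightarrow> ('a, 'n) gfun) \<Rightarrow> bool" where
  "bounded_l2 \<equiv> bounded_op l2_space l2_norm l2_space l2_norm"

text \<open>The operator norm from \<open>l1_space s\<close> to \<open>linf_space s\<close>.\<close>

definition op_norm :: "real \<Rightarrow> (('a, 'n) gfun \<Rightarrow> ('a, 'n) gfun) \<Rightarrow> real" where
  "op_norm s T = (SUP u\<in>{u \<in> l1_space s. l1_norm s u \<le> 1}. linf_norm s (T u))"

section \<open>The perturbation\<close>

text \<open>The adjoint of \<open>v\<close> is taken with respect to the pairing of \<open>l1_space s\<close> with its dual.\<close>

definition dual_adjoint ::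
  "('k::complex_hilbert \<Rightarrow> ('a, 'n) gfun) \<Rightarrow> ('a, 'n) gfun \<Rightarrow> 'k" where
  "dual_adjoint v u = (THE \<phi>. \<forall>\<psi>. cinner \<phi> \<psi> = pairing u (v \<psi>))"

definition selfadjoint_unitary :: "('k::complex_hilbert \<Rightarrow> 'k) \<Rightarrow> bool" where
  "selfadjoint_unitary U \<longleftrightarrow>
     bounded_op UNIV norm UNIV norm U \<and>
     (\<forall>\<phi> \<psi>. cinner (U \<phi>) \<psi> = cinner \<phi> (U \<psi>)) \<and>
     surj U \<and> (\<forall>\<phi> \<psi>. cinner (U \<phi>) (U \<psi>) = cinner \<phi> \<psi>)"

definition perturbation ::
  "real \<Rightarrow> (('a, 'n) gfun \<Rightarrow> ('a, 'n) gfun) \<Rightarrow> ('k::complex_hilbert \<Rightarrow> ('a, 'n) gfun)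
     \<Rightarrow> ('k \<Rightarrow> 'k) \<Rightarrow> bool" where
  "perturbation s V v U \<longleftrightarrow>
     bounded_l2 V \<and> (\<forall>u\<in>l2_space. \<forall>w\<in>l2_space. pairing (V u) w = pairing u (V w)) \<and>
     bounded_op UNIV norm (l1_space s) (l1_norm s) v \<and> inj v \<and>
     selfadjoint_unitary U \<and>
     bounded_op (linf_space s) (linf_norm s) (l1_space s) (l1_norm s) V \<and>
     (\<forall>u\<in>linf_space s. V u = v (U (dual_adjoint v u)))"

definition M0 ::
  "('a::finite \<times> 'a) set \<Rightarrow> ('n::finite \<Rightarrow> 'a) \<Rightarrow> ('k::complex_hilbert \<Rightarrow> ('a, 'n) gfun)
     \<Rightarrow> ('k \<Rightarrow> 'k) \<Rightarrow> 'k \<Rightarrow> 'k" where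
  "M0 E att v U \<phi> = U \<phi> + dual_adjoint v (free_green E att (v \<phi>))"

definition ker_op :: "('k::complex_hilbert \<Rightarrow> 'k) \<Rightarrow> 'k set" where
  "ker_op M = {\<phi>. M \<phi> = 0}"

definition ortho :: "'k::complex_hilbert set \<Rightarrow> 'k set" where
  "ortho S = {\<phi>. \<forall>\<psi>\<in>S. cinner \<psi> \<phi> = 0}"

definition pseudo_inverse :: "('k::complex_hilbert \<Rightarrow> 'k) \<Rightarrow> 'k \<Rightarrow> 'k" where
  "pseudo_inverse M =
     (THE N. linear_on UNIV N \<and> (\<forall>\<phi>\<in>ker_op M. N \<phi> = 0) \<and>
        (\<forall>\<phi>\<in>ortho (ker_op M). N \<phi> \<in> ortho (ker_op M) \<and> M (N \<phi>) = \<phi> \<and> N (M \<phi>) = \<phi>))"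

section \<open>Resolvent and its expansion\<close>

definition spectrum_l2 :: "(('a, 'n) gfun \<Rightarrow> ('a, 'n) gfun) \<Rightarrow> complex set" where
  "spectrum_l2 A =
     {z. \<not> (bij_betw (\<lambda>u. A u - z *\<^sub>C u) l2_space l2_space \<and>
            bounded_l2 (the_inv_into l2_space (\<lambda>u. A u - z *\<^sub>C u)))}"

definition resolvent ::
  "(('a, 'n) gfun \<Rightarrow> ('a, 'n) gfun) \<Rightarrow> complex \<Rightarrow> ('a, 'n) gfun \<Rightarrow> ('a, 'n) gfun" where
  "resolvent A \<kappa> = the_inv_into l2_space (\<lambda>u. A u + \<kappa>\<^sup>2 *\<^sub>C u)"

definition right_half_plane_0 :: "complex filter" where
  "right_half_plane_0 = at 0 within {\<kappa>. 0 < Re \<kappa>}"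

text \<open>The expansion of the resolvent up to an error of order \<open>\<kappa> ^ (b - 1)\<close>; it is meant
  for \<open>b \<ge> 2\<close>. It includes that the resolvent exists for all relevant \<open>\<kappa>\<close> near 0.\<close>

definition resolvent_expansion ::
  "nat \<Rightarrow> (('a, 'n) gfun \<Rightarrow> ('a, 'n) gfun) \<Rightarrow> (nat \<Rightarrow> ('a, 'n) gfun \<Rightarrow> ('a, 'n) gfun) \<Rightarrow> bool"
  where
  "resolvent_expansion b A G \<longleftrightarrow>
     (\<forall>j\<le>b - 2. bounded_l1_linf (real b) (G j)) \<and>
     (\<forall>\<^sub>F \<kappa> in right_half_plane_0. - \<kappa>\<^sup>2 \<notin> spectrum_l2 A) \<and>
     (\<lambda>\<kappa>. op_norm (real b) (\<lambda>u. resolvent A \<kappa> u - (\<Sum>j\<le>b - 2. \<kappa> ^ j *\<^sub>C G j u)))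
       \<in> O[right_half_plane_0](\<lambda>\<kappa>. cmod \<kappa> ^ (b - 1))"

section \<open>Generalized eigenspaces and the non-resonance projection\<close>

definition ray_lin :: "'n \<Rightarrow> ('a, 'n) gfun" where
  "ray_lin \<alpha> z =
     (case z of Core x \<Rightarrow> 0 | Ray \<alpha>' n \<Rightarrow> if \<alpha>' = \<alpha> then of_nat (Suc n) else 0)"

definition ray_one :: "'n \<Rightarrow> ('a, 'n) gfun" where
  "ray_one \<alpha> z = (case z of Core x \<Rightarrow> 0 | Ray \<alpha>' n \<Rightarrow> if \<alpha>' = \<alpha> then 1 else 0)"

definition one_plus_l1 :: "real \<Rightarrow> ('a, 'n::finite) gfun set" where
  "one_plus_l1 s = {(\<Sum>\<alpha>\<in>UNIV. c \<alpha> *\<^sub>C ray_one \<alpha>) + w | c w. w \<in> l1_space s}"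

definition eigen_tilde ::
  "real \<Rightarrow> (('a, 'n) gfun \<Rightarrow> ('a, 'n) gfun) \<Rightarrow> ('a, 'n) gfun set" where
  "eigen_tilde s A = {\<Psi> \<in> linf_space s. A \<Psi> = 0}"

definition eigen_cal ::
  "real \<Rightarrow> (('a, 'n::finite) gfun \<Rightarrow> ('a, 'n) gfun) \<Rightarrow> ('a, 'n) gfun set" where
  "eigen_cal s A = eigen_tilde s A \<inter> one_plus_l1 (s - 2)"

definition eigen_sf ::
  "real \<Rightarrow> (('a, 'n) gfun \<Rightarrow> ('a, 'n) gfun) \<Rightarrow> ('a, 'n) gfun set" where
  "eigen_sf s A = eigen_tilde s A \<inter> l1_space (s - 2)"

definition regular_threshold ::
  "real \<Rightarrow> (('a, 'n::finite) gfun \<Rightarrow> ('a, 'n) gfun) \<Rightarrow> bool" where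
  "regular_threshold s A \<longleftrightarrow> eigen_cal s A = {0} \<and> eigen_sf s A = {0}"

text \<open>The third and fourth conjuncts below say that the classes of the elements of \<open>B\<close> form a
  basis of the quotient of \<open>eigen_tilde\<close> by \<open>eigen_cal\<close>. Finiteness of \<open>B\<close> is no
  restriction: the vectors \<open>c \<Psi>\<close> are orthonormal in a space of dimension \<open>CARD('n)\<close>.\<close>

definition nonresonance_basis ::
  "real \<Rightarrow> (('a, 'n::finite) gfun \<Rightarrow> ('a, 'n) gfun) \<Rightarrow> ('a, 'n) gfun set \<Rightarrow> bool" where
  "nonresonance_basis s A B \<longleftrightarrow>
     finite B \<and> B \<subseteq> eigen_tilde s A \<and>
     (\<forall>\<Phi>\<in>eigen_tilde s A. \<exists>a. \<Phi> - (\<Sum>\<Psi>\<in>B. a \<Psi> *\<^sub>C \<Psi>) \<in> eigen_cal s A) \<and>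
     (\<forall>a. (\<Sum>\<Psi>\<in>B. a \<Psi> *\<^sub>C \<Psi>) \<in> eigen_cal s A \<longrightarrow> (\<forall>\<Psi>\<in>B. a \<Psi> = 0)) \<and>
     (\<forall>\<Phi>\<in>B. \<forall>\<Psi>\<in>eigen_sf s A. (\<lambda>x. cnj (\<Psi> x) * \<Phi> x) \<in> l1_space 0 \<and> pairing \<Psi> \<Phi> = 0) \<and>
     (\<exists>c :: ('a, 'n) gfun \<Rightarrow> 'n \<Rightarrow> complex.
        (\<forall>\<Phi>\<in>B. \<forall>\<Psi>\<in>B. (\<Sum>\<alpha>\<in>UNIV. cnj (c \<Phi> \<alpha>) * c \<Psi> \<alpha>) = (if \<Phi> = \<Psi> then 1 else 0)) \<and>
        (\<forall>\<Psi>\<in>B. \<Psi> - (\<Sum>\<alpha>\<in>UNIV. c \<Psi> \<alpha> *\<^sub>C ray_lin \<alpha>) \<in> one_plus_l1 (s - 2)))"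

definition nonresonance_projection ::
  "('a, 'n) gfun set \<Rightarrow> ('a, 'n) gfun \<Rightarrow> ('a, 'n) gfun" where
  "nonresonance_projection B u = (\<Sum>\<Psi>\<in>B. pairing \<Psi> u *\<^sub>C \<Psi>)"

end

(*
  Write v^t for the adjoint of v. The kernel of the free resolvent on a half-line is explicit in
  powers of the root z of z + 1/z = 2 + kappa^2 inside the unit disc, so R_0(kappa) expands at
  kappa = 0 with constant term G = G_{0,0} and first-order term - sum_alpha
  |n^(alpha)><n^(alpha)|. A vector phi in Ker M_0 yields the threshold eigenfunction - G v phi
  in the space E, so at a regular threshold M_0 is injective; as v^t G v is compact and U is
  unitary, M_0 is bounded below, hence invertible with inverse N. Then M(kappa) = U + v^t
  R_0(kappa) v is invertible for small kappa, and R(kappa) = R_0(kappa) - R_0(kappa) v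
  M(kappa)^{-1} v^t R_0(kappa). The identity

    R(kappa) - (G - G v N v^t G)
      = (1 - G v N v^t) (R_0(kappa) - G) (1 - v M(kappa)^{-1} v^t R_0(kappa))

  yields both coefficients: G_1 = - sum_alpha |Psi_alpha><Psi_alpha| with
  Psi_alpha = (1 - G v N v^t) n^(alpha).  The Psi_alpha form an orthonormal non-resonance basis,
  and every other one arises from it by a unitary matrix, so the projection is the same.
*)

theory Submission
  imports Defs "HOL-Complex_Analysis.Great_Picard"
begin

subsection \<open>Complex Hilbert spaces\<close>

text \<open>Weights and orders match exactly: the remainder after r terms of the half-line kernel is
  bounded by a multiple of (n m)^(r+1), so weight \<beta> affords order \<beta> - 1, and D(kappa) =
  (R_0(kappa) - G) / kappa keeps order \<beta> - 2 between the same spaces. As V is known only as v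
  U v^t, every inversion takes place in the Hilbert space, between v and v^t. Compactness of v^t G v
  comes from slack in the weights: G v phi is bounded without any weight, while the norm that v^t
  needs divides by a weight tending to infinity, so pointwise convergence of a bounded sequence
  becomes norm convergence. The bound \<beta> >= 2 puts G v phi into the space where regularity
  excludes eigenfunctions: on a ray, G u minus its limit is a tail sum that costs two powers of the
  weight. The finite graph depends on kappa only through kappa^2, so only the rays are seen at first
  order. The Psi_alpha exhaust the kernel of H because Psi + G V Psi is annihilated by H_0, hence is
  a combination of the n^(alpha).\<close>

lemma scaleC_zero_left [simp]: "0 *\<^sub>C (x::'a::complex_vector) = 0"
  using scaleC_add_left[of 0 0 x] by simp

lemma scaleC_zero_right [simp]: "c *\<^sub>C (0::'a::complex_vector) = 0"
  using scaleC_add_right[of c 0 "0::'a"] by simp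

lemma scaleC_minus_left: "(- c) *\<^sub>C (x::'a::complex_vector) = - (c *\<^sub>C x)"
  using scaleC_add_left[of "-c" c x] by (simp add: eq_neg_iff_add_eq_0)

lemma scaleC_minus_right: "c *\<^sub>C (- (x::'a::complex_vector)) = - (c *\<^sub>C x)"
  using scaleC_add_right[of c "-x" x] by (simp add: eq_neg_iff_add_eq_0)

lemma scaleC_diff_right: "c *\<^sub>C (x - (y::'a::complex_vector)) = c *\<^sub>C x - c *\<^sub>C y"
  using scaleC_add_right[of c x "-y"] by (simp add: scaleC_minus_right)

lemma scaleC_minus_one: "(- 1) *\<^sub>C (x::'a::complex_vector) = - x"
  by (simp add: scaleC_minus_left scaleC_one)

lemma scaleC_sum_right: "c *\<^sub>C (\<Sum>i\<in>I. f i :: 'a::complex_vector) = (\<Sum>i\<in>I. c *\<^sub>C f i)"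
  by (induction I rule: infinite_finite_induct) (auto simp: scaleC_add_right)

lemma scaleC_sum_left: "(\<Sum>i\<in>I. f i) *\<^sub>C (x::'a::complex_vector) = (\<Sum>i\<in>I. f i *\<^sub>C x)"
  by (induction I rule: infinite_finite_induct) (auto simp: scaleC_add_left)

lemma scaleC_fun_apply [simp]: "(c *\<^sub>C f) x = c *\<^sub>C f x"
  by (simp add: scaleC_fun_def)

lemma scaleC_complex_eq [simp]: "c *\<^sub>C x = c * (x::complex)"
  by (simp add: scaleC_complex_def)

lemma sum_fun_apply: "(\<Sum>i\<in>I. f i) x = (\<Sum>i\<in>I. (f i x :: 'b::ab_group_add))"
  by (induction I rule: infinite_finite_induct) auto

lemma cinner_add_left: "cinner (x + y) z = cinner x z + cinner y z"
  by (metis cinner_add_right cinner_commute complex_cnj_add)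

lemma cinner_scaleC_left: "cinner (c *\<^sub>C x) y = cnj c * cinner x y"
  by (metis cinner_scaleC_right cinner_commute complex_cnj_mult)

lemma cinner_zero_right [simp]: "cinner x 0 = 0"
  using cinner_add_right[of x 0 0] by simp

lemma cinner_zero_left [simp]: "cinner 0 x = 0"
  using cinner_add_left[of 0 0 x] by simp

lemma cinner_minus_right: "cinner x (- y) = - cinner x y"
  using cinner_add_right[of x "-y" y] by (simp add: eq_neg_iff_add_eq_0)

lemma cinner_minus_left: "cinner (- x) y = - cinner x y"
  using cinner_add_left[of "-x" x y] by (simp add: eq_neg_iff_add_eq_0)

lemma cinner_diff_left: "cinner (x - y) z = cinner x z - cinner y z"
  using cinner_add_left[of x "-y" z] by (simp add: cinner_minus_left)

lemma cinner_self: "cinner x x = complex_of_real ((norm x)\<^sup>2)"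
proof -
  have "Im (cinner x x) = 0"
    using arg_cong[OF cinner_commute[of x x], of Im] by simp
  then show ?thesis
    by (simp add: norm_eq_sqrt_cinner cinner_self_nonneg complex_eq_iff)
qed

lemma Re_cinner_self: "Re (cinner x x) = (norm x)\<^sup>2"
  by (simp add: cinner_self)

lemma norm_scaleC: "norm (c *\<^sub>C (x::'a::complex_hilbert)) = cmod c * norm x"
proof -
  have "cinner (c *\<^sub>C x) (c *\<^sub>C x) = complex_of_real ((cmod c * norm x)\<^sup>2)"
    by (simp only: cinner_scaleC_left cinner_scaleC_right cinner_self[of x] of_real_mult
        power_mult_distrib complex_norm_square[of c]) (simp add: mult_ac)
  then show ?thesis
    by (simp only: norm_eq_sqrt_cinner[of "c *\<^sub>C x"] Re_complex_of_real)
      (simp add: real_sqrt_mult)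
qed

lemma norm_add_square:
  "(norm (x + y :: 'a::complex_hilbert))\<^sup>2 = (norm x)\<^sup>2 + 2 * Re (cinner x y) + (norm y)\<^sup>2"
proof -
  have "Re (cinner y x) = Re (cinner x y)"
    by (metis cinner_commute cnj.simps(1))
  then show ?thesis
    by (simp flip: Re_cinner_self add: cinner_add_left cinner_add_right)
qed

lemma norm_diff_square:
  "(norm (x - y :: 'a::complex_hilbert))\<^sup>2 = (norm x)\<^sup>2 - 2 * Re (cinner x y) + (norm y)\<^sup>2"
  using norm_add_square[of x "-y"] by (simp add: cinner_minus_right)

lemma cinner_eqI:
  assumes "\<And>z. cinner x z = cinner y z"
  shows "x = y"
proof -
  have "cinner (x - y) (x - y) = 0"
    using assms[of "x - y"] by (simp add: cinner_diff_left)
  then show ?thesis by (simp add: cinner_self)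
qed

text \<open>The first-order condition at a minimum: a quadratic in t that is nonnegative and
  vanishes at 0 has slope 0 there. It turns minimality of \<open>J\<close> into the Riesz
  identity.\<close>

lemma quadratic_nonneg_imp_linear_zero:
  fixes a b :: real
  assumes "\<And>t. 0 \<le> a * t + b * t\<^sup>2"
  shows "a = 0"
proof (rule ccontr)
  assume a: "a \<noteq> 0"
  \<comment> \<open>Any c > 0 above b serves: at t = - a / c the quadratic equals (a / c)^2 (b - c)
    < 0.\<close>
  define c where "c = \<bar>b\<bar> + 1"
  have c: "c > 0" "b < c" by (auto simp: c_def)
  have "0 \<le> a * (- a / c) + b * (- a / c)\<^sup>2" by (rule assms)
  also have "\<dots> = (a / c)\<^sup>2 * (b - c)"
    using c by (simp add: field_simps power2_eq_square)
  also have "\<dots> < 0" using a c by (intro mult_pos_neg) auto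
  finally show False by simp
qed

text \<open>Without a projection theorem at hand, the representing vector is found directly as the
  minimiser of the functional \<open>J\<close>.\<close>

theorem riesz_representation:
  fixes f :: "'k::complex_hilbert \<Rightarrow> complex"
  assumes add: "\<And>x y. f (x + y) = f x + f y" and scale: "\<And>c x. f (c *\<^sub>C x) = c * f x"
    and bound: "\<And>x. cmod (f x) \<le> C * norm x"
  shows "\<exists>\<phi>. \<forall>\<psi>. cinner \<phi> \<psi> = f \<psi>"
proof -
  define J where "J x = (norm x)\<^sup>2 - 2 * Re (f x)" for x :: 'k
  have J_ge: "- C\<^sup>2 \<le> J x" for x
  proof -
    have "Re (f x) \<le> C * norm x" using bound[of x] complex_Re_le_cmod order_trans by blast
    moreover have "0 \<le> (norm x - C)\<^sup>2" by simp
    ultimately show ?thesis unfolding J_def power2_diff by (simp add: mult_ac)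
  qed
  define m where "m = Inf (range J)"
  have bdd: "bdd_below (range J)" by (rule bdd_belowI2) (rule J_ge)
  have m_le: "m \<le> J x" for x unfolding m_def using bdd by (intro cInf_lower) auto
  have "\<exists>x. J x < m + inverse (Suc n)" for n
    using cInf_lessD[of "range J" "m + inverse (Suc n)"] by (auto simp: m_def)
  then obtain s where s: "J (s n) < m + inverse (Suc n)" for n by metis
  have lin: "linear f"
    by (rule linearI) (use add scale in \<open>auto simp flip: scaleC_of_real simp: scaleR_conv_of_real\<close>)
  \<comment> \<open>Parallelogram identity: \<open>J\<close> is at least \<open>m\<close> at the
    midpoint too, so near-minimisers lie close together and the minimising sequence is
    Cauchy.\<close>
  have par: "(norm (x - y))\<^sup>2 \<le> 2 * (J x - m) + 2 * (J y - m)" for x y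
  proof -
    have e1: "Re (f ((1/2) *\<^sub>R (x + y))) = (Re (f x) + Re (f y)) / 2"
      by (simp add: linear_scale[OF lin] linear_add[OF lin] scaleR_conv_of_real)
    have e2: "(norm ((1/2) *\<^sub>R (x + y)))\<^sup>2 = (norm (x + y))\<^sup>2 / 4"
      by (simp add: power_mult_distrib power_divide)
    have "(norm (x - y))\<^sup>2 = 2 * J x + 2 * J y - 4 * J ((1/2) *\<^sub>R (x + y))"
      unfolding J_def e1 e2 norm_add_square norm_diff_square by (simp add: field_simps)
    with m_le[of "(1/2) *\<^sub>R (x + y)"] show ?thesis by simp
  qed
  have "Cauchy s"
  proof (rule CauchyI)
    fix e :: real assume e: "0 < e"
    obtain N where N: "inverse (Suc N) < e\<^sup>2 / 4"
      using reals_Archimedean[of "e\<^sup>2 / 4"] e by auto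
    have "norm (s i - s j) < e" if "N \<le> i" "N \<le> j" for i j
    proof -
      have J_less: "J (s k) < m + e\<^sup>2 / 4" if "N \<le> k" for k
      proof -
        have "inverse (real (Suc k)) \<le> inverse (real (Suc N))"
          using that by (intro le_imp_inverse_le) auto
        with N have "inverse (real (Suc k)) \<le> e\<^sup>2 / 4" by (meson less_imp_le order_trans)
        then show ?thesis by (intro less_le_trans[OF s] add_left_mono)
      qed
      have "(norm (s i - s j))\<^sup>2 < e\<^sup>2"
        using par[of "s i" "s j"] J_less[OF that(1)] J_less[OF that(2)] by argo
      then show ?thesis using e by (simp add: power2_less_imp_less)
    qed
    then show "\<exists>M. \<forall>m\<ge>M. \<forall>n\<ge>M. norm (s m - s n) < e" by blast
  qed
  then obtain \<phi> where \<phi>: "s \<longlonglongrightarrow> \<phi>" using Cauchy_convergent convergent_def by blast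
  have f_cont: "bounded_linear f"
    using bound by (intro bounded_linear_intro[of f C])
      (auto simp: linear_scale[OF lin] linear_add[OF lin] mult.commute)
  have "(\<lambda>n. J (s n)) \<longlonglongrightarrow> J \<phi>"
    unfolding J_def by (intro tendsto_intros bounded_linear.tendsto[OF f_cont] \<phi>)
  moreover have "(\<lambda>n. m + inverse (Suc n)) \<longlonglongrightarrow> m + 0"
    by (intro tendsto_intros LIMSEQ_inverse_real_of_nat)
  ultimately have "J \<phi> \<le> m"
    using s by (intro LIMSEQ_le[of _ "J \<phi>" "\<lambda>n. m + inverse (Suc n)" m]) (auto intro: less_imp_le)
  \<comment> \<open>First variation of \<open>J\<close> at its minimum along real multiples of
    \<psi>; this reaches real parts only.\<close>
  have Re: "Re (cinner \<phi> \<psi>) = Re (f \<psi>)" for \<psi>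
  proof -
    have "0 \<le> 2 * (Re (cinner \<phi> \<psi>) - Re (f \<psi>)) * t + (norm \<psi>)\<^sup>2 * t\<^sup>2" for t
    proof -
      have "J \<phi> \<le> J (\<phi> + complex_of_real t *\<^sub>C \<psi>)" using m_le \<open>J \<phi> \<le> m\<close> order_trans by blast
      then show ?thesis
        by (simp add: J_def norm_add_square add scale cinner_scaleC_right norm_scaleC
            power_mult_distrib algebra_simps)
    qed
    from quadratic_nonneg_imp_linear_zero[OF this] show ?thesis by simp
  qed
  \<comment> \<open>The direction \<i> \<psi> supplies the imaginary parts.\<close>
  have "cinner \<phi> \<psi> = f \<psi>" for \<psi>
    using Re[of \<psi>] Re[of "\<i> *\<^sub>C \<psi>"] by (simp add: complex_eq_iff cinner_scaleC_right scale)
  then show ?thesis by blast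
qed

text \<open>A Neumann series in fixed-point form: A x = y says that x is fixed by x |-> x - A x + y,
  a contraction with constant q on a complete space.\<close>

lemma bij_if_near_identity:
  fixes A :: "'k::banach \<Rightarrow> 'k"
  assumes diff: "\<And>x y. A (x - y) = A x - A y"
    and near: "\<And>x. norm (x - A x) \<le> q * norm x" and q: "q < 1"
  shows "bij A"
proof (rule bijI)
  have zero: "x = 0" if "A x = 0" for x
  proof -
    have "norm x \<le> q * norm x" using near[of x] that by simp
    then have "(1 - q) * norm x \<le> 0" by (simp add: algebra_simps)
    then show ?thesis using q by (simp add: mult_le_0_iff)
  qed
  show "inj A"
  proof (rule injI)
    fix x y assume "A x = A y"
    then show "x = y" using zero[of "x - y"] by (simp add: diff)
  qed
  show "surj A"
  proof (unfold surj_def, intro allI)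
    fix y
    have "\<exists>!x. x - A x + y = x"
    \<comment> \<open>The contraction constant must be nonnegative, while \<open>q\<close> is
      bounded only from above.\<close>
    proof (rule banach_fix_type[where c = "max q 0"])
      show "\<forall>x z. dist (x - A x + y) (z - A z + y) \<le> max q 0 * dist x z"
      proof (intro allI)
        fix x z :: 'k
        have "dist (x - A x + y) (z - A z + y) = norm ((x - z) - A (x - z))"
          by (simp add: dist_norm diff algebra_simps)
        also have "\<dots> \<le> q * norm (x - z)" by (rule near)
        also have "\<dots> \<le> max q 0 * norm (x - z)" by (intro mult_right_mono) auto
        finally show "dist (x - A x + y) (z - A z + y) \<le> max q 0 * dist x z"
          by (simp add: dist_norm)
      qed
    qed (use q in auto)
    then obtain x where "x - A x + y = x" by blast
    then have "y = A x" by (simp add: algebra_simps)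
    then show "\<exists>x. y = A x" ..
  qed
qed

subsection \<open>Bounded operators and expansions in powers of the spectral parameter\<close>

text \<open>Carrier and norm are explicit because one function type carries all the weighted spaces.
  Definiteness is left out, so that a mere linear subspace can be treated as a space with seminorm
  0.\<close>

definition seminormed_space :: "'a::complex_vector set \<Rightarrow> ('a \<Rightarrow> real) \<Rightarrow> bool" where
  "seminormed_space S p \<longleftrightarrow> 0 \<in> S \<and>
     (\<forall>u\<in>S. \<forall>w\<in>S. u + w \<in> S \<and> p (u + w) \<le> p u + p w) \<and>
     (\<forall>c. \<forall>u\<in>S. c *\<^sub>C u \<in> S \<and> p (c *\<^sub>C u) = cmod c * p u) \<and>
     (\<forall>u\<in>S. 0 \<le> p u)"

lemma seminormed_spaceD:
  assumes "seminormed_space S p"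
  shows "0 \<in> S" "u \<in> S \<Longrightarrow> w \<in> S \<Longrightarrow> u + w \<in> S" "u \<in> S \<Longrightarrow> w \<in> S \<Longrightarrow> p (u + w) \<le> p u + p w"
    "u \<in> S \<Longrightarrow> c *\<^sub>C u \<in> S" "u \<in> S \<Longrightarrow> p (c *\<^sub>C u) = cmod c * p u" "u \<in> S \<Longrightarrow> 0 \<le> p u"
  using assms by (auto simp: seminormed_space_def)

lemma seminormed_space_zero: "seminormed_space S p \<Longrightarrow> p 0 = 0"
  using seminormed_spaceD(5)[of S p 0 0] seminormed_spaceD(1)[of S p] by simp

lemma seminormed_space_minus:
  assumes "seminormed_space S p" "u \<in> S"
  shows "- u \<in> S" "p (- u) = p u"
  using seminormed_spaceD(4,5)[OF assms, of "-1"] by (auto simp: scaleC_minus_one)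

lemma seminormed_space_diff:
  assumes "seminormed_space S p" "u \<in> S" "w \<in> S"
  shows "u - w \<in> S" "p (u - w) \<le> p u + p w"
  using seminormed_spaceD(2,3)[OF assms(1,2), of "- w"] seminormed_space_minus[OF assms(1,3)]
  by auto

lemma seminormed_space_sum:
  assumes "seminormed_space S p" "\<And>i. i \<in> I \<Longrightarrow> f i \<in> S"
  shows "(\<Sum>i\<in>I. f i) \<in> S"
  using assms(2)
  by (induction I rule: infinite_finite_induct) (auto simp: seminormed_spaceD[OF assms(1)])

lemma linear_onD:
  assumes "linear_on S T"
  shows "u \<in> S \<Longrightarrow> w \<in> S \<Longrightarrow> T (u + w) = T u + T w" "u \<in> S \<Longrightarrow> T (c *\<^sub>C u) = c *\<^sub>C T u"
  using assms by (auto simp: linear_on_def)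

lemma linear_on_zero:
  assumes "seminormed_space S p" "linear_on S T" shows "T 0 = 0"
  using linear_onD(2)[OF assms(2), of 0 0] seminormed_spaceD(1)[OF assms(1)] by simp

lemma linear_on_minus:
  assumes "linear_on S T" "u \<in> S" shows "T (- u) = - T u"
  using linear_onD(2)[OF assms, of "-1"] by (simp add: scaleC_minus_one)

lemma linear_on_diff:
  assumes "seminormed_space S p" "linear_on S T" "u \<in> S" "w \<in> S" shows "T (u - w) = T u - T w"
  using linear_onD(1)[OF assms(2,3), of "- w"] linear_on_minus[OF assms(2,4)]
    seminormed_space_minus[OF assms(1,4)] by simp

lemma linear_on_sum:
  assumes "seminormed_space S p" "linear_on S T" "\<And>i. i \<in> I \<Longrightarrow> f i \<in> S"
  shows "T (\<Sum>i\<in>I. f i) = (\<Sum>i\<in>I. T (f i))"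
  using assms(3)
  by (induction I rule: infinite_finite_induct)
    (auto simp: linear_on_zero[OF assms(1,2)] linear_onD(1)[OF assms(2)]
      seminormed_space_sum[OF assms(1)])

text \<open>The constant is exposed, unlike in \<open>bounded_op\<close>, because a family in
  \<kappa> needs one bound valid for all small \<kappa>; bounds then multiply and add along
  compositions.\<close>

definition op_bound ::
  "'a::complex_vector set \<Rightarrow> ('a \<Rightarrow> real) \<Rightarrow> 'b::complex_vector set \<Rightarrow> ('b \<Rightarrow> real)
     \<Rightarrow> real \<Rightarrow> ('a \<Rightarrow> 'b) \<Rightarrow> bool" where
  "op_bound S p T q C A \<longleftrightarrow> 0 \<le> C \<and> A ` S \<subseteq> T \<and> linear_on S A \<and> (\<forall>u\<in>S. q (A u) \<le> C * p u)"

lemma op_boundI: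
  assumes "0 \<le> C" "\<And>u. u \<in> S \<Longrightarrow> A u \<in> T"
    "\<And>u w. u \<in> S \<Longrightarrow> w \<in> S \<Longrightarrow> A (u + w) = A u + A w"
    "\<And>c u. u \<in> S \<Longrightarrow> A (c *\<^sub>C u) = c *\<^sub>C A u" "\<And>u. u \<in> S \<Longrightarrow> q (A u) \<le> C * p u"
  shows "op_bound S p T q C A"
  using assms unfolding op_bound_def linear_on_def by blast

lemma op_boundD:
  assumes "op_bound S p T q C A"
  shows "0 \<le> C" "u \<in> S \<Longrightarrow> A u \<in> T" "linear_on S A" "u \<in> S \<Longrightarrow> q (A u) \<le> C * p u"
  using assms by (auto simp: op_bound_def)

lemma bounded_op_iff:
  assumes "seminormed_space S p"
  shows "bounded_op S p T q A \<longleftrightarrow> (\<exists>C. op_bound S p T q C A)"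
proof
  assume "bounded_op S p T q A"
  then obtain C where C: "A ` S \<subseteq> T" "linear_on S A" "\<And>u. u \<in> S \<Longrightarrow> q (A u) \<le> C * p u"
    by (auto simp: bounded_op_def)
  have "q (A u) \<le> max C 0 * p u" if "u \<in> S" for u
    using C(3)[OF that] seminormed_spaceD(6)[OF assms that]
      mult_right_mono[of C "max C 0" "p u"] by simp
  with C have "op_bound S p T q (max C 0) A" by (auto simp: op_bound_def)
  then show "\<exists>C. op_bound S p T q C A" ..
qed (auto simp: bounded_op_def op_bound_def)

lemma op_bound_imp_bounded_op: "op_bound S p T q C A \<Longrightarrow> bounded_op S p T q A"
  by (auto simp: bounded_op_def op_bound_def)

lemma op_bound_mono:
  assumes "op_bound S p T q C A" "C \<le> D" "seminormed_space S p"
  shows "op_bound S p T q D A"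
proof -
  have "C * p u \<le> D * p u" if "u \<in> S" for u
    using assms that by (intro mult_right_mono) (auto simp: seminormed_spaceD)
  with assms show ?thesis unfolding op_bound_def by force
qed

lemma op_bound_cong:
  assumes "op_bound S p T q C A" "\<And>u. u \<in> S \<Longrightarrow> A u = B u" "seminormed_space S p"
  shows "op_bound S p T q C B"
  using assms(1,2) seminormed_spaceD(2,4)[OF assms(3)]
  by (auto simp: op_bound_def linear_on_def image_subset_iff)

lemma op_bound_zero:
  assumes "seminormed_space T q"
  shows "op_bound S p T q 0 (\<lambda>u. 0)"
  by (auto simp: op_bound_def linear_on_def seminormed_spaceD[OF assms]
      seminormed_space_zero[OF assms])

lemma op_bound_id: "op_bound S p S p 1 (\<lambda>u. u)"
  by (auto simp: op_bound_def linear_on_def)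

lemma op_bound_add:
  assumes A: "op_bound S p T q C A" and B: "op_bound S p T q D B" and T: "seminormed_space T q"
  shows "op_bound S p T q (C + D) (\<lambda>u. A u + B u)"
proof (rule op_boundI)
  fix u assume u: "u \<in> S"
  have "q (A u + B u) \<le> q (A u) + q (B u)"
    using A B u by (intro seminormed_spaceD(3)[OF T]) (auto dest: op_boundD)
  then show "q (A u + B u) \<le> (C + D) * p u"
    using op_boundD(4)[OF A u] op_boundD(4)[OF B u] by (simp add: distrib_right)
qed (use A B in \<open>auto simp: linear_onD[OF op_boundD(3)[OF A]] linear_onD[OF op_boundD(3)[OF B]]
    scaleC_add_right op_boundD intro!: seminormed_spaceD(2)[OF T]\<close>)

lemma op_bound_scale:
  assumes A: "op_bound S p T q C A" and T: "seminormed_space T q"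
  shows "op_bound S p T q (cmod c * C) (\<lambda>u. c *\<^sub>C A u)"
proof (rule op_boundI)
  fix u assume u: "u \<in> S"
  show "q (c *\<^sub>C A u) \<le> cmod c * C * p u"
    using op_boundD(4)[OF A u] op_boundD(2)[OF A u]
    by (simp add: seminormed_spaceD(5)[OF T] mult.assoc mult_left_mono)
qed (use A in \<open>auto simp: linear_onD[OF op_boundD(3)[OF A]] op_boundD
    scaleC_add_right scaleC_scaleC mult.commute intro!: seminormed_spaceD(4)[OF T]\<close>)

lemma op_bound_minus:
  assumes A: "op_bound S p T q C A" and T: "seminormed_space T q"
  shows "op_bound S p T q C (\<lambda>u. - A u)"
  using op_bound_scale[OF assms, of "-1"] by (simp add: scaleC_minus_one)

lemma op_bound_diff:
  assumes A: "op_bound S p T q C A" and B: "op_bound S p T q D B" and T: "seminormed_space T q"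
  shows "op_bound S p T q (C + D) (\<lambda>u. A u - B u)"
  using op_bound_add[OF A op_bound_minus[OF B T] T] by simp

lemma op_bound_comp:
  assumes A: "op_bound S p T q C A" and B: "op_bound T q W r D B"
  shows "op_bound S p W r (D * C) (\<lambda>u. B (A u))"
proof (rule op_boundI)
  fix u assume u: "u \<in> S"
  have "r (B (A u)) \<le> D * q (A u)" by (rule op_boundD(4)[OF B op_boundD(2)[OF A u]])
  also have "\<dots> \<le> D * (C * p u)"
    by (intro mult_left_mono op_boundD(4)[OF A u] op_boundD(1)[OF B])
  finally show "r (B (A u)) \<le> D * C * p u" by (simp add: mult.assoc)
qed (use A B in \<open>auto simp: linear_onD[OF op_boundD(3)[OF A]] linear_onD[OF op_boundD(3)[OF B]]
    op_boundD\<close>)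

section \<open>Small \<kappa> in the right half-plane, and operator expansions there\<close>

lemma right_half_plane_0_eventually:
  "eventually P right_half_plane_0 \<longleftrightarrow> (\<exists>d>0. \<forall>\<kappa>. 0 < Re \<kappa> \<longrightarrow> cmod \<kappa> < d \<longrightarrow> P \<kappa>)"
proof -
  have "x \<noteq> 0" if "0 < Re x" for x :: complex using that by auto
  then show ?thesis unfolding right_half_plane_0_def eventually_at
    by (simp add: dist_norm)
qed

text \<open>Uniqueness of limits along the filter rests on this, and with it uniqueness of the
  expansion coefficients.\<close>

lemma right_half_plane_0_nontrivial: "right_half_plane_0 \<noteq> bot"
proof -
  have False if "eventually (\<lambda>_. False) right_half_plane_0"
  proof -
    obtain d where "0 < d" and d: "\<not> (0 < Re \<kappa> \<and> cmod \<kappa> < d)" for \<kappa>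
      using \<open>eventually (\<lambda>_. False) right_half_plane_0\<close> by (auto simp: right_half_plane_0_eventually)
    then show False using d[of "of_real (d/2)"] by auto
  qed
  then show ?thesis by (auto simp: eventually_False[symmetric] trivial_limit_def)
qed

lemma eventually_right_half_plane_0:
  "eventually (\<lambda>\<kappa>. 0 < Re \<kappa>) right_half_plane_0"
  "0 < d \<Longrightarrow> eventually (\<lambda>\<kappa>. cmod \<kappa> < d) right_half_plane_0"
  unfolding right_half_plane_0_eventually by (auto intro: exI[of _ 1] exI[of _ d])

lemma tendsto_right_half_plane_0: "((\<lambda>\<kappa>. \<kappa>) \<longlongrightarrow> 0) right_half_plane_0"
  unfolding right_half_plane_0_def by simp

text \<open>Describing an expansion of order \<open>n\<close> by its iterated difference quotients instead of its
  coefficients makes the closure properties below simple inductions.\<close>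

primrec op_expands ::
  "nat \<Rightarrow> 'a::complex_vector set \<Rightarrow> ('a \<Rightarrow> real) \<Rightarrow> 'b::complex_vector set \<Rightarrow> ('b \<Rightarrow> real)
     \<Rightarrow> (complex \<Rightarrow> 'a \<Rightarrow> 'b) \<Rightarrow> bool" where
  "op_expands 0 S p T q F \<longleftrightarrow> (\<exists>C. \<forall>\<^sub>F \<kappa> in right_half_plane_0. op_bound S p T q C (F \<kappa>))"
| "op_expands (Suc n) S p T q F \<longleftrightarrow>
     (\<exists>C A F'. op_bound S p T q C A \<and> op_expands n S p T q F' \<and>
        (\<forall>\<^sub>F \<kappa> in right_half_plane_0. \<forall>u\<in>S. F \<kappa> u = A u + \<kappa> *\<^sub>C F' \<kappa> u))"

lemma op_expands_SucI:
  assumes "op_bound S p T q C A" "op_expands n S p T q F'"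
    "\<forall>\<^sub>F \<kappa> in right_half_plane_0. \<forall>u\<in>S. F \<kappa> u = A u + \<kappa> *\<^sub>C F' \<kappa> u"
  shows "op_expands (Suc n) S p T q F"
  using assms by auto

lemma op_expands_bounded:
  assumes S: "seminormed_space S p" and T: "seminormed_space T q"
  shows "op_expands n S p T q F \<Longrightarrow> op_expands 0 S p T q F"
proof (induction n arbitrary: F)
  case (Suc n)
  then obtain C A F' where *: "op_bound S p T q C A" "op_expands n S p T q F'"
    "\<forall>\<^sub>F \<kappa> in right_half_plane_0. \<forall>u\<in>S. F \<kappa> u = A u + \<kappa> *\<^sub>C F' \<kappa> u" by auto
  obtain D where D: "\<forall>\<^sub>F \<kappa> in right_half_plane_0. op_bound S p T q D (F' \<kappa>)"
    using Suc.IH[OF *(2)] by auto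
  have "\<forall>\<^sub>F \<kappa> in right_half_plane_0. op_bound S p T q (C + D) (F \<kappa>)"
    using *(3) D eventually_right_half_plane_0(2)[of 1, simplified]
  proof eventually_elim
    case (elim \<kappa>)
    have "cmod \<kappa> * D \<le> 1 * D"
      using elim by (intro mult_right_mono) (auto dest: op_boundD)
    then have "op_bound S p T q D (\<lambda>u. \<kappa> *\<^sub>C F' \<kappa> u)"
      using op_bound_mono[OF op_bound_scale[OF elim(2) T]] S by auto
    from op_bound_add[OF *(1) this T] show ?case
      by (rule op_bound_cong[OF _ _ S]) (use elim(1) in auto)
  qed
  then show ?case by auto
qed

lemma op_expands_Suc_imp:
  assumes "seminormed_space S p" "seminormed_space T q"
  shows "op_expands (Suc n) S p T q F \<Longrightarrow> op_expands n S p T q F"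
proof (induction n arbitrary: F)
  case 0
  then show ?case by (rule op_expands_bounded[OF assms])
next
  case (Suc n)
  then obtain C A F' where *: "op_bound S p T q C A" "op_expands (Suc n) S p T q F'"
    "\<forall>\<^sub>F \<kappa> in right_half_plane_0. \<forall>u\<in>S. F \<kappa> u = A u + \<kappa> *\<^sub>C F' \<kappa> u"
    by (auto simp del: op_expands.simps simp: op_expands.simps(2)[of "Suc n"])
  then show ?case using op_expands_SucI[OF *(1) Suc.IH[OF *(2)] *(3)] by blast
qed

lemma op_expands_mono:
  assumes "seminormed_space S p" "seminormed_space T q" "m \<le> n" "op_expands n S p T q F"
  shows "op_expands m S p T q F"
  using assms(3,4)
  by (induction rule: inc_induct) (auto intro: op_expands_Suc_imp[OF assms(1,2)] simp del: op_expands.simps)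

lemma op_expands_const:
  assumes "seminormed_space T q" "op_bound S p T q C A"
  shows "op_expands n S p T q (\<lambda>_. A)"
  using assms(2)
proof (induction n arbitrary: A C)
  case (Suc n)
  show ?case
    by (rule op_expands_SucI[OF Suc.prems Suc.IH[OF op_bound_zero[OF assms(1)]]]) simp
next
  case 0
  then have "\<forall>\<^sub>F \<kappa> in right_half_plane_0. op_bound S p T q C A" by simp
  then show ?case unfolding op_expands.simps by blast
qed

lemma op_expands_add:
  assumes S: "seminormed_space S p" and T: "seminormed_space T q"
  shows "op_expands n S p T q F \<Longrightarrow> op_expands n S p T q G \<Longrightarrow> op_expands n S p T q (\<lambda>\<kappa> u. F \<kappa> u + G \<kappa> u)"
proof (induction n arbitrary: F G)
  case 0
  then obtain C D where *: "\<forall>\<^sub>F \<kappa> in right_half_plane_0. op_bound S p T q C (F \<kappa>)"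
    "\<forall>\<^sub>F \<kappa> in right_half_plane_0. op_bound S p T q D (G \<kappa>)" by auto
  have "\<forall>\<^sub>F \<kappa> in right_half_plane_0. op_bound S p T q (C + D) (\<lambda>u. F \<kappa> u + G \<kappa> u)"
    using * by eventually_elim (rule op_bound_add[OF _ _ T])
  then show ?case by auto
next
  case (Suc n)
  then obtain C A F' where F: "op_bound S p T q C A" "op_expands n S p T q F'"
    "\<forall>\<^sub>F \<kappa> in right_half_plane_0. \<forall>u\<in>S. F \<kappa> u = A u + \<kappa> *\<^sub>C F' \<kappa> u" by auto
  from Suc obtain D B G' where G: "op_bound S p T q D B" "op_expands n S p T q G'"
    "\<forall>\<^sub>F \<kappa> in right_half_plane_0. \<forall>u\<in>S. G \<kappa> u = B u + \<kappa> *\<^sub>C G' \<kappa> u" by auto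
  show ?case
  proof (rule op_expands_SucI[OF op_bound_add[OF F(1) G(1) T] Suc.IH[OF F(2) G(2)]])
    show "\<forall>\<^sub>F \<kappa> in right_half_plane_0. \<forall>u\<in>S. F \<kappa> u + G \<kappa> u = A u + B u + \<kappa> *\<^sub>C (F' \<kappa> u + G' \<kappa> u)"
      using F(3) G(3) by eventually_elim (simp add: scaleC_add_right algebra_simps)
  qed
qed

text \<open>Leibniz rule for difference quotients: G F = B A + \<kappa> (G' A + G F'). In the last
  term G itself occurs where only order n is wanted, so one order of G is given up first.\<close>

lemma op_expands_comp:
  assumes S: "seminormed_space S p" and T: "seminormed_space T q" and W: "seminormed_space W r"
  shows "op_expands n S p T q F \<Longrightarrow> op_expands n T q W r G \<Longrightarrow>
    op_expands n S p W r (\<lambda>\<kappa> u. G \<kappa> (F \<kappa> u))"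
proof (induction n arbitrary: F G)
  case 0
  then obtain C D where *: "\<forall>\<^sub>F \<kappa> in right_half_plane_0. op_bound S p T q C (F \<kappa>)"
    "\<forall>\<^sub>F \<kappa> in right_half_plane_0. op_bound T q W r D (G \<kappa>)" by auto
  have "\<forall>\<^sub>F \<kappa> in right_half_plane_0. op_bound S p W r (D * C) (\<lambda>u. G \<kappa> (F \<kappa> u))"
    using * by eventually_elim (rule op_bound_comp)
  then show ?case by auto
next
  case (Suc n)
  have G0: "op_expands n T q W r G" by (rule op_expands_Suc_imp[OF T W Suc.prems(2)])
  \<comment> \<open>The eventual bounds of \<open>G\<close> and F' are extracted only because they
    contain linearity of \<open>G \<kappa>\<close> and membership of F' u in
    \<open>T\<close>.\<close>
  have "op_expands 0 T q W r G" by (rule op_expands_bounded[OF T W Suc.prems(2)])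
  then obtain K where K: "\<forall>\<^sub>F \<kappa> in right_half_plane_0. op_bound T q W r K (G \<kappa>)" by auto
  from Suc obtain C A F' where F: "op_bound S p T q C A" "op_expands n S p T q F'"
    "\<forall>\<^sub>F \<kappa> in right_half_plane_0. \<forall>u\<in>S. F \<kappa> u = A u + \<kappa> *\<^sub>C F' \<kappa> u" by auto
  from Suc obtain D B G' where G: "op_bound T q W r D B" "op_expands n T q W r G'"
    "\<forall>\<^sub>F \<kappa> in right_half_plane_0. \<forall>u\<in>T. G \<kappa> u = B u + \<kappa> *\<^sub>C G' \<kappa> u" by auto
  have "op_expands 0 S p T q F'" by (rule op_expands_bounded[OF S T F(2)])
  then obtain L where L: "\<forall>\<^sub>F \<kappa> in right_half_plane_0. op_bound S p T q L (F' \<kappa>)" by auto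
  show ?case
  proof (rule op_expands_SucI[OF op_bound_comp[OF F(1) G(1)]
        op_expands_add[OF S W Suc.IH[OF op_expands_const[OF T F(1)] G(2)] Suc.IH[OF F(2) G0]]])
    show "\<forall>\<^sub>F \<kappa> in right_half_plane_0. \<forall>u\<in>S.
        G \<kappa> (F \<kappa> u) = B (A u) + \<kappa> *\<^sub>C (G' \<kappa> (A u) + G \<kappa> (F' \<kappa> u))"
      using F(3) G(3) K L
    proof eventually_elim
      case (elim \<kappa>)
      show ?case
      proof
        fix u assume u: "u \<in> S"
        have "G \<kappa> (F \<kappa> u) = G \<kappa> (A u) + \<kappa> *\<^sub>C G \<kappa> (F' \<kappa> u)"
          using elim(1) u op_boundD(2)[OF F(1) u] op_boundD(2)[OF elim(4) u]
            linear_onD[OF op_boundD(3)[OF elim(3)]] seminormed_spaceD(4)[OF T] by simp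
        also have "\<dots> = B (A u) + \<kappa> *\<^sub>C G' \<kappa> (A u) + \<kappa> *\<^sub>C G \<kappa> (F' \<kappa> u)"
          using elim(2) op_boundD(2)[OF F(1) u] by simp
        finally show "G \<kappa> (F \<kappa> u) = B (A u) + \<kappa> *\<^sub>C (G' \<kappa> (A u) + G \<kappa> (F' \<kappa> u))"
          by (simp add: scaleC_add_right add.assoc)
      qed
    qed
  qed
qed

lemma op_expands_minus:
  assumes S: "seminormed_space S p" and T: "seminormed_space T q" and F: "op_expands n S p T q F"
  shows "op_expands n S p T q (\<lambda>\<kappa> u. - F \<kappa> u)"
  by (rule op_expands_comp[OF S T T F op_expands_const[OF T op_bound_minus[OF op_bound_id T]]])

lemma op_expands_diff:
  assumes S: "seminormed_space S p" and T: "seminormed_space T q" and F: "op_expands n S p T q F"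
    and G: "op_expands n S p T q G"
  shows "op_expands n S p T q (\<lambda>\<kappa> u. F \<kappa> u - G \<kappa> u)"
  using op_expands_add[OF S T F op_expands_minus[OF S T G]] by simp

text \<open>A bounded solution of \<open>X = N - \<kappa> N D X\<close> inherits the expansion of \<open>D\<close>, one order at a time.\<close>

lemma op_expands_resolvent_eq:
  assumes S: "seminormed_space S p" and N: "op_bound S p S p C N"
    and D: "op_expands n S p S p D" and X: "op_expands 0 S p S p X"
    and eq: "\<forall>\<^sub>F \<kappa> in right_half_plane_0. \<forall>u\<in>S. X \<kappa> u = N u - \<kappa> *\<^sub>C N (D \<kappa> (X \<kappa> u))"
  shows "m \<le> Suc n \<Longrightarrow> op_expands m S p S p X"
proof (induction m)
  case (Suc m)
  then have X: "op_expands m S p S p X" and m: "m \<le> n" by auto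
  have Dm: "op_expands m S p S p D" by (rule op_expands_mono[OF S S m D])
  show ?case
    by (rule op_expands_SucI[OF N op_expands_minus[OF S S op_expands_comp[OF S S S
        op_expands_comp[OF S S S X Dm] op_expands_const[OF S N]]]])
      (use eq in \<open>simp add: scaleC_minus_right\<close>)
qed (rule X)

text \<open>Unwinds the nested quotients into a Taylor polynomial: the outermost operator is the
  constant term, and the coefficients of the quotient move up by one index.\<close>

lemma op_expands_coefficients:
  assumes S: "seminormed_space S p" and T: "seminormed_space T q"
  shows "op_expands n S p T q F \<Longrightarrow>
    \<exists>G C. (\<forall>j<n. bounded_op S p T q (G j)) \<and>
      (\<forall>\<^sub>F \<kappa> in right_half_plane_0.
         op_bound S p T q (C * cmod \<kappa> ^ n) (\<lambda>u. F \<kappa> u - (\<Sum>j<n. \<kappa> ^ j *\<^sub>C G j u)))"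
proof (induction n arbitrary: F)
  case 0
  then show ?case by auto
next
  case (Suc n)
  then obtain C A F' where F: "op_bound S p T q C A" "op_expands n S p T q F'"
    "\<forall>\<^sub>F \<kappa> in right_half_plane_0. \<forall>u\<in>S. F \<kappa> u = A u + \<kappa> *\<^sub>C F' \<kappa> u" by auto
  from Suc.IH[OF F(2)] obtain G D where G: "\<And>j. j < n \<Longrightarrow> bounded_op S p T q (G j)"
    "\<forall>\<^sub>F \<kappa> in right_half_plane_0.
         op_bound S p T q (D * cmod \<kappa> ^ n) (\<lambda>u. F' \<kappa> u - (\<Sum>j<n. \<kappa> ^ j *\<^sub>C G j u))" by blast
  define H where "H j = (case j of 0 \<Rightarrow> A | Suc i \<Rightarrow> G i)" for j
  have "bounded_op S p T q (H j)" if "j < Suc n" for j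
    using that G(1) op_bound_imp_bounded_op[OF F(1)] by (auto simp: H_def split: nat.split)
  moreover have "\<forall>\<^sub>F \<kappa> in right_half_plane_0.
     op_bound S p T q (D * cmod \<kappa> ^ Suc n) (\<lambda>u. F \<kappa> u - (\<Sum>j<Suc n. \<kappa> ^ j *\<^sub>C H j u))"
    using F(3) G(2)
  proof eventually_elim
    case (elim \<kappa>)
    from op_bound_scale[OF elim(2) T, of \<kappa>]
    have "op_bound S p T q (D * cmod \<kappa> ^ Suc n) (\<lambda>u. \<kappa> *\<^sub>C (F' \<kappa> u - (\<Sum>j<n. \<kappa> ^ j *\<^sub>C G j u)))"
      by (simp add: mult_ac)
    then show ?case
      by (rule op_bound_cong[OF _ _ S])
        (use elim(1) in \<open>simp add: sum.lessThan_Suc_shift H_def scaleC_one scaleC_diff_right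
          scaleC_sum_right scaleC_scaleC del: sum.lessThan_Suc\<close>)
  qed
  ultimately show ?case by blast
qed

subsection \<open>Scalar families\<close>

text \<open>The scheme of \<open>op_expands\<close> for scalar kernels. The index ranges over
  exponents or pairs of vertices, and \<open>w\<close> carries the growth, so that all bounds are
  uniform in the index.\<close>

primrec fam_expands :: "nat \<Rightarrow> ('i \<Rightarrow> real) \<Rightarrow> (complex \<Rightarrow> 'i \<Rightarrow> complex) \<Rightarrow> bool" where
  "fam_expands 0 w f \<longleftrightarrow> (\<exists>C\<ge>0. \<forall>\<^sub>F \<kappa> in right_half_plane_0. \<forall>i. cmod (f \<kappa> i) \<le> C * w i)"
| "fam_expands (Suc n) w f \<longleftrightarrow>
     (\<exists>C\<ge>0. \<exists>a f'. (\<forall>i. cmod (a i) \<le> C * w i) \<and> fam_expands n w f' \<and>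
        (\<forall>\<^sub>F \<kappa> in right_half_plane_0. \<forall>i. f \<kappa> i = a i + \<kappa> * f' \<kappa> i))"

lemma fam_expands_0I:
  assumes "0 \<le> C" "\<forall>\<^sub>F \<kappa> in right_half_plane_0. \<forall>i. cmod (f \<kappa> i) \<le> C * w i"
  shows "fam_expands 0 w f"
  using assms by auto

lemma fam_expands_SucI:
  assumes "0 \<le> C" "\<And>i. cmod (a i) \<le> C * w i" "fam_expands n w f'"
    "\<forall>\<^sub>F \<kappa> in right_half_plane_0. \<forall>i. f \<kappa> i = a i + \<kappa> * f' \<kappa> i"
  shows "fam_expands (Suc n) w f"
  using assms by auto

lemma fam_expands_0E:
  assumes "fam_expands 0 w f"
  obtains C where "0 \<le> C" "\<forall>\<^sub>F \<kappa> in right_half_plane_0. \<forall>i. cmod (f \<kappa> i) \<le> C * w i"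
  using assms by auto

lemma fam_expands_SucE:
  assumes "fam_expands (Suc n) w f"
  obtains C a f' where "0 \<le> C" "\<And>i. cmod (a i) \<le> C * w i" "fam_expands n w f'"
    "\<forall>\<^sub>F \<kappa> in right_half_plane_0. \<forall>i. f \<kappa> i = a i + \<kappa> * f' \<kappa> i"
  using assms by auto

lemma fam_expands_cong:
  assumes f: "fam_expands n w f" and eq: "\<forall>\<^sub>F \<kappa> in right_half_plane_0. \<forall>i. f \<kappa> i = g \<kappa> i"
  shows "fam_expands n w g"
proof (cases n)
  case 0
  from f obtain C where C: "0 \<le> C" "\<forall>\<^sub>F \<kappa> in right_half_plane_0. \<forall>i. cmod (f \<kappa> i) \<le> C * w i"
    unfolding 0 by (rule fam_expands_0E)
  have "\<forall>\<^sub>F \<kappa> in right_half_plane_0. \<forall>i. cmod (g \<kappa> i) \<le> C * w i"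
    using C(2) eq by eventually_elim simp
  with C(1) show ?thesis unfolding 0 by (rule fam_expands_0I)
next
  case (Suc m)
  obtain C a f' where *: "0 \<le> C" "\<And>i. cmod (a i) \<le> C * w i" "fam_expands m w f'"
    "\<forall>\<^sub>F \<kappa> in right_half_plane_0. \<forall>i. f \<kappa> i = a i + \<kappa> * f' \<kappa> i"
    using fam_expands_SucE[OF f[unfolded Suc]] by blast
  have "\<forall>\<^sub>F \<kappa> in right_half_plane_0. \<forall>i. g \<kappa> i = a i + \<kappa> * f' \<kappa> i"
    using *(4) eq by eventually_elim simp
  then show ?thesis unfolding Suc by (rule fam_expands_SucI[OF *(1,2,3)])
qed

lemma fam_expands_bounded:
  assumes w: "\<And>i. 0 \<le> w i"
  shows "fam_expands n w f \<Longrightarrow> fam_expands 0 w f"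
proof (induction n arbitrary: f)
  case (Suc n)
  then obtain C a f' where *: "0 \<le> C" "\<And>i. cmod (a i) \<le> C * w i" "fam_expands n w f'"
    "\<forall>\<^sub>F \<kappa> in right_half_plane_0. \<forall>i. f \<kappa> i = a i + \<kappa> * f' \<kappa> i"
    using fam_expands_SucE by blast
  from Suc.IH[OF *(3)] obtain D where D: "0 \<le> D"
    "\<forall>\<^sub>F \<kappa> in right_half_plane_0. \<forall>i. cmod (f' \<kappa> i) \<le> D * w i"
    by (rule fam_expands_0E)
  have "\<forall>\<^sub>F \<kappa> in right_half_plane_0. \<forall>i. cmod (f \<kappa> i) \<le> (C + D) * w i"
    using *(4) D(2) eventually_right_half_plane_0(2)[of 1, simplified]
  proof eventually_elim
    case (elim \<kappa>)
    show ?case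
    proof
      fix i
      have "cmod (f \<kappa> i) \<le> cmod (a i) + cmod \<kappa> * cmod (f' \<kappa> i)"
        using elim(1) norm_triangle_ineq[of "a i" "\<kappa> * f' \<kappa> i"] by (simp add: norm_mult)
      also have "\<dots> \<le> C * w i + 1 * (D * w i)"
        using elim *(2)[of i] w[of i] D(1) by (intro add_mono mult_mono) auto
      finally show "cmod (f \<kappa> i) \<le> (C + D) * w i" by (simp add: algebra_simps)
    qed
  qed
  then show ?case using *(1) D(1) by (intro fam_expands_0I[of "C + D"]) auto
qed

lemma fam_expands_Suc_imp:
  assumes w: "\<And>i. 0 \<le> w i"
  shows "fam_expands (Suc n) w f \<Longrightarrow> fam_expands n w f"
proof (induction n arbitrary: f)
  case 0
  show ?case using fam_expands_bounded[OF w 0] .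
next
  case (Suc n)
  then obtain C a f' where *: "0 \<le> C" "\<And>i. cmod (a i) \<le> C * w i" "fam_expands (Suc n) w f'"
    "\<forall>\<^sub>F \<kappa> in right_half_plane_0. \<forall>i. f \<kappa> i = a i + \<kappa> * f' \<kappa> i"
    using fam_expands_SucE by blast
  show ?case by (rule fam_expands_SucI[OF *(1,2) Suc.IH[OF *(3)] *(4)])
qed

lemma fam_expands_zero: "(\<And>i. 0 \<le> w i) \<Longrightarrow> fam_expands n w (\<lambda>_ _. 0)"
proof (induction n)
  case 0
  then show ?case by (intro fam_expands_0I[of 0]) auto
next
  case (Suc n)
  then show ?case by (intro fam_expands_SucI[of 0 "\<lambda>_. 0" _ _ "\<lambda>_ _. 0"]) auto
qed

lemma fam_expands_const:
  assumes w: "\<And>i. 0 \<le> w i" and C: "0 \<le> C" "\<And>i. cmod (a i) \<le> C * w i"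
  shows "fam_expands n w (\<lambda>_. a)"
proof (cases n)
  case 0
  have "\<forall>\<^sub>F \<kappa> in right_half_plane_0. \<forall>i. cmod (a i) \<le> C * w i" using C(2) by simp
  then show ?thesis unfolding 0 by (rule fam_expands_0I[OF C(1)])
next
  case (Suc m)
  show ?thesis unfolding Suc by (rule fam_expands_SucI[OF C fam_expands_zero[OF w]]) auto
qed

lemma fam_expands_weight:
  assumes K: "0 \<le> K" "\<And>i. w i \<le> K * w' i"
  shows "fam_expands n w f \<Longrightarrow> fam_expands n w' f"
proof (induction n arbitrary: f)
  case 0
  then obtain C where C: "0 \<le> C" "\<forall>\<^sub>F \<kappa> in right_half_plane_0. \<forall>i. cmod (f \<kappa> i) \<le> C * w i"
    by (rule fam_expands_0E)
  have "\<forall>\<^sub>F \<kappa> in right_half_plane_0. \<forall>i. cmod (f \<kappa> i) \<le> (C * K) * w' i"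
    using C(2) by eventually_elim (metis C(1) K(2) mult.assoc mult_left_mono order_trans)
  then show ?case using C K by (intro fam_expands_0I[of "C * K"]) auto
next
  case (Suc n)
  then obtain C a f' where *: "0 \<le> C" "\<And>i. cmod (a i) \<le> C * w i" "fam_expands n w f'"
    "\<forall>\<^sub>F \<kappa> in right_half_plane_0. \<forall>i. f \<kappa> i = a i + \<kappa> * f' \<kappa> i"
    using fam_expands_SucE by blast
  have "cmod (a i) \<le> (C * K) * w' i" for i
    using *(2)[of i] mult_left_mono[OF K(2)[of i] *(1)] by (simp add: mult.assoc)
  then show ?case using *(1) K(1)
    by (intro fam_expands_SucI[of "C * K" a, OF _ _ Suc.IH[OF *(3)] *(4)]) auto
qed

lemma fam_expands_add:
  assumes w: "\<And>i. 0 \<le> w i"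
  shows "fam_expands n w f \<Longrightarrow> fam_expands n w g \<Longrightarrow> fam_expands n w (\<lambda>\<kappa> i. f \<kappa> i + g \<kappa> i)"
proof (induction n arbitrary: f g)
  case 0
  from 0(1) obtain C where C: "0 \<le> C" "\<forall>\<^sub>F \<kappa> in right_half_plane_0. \<forall>i. cmod (f \<kappa> i) \<le> C * w i"
    by (rule fam_expands_0E)
  from 0(2) obtain D where D: "0 \<le> D" "\<forall>\<^sub>F \<kappa> in right_half_plane_0. \<forall>i. cmod (g \<kappa> i) \<le> D * w i"
    by (rule fam_expands_0E)
  have "\<forall>\<^sub>F \<kappa> in right_half_plane_0. \<forall>i. cmod (f \<kappa> i + g \<kappa> i) \<le> (C + D) * w i"
    using C(2) D(2)
    by eventually_elim (metis add_mono distrib_right norm_triangle_ineq order_trans)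
  then show ?case using C D by (intro fam_expands_0I[of "C + D"]) auto
next
  case (Suc n)
  from Suc.prems(1) obtain C a f' where f: "0 \<le> C" "\<And>i. cmod (a i) \<le> C * w i" "fam_expands n w f'"
    "\<forall>\<^sub>F \<kappa> in right_half_plane_0. \<forall>i. f \<kappa> i = a i + \<kappa> * f' \<kappa> i"
    using fam_expands_SucE by blast
  from Suc.prems(2) obtain D b g' where g: "0 \<le> D" "\<And>i. cmod (b i) \<le> D * w i" "fam_expands n w g'"
    "\<forall>\<^sub>F \<kappa> in right_half_plane_0. \<forall>i. g \<kappa> i = b i + \<kappa> * g' \<kappa> i"
    using fam_expands_SucE by blast
  have *: "cmod (a i + b i) \<le> (C + D) * w i" for i
    using f(2)[of i] g(2)[of i] norm_triangle_ineq[of "a i" "b i"] by (simp add: distrib_right)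
  have "\<forall>\<^sub>F \<kappa> in right_half_plane_0. \<forall>i. f \<kappa> i + g \<kappa> i = (a i + b i) + \<kappa> * (f' \<kappa> i + g' \<kappa> i)"
    using f(4) g(4) by eventually_elim (simp add: algebra_simps)
  then show ?case using f(1) g(1)
    by (intro fam_expands_SucI[OF _ * Suc.IH[OF f(3) g(3)]]) auto
qed

text \<open>The Leibniz rule again; each product of two terms is controlled by the product of the
  weights.\<close>

lemma fam_expands_mult:
  assumes v: "\<And>i. 0 \<le> v i" and w: "\<And>i. 0 \<le> w i"
  shows "fam_expands n v f \<Longrightarrow> fam_expands n w g \<Longrightarrow>
    fam_expands n (\<lambda>i. v i * w i) (\<lambda>\<kappa> i. f \<kappa> i * g \<kappa> i)"
proof (induction n arbitrary: f g)
  case 0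
  from 0(1) obtain C where C: "0 \<le> C" "\<forall>\<^sub>F \<kappa> in right_half_plane_0. \<forall>i. cmod (f \<kappa> i) \<le> C * v i"
    by (rule fam_expands_0E)
  from 0(2) obtain D where D: "0 \<le> D" "\<forall>\<^sub>F \<kappa> in right_half_plane_0. \<forall>i. cmod (g \<kappa> i) \<le> D * w i"
    by (rule fam_expands_0E)
  have "\<forall>\<^sub>F \<kappa> in right_half_plane_0. \<forall>i. cmod (f \<kappa> i * g \<kappa> i) \<le> (C * D) * (v i * w i)"
    using C(2) D(2)
  proof eventually_elim
    case (elim \<kappa>)
    have "cmod (f \<kappa> i * g \<kappa> i) \<le> (C * v i) * (D * w i)" for i
      unfolding norm_mult using elim C(1) D(1) v w by (intro mult_mono) auto
    then show ?case by (simp add: mult_ac)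
  qed
  then show ?case using C D by (intro fam_expands_0I[of "C * D"]) auto
next
  case (Suc n)
  have g0: "fam_expands n w g" by (rule fam_expands_Suc_imp[OF w Suc.prems(2)])
  from Suc.prems(1) obtain C a f' where f: "0 \<le> C" "\<And>i. cmod (a i) \<le> C * v i" "fam_expands n v f'"
    "\<forall>\<^sub>F \<kappa> in right_half_plane_0. \<forall>i. f \<kappa> i = a i + \<kappa> * f' \<kappa> i"
    using fam_expands_SucE by blast
  from Suc.prems(2) obtain D b g' where g: "0 \<le> D" "\<And>i. cmod (b i) \<le> D * w i" "fam_expands n w g'"
    "\<forall>\<^sub>F \<kappa> in right_half_plane_0. \<forall>i. g \<kappa> i = b i + \<kappa> * g' \<kappa> i"
    using fam_expands_SucE by blast
  have a: "fam_expands n v (\<lambda>_. a)" by (rule fam_expands_const[OF v f(1,2)])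
  have *: "cmod (a i * b i) \<le> (C * D) * (v i * w i)" for i
  proof -
    have "cmod (a i * b i) \<le> (C * v i) * (D * w i)"
      unfolding norm_mult using f g v w by (intro mult_mono) auto
    then show ?thesis by (simp add: mult_ac)
  qed
  have vw: "0 \<le> v i * w i" for i using v w by simp
  have "\<forall>\<^sub>F \<kappa> in right_half_plane_0. \<forall>i. f \<kappa> i * g \<kappa> i =
      (a i * b i) + \<kappa> * (a i * g' \<kappa> i + f' \<kappa> i * g \<kappa> i)"
    using f(4) g(4) by eventually_elim (simp add: algebra_simps)
  then show ?case using f(1) g(1)
    by (intro fam_expands_SucI[OF _ *
          fam_expands_add[OF vw Suc.IH[OF a g(3)] Suc.IH[OF f(3) g0]]]) auto
qed

text \<open>Summation ranges may depend on the index but not on \<kappa>, so quotients pass through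
  the sum. This serves both geometric sums of powers and finite matrix products.\<close>

lemma fam_expands_sum:
  assumes w: "\<And>i. (\<Sum>k\<in>A i. w (h i k)) \<le> w' i"
  shows "fam_expands n w g \<Longrightarrow> fam_expands n w' (\<lambda>\<kappa> i. \<Sum>k\<in>A i. g \<kappa> (h i k))"
proof (induction n arbitrary: g)
  case 0
  then obtain C where C: "0 \<le> C" "\<forall>\<^sub>F \<kappa> in right_half_plane_0. \<forall>i. cmod (g \<kappa> i) \<le> C * w i"
    by (rule fam_expands_0E)
  have "\<forall>\<^sub>F \<kappa> in right_half_plane_0. \<forall>i. cmod (\<Sum>k\<in>A i. g \<kappa> (h i k)) \<le> C * w' i"
    using C(2)
  proof eventually_elim
    case (elim \<kappa>)
    have "cmod (\<Sum>k\<in>A i. g \<kappa> (h i k)) \<le> (\<Sum>k\<in>A i. C * w (h i k))" for i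
      using elim by (intro sum_norm_le) auto
    then show ?case
      using mult_left_mono[OF w C(1)] by (simp flip: sum_distrib_left) (meson order_trans)
  qed
  then show ?case by (rule fam_expands_0I[OF C(1)])
next
  case (Suc n)
  then obtain C a f' where *: "0 \<le> C" "\<And>i. cmod (a i) \<le> C * w i" "fam_expands n w f'"
    "\<forall>\<^sub>F \<kappa> in right_half_plane_0. \<forall>i. g \<kappa> i = a i + \<kappa> * f' \<kappa> i"
    using fam_expands_SucE by blast
  have "cmod (\<Sum>k\<in>A i. a (h i k)) \<le> C * w' i" for i
  proof -
    have "cmod (\<Sum>k\<in>A i. a (h i k)) \<le> (\<Sum>k\<in>A i. C * w (h i k))"
      using *(2) by (intro sum_norm_le) auto
    also have "\<dots> \<le> C * w' i"
      using mult_left_mono[OF w *(1)] by (simp flip: sum_distrib_left)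
    finally show ?thesis .
  qed
  moreover have "\<forall>\<^sub>F \<kappa> in right_half_plane_0. \<forall>i. (\<Sum>k\<in>A i. g \<kappa> (h i k)) =
      (\<Sum>k\<in>A i. a (h i k)) + \<kappa> * (\<Sum>k\<in>A i. f' \<kappa> (h i k))"
    using *(4) by eventually_elim (simp add: sum.distrib sum_distrib_left)
  ultimately show ?case by (rule fam_expands_SucI[OF *(1) _ Suc.IH[OF *(3)]])
qed

lemma fam_expands_reindex:
  "fam_expands n w g \<Longrightarrow> fam_expands n (\<lambda>i. w (h i)) (\<lambda>\<kappa> i. g \<kappa> (h i))"
  using fam_expands_sum[where A = "\<lambda>_. {()}" and h = "\<lambda>i _. h i" and w = w
      and w' = "\<lambda>i. w (h i)" and n = n and g = g] by simp

text \<open>Glues the blocks of a kernel: the condition sees the index only, so it commutes with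
  taking difference quotients.\<close>

lemma fam_expands_if:
  assumes w: "\<And>i. 0 \<le> w i"
  shows "fam_expands n w f \<Longrightarrow> fam_expands n w g \<Longrightarrow>
    fam_expands n w (\<lambda>\<kappa> i. if P i then f \<kappa> i else g \<kappa> i)"
proof (induction n arbitrary: f g)
  case 0
  from 0(1) obtain C where C: "0 \<le> C" "\<forall>\<^sub>F \<kappa> in right_half_plane_0. \<forall>i. cmod (f \<kappa> i) \<le> C * w i"
    by (rule fam_expands_0E)
  from 0(2) obtain D where D: "0 \<le> D" "\<forall>\<^sub>F \<kappa> in right_half_plane_0. \<forall>i. cmod (g \<kappa> i) \<le> D * w i"
    by (rule fam_expands_0E)
  have le: "C * w i \<le> max C D * w i" "D * w i \<le> max C D * w i" for i
    using w by (auto intro!: mult_right_mono)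
  have "\<forall>\<^sub>F \<kappa> in right_half_plane_0. \<forall>i. cmod (if P i then f \<kappa> i else g \<kappa> i) \<le> max C D * w i"
    using C(2) D(2)
  proof eventually_elim
    case (elim \<kappa>)
    have "cmod (f \<kappa> i) \<le> max C D * w i" "cmod (g \<kappa> i) \<le> max C D * w i" for i
      using elim le[of i] order_trans by blast+
    then show ?case by simp
  qed
  then show ?case using C D by (intro fam_expands_0I[of "max C D"]) auto
next
  case (Suc n)
  from Suc.prems(1) obtain C a f' where f: "0 \<le> C" "\<And>i. cmod (a i) \<le> C * w i" "fam_expands n w f'"
    "\<forall>\<^sub>F \<kappa> in right_half_plane_0. \<forall>i. f \<kappa> i = a i + \<kappa> * f' \<kappa> i"
    using fam_expands_SucE by blast
  from Suc.prems(2) obtain D b g' where g: "0 \<le> D" "\<And>i. cmod (b i) \<le> D * w i" "fam_expands n w g'"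
    "\<forall>\<^sub>F \<kappa> in right_half_plane_0. \<forall>i. g \<kappa> i = b i + \<kappa> * g' \<kappa> i"
    using fam_expands_SucE by blast
  have le: "C * w i \<le> max C D * w i" "D * w i \<le> max C D * w i" for i
    using w by (auto intro!: mult_right_mono)
  have *: "cmod (if P i then a i else b i) \<le> max C D * w i" for i
    using f(2)[of i] g(2)[of i] le[of i] by auto
  have "\<forall>\<^sub>F \<kappa> in right_half_plane_0. \<forall>i. (if P i then f \<kappa> i else g \<kappa> i) =
      (if P i then a i else b i) + \<kappa> * (if P i then f' \<kappa> i else g' \<kappa> i)"
    using f(4) g(4) by eventually_elim simp
  then show ?case using f(1) g(1)
    by (intro fam_expands_SucI[OF _ * Suc.IH[OF f(3) g(3)]]) auto
qed

text \<open>The definition asserts only that some leading family exists; the pointwise limit at 0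
  pins it down. Thus an expansion with known limit yields one of its difference quotient, of one
  order less.\<close>

lemma fam_expands_Suc_limit:
  assumes w: "\<And>i. 0 \<le> w i" and f: "fam_expands (Suc n) w f"
    and lim: "\<And>i. ((\<lambda>\<kappa>. f \<kappa> i) \<longlongrightarrow> a i) right_half_plane_0"
  obtains C f' where "0 \<le> C" "\<And>i. cmod (a i) \<le> C * w i" "fam_expands n w f'"
    "\<forall>\<^sub>F \<kappa> in right_half_plane_0. \<forall>i. f \<kappa> i = a i + \<kappa> * f' \<kappa> i"
proof -
  obtain C b f' where *: "0 \<le> C" "\<And>i. cmod (b i) \<le> C * w i" "fam_expands n w f'"
    "\<forall>\<^sub>F \<kappa> in right_half_plane_0. \<forall>i. f \<kappa> i = b i + \<kappa> * f' \<kappa> i"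
    using fam_expands_SucE[OF f] by blast
  from fam_expands_bounded[OF w *(3)] obtain D where D: "0 \<le> D"
    "\<forall>\<^sub>F \<kappa> in right_half_plane_0. \<forall>i. cmod (f' \<kappa> i) \<le> D * w i"
    by (rule fam_expands_0E)
  have "a i = b i" for i
  proof -
    have "((\<lambda>\<kappa>. f \<kappa> i - b i) \<longlongrightarrow> 0) right_half_plane_0"
    proof (rule Lim_null_comparison)
      show "\<forall>\<^sub>F \<kappa> in right_half_plane_0. norm (f \<kappa> i - b i) \<le> cmod \<kappa> * (D * w i)"
        using *(4) D(2) by eventually_elim (simp add: norm_mult mult_left_mono)
      show "((\<lambda>\<kappa>. cmod \<kappa> * (D * w i)) \<longlongrightarrow> 0) right_half_plane_0"
        using tendsto_mult_left_zero[OF tendsto_norm_zero[OF tendsto_right_half_plane_0]] .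
    qed
    then have "((\<lambda>\<kappa>. f \<kappa> i) \<longlongrightarrow> b i) right_half_plane_0"
      by (rule LIM_zero_cancel)
    then show ?thesis using lim[of i] right_half_plane_0_nontrivial tendsto_unique by blast
  qed
  then have "a = b" by auto
  with * that show ?thesis by blast
qed

lemma fam_expands_one_mult:
  "fam_expands n (\<lambda>_. 1) f \<Longrightarrow> fam_expands n (\<lambda>_. 1) g \<Longrightarrow>
    fam_expands n (\<lambda>_. 1) (\<lambda>\<kappa> i. f \<kappa> i * g \<kappa> i)"
  using fam_expands_mult[of "\<lambda>_. 1" "\<lambda>_. 1" n f g] by simp

lemma fam_expands_parameter: "fam_expands n (\<lambda>_. 1) (\<lambda>\<kappa> _. \<kappa>)"
proof (cases n)
  case 0
  have "\<forall>\<^sub>F \<kappa> in right_half_plane_0. \<forall>i::'a. cmod \<kappa> \<le> 1 * 1"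
    using eventually_right_half_plane_0(2)[of 1, simplified] by eventually_elim simp
  then show ?thesis unfolding 0 by (intro fam_expands_0I[of 1]) auto
next
  case (Suc m)
  show ?thesis unfolding Suc
    by (rule fam_expands_SucI[of 0 "\<lambda>_. 0" _ _ "\<lambda>_ _. 1"])
      (auto intro!: fam_expands_const[of _ 1])
qed

lemma fam_expands_scalar_const: "fam_expands n (\<lambda>_. 1) (\<lambda>_ _. c)"
  by (rule fam_expands_const[of _ "cmod c"]) auto

subsection \<open>The resolvent kernel of the half-line\<close>

text \<open>The root of \<open>z + 1 / z = 2 + \<kappa>\<^sup>2\<close> inside the unit disc.\<close>

definition ray_root :: "complex \<Rightarrow> complex" where
  "ray_root \<kappa> = (csqrt (1 + \<kappa>\<^sup>2 / 4) - \<kappa> / 2)\<^sup>2"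

text \<open>With z = w^2 the equation z + 1/z = 2 + \<kappa>^2 reads (1/w - w)^2 = \<kappa>^2. The
  first factor is the solution w with 1/w - w = \<kappa>; the second is 1/w.\<close>

lemma ray_root_factors:
  "(csqrt (1 + \<kappa>\<^sup>2 / 4) - \<kappa> / 2) * (csqrt (1 + \<kappa>\<^sup>2 / 4) + \<kappa> / 2) = 1"
  using power2_csqrt[of "1 + \<kappa>\<^sup>2 / 4"] by (simp add: algebra_simps power2_eq_square)

lemma ray_root_nonzero: "ray_root \<kappa> \<noteq> 0"
proof
  assume "ray_root \<kappa> = 0"
  then have "csqrt (1 + \<kappa>\<^sup>2 / 4) - \<kappa> / 2 = 0" by (simp only: ray_root_def power_eq_0_iff)
  then show False using ray_root_factors[of \<kappa>] by (simp only: mult_zero_left zero_neq_one)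
qed

text \<open>This is w^2 = 1 - \<kappa> w, equivalent to 1/w - w = \<kappa>; it displays the factor
  \<kappa> of z - 1.\<close>

lemma ray_root_eq: "ray_root \<kappa> = 1 - \<kappa> * (csqrt (1 + \<kappa>\<^sup>2 / 4) - \<kappa> / 2)"
  using power2_csqrt[of "1 + \<kappa>\<^sup>2 / 4"]
  by (simp add: ray_root_def algebra_simps power2_eq_square)

lemma ray_root_quadratic: "(ray_root \<kappa>)\<^sup>2 + 1 = (2 + \<kappa>\<^sup>2) * ray_root \<kappa>"
proof -
  define s where "s = csqrt (1 + \<kappa>\<^sup>2 / 4)"
  have s: "s\<^sup>2 = 1 + \<kappa>\<^sup>2 / 4" by (simp add: s_def)
  have 1: "(s - \<kappa> / 2) * (s + \<kappa> / 2) = 1" unfolding s_def by (rule ray_root_factors)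
  have "(s - \<kappa> / 2)\<^sup>2 + (s + \<kappa> / 2)\<^sup>2 = 2 * s\<^sup>2 + \<kappa>\<^sup>2 / 2"
    by (simp add: power2_eq_square algebra_simps)
  then have 2: "(s - \<kappa> / 2)\<^sup>2 + (s + \<kappa> / 2)\<^sup>2 = 2 + \<kappa>\<^sup>2" by (simp add: s)
  have "(x\<^sup>2)\<^sup>2 + (x * y)\<^sup>2 = (x\<^sup>2 + y\<^sup>2) * x\<^sup>2" for x y :: complex
    by (simp add: power2_eq_square algebra_simps)
  from this[of "s - \<kappa> / 2" "s + \<kappa> / 2"] show ?thesis
    unfolding 1 2 by (simp add: ray_root_def s_def)
qed

text \<open>The principal square root has nonnegative real part, so Re w + Re (1/w) >= 0 and hence
  Re w >= 0. Since Re (1/w) - Re w = Re \<kappa> > 0 and Re (1/w) = Re w / |w|^2, it follows that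
  |w| < 1.\<close>

lemma ray_root_norm_less_1:
  assumes "0 < Re \<kappa>"
  shows "cmod (ray_root \<kappa>) < 1"
proof -
  define s where "s = csqrt (1 + \<kappa>\<^sup>2 / 4)"
  define w where "w = s - \<kappa> / 2"
  have 1: "w * (s + \<kappa> / 2) = 1" unfolding w_def s_def by (rule ray_root_factors)
  then have w0: "w \<noteq> 0" by auto
  have inv: "s + \<kappa> / 2 = inverse w" using 1 by (simp add: inverse_unique)
  have Re_inv: "Re (inverse w) = Re w / (cmod w)\<^sup>2"
    by (simp add: cmod_power2)
  have kappa: "Re \<kappa> = Re w / (cmod w)\<^sup>2 - Re w"
    using arg_cong[OF inv, of Re] unfolding Re_inv[symmetric] by (simp add: w_def)
  have "Re w + Re w / (cmod w)\<^sup>2 = 2 * Re s"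
    using arg_cong[OF inv, of Re] unfolding Re_inv[symmetric] by (simp add: w_def)
  also have "\<dots> \<ge> 0" using csqrt_principal[of "1 + \<kappa>\<^sup>2 / 4"] by (auto simp: s_def)
  finally have "0 \<le> Re w * (1 + inverse ((cmod w)\<^sup>2))" by (simp add: field_simps)
  moreover have "0 < 1 + inverse ((cmod w)\<^sup>2)" by (simp add: add_pos_nonneg)
  ultimately have "0 \<le> Re w" by (simp add: zero_le_mult_iff)
  moreover have "0 < Re w * (inverse ((cmod w)\<^sup>2) - 1)"
    using assms kappa by (simp add: field_simps)
  ultimately have "1 < inverse ((cmod w)\<^sup>2)" by (simp add: zero_less_mult_iff)
  then have "(cmod w)\<^sup>2 < 1" using w0 by (simp add: one_less_inverse_iff)
  then show ?thesis by (simp add: ray_root_def w_def s_def norm_power)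
qed

text \<open>No power series is summed. With s the square root and t = 1 / (s + 1), one has s = 1 +
  \<kappa>^2 t / 4 and t = 1/2 - \<kappa>^2 t^2 / 8; the second equation improves an expansion of t
  by one order per use, starting from |t| <= 1, which holds as Re s >= 0.\<close>

lemma fam_expands_csqrt: "fam_expands n (\<lambda>_. 1) (\<lambda>\<kappa> _. csqrt (1 + \<kappa>\<^sup>2 / 4))"
proof -
  define t where "t \<kappa> = inverse (csqrt (1 + \<kappa>\<^sup>2 / 4) + 1)" for \<kappa>
  have nz: "csqrt (1 + \<kappa>\<^sup>2 / 4) + 1 \<noteq> 0" and ge: "1 \<le> cmod (csqrt (1 + \<kappa>\<^sup>2 / 4) + 1)" for \<kappa>
  proof -
    have "1 \<le> Re (csqrt (1 + \<kappa>\<^sup>2 / 4) + 1)" using csqrt_principal[of "1 + \<kappa>\<^sup>2 / 4"] by auto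
    then show "1 \<le> cmod (csqrt (1 + \<kappa>\<^sup>2 / 4) + 1)" using complex_Re_le_cmod order_trans by blast
    then show "csqrt (1 + \<kappa>\<^sup>2 / 4) + 1 \<noteq> 0" by auto
  qed
  have s: "csqrt (1 + \<kappa>\<^sup>2 / 4) = 1 + (\<kappa> * \<kappa>) * (1 / 4 * t \<kappa>)" for \<kappa>
  proof -
    have "(csqrt (1 + \<kappa>\<^sup>2 / 4) - 1) * (csqrt (1 + \<kappa>\<^sup>2 / 4) + 1) = \<kappa> * \<kappa> / 4"
      using power2_csqrt[of "1 + \<kappa>\<^sup>2 / 4"] by (simp add: algebra_simps power2_eq_square)
    then have "csqrt (1 + \<kappa>\<^sup>2 / 4) - 1 = \<kappa> * \<kappa> / 4 * t \<kappa>"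
      unfolding t_def by (simp only: nonzero_eq_divide_eq[OF nz] flip: divide_inverse)
    then have "csqrt (1 + \<kappa>\<^sup>2 / 4) = \<kappa> * \<kappa> / 4 * t \<kappa> + 1" by (simp only: diff_eq_eq)
    then show ?thesis by simp
  qed
  have t: "t \<kappa> = 1 / 2 + \<kappa> * (\<kappa> * (- 1 / 8 * (t \<kappa> * t \<kappa>)))" for \<kappa>
  proof -
    have "t \<kappa> * (csqrt (1 + \<kappa>\<^sup>2 / 4) + 1) = 1" using nz by (simp add: t_def)
    then have "t \<kappa> * (1 + \<kappa> * \<kappa> * (1 / 4 * t \<kappa>) + 1) = 1" unfolding s .
    then show ?thesis by (simp add: algebra_simps)
  qed
  have "fam_expands m (\<lambda>_. 1) (\<lambda>\<kappa> (_::'a). t \<kappa>)" for m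
  proof (induction m)
    case 0
    have "cmod (t \<kappa>) \<le> 1" for \<kappa>
      using le_imp_inverse_le[OF ge[of \<kappa>]] by (simp add: t_def norm_inverse)
    then show ?case by (intro fam_expands_0I[of 1]) auto
  next
    case (Suc m)
    show ?case
      by (rule fam_expands_SucI[where C = 1 and a = "\<lambda>_. 1/2",
          OF _ _ fam_expands_one_mult[OF fam_expands_parameter
            fam_expands_one_mult[OF fam_expands_scalar_const[of _ "- 1 / 8"] fam_expands_one_mult[OF Suc Suc]]]])
        (simp_all only: t[symmetric], auto)
  qed
  then have "fam_expands n (\<lambda>_. 1) (\<lambda>\<kappa> (_::'a). 1 + (\<kappa> * \<kappa>) * (1 / 4 * t \<kappa>))"
    by (intro fam_expands_add fam_expands_one_mult fam_expands_parameter fam_expands_scalar_const) auto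
  then show ?thesis by (simp only: s[symmetric])
qed

text \<open>This is -w for the square root w of \<open>ray_root\<close>, and for nonzero \<kappa>
  the exact quotient (z - 1) / \<kappa>; its limit -1 is the derivative of the root at the
  threshold.\<close>

definition ray_slope :: "complex \<Rightarrow> complex" where
  "ray_slope \<kappa> = \<kappa> / 2 - csqrt (1 + \<kappa>\<^sup>2 / 4)"

lemma ray_root_slope: "ray_root \<kappa> = 1 + \<kappa> * ray_slope \<kappa>"
  by (simp add: ray_root_eq ray_slope_def algebra_simps)

lemma fam_expands_ray_slope: "fam_expands n (\<lambda>_. 1) (\<lambda>\<kappa> _. ray_slope \<kappa>)"
proof -
  have "fam_expands n (\<lambda>_. 1) (\<lambda>\<kappa> (_::'a). 1/2 * \<kappa> + (-1) * csqrt (1 + \<kappa>\<^sup>2 / 4))"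
    by (intro fam_expands_add fam_expands_one_mult fam_expands_parameter fam_expands_scalar_const
        fam_expands_csqrt) auto
  then show ?thesis by (simp add: ray_slope_def)
qed

lemma tendsto_ray_slope: "(ray_slope \<longlongrightarrow> -1) right_half_plane_0"
proof -
  have "((\<lambda>\<kappa>. csqrt (1 + \<kappa>\<^sup>2 / 4)) \<longlongrightarrow> csqrt 1) right_half_plane_0"
  proof (rule isCont_tendsto_compose[OF continuous_at_csqrt])
    show "((\<lambda>\<kappa>. 1 + \<kappa>\<^sup>2 / 4) \<longlongrightarrow> 1) right_half_plane_0"
      by (rule tendsto_eq_intros tendsto_right_half_plane_0 | simp)+
  qed auto
  then show ?thesis unfolding ray_slope_def
    by (auto intro!: tendsto_eq_intros tendsto_right_half_plane_0)
qed

lemma tendsto_ray_root: "(ray_root \<longlongrightarrow> 1) right_half_plane_0"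
  unfolding ray_root_slope
  by (auto intro!: tendsto_eq_intros tendsto_right_half_plane_0 tendsto_ray_slope)

lemma power_ray_root: "ray_root \<kappa> ^ p = 1 + \<kappa> * (ray_slope \<kappa> * (\<Sum>i<p. ray_root \<kappa> ^ i))"
  using power_diff_1_eq[of "ray_root \<kappa>" p] by (simp add: ray_root_slope algebra_simps)

text \<open>The difference quotient of z^p is the slope times a geometric sum of p lower powers.
  Each order therefore costs one power of p; order 0 is |z| < 1.\<close>

lemma fam_expands_ray_root_power:
  "fam_expands n (\<lambda>p. real (Suc p) ^ n) (\<lambda>\<kappa> p. ray_root \<kappa> ^ p)"
proof (induction n)
  case 0
  have "\<forall>\<^sub>F \<kappa> in right_half_plane_0. \<forall>p. cmod (ray_root \<kappa> ^ p) \<le> 1 * real (Suc p) ^ 0"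
    using eventually_right_half_plane_0(1)
  proof eventually_elim
    case (elim \<kappa>)
    then show ?case using ray_root_norm_less_1[OF elim] by (auto simp: norm_power power_le_one)
  qed
  then show ?case by (rule fam_expands_0I[rotated]) simp
next
  case (Suc n)
  have "(\<Sum>i<p. real (Suc i) ^ n) \<le> real (Suc p) ^ Suc n" for p
  proof -
    have "(\<Sum>i<p. real (Suc i) ^ n) \<le> (\<Sum>i<p. real (Suc p) ^ n)"
      by (intro sum_mono power_mono) auto
    also have "\<dots> \<le> real (Suc p) * real (Suc p) ^ n"
      unfolding sum_constant card_lessThan by (intro mult_right_mono) auto
    finally show ?thesis by simp
  qed
  from fam_expands_sum[where h = "\<lambda>p i. i", OF this Suc]
  have "fam_expands n (\<lambda>p. 1 * real (Suc p) ^ Suc n)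
      (\<lambda>\<kappa> p. ray_slope \<kappa> * (\<Sum>i<p. ray_root \<kappa> ^ i))"
    by (intro fam_expands_mult fam_expands_ray_slope) auto
  then have *: "fam_expands n (\<lambda>p. real (Suc p) ^ Suc n)
      (\<lambda>\<kappa> p. ray_slope \<kappa> * (\<Sum>i<p. ray_root \<kappa> ^ i))" by (simp only: mult_1)
  have "1 \<le> real (Suc p) ^ Suc n" for p by (rule one_le_power) simp
  then show ?case
    by (intro fam_expands_SucI[where C = 1 and a = "\<lambda>_. 1", OF _ _ *])
      (auto simp del: power_Suc intro!: always_eventually power_ray_root)
qed

text \<open>The Dirichlet Green kernel (z^(|n-m|+1) - z^(n+m+3)) / (1 - z^2) in zero-based
  coordinates, with the division carried out as a geometric sum so that it also makes sense at the
  threshold z = 1. The two truncated differences add up to |n - m|.\<close>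

definition ray_kernel :: "complex \<Rightarrow> nat \<Rightarrow> nat \<Rightarrow> complex" where
  "ray_kernel z n m = (\<Sum>k\<le>min n m. z ^ ((n - m) + (m - n) + 1 + 2 * k))"

lemma ray_kernel_commute: "ray_kernel z n m = ray_kernel z m n"
  by (simp add: ray_kernel_def min.commute add.commute)

lemma ray_kernel_1: "ray_kernel 1 n m = of_nat (min (Suc n) (Suc m))"
  by (simp add: ray_kernel_def)

lemma ray_kernel_closed_form:
  "(1 - z\<^sup>2) * ray_kernel z n m = z ^ ((n - m) + (m - n) + 1) - z ^ (n + m + 3)"
proof -
  define d where "d = (n - m) + (m - n)"
  have d: "d + 1 + Suc (min n m) * 2 = n + m + 3" by (auto simp: d_def min_def)
  have "ray_kernel z n m = z ^ (d + 1) * (\<Sum>k\<le>min n m. (z\<^sup>2) ^ k)"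
    by (simp add: ray_kernel_def d_def sum_distrib_left power_add power_mult[of z 2]
        mult.assoc)
  then have "(1 - z\<^sup>2) * ray_kernel z n m = z ^ (d + 1) * ((1 - z\<^sup>2) * (\<Sum>k\<le>min n m. (z\<^sup>2) ^ k))"
    by (simp only: mult_ac)
  also have "\<dots> = z ^ (d + 1) * (1 - (z\<^sup>2) ^ Suc (min n m))" by (simp only: sum_gp_basic)
  also have "\<dots> = z ^ (d + 1) - z ^ (d + 1 + Suc (min n m) * 2)"
  proof -
    have "z ^ (d + 1 + Suc (min n m) * 2) = z ^ (d + 1) * (z\<^sup>2) ^ Suc (min n m)"
      unfolding power_add[of z "d + 1"] mult.commute[of "Suc (min n m)" 2] power_mult ..
    then show ?thesis by (simp only: right_diff_distrib mult_1_right)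
  qed
  finally show ?thesis unfolding d by (simp add: d_def)
qed


text \<open>After multiplication by the nonzero factor z (1 - z^2) both equations become identities
  between powers of z, checked on the numerators \<open>P\<close> of the closed form.\<close>

lemma ray_kernel_recurrence:
  assumes z2: "z\<^sup>2 \<noteq> 1" and z0: "z \<noteq> 0" and c: "z\<^sup>2 + 1 = c * z"
  shows "c * ray_kernel z 0 m - ray_kernel z 1 m = (if m = 0 then 1 else 0)"
    and "c * ray_kernel z (Suc n) m - ray_kernel z (Suc (Suc n)) m - ray_kernel z n m =
      (if m = Suc n then 1 else 0)"
proof -
  define P where "P n m = z ^ ((n - m) + (m - n) + 1) - z ^ (n + m + 3)" for n m
  have P: "(1 - z\<^sup>2) * ray_kernel z n m = P n m" for n m
    by (simp only: P_def ray_kernel_closed_form)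
  have cancel: "c * a - b = y"
    if "(z\<^sup>2 + 1) * ((1 - z\<^sup>2) * a) - z * ((1 - z\<^sup>2) * b) = z * (1 - z\<^sup>2) * y" for y a b
  proof -
    have "z * (1 - z\<^sup>2) * (c * a - b) = z * (1 - z\<^sup>2) * y"
      using that unfolding c by (simp add: algebra_simps)
    then show ?thesis using z0 z2 by auto
  qed
  have "(z\<^sup>2 + 1) * P 0 m - z * P 1 m = z * (1 - z\<^sup>2) * (if m = 0 then 1 else 0)"
    by (cases m) (simp_all add: P_def power2_eq_square eval_nat_numeral algebra_simps)
  then show "c * ray_kernel z 0 m - ray_kernel z 1 m = (if m = 0 then 1 else 0)"
    by (intro cancel) (simp only: P)
  have "(z\<^sup>2 + 1) * P (Suc n) m - z * (P (Suc (Suc n)) m + P n m) =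
      z * (1 - z\<^sup>2) * (if m = Suc n then 1 else 0)"
  proof -
    define Q where "Q = z ^ (n + m + 3)"
    have Q: "z ^ (Suc n + m + 3) = Q * z" "z ^ (Suc (Suc n) + m + 3) = Q * z\<^sup>2"
      by (simp_all add: Q_def power2_eq_square power_add eval_nat_numeral mult_ac)
    \<comment> \<open>The exponent |n - m| has its kink at the diagonal: off it, the powers solve
      the homogeneous recursion, and the case m = n + 1 produces the delta.\<close>
    consider "m \<le> n" | "m = Suc n" | "Suc (Suc n) \<le> m" by linarith
    then show ?thesis
    proof cases
      case 1
      define A where "A = z ^ (n - m + 1)"
      have PA: "P n m = A - Q" "P (Suc n) m = A * z - Q * z" "P (Suc (Suc n)) m = A * z\<^sup>2 - Q * z\<^sup>2"
        unfolding P_def Q using 1 by (simp_all add: A_def Q_def Suc_diff_le power2_eq_square)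
      show ?thesis unfolding PA using 1 by (simp add: power2_eq_square algebra_simps)
    next
      case 2
      then have PA: "P n m = z\<^sup>2 - Q" "P (Suc n) m = z - Q * z" "P (Suc (Suc n)) m = z\<^sup>2 - Q * z\<^sup>2"
        unfolding P_def Q by (simp_all add: Q_def power2_eq_square)
      show ?thesis unfolding PA using 2 by (simp add: power2_eq_square algebra_simps)
    next
      case 3
      define A where "A = z ^ (m - Suc (Suc n) + 1)"
      have "m - n = Suc (Suc (m - Suc (Suc n)))" "m - Suc n = Suc (m - Suc (Suc n))"
        using 3 by auto
      then have PA: "P n m = A * z\<^sup>2 - Q" "P (Suc n) m = A * z - Q * z"
        "P (Suc (Suc n)) m = A - Q * z\<^sup>2"
        unfolding P_def Q using 3 by (simp_all add: A_def Q_def power2_eq_square)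
      show ?thesis unfolding PA using 3 by (simp add: power2_eq_square algebra_simps)
    qed
  qed
  then show "c * ray_kernel z (Suc n) m - ray_kernel z (Suc (Suc n)) m - ray_kernel z n m =
      (if m = Suc n then 1 else 0)"
    unfolding diff_diff_eq by (intro cancel) (simp only: P distrib_left)
qed

text \<open>Exponential decay off the diagonal, as required by the Schur test on
  \<open>l2_space\<close>. Both powers in the closed form are at most |z|^|n-m|, whence the factor
  2.\<close>

lemma ray_kernel_decay:
  assumes "cmod z < 1"
  shows "cmod (ray_kernel z n m) \<le> 2 / cmod (1 - z\<^sup>2) * cmod z ^ ((n - m) + (m - n))"
proof -
  define d where "d = (n - m) + (m - n)"
  have "(cmod z)\<^sup>2 < 1" using assms by (simp add: power_less_one_iff)
  then have nz: "1 - z\<^sup>2 \<noteq> 0" by (metis eq_iff_diff_eq_0 less_irrefl norm_one norm_power)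
  have "cmod ((1 - z\<^sup>2) * ray_kernel z n m) \<le> cmod z ^ (d + 1) + cmod z ^ (n + m + 3)"
    unfolding ray_kernel_closed_form d_def
    using norm_triangle_ineq4[of "z ^ (n - m + (m - n) + 1)" "z ^ (n + m + 3)"] by (simp only: norm_power)
  also have "\<dots> \<le> cmod z ^ d + cmod z ^ d"
    using assms by (intro add_mono power_decreasing) (auto simp: d_def)
  finally have "cmod (ray_kernel z n m) * cmod (1 - z\<^sup>2) \<le> 2 * cmod z ^ d"
    by (simp only: norm_mult mult.commute mult_2)
  then show ?thesis using nz unfolding d_def[symmetric] by (simp add: pos_le_divide_eq)
qed

lemma tendsto_ray_kernel:
  "((\<lambda>\<kappa>. ray_kernel (ray_root \<kappa>) n m) \<longlongrightarrow> ray_kernel 1 n m) right_half_plane_0"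
  unfolding ray_kernel_def by (intro tendsto_intros tendsto_ray_root)

text \<open>A power z^p has derivative -p at the threshold, so the limit is minus the sum of the
  exponents. These are |n-m| + 1 + 2k for k up to the minimum, and their sum is exactly
  (n+1)(m+1).\<close>

lemma tendsto_ray_kernel_quotient:
  "((\<lambda>\<kappa>. (ray_kernel (ray_root \<kappa>) n m - ray_kernel 1 n m) / \<kappa>) \<longlongrightarrow> - of_nat (Suc n * Suc m))
     right_half_plane_0"
proof -
  define d where "d = (n - m) + (m - n)"
  have pow: "((\<lambda>\<kappa>. (ray_root \<kappa> ^ p - 1) / \<kappa>) \<longlongrightarrow> - of_nat p) right_half_plane_0" for p
  proof (rule Lim_transform_eventually)
    show "((\<lambda>\<kappa>. ray_slope \<kappa> * (\<Sum>i<p. ray_root \<kappa> ^ i)) \<longlongrightarrow> - of_nat p) right_half_plane_0"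
      by (rule tendsto_eq_intros tendsto_ray_root tendsto_ray_slope refl | simp)+
    show "\<forall>\<^sub>F \<kappa> in right_half_plane_0. ray_slope \<kappa> * (\<Sum>i<p. ray_root \<kappa> ^ i) = (ray_root \<kappa> ^ p - 1) / \<kappa>"
      using eventually_right_half_plane_0(1)
    proof eventually_elim
      case (elim \<kappa>)
      then have "\<kappa> \<noteq> 0" by auto
      then show ?case by (subst power_ray_root) simp
    qed
  qed
  have count: "(\<Sum>k\<le>l. d + 1 + 2 * k) = Suc l * Suc (l + d)" for l
    by (induction l) auto
  have "Suc (min n m) * Suc (min n m + d) = Suc n * Suc m"
    by (cases "n \<le> m") (auto simp: d_def min_def)
  then have sum: "(\<Sum>k\<le>min n m. - of_nat (d + 1 + 2 * k)) = (- of_nat (Suc n * Suc m) :: complex)"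
    unfolding sum_negf of_nat_sum[symmetric] count by simp
  have "((\<lambda>\<kappa>. \<Sum>k\<le>min n m. (ray_root \<kappa> ^ (d + 1 + 2 * k) - 1) / \<kappa>) \<longlongrightarrow> - of_nat (Suc n * Suc m))
     right_half_plane_0"
    unfolding sum[symmetric] by (intro tendsto_sum pow)
  then show ?thesis
    by (simp add: ray_kernel_def d_def sum_subtractf diff_divide_distrib sum_divide_distrib)
qed

text \<open>Each exponent plus one is at most 2 (n+1)(m+1), which accounts for the power r; the
  number of terms, min n m + 1, accounts for the additional one.\<close>

lemma fam_expands_ray_kernel:
  "fam_expands r (\<lambda>(n, m). (real (Suc n) * real (Suc m)) ^ Suc r)
     (\<lambda>\<kappa> (n, m). ray_kernel (ray_root \<kappa>) n m)"
proof -
  have "(\<Sum>k\<le>min n m. real (Suc ((n - m) + (m - n) + 1 + 2 * k)) ^ r)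
      \<le> 2 ^ r * (real (Suc n) * real (Suc m)) ^ Suc r" for n m
  proof -
    have "(\<Sum>k\<le>min n m. real (Suc ((n - m) + (m - n) + 1 + 2 * k)) ^ r)
        \<le> (\<Sum>k\<le>min n m. (2 * (real (Suc n) * real (Suc m))) ^ r)"
    proof (intro sum_mono power_mono)
      fix k assume "k \<in> {..min n m}"
      then have "Suc ((n - m) + (m - n) + 1 + 2 * k) \<le> Suc n + Suc m" by auto
      also have "\<dots> \<le> 2 * (Suc n * Suc m)" by simp
      finally have "real (Suc ((n - m) + (m - n) + 1 + 2 * k)) \<le> real (2 * (Suc n * Suc m))"
        by (rule of_nat_mono)
      then show "real (Suc ((n - m) + (m - n) + 1 + 2 * k)) \<le> 2 * (real (Suc n) * real (Suc m))"
        by (simp only: of_nat_mult of_nat_numeral)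
    qed auto
    also have "\<dots> = real (Suc (min n m)) * (2 * (real (Suc n) * real (Suc m))) ^ r" by simp
    also have "\<dots> \<le> (real (Suc n) * real (Suc m)) * (2 * (real (Suc n) * real (Suc m))) ^ r"
    proof (intro mult_right_mono)
      have "Suc (min n m) \<le> Suc n * Suc m" by (simp add: min_def)
      then have "real (Suc (min n m)) \<le> real (Suc n * Suc m)" by (rule of_nat_mono)
      then show "real (Suc (min n m)) \<le> real (Suc n) * real (Suc m)" by (simp only: of_nat_mult)
    qed auto
    finally show ?thesis by (simp only: power_mult_distrib power_Suc mult_ac)
  qed
  then have *: "(\<Sum>k\<in>(case i of (n, m) \<Rightarrow> {..min n m}).
        real (Suc (case i of (n, m) \<Rightarrow> (n - m) + (m - n) + 1 + 2 * k)) ^ r)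
      \<le> (case i of (n, m) \<Rightarrow> 2 ^ r * (real (Suc n) * real (Suc m)) ^ Suc r)" for i
    by (cases i) (simp only: prod.case)
  have eq: "(\<lambda>\<kappa> i. \<Sum>k\<in>(case i of (n, m) \<Rightarrow> {..min n m}).
        ray_root \<kappa> ^ (case i of (n, m) \<Rightarrow> (n - m) + (m - n) + 1 + 2 * k)) =
      (\<lambda>\<kappa> (n, m). ray_kernel (ray_root \<kappa>) n m)"
    by (auto simp: ray_kernel_def fun_eq_iff)
  have "fam_expands r (\<lambda>(n, m). 2 ^ r * (real (Suc n) * real (Suc m)) ^ Suc r)
      (\<lambda>\<kappa> (n, m). ray_kernel (ray_root \<kappa>) n m)"
    using fam_expands_sum[where h = "\<lambda>i k. case i of (n, m) \<Rightarrow> (n - m) + (m - n) + 1 + 2 * k",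
        OF * fam_expands_ray_root_power] unfolding eq .
  then show ?thesis by (rule fam_expands_weight[rotated 2, where K = "2 ^ r"]) auto
qed

text \<open>Factoring the recursion by its roots z and 1/z shows that z^(n+1) (u(n+1) - z u(n)) does
  not depend on n; its value is u(0). Boundedness of u sends it to 0, after which u(n+1) = z u(n)
  leaves only zero.\<close>

lemma bounded_ray_solution_zero:
  assumes z1: "cmod z < 1" and z0: "z \<noteq> 0" and c: "z\<^sup>2 + 1 = (2 + c) * z"
    and bnd: "\<And>n. cmod (u n) \<le> C" and eq: "\<And>n. ray_op u n + c * u n = 0"
  shows "u = (\<lambda>_. 0)"
proof -
  have step0: "u (Suc 0) = (2 + c) * u 0" using eq[of 0] by (simp add: algebra_simps)
  have step: "u (Suc (Suc n)) = (2 + c) * u (Suc n) - u n" for n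
    using eq[of "Suc n"] by (simp add: algebra_simps)
  have d: "z ^ Suc n * (u (Suc n) - z * u n) = u 0" for n
  proof (induction n)
    case 0
    have "z * (u (Suc 0) - z * u 0) = ((2 + c) * z) * u 0 - z\<^sup>2 * u 0"
      by (simp add: step0 algebra_simps power2_eq_square)
    then show ?case unfolding c[symmetric] by (simp add: algebra_simps)
  next
    case (Suc n)
    have "z * (u (Suc (Suc n)) - z * u (Suc n)) = ((2 + c) * z) * u (Suc n) - z * u n - z\<^sup>2 * u (Suc n)"
      by (simp add: step algebra_simps power2_eq_square)
    also have "\<dots> = u (Suc n) - z * u n" unfolding c[symmetric] by (simp add: algebra_simps)
    finally show ?case using Suc by (simp only: power_Suc2 mult.assoc)
  qed
  have "(\<lambda>n. cmod z ^ Suc n * (2 * C)) \<longlonglongrightarrow> 0 * (2 * C)"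
    using z1 by (intro tendsto_mult tendsto_const LIMSEQ_power_zero[THEN LIMSEQ_Suc]) auto
  moreover have "cmod (u 0) \<le> cmod z ^ Suc n * (2 * C)" for n
  proof -
    have "cmod (u (Suc n) - z * u n) \<le> cmod (u (Suc n)) + cmod z * cmod (u n)"
      using norm_triangle_ineq4[of "u (Suc n)" "z * u n"] by (simp add: norm_mult)
    also have "\<dots> \<le> C + 1 * C" using z1 bnd by (intro add_mono mult_mono) auto
    finally have "cmod z ^ Suc n * cmod (u (Suc n) - z * u n) \<le> cmod z ^ Suc n * (2 * C)"
      by (intro mult_left_mono) auto
    then show ?thesis using arg_cong[OF d[of n], of cmod] by (simp only: norm_mult norm_power)
  qed
  ultimately have "cmod (u 0) \<le> 0 * (2 * C)"
    by (intro LIMSEQ_le[OF tendsto_const]) auto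
  then have u0: "u 0 = 0" by simp
  have "u n = 0" for n
  proof (induction n)
    case (Suc n)
    then show ?case using d[of n] z0 u0 by simp
  qed (rule u0)
  then show ?thesis by auto
qed

subsection \<open>Weighted sequence spaces\<close>

lemma vertex_UNIV: "(UNIV :: ('a, 'n) vertex set) = range Core \<union> (\<Union>\<alpha>. range (Ray \<alpha>))"
proof -
  have "z \<in> range Core \<union> (\<Union>\<alpha>. range (Ray \<alpha>))" for z :: "('a, 'n) vertex"
    by (cases z) auto
  then show ?thesis by blast
qed

lemma summable_on_rayD:
  fixes f :: "('a, 'n) vertex \<Rightarrow> 'b::banach"
  assumes "f summable_on UNIV"
  shows "(\<lambda>n. f (Ray \<alpha> n)) summable_on UNIV"
proof -
  have "f summable_on range (Ray \<alpha>)" by (rule summable_on_subset_banach[OF assms]) auto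
  then show ?thesis by (subst (asm) summable_on_reindex) (auto simp: inj_on_def o_def)
qed

lemma summable_on_vertexI:
  fixes f :: "('a::finite, 'n::finite) vertex \<Rightarrow> real"
  assumes "\<And>\<alpha>. (\<lambda>n. f (Ray \<alpha> n)) summable_on UNIV"
  shows "f summable_on UNIV"
proof -
  have "f summable_on range (Ray \<alpha>)" for \<alpha>
    using assms[of \<alpha>] by (subst summable_on_reindex) (auto simp: inj_on_def o_def)
  then have "f summable_on (\<Union>\<alpha>. range (Ray \<alpha>))"
    by (intro summable_on_finite_union_disjoint) auto
  then show ?thesis unfolding vertex_UNIV
    by (intro summable_on_Un_disjoint) auto
qed

lemma infsum_supported_on_ray:
  fixes f :: "('a, 'n) vertex \<Rightarrow> 'b::{comm_monoid_add, t2_space}"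
  assumes "\<And>x. f (Core x) = 0" "\<And>\<alpha>' n. \<alpha>' \<noteq> \<alpha> \<Longrightarrow> f (Ray \<alpha>' n) = 0"
  shows "infsum f UNIV = (\<Sum>\<^sub>\<infinity>n. f (Ray \<alpha> n))"
proof -
  have z: "f z = 0" if "z \<notin> range (Ray \<alpha>)" for z
  proof (cases z)
    case (Ray \<alpha>' n)
    then show ?thesis using that assms(2)[of \<alpha>'] by auto
  qed (simp add: assms(1))
  have "infsum f UNIV = infsum f (range (Ray \<alpha>))"
    by (rule infsum_cong_neutral) (use z in auto)
  also have "\<dots> = infsum (f \<circ> Ray \<alpha>) UNIV" by (rule infsum_reindex) (auto simp: inj_on_def)
  finally show ?thesis by (simp add: o_def)
qed

lemma infsum_supported_on_core:
  fixes f :: "('a::finite, 'n) vertex \<Rightarrow> 'b::{comm_monoid_add, t2_space}"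
  assumes "\<And>\<alpha> n. f (Ray \<alpha> n) = 0"
  shows "infsum f UNIV = (\<Sum>x\<in>UNIV. f (Core x))"
proof -
  have z: "f z = 0" if "z \<notin> range Core" for z
    using assms that by (cases z) auto
  have "infsum f UNIV = infsum f (range Core)"
    by (rule infsum_cong_neutral) (use z in auto)
  also have "\<dots> = infsum (f \<circ> Core) UNIV" by (rule infsum_reindex) (auto simp: inj_on_def)
  finally show ?thesis by (simp add: o_def)
qed

section \<open>Weights and the three sequence spaces\<close>

lemma weight_pos [simp]: "0 < weight s x"
proof (cases x)
  case (Ray \<alpha> n)
  have "0 < 1 + (real (Suc n))\<^sup>2" by (rule add_pos_nonneg) auto
  then show ?thesis unfolding Ray weight.simps by (subst powr_gt_zero) linarith
qed auto

lemma weight_nonneg [simp]: "0 \<le> weight s x"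
  by (rule less_imp_le[OF weight_pos])

lemma weight_minus: "weight (- s) x = inverse (weight s x)"
  by (cases x) (auto simp: powr_minus)

lemma weight_0 [simp]: "weight 0 x = 1"
proof (cases x)
  case (Ray \<alpha> n)
  have "0 < 1 + (1 + real n)\<^sup>2" by (simp add: add_pos_nonneg)
  then show ?thesis using Ray by simp
qed auto

lemma weight_mono: "s \<le> t \<Longrightarrow> weight s x \<le> weight t x"
  by (cases x) (auto intro: powr_mono)

lemma weight_ge_1: "0 \<le> s \<Longrightarrow> 1 \<le> weight s x"
  using weight_mono[of 0 s x] by simp

lemma weight_ray_mono: "0 \<le> s \<Longrightarrow> n \<le> m \<Longrightarrow> weight s (Ray \<alpha> n) \<le> weight s (Ray \<alpha> m)"
  by (auto intro!: powr_mono2 power_mono add_nonneg_nonneg)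

lemma weight_ray_power_le: "real (Suc n) ^ b \<le> weight (real b) (Ray \<alpha> n)"
proof -
  have "real (Suc n) ^ b = ((real (Suc n))\<^sup>2) powr (real b / 2)"
    by (simp add: powr_realpow[symmetric] powr_powr flip: powr_numeral)
  also have "\<dots> \<le> weight (real b) (Ray \<alpha> n)" by (auto intro!: powr_mono2)
  finally show ?thesis .
qed

lemma weight_plus_2: "weight (s + 2) (Ray \<alpha> n) = weight s (Ray \<alpha> n) * (1 + (real (Suc n))\<^sup>2)"
proof -
  have "0 < 1 + (real (Suc n))\<^sup>2" by (simp add: add_pos_nonneg)
  then show ?thesis by (simp add: add_divide_distrib powr_add)
qed

lemma l1_spaceD:
  "u \<in> l1_space s \<Longrightarrow> (\<lambda>x. weight s x * cmod (u x)) summable_on UNIV"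
  by (simp add: l1_space_def)

lemma l1_spaceI_le:
  assumes "w \<in> l1_space t" "\<And>x. weight s x * cmod (u x) \<le> weight t x * cmod (w x)"
  shows "u \<in> l1_space s"
  unfolding l1_space_def mem_Collect_eq
  by (rule summable_on_comparison_test[OF l1_spaceD[OF assms(1)]]) (use assms(2) in auto)

lemma seminormed_l1: "seminormed_space (l1_space s :: ('a, 'n) gfun set) (l1_norm s)"
  unfolding seminormed_space_def
proof (intro conjI ballI allI)
  show "(0 :: ('a, 'n) gfun) \<in> l1_space s" by (simp add: l1_space_def)
  fix u w :: "('a, 'n) gfun" assume u: "u \<in> l1_space s"
  show "0 \<le> l1_norm s u" unfolding l1_norm_def by (intro infsum_nonneg) auto
  show "c *\<^sub>C u \<in> l1_space s" and "l1_norm s (c *\<^sub>C u) = cmod c * l1_norm s u" for c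
    using summable_on_cmult_right[OF l1_spaceD[OF u], of "cmod c"]
      infsum_cmult_right'[of "cmod c" "\<lambda>x. weight s x * cmod (u x)" UNIV]
    by (simp_all add: l1_space_def l1_norm_def norm_mult mult_ac)
  assume w: "w \<in> l1_space s"
  have s: "(\<lambda>x. weight s x * cmod (u x) + weight s x * cmod (w x)) summable_on UNIV"
    by (rule summable_on_add[OF l1_spaceD[OF u] l1_spaceD[OF w]])
  have le: "weight s x * cmod ((u + w) x) \<le> weight s x * cmod (u x) + weight s x * cmod (w x)" for x
    using mult_left_mono[OF norm_triangle_ineq, of "weight s x" "u x" "w x"]
    by (simp add: distrib_left)
  show uw: "u + w \<in> l1_space s"
    unfolding l1_space_def mem_Collect_eq
    by (rule summable_on_comparison_test[OF s le]) (auto intro!: mult_nonneg_nonneg)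
  show "l1_norm s (u + w) \<le> l1_norm s u + l1_norm s w"
    unfolding l1_norm_def
    by (subst infsum_add[symmetric], rule l1_spaceD[OF u], rule l1_spaceD[OF w])
      (rule infsum_mono[OF l1_spaceD[OF uw] s le])
qed

lemma l1_point_le:
  assumes "u \<in> l1_space s"
  shows "weight s x * cmod (u x) \<le> l1_norm s u"
  unfolding l1_norm_def
  using finite_sum_le_infsum[OF l1_spaceD[OF assms], of "{x}"] by simp

lemma linf_spaceI:
  assumes "\<And>x. cmod (u x) \<le> C * weight s x"
  shows "u \<in> linf_space s" and "linf_norm s u \<le> C"
proof -
  have *: "weight (- s) x * cmod (u x) \<le> C" for x
    using assms[of x] by (simp add: weight_minus field_simps)
  then show "u \<in> linf_space s" by (auto simp: linf_space_def intro!: bdd_aboveI)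
  show "linf_norm s u \<le> C" unfolding linf_norm_def using * by (intro cSUP_least) auto
qed

lemma linf_point_le:
  assumes "u \<in> linf_space s"
  shows "cmod (u x) \<le> linf_norm s u * weight s x"
proof -
  have "weight (- s) x * cmod (u x) \<le> linf_norm s u"
    unfolding linf_norm_def using assms by (intro cSUP_upper) (auto simp: linf_space_def)
  then show ?thesis by (simp add: weight_minus field_simps)
qed

lemma linf_norm_nonneg:
  assumes "u \<in> linf_space s" shows "0 \<le> linf_norm s u"
proof -
  obtain x :: "('a, 'b) vertex" where True by blast
  have "0 \<le> linf_norm s u * weight s x" using linf_point_le[OF assms, of x] norm_ge_zero order_trans by blast
  then show ?thesis using weight_pos[of s x] by (simp add: zero_le_mult_iff)
qed

lemma seminormed_linf: "seminormed_space (linf_space s :: ('a, 'n) gfun set) (linf_norm s)"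
  unfolding seminormed_space_def
proof (intro conjI ballI allI)
  show "(0 :: ('a, 'n) gfun) \<in> linf_space s" by (rule linf_spaceI[of _ 0]) auto
  fix u w :: "('a, 'n) gfun" assume u: "u \<in> linf_space s"
  show "0 \<le> linf_norm s u" by (rule linf_norm_nonneg[OF u])
  have cu: "cmod ((c *\<^sub>C u) x) \<le> cmod c * linf_norm s u * weight s x" for c x
    using mult_left_mono[OF linf_point_le[OF u], of "cmod c" x] by (simp add: norm_mult mult.assoc)
  show cu1: "c *\<^sub>C u \<in> linf_space s" for c by (rule linf_spaceI(1)[OF cu])
  have cu2: "linf_norm s (c *\<^sub>C u) \<le> cmod c * linf_norm s u" for c
    by (rule linf_spaceI(2)[OF cu])
  show "linf_norm s (c *\<^sub>C u) = cmod c * linf_norm s u" for c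
  proof (cases "c = 0")
    case True
    then show ?thesis using cu2[of 0] linf_norm_nonneg[OF cu1[of 0]] by simp
  next
    case False
    have "cmod (u x) \<le> linf_norm s (c *\<^sub>C u) / cmod c * weight s x" for x
      using linf_point_le[OF cu1[of c], of x] False by (simp add: norm_mult field_simps)
    from linf_spaceI(2)[OF this] have "cmod c * linf_norm s u \<le> linf_norm s (c *\<^sub>C u)"
      using False by (simp add: field_simps)
    then show ?thesis using cu2[of c] by simp
  qed
  assume w: "w \<in> linf_space s"
  have uw: "cmod ((u + w) x) \<le> (linf_norm s u + linf_norm s w) * weight s x" for x
    using linf_point_le[OF u, of x] linf_point_le[OF w, of x] norm_triangle_ineq[of "u x" "w x"]
    by (simp add: distrib_right)
  show "u + w \<in> linf_space s" by (rule linf_spaceI(1)[OF uw])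
  show "linf_norm s (u + w) \<le> linf_norm s u + linf_norm s w" by (rule linf_spaceI(2)[OF uw])
qed

lemma l2_spaceI:
  assumes "0 \<le> C" "\<And>F. finite F \<Longrightarrow> (\<Sum>x\<in>F. (cmod (u x))\<^sup>2) \<le> C\<^sup>2"
  shows "u \<in> l2_space" and "l2_norm u \<le> C"
proof -
  show s: "u \<in> l2_space" unfolding l2_space_def mem_Collect_eq
    by (rule nonneg_bdd_above_summable_on) (auto intro!: bdd_aboveI2[where M = "C\<^sup>2"] assms)
  have "(\<Sum>\<^sub>\<infinity>x. (cmod (u x))\<^sup>2) \<le> C\<^sup>2"
    by (rule infsum_le_finite_sums) (use s assms in \<open>auto simp: l2_space_def\<close>)
  then show "l2_norm u \<le> C" unfolding l2_norm_def using assms(1)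
    by (simp add: real_le_lsqrt infsum_nonneg)
qed

lemma l2_norm_nonneg: "0 \<le> l2_norm u"
  by (simp add: l2_norm_def infsum_nonneg)

lemma l2_norm_square: "(l2_norm u)\<^sup>2 = (\<Sum>\<^sub>\<infinity>x. (cmod (u x))\<^sup>2)"
  by (simp add: l2_norm_def infsum_nonneg)

lemma l2_finite_sum_le:
  assumes "u \<in> l2_space" "finite F"
  shows "(\<Sum>x\<in>F. (cmod (u x))\<^sup>2) \<le> (l2_norm u)\<^sup>2"
  unfolding l2_norm_square
  using assms by (intro finite_sum_le_infsum) (auto simp: l2_space_def)

lemma l2_point_le:
  assumes "u \<in> l2_space" shows "cmod (u x) \<le> l2_norm u"
  using l2_finite_sum_le[OF assms, of "{x}"] l2_norm_nonneg[of u]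
  by (simp add: abs_le_square_iff[symmetric])

lemma l2_set_le:
  assumes "u \<in> l2_space" "finite F"
  shows "L2_set (\<lambda>x. cmod (u x)) F \<le> l2_norm u"
  unfolding L2_set_def using l2_finite_sum_le[OF assms] l2_norm_nonneg
  by (metis real_sqrt_abs real_sqrt_le_mono abs_of_nonneg)

lemma seminormed_l2: "seminormed_space (l2_space :: ('a, 'n) gfun set) l2_norm"
  unfolding seminormed_space_def
proof (intro conjI ballI allI)
  show "(0 :: ('a, 'n) gfun) \<in> l2_space" by (simp add: l2_space_def)
  fix u w :: "('a, 'n) gfun" assume u: "u \<in> l2_space"
  show "0 \<le> l2_norm u" by (rule l2_norm_nonneg)
  have s: "(\<lambda>x. (cmod (u x))\<^sup>2) summable_on UNIV" using u by (simp add: l2_space_def)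
  show "c *\<^sub>C u \<in> l2_space" for c
    using summable_on_cmult_right[OF s, of "(cmod c)\<^sup>2"]
    by (simp add: l2_space_def norm_mult power_mult_distrib)
  show "l2_norm (c *\<^sub>C u) = cmod c * l2_norm u" for c
    by (simp add: l2_norm_def norm_mult power_mult_distrib infsum_cmult_right' real_sqrt_mult)
  assume w: "w \<in> l2_space"
  have "(\<Sum>x\<in>F. (cmod ((u + w) x))\<^sup>2) \<le> (l2_norm u + l2_norm w)\<^sup>2" if F: "finite F" for F
  proof -
    have "L2_set (\<lambda>x. cmod ((u + w) x)) F \<le> L2_set (\<lambda>x. cmod (u x) + cmod (w x)) F"
      by (rule L2_set_mono) (auto intro: norm_triangle_ineq)
    also have "\<dots> \<le> L2_set (\<lambda>x. cmod (u x)) F + L2_set (\<lambda>x. cmod (w x)) F"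
      by (rule L2_set_triangle_ineq)
    also have "\<dots> \<le> l2_norm u + l2_norm w" by (intro add_mono l2_set_le u w F)
    finally have "sqrt (\<Sum>x\<in>F. (cmod ((u + w) x))\<^sup>2) \<le> l2_norm u + l2_norm w"
      by (simp add: L2_set_def)
    then show ?thesis by (rule sqrt_le_D)
  qed
  note uw = l2_spaceI[OF add_nonneg_nonneg[OF l2_norm_nonneg l2_norm_nonneg] this]
  show "u + w \<in> l2_space" by (rule uw(1))
  show "l2_norm (u + w) \<le> l2_norm u + l2_norm w" by (rule uw(2))
qed

text \<open>With \<open>op_bound_l1_l2\<close> this gives the chain from \<open>l1_space\<close>
  through \<open>l2_space\<close> to \<open>linf_space\<close>, along which the resolvent on l^2 is
  compared with operators between the weighted spaces.\<close>

lemma op_bound_l2_linf: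
  assumes "0 \<le> s"
  shows "op_bound l2_space l2_norm (linf_space s) (linf_norm s) 1 (\<lambda>u. u)"
proof (rule op_boundI)
  fix u :: "('a, 'n) gfun" assume u: "u \<in> l2_space"
  have "cmod (u x) \<le> l2_norm u * weight s x" for x
    using l2_point_le[OF u, of x] mult_left_mono[OF weight_ge_1[OF assms] l2_norm_nonneg, of u x]
    by simp
  from linf_spaceI[OF this] show "u \<in> linf_space s" "linf_norm s u \<le> 1 * l2_norm u" by auto
qed auto

lemma op_bound_l1_l2:
  assumes "0 \<le> s"
  shows "op_bound (l1_space s) (l1_norm s) l2_space l2_norm 1 (\<lambda>u. u)"
proof (rule op_boundI)
  fix u :: "('a, 'n) gfun" assume u: "u \<in> l1_space s"
  have le: "cmod (u x) \<le> weight s x * cmod (u x)" for x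
    using mult_right_mono[OF weight_ge_1[OF assms], of "cmod (u x)"] by simp
  have n: "0 \<le> l1_norm s u" by (rule seminormed_spaceD(6)[OF seminormed_l1 u])
  have "(\<Sum>x\<in>F. (cmod (u x))\<^sup>2) \<le> (l1_norm s u)\<^sup>2" if F: "finite F" for F
  proof -
    \<comment> \<open>One factor of each square is bounded by the whole l^1 norm; the other is kept
      for the summation.\<close>
    have "(\<Sum>x\<in>F. (cmod (u x))\<^sup>2) \<le> (\<Sum>x\<in>F. l1_norm s u * (weight s x * cmod (u x)))"
      unfolding power2_eq_square using le l1_point_le[OF u]
      by (intro sum_mono mult_mono) (auto intro: order_trans simp: n)
    also have "\<dots> = l1_norm s u * (\<Sum>x\<in>F. weight s x * cmod (u x))" by (simp add: sum_distrib_left)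
    also have "\<dots> \<le> l1_norm s u * l1_norm s u"
      unfolding l1_norm_def[of s u]
      by (intro mult_left_mono finite_sum_le_infsum l1_spaceD[OF u] F infsum_nonneg) auto
    finally show ?thesis by (simp add: power2_eq_square)
  qed
  from l2_spaceI[OF n this] show "u \<in> l2_space" "l2_norm u \<le> 1 * l1_norm s u" by auto
qed auto

subsection \<open>The duality pairing\<close>

lemma pairing_has_sum:
  assumes u: "u \<in> linf_space s" and w: "w \<in> l1_space s"
  shows "(\<lambda>x. norm (cnj (u x) * w x)) summable_on UNIV"
    and "cmod (pairing u w) \<le> linf_norm s u * l1_norm s w"
proof -
  have le: "norm (cnj (u x) * w x) \<le> linf_norm s u * (weight s x * cmod (w x))" for x
    using mult_right_mono[OF linf_point_le[OF u, of x], of "cmod (w x)"]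
    by (simp add: norm_mult mult.assoc)
  have s: "(\<lambda>x. linf_norm s u * (weight s x * cmod (w x))) summable_on UNIV"
    by (rule summable_on_cmult_right[OF l1_spaceD[OF w]])
  show *: "(\<lambda>x. norm (cnj (u x) * w x)) summable_on UNIV"
    by (rule Infinite_Sum.abs_summable_on_comparison_test'[OF s le])
  have "cmod (pairing u w) \<le> (\<Sum>\<^sub>\<infinity>x. norm (cnj (u x) * w x))"
    unfolding pairing_def by (rule norm_infsum_bound[OF *])
  also have "\<dots> \<le> (\<Sum>\<^sub>\<infinity>x. linf_norm s u * (weight s x * cmod (w x)))"
    by (rule infsum_mono[OF * s le])
  also have "\<dots> = linf_norm s u * l1_norm s w" by (simp add: infsum_cmult_right' l1_norm_def)
  finally show "cmod (pairing u w) \<le> linf_norm s u * l1_norm s w" .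
qed

lemma pairing_summable:
  "u \<in> linf_space s \<Longrightarrow> w \<in> l1_space s \<Longrightarrow> (\<lambda>x. cnj (u x) * w x) summable_on UNIV"
  using pairing_has_sum(1) summable_on_iff_abs_summable_on_complex by blast

lemma pairing_add_right:
  "u \<in> linf_space s \<Longrightarrow> w \<in> l1_space s \<Longrightarrow> w' \<in> l1_space s \<Longrightarrow>
    pairing u (w + w') = pairing u w + pairing u w'"
  unfolding pairing_def by (subst infsum_add[symmetric]) (auto simp: pairing_summable distrib_left)

lemma pairing_add_left:
  "u \<in> linf_space s \<Longrightarrow> u' \<in> linf_space s \<Longrightarrow> w \<in> l1_space s \<Longrightarrow>
    pairing (u + u') w = pairing u w + pairing u' w"
  unfolding pairing_def by (subst infsum_add[symmetric]) (auto simp: pairing_summable distrib_right)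

lemma pairing_scaleC_right: "pairing u (c *\<^sub>C w) = c * pairing u w"
  unfolding pairing_def by (simp flip: infsum_cmult_right' add: mult_ac)

lemma pairing_scaleC_left: "pairing (c *\<^sub>C u) w = cnj c * pairing u w"
  unfolding pairing_def by (simp flip: infsum_cmult_right' add: mult_ac)

lemma pairing_commute: "pairing u w = cnj (pairing w u)"
  unfolding pairing_def by (simp flip: infsum_cnj add: mult.commute)

lemma pairing_diff_right:
  assumes "u \<in> linf_space s" "w \<in> l1_space s" "w' \<in> l1_space s"
  shows "pairing u (w - w') = pairing u w - pairing u w'"
  using pairing_add_right[OF assms(1,2) seminormed_space_minus(1)[OF seminormed_l1 assms(3)]]
    pairing_scaleC_right[of u "-1" w'] by (simp add: scaleC_minus_one)

lemma pairing_diff_left: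
  assumes "u \<in> linf_space s" "u' \<in> linf_space s" "w \<in> l1_space s"
  shows "pairing (u - u') w = pairing u w - pairing u' w"
  using pairing_add_left[OF assms(1) seminormed_space_minus(1)[OF seminormed_linf assms(2)] assms(3)]
    pairing_scaleC_left[of "-1" u' w] by (simp add: scaleC_minus_one)

lemma pairing_sum_left:
  assumes "w \<in> l1_space s" "\<And>i. i \<in> I \<Longrightarrow> f i \<in> linf_space s"
  shows "pairing (\<Sum>i\<in>I. f i) w = (\<Sum>i\<in>I. pairing (f i) w)"
  using assms(2)
proof (induction I rule: infinite_finite_induct)
  case (insert i I)
  have "pairing (f i + sum f I) w = pairing (f i) w + pairing (sum f I) w"
    using insert.prems by (intro pairing_add_left[OF _ _ assms(1)] seminormed_space_sum[OF seminormed_linf]) auto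
  moreover have "pairing (sum f I) w = (\<Sum>i\<in>I. pairing (f i) w)"
    using insert by blast
  ultimately show ?case by (simp only: sum.insert[OF insert.hyps])
qed (simp_all add: pairing_def)

subsection \<open>Kernel operators\<close>

definition kernel_op :: "('x \<Rightarrow> 'x \<Rightarrow> complex) \<Rightarrow> ('x \<Rightarrow> complex) \<Rightarrow> 'x \<Rightarrow> complex" where
  "kernel_op k u x = (\<Sum>\<^sub>\<infinity>y. k x y * u y)"

text \<open>A product of weights is the right majorant: one weight is absorbed by the summed l^1
  norm of the argument, the other by the division in the sup norm of the value.\<close>

definition kernel_bound :: "real \<Rightarrow> real \<Rightarrow> (('a, 'n) vertex \<Rightarrow> ('a, 'n) vertex \<Rightarrow> complex) \<Rightarrow> bool" where
  "kernel_bound s C k \<longleftrightarrow> 0 \<le> C \<and> (\<forall>x y. cmod (k x y) \<le> C * (weight s x * weight s y))"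

lemma kernel_summable:
  assumes k: "kernel_bound s C k" and u: "u \<in> l1_space s"
  shows "(\<lambda>y. norm (k x y * u y)) summable_on UNIV"
    and "cmod (kernel_op k u x) \<le> C * l1_norm s u * weight s x"
proof -
  have le: "norm (k x y * u y) \<le> C * weight s x * (weight s y * cmod (u y))" for y
  proof -
    have "norm (k x y * u y) \<le> (C * (weight s x * weight s y)) * cmod (u y)"
      unfolding norm_mult using k by (intro mult_right_mono) (auto simp: kernel_bound_def)
    then show ?thesis by (simp add: mult_ac)
  qed
  have s: "(\<lambda>y. C * weight s x * (weight s y * cmod (u y))) summable_on UNIV"
    by (rule summable_on_cmult_right[OF l1_spaceD[OF u]])
  show *: "(\<lambda>y. norm (k x y * u y)) summable_on UNIV"
    by (rule Infinite_Sum.abs_summable_on_comparison_test'[OF s le])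
  have "cmod (kernel_op k u x) \<le> (\<Sum>\<^sub>\<infinity>y. norm (k x y * u y))"
    unfolding kernel_op_def by (rule norm_infsum_bound[OF *])
  also have "\<dots> \<le> (\<Sum>\<^sub>\<infinity>y. C * weight s x * (weight s y * cmod (u y)))"
    by (rule infsum_mono[OF * s le])
  also have "\<dots> = C * l1_norm s u * weight s x"
    by (simp add: infsum_cmult_right' l1_norm_def)
  finally show "cmod (kernel_op k u x) \<le> C * l1_norm s u * weight s x" .
qed

lemma kernel_op_summable:
  "kernel_bound s C k \<Longrightarrow> u \<in> l1_space s \<Longrightarrow> (\<lambda>y. k x y * u y) summable_on UNIV"
  using kernel_summable(1) summable_on_iff_abs_summable_on_complex by blast

lemma op_bound_kernel:
  fixes k :: "('a, 'n) vertex \<Rightarrow> ('a, 'n) vertex \<Rightarrow> complex"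
  assumes k: "kernel_bound s C k"
  shows "op_bound (l1_space s) (l1_norm s) (linf_space s) (linf_norm s) C (kernel_op k)"
proof (rule op_boundI)
  show "0 \<le> C" using k by (simp add: kernel_bound_def)
  fix u w :: "('a, 'n) gfun" and c assume u: "u \<in> l1_space s"
  show "kernel_op k u \<in> linf_space s" "linf_norm s (kernel_op k u) \<le> C * l1_norm s u"
    using linf_spaceI[OF kernel_summable(2)[OF k u]] by auto
  show "kernel_op k (c *\<^sub>C u) = c *\<^sub>C kernel_op k u"
    by (simp add: fun_eq_iff kernel_op_def flip: infsum_cmult_right') (simp add: mult_ac)
  assume w: "w \<in> l1_space s"
  show "kernel_op k (u + w) = kernel_op k u + kernel_op k w"
    using kernel_op_summable[OF k u] kernel_op_summable[OF k w]
    by (simp add: fun_eq_iff kernel_op_def distrib_left infsum_add)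
qed

lemma kernel_op_add_scale:
  assumes "kernel_bound s C k" "kernel_bound s D l" "u \<in> l1_space s"
  shows "kernel_op (\<lambda>x y. k x y + c * l x y) u = kernel_op k u + c *\<^sub>C kernel_op l u"
proof
  fix x
  have "(\<lambda>y. c * (l x y * u y)) summable_on UNIV"
    by (rule summable_on_cmult_right[OF kernel_op_summable[OF assms(2,3)]])
  then have "infsum (\<lambda>y. k x y * u y + c * (l x y * u y)) UNIV =
      kernel_op k u x + infsum (\<lambda>y. c * (l x y * u y)) UNIV"
    unfolding kernel_op_def by (rule infsum_add[OF kernel_op_summable[OF assms(1,3)]])
  then show "kernel_op (\<lambda>x y. k x y + c * l x y) u x = (kernel_op k u + c *\<^sub>C kernel_op l u) x"
    by (simp add: kernel_op_def distrib_right mult.assoc infsum_cmult_right')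
qed

text \<open>Fubini for the double series. It converges absolutely because summation over y first
  leaves a multiple of the weighted summand of \<open>w\<close>.\<close>

lemma kernel_op_symmetric:
  assumes k: "kernel_bound s C k" and sym: "\<And>x y. k y x = cnj (k x y)"
    and u: "u \<in> l1_space s" and w: "w \<in> l1_space s"
  shows "pairing (kernel_op k u) w = pairing u (kernel_op k w)"
proof -
  have C: "0 \<le> C" using k by (simp add: kernel_bound_def)
  have "(\<lambda>p. norm (case p of (x, y) \<Rightarrow> w x * (cnj (k x y) * cnj (u y)))) summable_on UNIV \<times> UNIV"
  proof (subst Infinite_Sum.abs_summable_on_Sigma_iff, intro conjI ballI)
    fix x
    have *: "(\<lambda>y. norm (k x y * u y)) summable_on UNIV" by (rule kernel_summable(1)[OF k u])
    then have s: "(\<lambda>y. cmod (w x) * norm (k x y * u y)) summable_on UNIV"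
      by (rule summable_on_cmult_right)
    then show "(\<lambda>y. norm (case (x, y) of (x, y) \<Rightarrow> w x * (cnj (k x y) * cnj (u y)))) summable_on UNIV"
      by (simp add: norm_mult)
  next
    have "(\<Sum>\<^sub>\<infinity>y. norm (w x * (cnj (k x y) * cnj (u y)))) \<le> C * l1_norm s u * (weight s x * cmod (w x))" for x
    proof -
      have le: "norm (k x y * u y) \<le> C * weight s x * (weight s y * cmod (u y))" for y
      proof -
        have "norm (k x y * u y) \<le> (C * (weight s x * weight s y)) * cmod (u y)"
          unfolding norm_mult using k by (intro mult_right_mono) (auto simp: kernel_bound_def)
        then show ?thesis by (simp add: mult_ac)
      qed
      have "(\<Sum>\<^sub>\<infinity>y. norm (k x y * u y)) \<le> (\<Sum>\<^sub>\<infinity>y. C * weight s x * (weight s y * cmod (u y)))"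
        by (rule infsum_mono[OF kernel_summable(1)[OF k u] summable_on_cmult_right[OF l1_spaceD[OF u]] le])
      then have "cmod (w x) * (\<Sum>\<^sub>\<infinity>y. norm (k x y * u y)) \<le> cmod (w x) * (C * weight s x * l1_norm s u)"
        by (intro mult_left_mono) (simp_all add: infsum_cmult_right' l1_norm_def)
      moreover have "norm (w x * (cnj (k x y) * cnj (u y))) = cmod (w x) * norm (k x y * u y)" for y
        by (simp add: norm_mult)
      ultimately show ?thesis by (simp only: infsum_cmult_right') (simp add: mult_ac)
    qed
    then show "(\<lambda>x. norm (\<Sum>\<^sub>\<infinity>y. norm (case (x, y) of (x, y) \<Rightarrow> w x * (cnj (k x y) * cnj (u y))))) summable_on UNIV"
      by (intro Infinite_Sum.abs_summable_on_comparison_test'[OF summable_on_cmult_right[OF l1_spaceD[OF w],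
              of "C * l1_norm s u"]]) (simp add: infsum_nonneg)
  qed
  then have "(\<lambda>(x, y). w x * (cnj (k x y) * cnj (u y))) summable_on UNIV \<times> UNIV"
    using summable_on_iff_abs_summable_on_complex by blast
  from infsum_swap_banach[OF this]
  have "(\<Sum>\<^sub>\<infinity>x. w x * cnj (kernel_op k u x)) = (\<Sum>\<^sub>\<infinity>y. \<Sum>\<^sub>\<infinity>x. w x * (cnj (k x y) * cnj (u y)))"
    by (simp add: kernel_op_def infsum_cmult_right' flip: infsum_cnj)
  also have "\<dots> = (\<Sum>\<^sub>\<infinity>y. cnj (u y) * kernel_op k w y)"
  proof (rule infsum_cong)
    fix y
    have "(\<Sum>\<^sub>\<infinity>x. w x * (cnj (k x y) * cnj (u y))) = (\<Sum>\<^sub>\<infinity>x. cnj (u y) * (k y x * w x))"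
      by (simp add: sym[of y] mult_ac)
    then show "(\<Sum>\<^sub>\<infinity>x. w x * (cnj (k x y) * cnj (u y))) = cnj (u y) * kernel_op k w y"
      by (simp add: kernel_op_def infsum_cmult_right')
  qed
  finally show ?thesis by (simp add: pairing_def mult.commute)
qed

text \<open>The passage from pointwise expansions of kernels to operator expansions: coefficients
  and remainders are again kernels with the same weights.\<close>

lemma op_expands_kernel:
  assumes s: "0 \<le> s"
  shows "fam_expands n (\<lambda>(x, y). weight s x * weight s y) (\<lambda>\<kappa> (x, y). K \<kappa> x y) \<Longrightarrow>
    op_expands n (l1_space s) (l1_norm s) (linf_space s) (linf_norm s) (\<lambda>\<kappa>. kernel_op (K \<kappa>))"
proof (induction n arbitrary: K)
  case 0
  then obtain C where C: "0 \<le> C" "\<forall>\<^sub>F \<kappa> in right_half_plane_0.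
      \<forall>i. cmod (case i of (x, y) \<Rightarrow> K \<kappa> x y) \<le> C * (case i of (x, y) \<Rightarrow> weight s x * weight s y)"
    by (rule fam_expands_0E)
  have "\<forall>\<^sub>F \<kappa> in right_half_plane_0. op_bound (l1_space s) (l1_norm s) (linf_space s) (linf_norm s) C (kernel_op (K \<kappa>))"
    using C(2) by eventually_elim (rule op_bound_kernel, auto simp: kernel_bound_def C(1))
  then show ?case unfolding op_expands.simps by blast
next
  case (Suc n)
  then obtain C a f where *: "0 \<le> C"
    "\<And>i. cmod (a i) \<le> C * (case i of (x, y) \<Rightarrow> weight s x * weight s y)"
    "fam_expands n (\<lambda>(x, y). weight s x * weight s y) f"
    "\<forall>\<^sub>F \<kappa> in right_half_plane_0. \<forall>i. (case i of (x, y) \<Rightarrow> K \<kappa> x y) = a i + \<kappa> * f \<kappa> i"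
    using fam_expands_SucE by blast
  define A where "A x y = a (x, y)" for x y
  define F where "F \<kappa> x y = f \<kappa> (x, y)" for \<kappa> x y
  have fF: "fam_expands n (\<lambda>(x, y). weight s x * weight s y) (\<lambda>\<kappa> (x, y). F \<kappa> x y)"
    using *(3) by (simp add: F_def)
  have A: "kernel_bound s C A" using *(1,2) by (auto simp: kernel_bound_def A_def split: prod.splits)
  have "fam_expands 0 (\<lambda>(x, y). weight s x * weight s y) f"
    by (rule fam_expands_bounded[OF _ *(3)]) (auto split: prod.splits)
  then obtain D where D: "0 \<le> D" "\<forall>\<^sub>F \<kappa> in right_half_plane_0.
      \<forall>i. cmod (f \<kappa> i) \<le> D * (case i of (x, y) \<Rightarrow> weight s x * weight s y)"
    by (rule fam_expands_0E)
  show ?case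
  proof (rule op_expands_SucI[OF op_bound_kernel[OF A] Suc.IH[OF fF]])
    show "\<forall>\<^sub>F \<kappa> in right_half_plane_0. \<forall>u\<in>l1_space s.
        kernel_op (K \<kappa>) u = kernel_op A u + \<kappa> *\<^sub>C kernel_op (F \<kappa>) u"
      using *(4) D(2)
    proof eventually_elim
      case (elim \<kappa>)
      have "kernel_bound s D (F \<kappa>)" using elim(2) D(1) by (auto simp: kernel_bound_def F_def)
      moreover have "K \<kappa> = (\<lambda>x y. A x y + \<kappa> * F \<kappa> x y)"
        using elim(1) by (auto simp: fun_eq_iff A_def F_def)
      ultimately show ?case using kernel_op_add_scale[OF A] by simp
    qed
  qed
qed

lemma has_sum_sum:
  fixes f :: "'i \<Rightarrow> 'x \<Rightarrow> 'b::topological_comm_monoid_add"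
  assumes "\<And>i. i \<in> I \<Longrightarrow> (f i has_sum s i) A"
  shows "((\<lambda>x. \<Sum>i\<in>I. f i x) has_sum (\<Sum>i\<in>I. s i)) A"
  using assms by (induction I rule: infinite_finite_induct) (auto intro: has_sum_add)

text \<open>The Schur test: Cauchy-Schwarz within each row, then the column sums after exchanging
  the summations. Equal row and column bounds give that same number as norm bound.\<close>

lemma op_bound_kernel_l2:
  fixes k :: "('a, 'n) vertex \<Rightarrow> ('a, 'n) vertex \<Rightarrow> complex"
  assumes rows: "\<And>x F. finite F \<Longrightarrow> (\<Sum>y\<in>F. cmod (k x y)) \<le> A"
    and cols: "\<And>y F. finite F \<Longrightarrow> (\<Sum>x\<in>F. cmod (k x y)) \<le> A"
  shows "op_bound l2_space l2_norm l2_space l2_norm A (kernel_op k)"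
    and "u \<in> l2_space \<Longrightarrow> (\<lambda>y. k x y * u y) summable_on UNIV"
proof -
  have A: "0 \<le> A" using rows[of "{}"] by simp
  have rs: "(\<lambda>y. cmod (k x y)) summable_on UNIV" for x
    by (rule nonneg_bdd_above_summable_on) (auto intro!: bdd_aboveI2[where M = A] rows)
  have s: "(\<lambda>y. norm (k x y * u y)) summable_on UNIV" if u: "u \<in> l2_space" for u x
  proof (rule Infinite_Sum.abs_summable_on_comparison_test')
    show "(\<lambda>y. cmod (k x y) * l2_norm u) summable_on UNIV" by (rule summable_on_cmult_left[OF rs])
    show "norm (k x y * u y) \<le> cmod (k x y) * l2_norm u" for y
      unfolding norm_mult by (intro mult_left_mono l2_point_le[OF u]) auto
  qed
  have s': "(\<lambda>y. k x y * u y) summable_on UNIV" if u: "u \<in> l2_space" for u x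
    using s[OF u] summable_on_iff_abs_summable_on_complex by blast
  then show "u \<in> l2_space \<Longrightarrow> (\<lambda>y. k x y * u y) summable_on UNIV" .
  have s2: "(\<lambda>y. cmod (k x y) * (cmod (u y))\<^sup>2) summable_on UNIV" if u: "u \<in> l2_space" for u x
  proof (rule summable_on_comparison_test)
    show "(\<lambda>y. cmod (k x y) * (l2_norm u)\<^sup>2) summable_on UNIV" by (rule summable_on_cmult_left[OF rs])
    show "cmod (k x y) * (cmod (u y))\<^sup>2 \<le> cmod (k x y) * (l2_norm u)\<^sup>2" for y
      by (intro mult_left_mono power_mono l2_point_le[OF u]) auto
  qed auto
  have cs: "(cmod (kernel_op k u x))\<^sup>2 \<le> A * (\<Sum>\<^sub>\<infinity>y. cmod (k x y) * (cmod (u y))\<^sup>2)"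
    (is "_ \<le> A * ?B") if u: "u \<in> l2_space" for u x
  proof -
    have B: "0 \<le> ?B" by (intro infsum_nonneg) auto
    have "(\<Sum>y\<in>F. cmod (k x y * u y)) \<le> sqrt (A * ?B)" if F: "finite F" for F
    proof (rule real_le_rsqrt)
      \<comment> \<open>Splitting |k| into two square roots lets one half meet the row bound and
        leaves the other half with |u|^2.\<close>
      have "(\<Sum>y\<in>F. cmod (k x y * u y)) =
          (\<Sum>y\<in>F. sqrt (cmod (k x y)) * (sqrt (cmod (k x y)) * cmod (u y)))"
        by (intro sum.cong) (auto simp: norm_mult simp flip: mult.assoc)
      also have "\<dots>\<^sup>2 \<le> (\<Sum>y\<in>F. (sqrt (cmod (k x y)))\<^sup>2) * (\<Sum>y\<in>F. (sqrt (cmod (k x y)) * cmod (u y))\<^sup>2)"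
        by (rule Cauchy_Schwarz_ineq_sum)
      also have "\<dots> = (\<Sum>y\<in>F. cmod (k x y)) * (\<Sum>y\<in>F. cmod (k x y) * (cmod (u y))\<^sup>2)"
        by (simp add: power_mult_distrib)
      also have "\<dots> \<le> A * ?B"
        using F A by (intro mult_mono rows finite_sum_le_infsum s2[OF u] sum_nonneg) auto
      finally show "(\<Sum>y\<in>F. cmod (k x y * u y))\<^sup>2 \<le> A * ?B" .
    qed
    then have "(\<Sum>\<^sub>\<infinity>y. cmod (k x y * u y)) \<le> sqrt (A * ?B)"
      by (intro infsum_le_finite_sums s[OF u]) auto
    then have "cmod (kernel_op k u x) \<le> sqrt (A * ?B)"
      unfolding kernel_op_def using norm_infsum_bound[OF s[OF u]] order_trans by blast
    then have "(cmod (kernel_op k u x))\<^sup>2 \<le> (sqrt (A * ?B))\<^sup>2" by (intro power_mono) auto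
    then show ?thesis using A B by simp
  qed
  show "op_bound l2_space l2_norm l2_space l2_norm A (kernel_op k)"
  proof (rule op_boundI[OF A])
    fix u w :: "('a, 'n) gfun" and c assume u: "u \<in> l2_space"
    have us: "(\<lambda>x. (cmod (u x))\<^sup>2) summable_on UNIV" using u by (simp add: l2_space_def)
    have "(\<Sum>x\<in>F. (cmod (kernel_op k u x))\<^sup>2) \<le> (A * l2_norm u)\<^sup>2" if F: "finite F" for F
    proof -
      have "(\<Sum>x\<in>F. (cmod (kernel_op k u x))\<^sup>2) \<le> (\<Sum>x\<in>F. A * (\<Sum>\<^sub>\<infinity>y. cmod (k x y) * (cmod (u y))\<^sup>2))"
        by (intro sum_mono cs[OF u])
      also have "\<dots> = A * (\<Sum>\<^sub>\<infinity>y. \<Sum>x\<in>F. cmod (k x y) * (cmod (u y))\<^sup>2)"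
        unfolding sum_distrib_left[symmetric] infsumI[OF has_sum_sum[OF has_sum_infsum[OF s2[OF u]]]] ..
      also have "\<dots> \<le> A * (\<Sum>\<^sub>\<infinity>y. A * (cmod (u y))\<^sup>2)"
      proof (intro mult_left_mono A infsum_mono)
        show "(\<lambda>y. \<Sum>x\<in>F. cmod (k x y) * (cmod (u y))\<^sup>2) summable_on UNIV"
          by (rule has_sum_imp_summable[OF has_sum_sum[OF has_sum_infsum[OF s2[OF u]]]])
        show "(\<lambda>y. A * (cmod (u y))\<^sup>2) summable_on UNIV" by (rule summable_on_cmult_right[OF us])
        fix y
        have "(\<Sum>x\<in>F. cmod (k x y)) \<le> A" by (rule cols[OF F])
        then show "(\<Sum>x\<in>F. cmod (k x y) * (cmod (u y))\<^sup>2) \<le> A * (cmod (u y))\<^sup>2"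
          unfolding sum_distrib_right[symmetric] by (rule mult_right_mono) auto
      qed
      also have "\<dots> = (A * l2_norm u)\<^sup>2"
        unfolding power_mult_distrib l2_norm_square by (simp add: infsum_cmult_right' power2_eq_square)
      finally show ?thesis .
    qed
    from l2_spaceI[OF _ this] show "kernel_op k u \<in> l2_space" "l2_norm (kernel_op k u) \<le> A * l2_norm u"
      using A l2_norm_nonneg[of u] by auto
    show "kernel_op k (c *\<^sub>C u) = c *\<^sub>C kernel_op k u"
      by (simp add: fun_eq_iff kernel_op_def flip: infsum_cmult_right') (simp add: mult_ac)
    assume w: "w \<in> l2_space"
    show "kernel_op k (u + w) = kernel_op k u + kernel_op k w"
      using s'[OF u] s'[OF w] by (simp add: fun_eq_iff kernel_op_def distrib_left infsum_add)
  qed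
qed

subsection \<open>The free operator\<close>

text \<open>Injective linear maps in finite dimension are onto. The functions are moved to
  \<open>complex ^ 'a\<close>, a finite-dimensional real space, where real linearity is
  enough.\<close>

lemma linear_inj_imp_bij_fun:
  fixes f :: "('a::finite \<Rightarrow> complex) \<Rightarrow> 'a \<Rightarrow> complex"
  assumes add: "\<And>u w. f (u + w) = f u + f w" and scale: "\<And>c u. f (c *\<^sub>C u) = c *\<^sub>C f u"
    and inj: "\<And>u. f u = 0 \<Longrightarrow> u = 0"
  shows "bij f"
proof -
  define g :: "complex ^ 'a \<Rightarrow> complex ^ 'a" where "g v = (\<chi> i. f (\<lambda>j. v $ j) i)" for v
  have g: "g v $ i = f (\<lambda>j. v $ j) i" for v i by (simp add: g_def)
  have lin: "linear g"
  proof (rule linearI)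
    fix v w :: "complex ^ 'a" and r :: real
    have "(\<lambda>j. (v + w) $ j) = (\<lambda>j. v $ j) + (\<lambda>j. w $ j)" by (simp add: fun_eq_iff)
    then have "f (\<lambda>j. (v + w) $ j) i = f (\<lambda>j. v $ j) i + f (\<lambda>j. w $ j) i" for i
      using add[of "\<lambda>j. v $ j" "\<lambda>j. w $ j"] by (metis plus_fun_apply)
    then show "g (v + w) = g v + g w" unfolding vec_eq_iff vector_add_component g by blast
    have "(\<lambda>j. (r *\<^sub>R v) $ j) = complex_of_real r *\<^sub>C (\<lambda>j. v $ j)"
      by (simp only: fun_eq_iff vector_scaleR_component scaleC_fun_apply scaleC_complex_eq)
        (simp add: scaleR_conv_of_real)
    then have eq: "f (\<lambda>j. (r *\<^sub>R v) $ j) = complex_of_real r *\<^sub>C f (\<lambda>j. v $ j)"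
      by (simp only: scale)
    have "f (\<lambda>j. (r *\<^sub>R v) $ j) i = r *\<^sub>R f (\<lambda>j. v $ j) i" for i
      by (subst eq) (simp add: scaleR_conv_of_real)
    then show "g (r *\<^sub>R v) = r *\<^sub>R g v" unfolding vec_eq_iff vector_scaleR_component g by blast
  qed
  have "inj g"
  proof (subst linear_injective_0[OF lin], intro allI impI)
    fix v assume "g v = 0"
    then have "f (\<lambda>j. v $ j) i = 0" for i using g[of v i] by simp
    then have "f (\<lambda>j. v $ j) = 0" by (simp add: fun_eq_iff)
    then have "(\<lambda>j. v $ j) = 0" by (rule inj)
    then show "v = 0" by (simp add: vec_eq_iff fun_eq_iff)
  qed
  then have "surj g" by (rule linear_inj_imp_surj[OF lin])
  show ?thesis
  proof (rule bijI)
    show "inj f"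
    proof (rule injI)
      fix u w assume "f u = f w"
      have "f (u + (-1) *\<^sub>C w) = f u + (-1) *\<^sub>C f w" by (simp only: add scale)
      also have "\<dots> = 0" unfolding \<open>f u = f w\<close> scaleC_minus_one by simp
      finally have "f (u + (-1) *\<^sub>C w) = 0" .
      then have "u + (-1) *\<^sub>C w = 0" by (rule inj)
      then show "u = w" by (simp add: scaleC_minus_one)
    qed
    show "surj f"
    proof (unfold surj_def, intro allI)
      fix y :: "'a \<Rightarrow> complex"
      obtain v where "(\<chi> i. y i) = g v" using \<open>surj g\<close> by (auto simp: surj_def)
      then have "y i = f (\<lambda>j. v $ j) i" for i using g[of v i] by (metis vec_lambda_beta)
      then show "\<exists>u. y = f u" by blast
    qed
  qed
qed

section \<open>The operator on the finite graph and its inverse\<close>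

locale ray_graph =
  fixes E0 :: "('a::finite \<times> 'a) set" and att :: "'n::finite \<Rightarrow> 'a"
  assumes sym_E0: "sym E0" and connected: "\<forall>x y. (x, y) \<in> E0\<^sup>*"
begin

definition edge :: "'a \<Rightarrow> 'a \<Rightarrow> complex" where
  "edge x y = (if (x, y) \<in> E0 then 1 else 0)"

lemma edge_commute: "edge x y = edge y x"
  using sym_E0 by (auto simp: edge_def dest: symD)

lemma core_op_edge:
  "core_op E0 att u x = (\<Sum>y\<in>UNIV. edge x y * (u x - u y)) + (\<Sum>\<alpha>\<in>UNIV. (if x = att \<alpha> then 1 else 0)) * u x"
proof -
  have "(\<Sum>y\<in>E0 `` {x}. u x - u y) = (\<Sum>y\<in>UNIV. edge x y * (u x - u y))"
    by (rule sum.mono_neutral_cong_left) (auto simp: edge_def)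
  then show ?thesis by (simp add: core_op_def sum_distrib_right)
qed

lemma core_op_add: "core_op E0 att (u + w) = core_op E0 att u + core_op E0 att w"
  by (simp add: fun_eq_iff core_op_edge sum.distrib[symmetric] algebra_simps)

lemma core_op_scale: "core_op E0 att (c *\<^sub>C u) = c *\<^sub>C core_op E0 att u"
  by (simp add: fun_eq_iff core_op_edge sum_distrib_left algebra_simps)

lemma core_op_hermitian:
  "(\<Sum>x\<in>UNIV. cnj (u x) * core_op E0 att w x) = (\<Sum>x\<in>UNIV. cnj (core_op E0 att u x) * w x)"
proof -
  have edge_cnj: "cnj (edge x y) = edge x y" for x y by (simp add: edge_def)
  have "(\<Sum>x\<in>UNIV. \<Sum>y\<in>UNIV. edge x y * (cnj (u x) * w y)) =
      (\<Sum>y\<in>UNIV. \<Sum>x\<in>UNIV. edge x y * (cnj (u x) * w y))" by (rule sum.swap)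
  also have "\<dots> = (\<Sum>y\<in>UNIV. \<Sum>x\<in>UNIV. edge y x * (cnj (u x) * w y))"
    by (simp add: edge_commute)
  finally have swap: "(\<Sum>x\<in>UNIV. \<Sum>y\<in>UNIV. edge x y * (cnj (u x) * w y)) =
      (\<Sum>x\<in>UNIV. \<Sum>y\<in>UNIV. edge x y * (cnj (u y) * w x))" .
  have "(\<Sum>x\<in>UNIV. cnj (u x) * core_op E0 att w x) - (\<Sum>x\<in>UNIV. cnj (core_op E0 att u x) * w x) =
      (\<Sum>x\<in>UNIV. \<Sum>y\<in>UNIV. edge x y * (cnj (u y) * w x)) - (\<Sum>x\<in>UNIV. \<Sum>y\<in>UNIV. edge x y * (cnj (u x) * w y))"
    by (simp add: core_op_edge edge_cnj sum_subtractf[symmetric] sum_distrib_left sum_distrib_right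
        algebra_simps)
      (simp add: sum.distrib[symmetric] sum_subtractf[symmetric] if_distrib cong: if_cong)
  then show ?thesis unfolding swap by simp
qed

text \<open>The quadratic form is half the sum of |u(x) - u(y)|^2 over ordered edges plus |u|^2 at
  the attachment vertices. If it vanishes, u is constant by connectedness and zero where a ray is
  attached.\<close>

lemma core_op_injective:
  assumes "core_op E0 att u = 0"
  shows "u = 0"
proof -
  define D where "D x = (\<Sum>\<alpha>\<in>UNIV. if x = att \<alpha> then 1 else (0::real))" for x
  have D: "0 \<le> D x" for x by (auto simp: D_def intro!: sum_nonneg)
  define e where "e x y = (if (x, y) \<in> E0 then 1 else (0::real))" for x y
  have e: "0 \<le> e x y" for x y by (simp add: e_def)
  have ee: "edge x y = complex_of_real (e x y)" for x y by (simp add: edge_def e_def)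
  have DD: "(\<Sum>\<alpha>\<in>UNIV. if x = att \<alpha> then 1 else 0) = complex_of_real (D x)" for x
    unfolding D_def of_real_sum by (rule sum.cong) auto
  define S where "S = (\<Sum>x\<in>UNIV. \<Sum>y\<in>UNIV. edge x y * (cnj (u x) * (u x - u y)))"
  have "S = (\<Sum>y\<in>UNIV. \<Sum>x\<in>UNIV. edge x y * (cnj (u x) * (u x - u y)))"
    unfolding S_def by (rule sum.swap)
  also have "\<dots> = (\<Sum>x\<in>UNIV. \<Sum>y\<in>UNIV. edge x y * (cnj (u y) * (u y - u x)))"
    by (simp add: edge_commute)
  \<comment> \<open>The double sum is averaged with its copy in which the ends of each edge are
    exchanged; the two combine to a square.\<close>
  finally have "2 * S = (\<Sum>x\<in>UNIV. \<Sum>y\<in>UNIV. edge x y * (cnj (u x - u y) * (u x - u y)))"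
    unfolding mult_2 by (subst (1) S_def)
      (simp only: sum.distrib[symmetric] distrib_left[symmetric] complex_cnj_diff,
        simp add: algebra_simps)
  then have S: "2 * S = complex_of_real (\<Sum>x\<in>UNIV. \<Sum>y\<in>UNIV. e x y * (cmod (u x - u y))\<^sup>2)"
    by (simp add: ee complex_norm_square mult.commute del: complex_cnj_diff of_real_power
        flip: of_real_power)
  have "0 = (\<Sum>x\<in>UNIV. cnj (u x) * core_op E0 att u x)" by (simp add: assms)
  also have "\<dots> = S + (\<Sum>x\<in>UNIV. complex_of_real (D x) * (cnj (u x) * u x))"
    unfolding S_def by (simp add: core_op_edge DD sum_distrib_left sum.distrib[symmetric] algebra_simps)
  also have "\<dots> = S + complex_of_real (\<Sum>x\<in>UNIV. D x * (cmod (u x))\<^sup>2)"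
    by (simp add: complex_norm_square mult.commute del: of_real_power flip: of_real_power)
  finally have SD: "S + complex_of_real (\<Sum>x\<in>UNIV. D x * (cmod (u x))\<^sup>2) = 0" by (rule sym)
  define A where "A = (\<Sum>x\<in>UNIV. \<Sum>y\<in>UNIV. e x y * (cmod (u x - u y))\<^sup>2)"
  define B where "B = (\<Sum>x\<in>UNIV. D x * (cmod (u x))\<^sup>2)"
  have "complex_of_real (A + 2 * B) = 2 * S + 2 * complex_of_real B"
    unfolding S A_def[symmetric] by simp
  also have "\<dots> = 2 * (S + complex_of_real B)" by (rule distrib_left[symmetric])
  also have "\<dots> = 0" using SD by (simp only: B_def mult_zero_right)
  finally have zero: "(\<Sum>x\<in>UNIV. \<Sum>y\<in>UNIV. e x y * (cmod (u x - u y))\<^sup>2) +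
      2 * (\<Sum>x\<in>UNIV. D x * (cmod (u x))\<^sup>2) = 0"
    unfolding A_def B_def by (simp only: of_real_eq_0_iff)
  have n1: "0 \<le> (\<Sum>y\<in>UNIV. e x y * (cmod (u x - u y))\<^sup>2)" for x
    by (intro sum_nonneg mult_nonneg_nonneg e) auto
  have n2: "0 \<le> (\<Sum>x\<in>UNIV. D x * (cmod (u x))\<^sup>2)"
    by (intro sum_nonneg mult_nonneg_nonneg D) auto
  have n3: "0 \<le> (\<Sum>x\<in>UNIV. \<Sum>y\<in>UNIV. e x y * (cmod (u x - u y))\<^sup>2)"
    by (intro sum_nonneg n1)
  have z2: "(\<Sum>x\<in>UNIV. D x * (cmod (u x))\<^sup>2) = 0" and
    z1: "(\<Sum>x\<in>UNIV. \<Sum>y\<in>UNIV. e x y * (cmod (u x - u y))\<^sup>2) = 0"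
    using zero n2 n3 by auto
  have step: "u x = u y" if "(x, y) \<in> E0" for x y
  proof -
    have "(\<Sum>y\<in>UNIV. e x y * (cmod (u x - u y))\<^sup>2) = 0"
      using z1 n1 by (subst (asm) sum_nonneg_eq_0_iff) auto
    then have "e x y * (cmod (u x - u y))\<^sup>2 = 0"
      by (subst (asm) sum_nonneg_eq_0_iff) (auto intro!: mult_nonneg_nonneg e)
    then show ?thesis using that by (simp add: e_def)
  qed
  have const: "u x = u y" if "(x, y) \<in> E0\<^sup>*" for x y
    using that by (induction rule: rtrancl_induct) (use step in auto)
  fix \<alpha> :: 'n
  have "D (att \<alpha>) * (cmod (u (att \<alpha>)))\<^sup>2 = 0" for \<alpha> :: 'n
    using z2 by (subst (asm) sum_nonneg_eq_0_iff) (auto intro!: mult_nonneg_nonneg D)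
  moreover have "D (att \<alpha>) \<noteq> 0" for \<alpha> :: 'n
  proof -
    have "1 \<le> D (att \<alpha>)"
    proof -
      have "0 \<le> (\<Sum>\<gamma>\<in>UNIV - {\<alpha>}. if att \<alpha> = att \<gamma> then 1 else (0::real))"
        by (rule sum_nonneg) simp
      then show ?thesis unfolding D_def by (subst sum.remove[of _ \<alpha>]) auto
    qed
    then show ?thesis by linarith
  qed
  ultimately have "u (att \<alpha>) = 0" for \<alpha> by simp
  \<comment> \<open>The type \<open>'n\<close> is inhabited, so some vertex does carry a ray;
    constancy spreads the zero from there.\<close>
  then have "u x = 0" for x using const connected by metis
  then show ?thesis by auto
qed

lemma bij_core_op: "bij (core_op E0 att)"
  by (rule linear_inj_imp_bij_fun) (auto simp: core_op_add core_op_scale core_op_injective)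

definition core_shift :: "complex \<Rightarrow> ('a \<Rightarrow> complex) \<Rightarrow> 'a \<Rightarrow> complex" where
  "core_shift \<kappa> u = core_op E0 att u + \<kappa>\<^sup>2 *\<^sub>C u"

text \<open>A column of the inverse matrix, provided \<open>core_shift \<kappa>\<close> is
  bijective; otherwise \<open>inv\<close> yields arbitrary values, so bijectivity accompanies each
  use.\<close>

definition core_green :: "complex \<Rightarrow> 'a \<Rightarrow> 'a \<Rightarrow> complex" where
  "core_green \<kappa> x y = inv (core_shift \<kappa>) (\<lambda>z. if z = y then 1 else 0) x"

lemma core_shift_0 [simp]: "core_shift 0 = core_op E0 att"
  by (simp add: core_shift_def fun_eq_iff)

lemma core_shift_add: "core_shift \<kappa> (u + w) = core_shift \<kappa> u + core_shift \<kappa> w"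
  by (simp add: core_shift_def core_op_add scaleC_add_right algebra_simps)

lemma core_shift_scale: "core_shift \<kappa> (c *\<^sub>C u) = c *\<^sub>C core_shift \<kappa> u"
  by (simp add: core_shift_def core_op_scale scaleC_add_right scaleC_scaleC mult.commute)

lemma core_shift_zero [simp]: "core_shift \<kappa> 0 = 0"
  using core_shift_scale[of \<kappa> 0 0] by simp

lemma core_shift_sum: "core_shift \<kappa> (\<Sum>i\<in>I. f i) = (\<Sum>i\<in>I. core_shift \<kappa> (f i))"
  by (induction I rule: infinite_finite_induct)
    (simp_all only: core_shift_add core_shift_zero sum.infinite sum.empty sum.insert not_False_eq_True)

lemma core_shift_green:
  assumes "bij (core_shift \<kappa>)"
  shows "core_shift \<kappa> (\<lambda>x. \<Sum>y\<in>UNIV. core_green \<kappa> x y * u y) = u"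
    and "inv (core_shift \<kappa>) u = (\<lambda>x. \<Sum>y\<in>UNIV. core_green \<kappa> x y * u y)"
proof -
  define \<delta> :: "'a \<Rightarrow> 'a \<Rightarrow> complex" where "\<delta> y = (\<lambda>z. if z = y then 1 else 0)" for y
  have \<delta>: "core_shift \<kappa> (\<lambda>x. core_green \<kappa> x y) = \<delta> y" for y
    unfolding core_green_def \<delta>_def using assms by (simp add: bij_is_surj surj_f_inv_f)
  have eq: "(\<lambda>x. \<Sum>y\<in>UNIV. core_green \<kappa> x y * u y) = (\<Sum>y\<in>UNIV. u y *\<^sub>C (\<lambda>x. core_green \<kappa> x y))"
    by (simp add: fun_eq_iff sum_fun_apply mult.commute)
  have "(\<Sum>y\<in>UNIV. u y *\<^sub>C \<delta> y) = u"
    by (simp add: fun_eq_iff sum_fun_apply \<delta>_def if_distrib cong: if_cong)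
  then show *: "core_shift \<kappa> (\<lambda>x. \<Sum>y\<in>UNIV. core_green \<kappa> x y * u y) = u"
    unfolding eq by (simp only: core_shift_sum core_shift_scale \<delta>)
  show "inv (core_shift \<kappa>) u = (\<lambda>x. \<Sum>y\<in>UNIV. core_green \<kappa> x y * u y)"
    using inv_f_f[OF bij_is_inj[OF assms], of "\<lambda>x. \<Sum>y\<in>UNIV. core_green \<kappa> x y * u y"]
    unfolding * .
qed

lemma core_green_core_op: "(\<lambda>x. \<Sum>y\<in>UNIV. core_green 0 x y * core_op E0 att u y) = u"
proof -
  have "inv (core_op E0 att) (core_op E0 att u) = u" by (rule inv_f_f[OF bij_is_inj[OF bij_core_op]])
  then show ?thesis using core_shift_green(2)[of 0 "core_op E0 att u"] bij_core_op
    by (simp only: core_shift_0)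
qed

lemma core_green_hermitian: "core_green 0 y x = cnj (core_green 0 x y)"
proof -
  define \<delta> :: "'a \<Rightarrow> 'a \<Rightarrow> complex" where "\<delta> y = (\<lambda>z. if z = y then 1 else 0)" for y
  have \<delta>: "core_op E0 att (\<lambda>x. core_green 0 x y) = \<delta> y" for y
    unfolding core_green_def \<delta>_def using bij_core_op by (simp add: bij_is_surj surj_f_inv_f)
  have "(\<Sum>z\<in>UNIV. cnj (core_green 0 z x) * \<delta> y z) = (\<Sum>z\<in>UNIV. cnj (\<delta> x z) * core_green 0 z y)"
    using core_op_hermitian[of "\<lambda>z. core_green 0 z x" "\<lambda>z. core_green 0 z y"] by (simp only: \<delta>)
  then have "cnj (core_green 0 y x) = core_green 0 x y"
    by (simp add: \<delta>_def if_distrib if_distribR cong: if_cong)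
  then show ?thesis by (metis complex_cnj_cnj)
qed

text \<open>Writing u as the inverse at 0 applied to \<open>core_shift \<kappa> u\<close> minus
  \<kappa>^2 u, the last term is absorbed once |\<kappa>|^2 \<open>B\<close> <= 1/2. The resulting a
  priori bound 2 \<open>B\<close> gives injectivity and bounds the inverse.\<close>

lemma core_green_eventually:
  obtains C where "0 \<le> C"
    "\<forall>\<^sub>F \<kappa> in right_half_plane_0. bij (core_shift \<kappa>) \<and> (\<forall>x y. cmod (core_green \<kappa> x y) \<le> C)"
proof -
  define B where "B = (\<Sum>x\<in>UNIV. \<Sum>y\<in>UNIV. cmod (core_green 0 x y))"
  define p :: "('a \<Rightarrow> complex) \<Rightarrow> real" where "p u = (\<Sum>x\<in>UNIV. cmod (u x))" for u
  have B: "0 \<le> B" unfolding B_def by (intro sum_nonneg) auto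
  have p: "0 \<le> p u" "cmod (u x) \<le> p u" for u x
    unfolding p_def by (intro sum_nonneg member_le_sum; auto)+
  have N: "p (\<lambda>x. \<Sum>y\<in>UNIV. core_green 0 x y * u y) \<le> B * p u" for u
  proof -
    have "cmod (\<Sum>y\<in>UNIV. core_green 0 x y * u y) \<le> (\<Sum>y\<in>UNIV. cmod (core_green 0 x y)) * p u" for x
      unfolding sum_distrib_right by (intro sum_norm_le) (simp add: norm_mult mult_left_mono p)
    then have "p (\<lambda>x. \<Sum>y\<in>UNIV. core_green 0 x y * u y) \<le> (\<Sum>x\<in>UNIV. (\<Sum>y\<in>UNIV. cmod (core_green 0 x y)) * p u)"
      unfolding p_def[of "\<lambda>x. \<Sum>y\<in>UNIV. core_green 0 x y * u y"] by (intro sum_mono)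
    also have "\<dots> = B * p u" unfolding B_def sum_distrib_right ..
    finally show ?thesis .
  qed
  have bound: "p u \<le> 2 * B * p (core_shift \<kappa> u)" if \<kappa>: "(cmod \<kappa>)\<^sup>2 * B \<le> 1 / 2" for \<kappa> u
  proof -
    have "core_op E0 att u = core_shift \<kappa> u + (- \<kappa>\<^sup>2) *\<^sub>C u"
      by (simp add: core_shift_def scaleC_minus_left)
    then have "u = (\<lambda>x. \<Sum>y\<in>UNIV. core_green 0 x y * (core_shift \<kappa> u + (- \<kappa>\<^sup>2) *\<^sub>C u) y)"
      using core_green_core_op[of u] by (simp only:)
    then have 1: "p u \<le> B * p (core_shift \<kappa> u + (- \<kappa>\<^sup>2) *\<^sub>C u)" using N by metis
    have 2: "p (core_shift \<kappa> u + (- \<kappa>\<^sup>2) *\<^sub>C u) \<le> p (core_shift \<kappa> u) + (cmod \<kappa>)\<^sup>2 * p u"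
      unfolding p_def sum_distrib_left sum.distrib[symmetric]
      by (intro sum_mono) (simp, metis norm_mult norm_power norm_triangle_ineq4)
    have "p u \<le> B * p (core_shift \<kappa> u) + ((cmod \<kappa>)\<^sup>2 * B) * p u"
      using order_trans[OF 1 mult_left_mono[OF 2 B]] by (simp add: distrib_left mult_ac)
    also have "((cmod \<kappa>)\<^sup>2 * B) * p u \<le> (1 / 2) * p u" by (rule mult_right_mono[OF \<kappa> p(1)])
    finally show ?thesis by simp
  qed
  have "\<forall>\<^sub>F \<kappa> in right_half_plane_0. (cmod \<kappa>)\<^sup>2 * B < 1 / 2"
  proof (rule order_tendstoD(2))
    show "((\<lambda>\<kappa>. (cmod \<kappa>)\<^sup>2 * B) \<longlongrightarrow> 0) right_half_plane_0"
      by (auto intro!: tendsto_eq_intros tendsto_right_half_plane_0)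
  qed auto
  then have "\<forall>\<^sub>F \<kappa> in right_half_plane_0. bij (core_shift \<kappa>) \<and> (\<forall>x y. cmod (core_green \<kappa> x y) \<le> 2 * B)"
  proof eventually_elim
    case (elim \<kappa>)
    have bij: "bij (core_shift \<kappa>)"
    proof (rule linear_inj_imp_bij_fun[OF core_shift_add core_shift_scale])
      fix u assume "core_shift \<kappa> u = 0"
      then have "p u \<le> 0" using bound[of \<kappa> u] elim by (simp add: p_def)
      then have "cmod (u x) \<le> 0" for x using p(2)[of u x] by linarith
      then show "u = 0" by auto
    qed
    have "cmod (core_green \<kappa> x y) \<le> 2 * B" for x y
    proof -
      have "core_shift \<kappa> (\<lambda>x. core_green \<kappa> x y) = (\<lambda>z. if z = y then 1 else 0)"
        unfolding core_green_def using bij by (simp add: bij_is_surj surj_f_inv_f)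
      then have "p (\<lambda>x. core_green \<kappa> x y) \<le> 2 * B * p (\<lambda>z. if z = y then 1 else 0)"
        using bound[of \<kappa> "\<lambda>x. core_green \<kappa> x y"] elim by simp
      also have "p (\<lambda>z. if z = y then 1 else 0) = 1"
        by (simp add: p_def if_distrib cong: if_cong)
      finally show ?thesis using p(2)[of "\<lambda>x. core_green \<kappa> x y" x] by simp
    qed
    with bij show ?case by blast
  qed
  with B show ?thesis by (intro that[of "2 * B"]) auto
qed

text \<open>The first resolvent identity. The square of \<kappa> is split because an expansion peels
  off one factor at a time; the second factor is what leaves no first-order term.\<close>

lemma core_green_resolvent_eq:
  assumes bij: "bij (core_shift \<kappa>)"
  shows "core_green \<kappa> x y = core_green 0 x y + \<kappa> * (\<kappa> * (\<Sum>z\<in>UNIV. - core_green 0 x z * core_green \<kappa> z y))"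
proof -
  define u where "u = (\<lambda>x. core_green \<kappa> x y)"
  have "core_shift \<kappa> u = (\<lambda>z. if z = y then 1 else 0)"
    unfolding core_green_def u_def using bij by (simp add: bij_is_surj surj_f_inv_f)
  then have "core_op E0 att u = (\<lambda>z. (if z = y then 1 else 0) - \<kappa>\<^sup>2 * u z)"
    by (auto simp: core_shift_def fun_eq_iff algebra_simps)
  then have "u x = (\<Sum>z\<in>UNIV. core_green 0 x z * ((if z = y then 1 else 0) - \<kappa>\<^sup>2 * u z))"
    using fun_cong[OF core_green_core_op[of u], of x] by (simp only:)
  also have "\<dots> = (\<Sum>z\<in>UNIV. core_green 0 x z * (if z = y then 1 else 0)) -
      (\<Sum>z\<in>UNIV. core_green 0 x z * (\<kappa>\<^sup>2 * u z))"
    by (simp add: right_diff_distrib sum_subtractf)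
  also have "(\<Sum>z\<in>UNIV. core_green 0 x z * (if z = y then 1 else 0)) = core_green 0 x y"
    by (simp add: if_distrib cong: if_cong)
  finally show ?thesis
    by (simp add: u_def sum_distrib_left sum_negf power2_eq_square mult_ac)
qed

text \<open>The resolvent identity reproduces the kernel with a factor of \<kappa>, so order n
  implies order n + 1; the start is the uniform bound near 0.\<close>

lemma fam_expands_core_green: "fam_expands n (\<lambda>_. 1) (\<lambda>\<kappa> (x, y). core_green \<kappa> x y)"
proof (induction n)
  case 0
  obtain C where "0 \<le> C"
    "\<forall>\<^sub>F \<kappa> in right_half_plane_0. bij (core_shift \<kappa>) \<and> (\<forall>x y. cmod (core_green \<kappa> x y) \<le> C)"
    by (rule core_green_eventually)
  then show ?case by (intro fam_expands_0I[of C]) (auto elim!: eventually_mono)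
next
  case (Suc n)
  obtain C where C: "0 \<le> C"
    "\<forall>\<^sub>F \<kappa> in right_half_plane_0. bij (core_shift \<kappa>) \<and> (\<forall>x y. cmod (core_green \<kappa> x y) \<le> C)"
    by (rule core_green_eventually)
  define B where "B = (\<Sum>x\<in>UNIV. \<Sum>y\<in>UNIV. cmod (core_green 0 x y))"
  have B0: "0 \<le> B" unfolding B_def by (intro sum_nonneg) auto
  have B: "cmod (core_green 0 x y) \<le> B" for x y
  proof -
    have "cmod (core_green 0 x y) \<le> (\<Sum>y\<in>UNIV. cmod (core_green 0 x y))" by (rule member_le_sum) auto
    also have "\<dots> \<le> B" unfolding B_def by (rule member_le_sum) (auto intro!: sum_nonneg)
    finally show ?thesis .
  qed
  have 1: "fam_expands n (\<lambda>_. 1) (\<lambda>_ (x, y, z). - core_green 0 x z)"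
    by (rule fam_expands_const[of _ B]) (auto simp: B0 B)
  have 2: "fam_expands n (\<lambda>_. 1) (\<lambda>\<kappa> (x, y, z). core_green \<kappa> z y)"
    using fam_expands_reindex[OF Suc, of "\<lambda>(x, y, z). (z, y)"] by (simp add: case_prod_unfold)
  have "fam_expands n (\<lambda>_. 1) (\<lambda>\<kappa> i. \<kappa> * (\<Sum>z\<in>UNIV. - core_green 0 (fst i) z * core_green \<kappa> z (snd i)))"
  proof (rule fam_expands_one_mult[OF fam_expands_parameter])
    have "fam_expands n (\<lambda>_. real (CARD('a))) (\<lambda>\<kappa> i. \<Sum>z\<in>UNIV.
        (\<lambda>(x, y, z). - core_green 0 x z) (fst i, snd i, z) * (\<lambda>(x, y, z). core_green \<kappa> z y) (fst i, snd i, z))"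
      by (rule fam_expands_sum[where h = "\<lambda>i z. (fst i, snd i, z)" and w = "\<lambda>_. 1",
            OF _ fam_expands_one_mult[OF 1 2]]) simp
    then have "fam_expands n (\<lambda>_. real (CARD('a)))
        (\<lambda>\<kappa> i. \<Sum>z\<in>UNIV. - core_green 0 (fst i) z * core_green \<kappa> z (snd i))" by simp
    then show "fam_expands n (\<lambda>_. 1) (\<lambda>\<kappa> i. \<Sum>z\<in>UNIV. - core_green 0 (fst i) z * core_green \<kappa> z (snd i))"
      by (rule fam_expands_weight[rotated 2, where K = "real (CARD('a))"]) auto
  qed
  then show ?case
  proof (rule fam_expands_SucI[rotated 2])
    show "\<forall>\<^sub>F \<kappa> in right_half_plane_0. \<forall>i. (case i of (x, y) \<Rightarrow> core_green \<kappa> x y) =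
        core_green 0 (fst i) (snd i) + \<kappa> * (\<kappa> * (\<Sum>z\<in>UNIV. - core_green 0 (fst i) z * core_green \<kappa> z (snd i)))"
      using C(2)
    proof eventually_elim
      case (elim \<kappa>)
      show ?case unfolding case_prod_beta
        by (intro allI core_green_resolvent_eq) (use elim in blast)
    qed
    show "cmod (core_green 0 (fst i) (snd i)) \<le> B * 1" for i by (simp add: B)
  qed (rule B0)
qed

lemma tendsto_core_green_quotient:
  "((\<lambda>\<kappa>. (core_green \<kappa> x y - core_green 0 x y) / \<kappa>) \<longlongrightarrow> 0) right_half_plane_0"
proof -
  obtain C where C: "0 \<le> C"
    "\<forall>\<^sub>F \<kappa> in right_half_plane_0. bij (core_shift \<kappa>) \<and> (\<forall>x y. cmod (core_green \<kappa> x y) \<le> C)"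
    by (rule core_green_eventually)
  show ?thesis
  proof (rule Lim_null_comparison)
    show "\<forall>\<^sub>F \<kappa> in right_half_plane_0. norm ((core_green \<kappa> x y - core_green 0 x y) / \<kappa>)
        \<le> cmod \<kappa> * (\<Sum>z\<in>UNIV. cmod (core_green 0 x z) * C)"
      using C(2) eventually_right_half_plane_0(1)
    proof eventually_elim
      case (elim \<kappa>)
      then have "\<kappa> \<noteq> 0" by auto
      then have "(core_green \<kappa> x y - core_green 0 x y) / \<kappa> =
          \<kappa> * (\<Sum>z\<in>UNIV. - core_green 0 x z * core_green \<kappa> z y)"
        using core_green_resolvent_eq[of \<kappa> x y] elim by simp
      then have "norm ((core_green \<kappa> x y - core_green 0 x y) / \<kappa>) =
          cmod \<kappa> * cmod (\<Sum>z\<in>UNIV. - core_green 0 x z * core_green \<kappa> z y)"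
        by (simp only: norm_mult)
      also have "\<dots> \<le> cmod \<kappa> * (\<Sum>z\<in>UNIV. cmod (core_green 0 x z) * C)"
        using elim by (intro mult_left_mono sum_norm_le) (auto simp: norm_mult intro!: mult_left_mono)
      finally show ?case .
    qed
    show "((\<lambda>\<kappa>. cmod \<kappa> * (\<Sum>z\<in>UNIV. cmod (core_green 0 x z) * C)) \<longlongrightarrow> 0) right_half_plane_0"
      by (rule tendsto_mult_left_zero[OF tendsto_norm_zero[OF tendsto_right_half_plane_0]])
  qed
qed

end

subsection \<open>The free resolvent\<close>

fun vertex_kernel ::
  "('a \<Rightarrow> 'a \<Rightarrow> complex) \<Rightarrow> (nat \<Rightarrow> nat \<Rightarrow> complex) \<Rightarrow> ('a, 'n) vertex \<Rightarrow> ('a, 'n) vertex \<Rightarrow> complex"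
  where
  "vertex_kernel c r (Core x) (Core y) = c x y"
| "vertex_kernel c r (Ray \<alpha> n) (Ray \<gamma> m) = (if \<alpha> = \<gamma> then r n m else 0)"
| "vertex_kernel c r (Core x) (Ray \<gamma> m) = 0"
| "vertex_kernel c r (Ray \<alpha> n) (Core y) = 0"

lemma kernel_op_vertex_kernel:
  fixes u :: "('a::finite, 'n) gfun"
  shows "kernel_op (vertex_kernel c r) u (Core x) = (\<Sum>y\<in>UNIV. c x y * u (Core y))"
    and "kernel_op (vertex_kernel c r) u (Ray \<alpha> n) = (\<Sum>\<^sub>\<infinity>m. r n m * u (Ray \<alpha> m))"
  unfolding kernel_op_def
  by (subst infsum_supported_on_core; simp) (subst infsum_supported_on_ray[of _ \<alpha>]; simp)

lemma has_sum_single: "((\<lambda>m. if m = n then c m else 0) has_sum c n) UNIV"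
  by (rule has_sum_finite_neutralI[of "{n}"]) auto

text \<open>The kernel solves the recursion in its first variable with a delta on the right;
  convergence of every row allows the recursion to be applied term by term. It is used with c = 2 +
  \<kappa>^2.\<close>

lemma ray_op_kernel:
  fixes r :: "nat \<Rightarrow> nat \<Rightarrow> complex"
  assumes rec0: "\<And>m. c * r 0 m - r 1 m = (if m = 0 then 1 else 0)"
    and rec: "\<And>n m. c * r (Suc n) m - r (Suc (Suc n)) m - r n m = (if m = Suc n then 1 else 0)"
    and summable: "\<And>n. (\<lambda>m. r n m * u m) summable_on UNIV"
  shows "ray_op (\<lambda>n. \<Sum>\<^sub>\<infinity>m. r n m * u m) n + (c - 2) * (\<Sum>\<^sub>\<infinity>m. r n m * u m) = u n"
proof -
  define S where "S n = (\<Sum>\<^sub>\<infinity>m. r n m * u m)" for n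
  have S: "((\<lambda>m. r n m * u m) has_sum S n) UNIV" for n
    unfolding S_def by (rule has_sum_infsum[OF summable])
  show ?thesis
  proof (cases n)
    case 0
    have "((\<lambda>m. c * (r 0 m * u m) + (-1) * (r 1 m * u m)) has_sum (c * S 0 + (-1) * S 1)) UNIV"
      by (intro has_sum_add has_sum_cmult_right S)
    moreover have "c * (r 0 m * u m) + (-1) * (r 1 m * u m) = (if m = 0 then u m else 0)" for m
      using arg_cong[OF rec0[of m], of "\<lambda>t. t * u m"] by (simp add: algebra_simps)
    ultimately have "c * S 0 + (-1) * S 1 = u 0"
      using has_sum_single[of 0 u] has_sum_unique by (simp only:) blast
    then show ?thesis using 0 by (simp add: S_def algebra_simps)
  next
    case (Suc k)
    have "((\<lambda>m. c * (r (Suc k) m * u m) + ((-1) * (r (Suc (Suc k)) m * u m) + (-1) * (r k m * u m)))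
        has_sum (c * S (Suc k) + ((-1) * S (Suc (Suc k)) + (-1) * S k))) UNIV"
      by (intro has_sum_add has_sum_cmult_right S)
    moreover have "c * (r (Suc k) m * u m) + ((-1) * (r (Suc (Suc k)) m * u m) + (-1) * (r k m * u m)) =
        (if m = Suc k then u m else 0)" for m
      using arg_cong[OF rec[of k m], of "\<lambda>t. t * u m"] by (simp add: algebra_simps)
    ultimately have "c * S (Suc k) + ((-1) * S (Suc (Suc k)) + (-1) * S k) = u (Suc k)"
      using has_sum_single[of "Suc k" u] has_sum_unique by (simp only:) blast
    then show ?thesis using Suc by (simp add: S_def algebra_simps)
  qed
qed

text \<open>Two geometric series, one on each side of n.\<close>

lemma sum_ray_decay_le:
  fixes \<rho> :: real
  assumes \<rho>: "0 \<le> \<rho>" "\<rho> < 1" and M: "finite M"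
  shows "(\<Sum>m\<in>M. \<rho> ^ ((n - m) + (m - n))) \<le> 2 / (1 - \<rho>)"
proof -
  have geo: "(\<Sum>j\<in>J. \<rho> ^ j) \<le> 1 / (1 - \<rho>)" if "finite J" for J
    using sum_le_suminf[of "\<lambda>j. \<rho> ^ j" J] that \<rho> by (simp add: suminf_geometric)
  have "(\<Sum>m\<in>M. \<rho> ^ ((n - m) + (m - n))) =
      (\<Sum>m\<in>M \<inter> {..n}. \<rho> ^ ((n - m) + (m - n))) + (\<Sum>m\<in>M - {..n}. \<rho> ^ ((n - m) + (m - n)))"
    using sum.Int_Diff[OF M, of _ "{..n}"] .
  also have "(\<Sum>m\<in>M \<inter> {..n}. \<rho> ^ ((n - m) + (m - n))) = (\<Sum>j\<in>(\<lambda>m. n - m) ` (M \<inter> {..n}). \<rho> ^ j)"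
    by (subst sum.reindex) (auto simp: inj_on_def)
  also have "\<dots> \<le> 1 / (1 - \<rho>)" using M by (intro geo) auto
  also have "(\<Sum>m\<in>M - {..n}. \<rho> ^ ((n - m) + (m - n))) = (\<Sum>j\<in>(\<lambda>m. m - n) ` (M - {..n}). \<rho> ^ j)"
    by (subst sum.reindex) (auto simp: inj_on_def)
  also have "\<dots> \<le> 1 / (1 - \<rho>)" using M by (intro geo) auto
  finally show ?thesis by simp
qed

lemma free_op_add: "free_op E att (u + w) = free_op E att u + free_op E att w"
proof
  fix z show "free_op E att (u + w) z = (free_op E att u + free_op E att w) z"
  proof (cases z)
    case (Core x)
    then show ?thesis
      by (simp add: free_op_def direct_sum_def core_op_def sum.distrib[symmetric] algebra_simps)
  next
    case (Ray \<alpha> n)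
    then show ?thesis by (cases n) (simp_all add: free_op_def direct_sum_def)
  qed
qed

lemma free_op_scale: "free_op E att (c *\<^sub>C u) = c *\<^sub>C free_op E att u"
proof
  fix z show "free_op E att (c *\<^sub>C u) z = (c *\<^sub>C free_op E att u) z"
  proof (cases z)
    case (Core x)
    then show ?thesis
      by (simp add: free_op_def direct_sum_def core_op_def sum_distrib_left algebra_simps)
  next
    case (Ray \<alpha> n)
    then show ?thesis by (cases n) (simp_all add: free_op_def direct_sum_def algebra_simps)
  qed
qed

lemma free_op_diff: "free_op E att (u - w) = free_op E att u - free_op E att w"
  using free_op_add[of E att u "- w"] free_op_scale[of E att "-1" w]
  unfolding scaleC_minus_one by simp

lemma ray_lin_apply [simp]: "ray_lin \<alpha> (Core x) = 0"
  "ray_lin \<alpha> (Ray \<gamma> n) = (if \<gamma> = \<alpha> then of_nat (Suc n) else 0)"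
  by (simp_all add: ray_lin_def)

lemma ray_one_apply [simp]: "ray_one \<alpha> (Core x) = 0"
  "ray_one \<alpha> (Ray \<gamma> n) = (if \<gamma> = \<alpha> then 1 else 0)"
  by (simp_all add: ray_one_def)

lemma ray_lin_sum_apply:
  fixes c :: "'n::finite \<Rightarrow> complex"
  shows "(\<Sum>\<alpha>\<in>UNIV. c \<alpha> *\<^sub>C ray_lin \<alpha>) (Core x) = 0"
    and "(\<Sum>\<alpha>\<in>UNIV. c \<alpha> *\<^sub>C ray_lin \<alpha>) (Ray \<gamma> n) = c \<gamma> * of_nat (Suc n)"
  unfolding sum_fun_apply by (simp_all add: if_distrib cong: if_cong)

lemma ray_one_sum_apply:
  fixes c :: "'n::finite \<Rightarrow> complex"
  shows "(\<Sum>\<alpha>\<in>UNIV. c \<alpha> *\<^sub>C ray_one \<alpha>) (Core x) = 0"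
    and "(\<Sum>\<alpha>\<in>UNIV. c \<alpha> *\<^sub>C ray_one \<alpha>) (Ray \<gamma> n) = c \<gamma>"
  unfolding sum_fun_apply by (simp_all add: if_distrib cong: if_cong)

lemma ray_lin_in_linf:
  assumes "1 \<le> s" shows "ray_lin \<alpha> \<in> (linf_space s :: ('a, 'n) gfun set)"
proof (rule linf_spaceI)
  fix x :: "('a, 'n) vertex"
  show "cmod (ray_lin \<alpha> x) \<le> 1 * weight s x"
  proof (cases x)
    case (Ray \<gamma> n)
    have "real (Suc n) ^ 1 \<le> weight (real 1) (Ray \<gamma> n :: ('a, 'n) vertex)" by (rule weight_ray_power_le)
    also have "\<dots> \<le> weight s (Ray \<gamma> n :: ('a, 'n) vertex)" by (rule weight_mono) (use assms in simp)
    finally show ?thesis using Ray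
      by (cases "\<gamma> = \<alpha>") (simp_all del: of_nat_Suc add: norm_of_nat del: weight.simps)
  qed simp
qed

text \<open>At index n the value is n + 1, so the linear function continues to 0 at the missing
  index -1: this is the Dirichlet condition built into the first line of
  \<open>ray_op\<close>.\<close>

lemma free_op_ray_lin: "free_op E att (ray_lin \<alpha>) = 0"
proof
  fix z show "free_op E att (ray_lin \<alpha>) z = 0 z"
  proof (cases z)
    case (Ray \<gamma> n)
    then show ?thesis by (cases n) (simp_all add: free_op_def direct_sum_def)
  qed (simp add: free_op_def direct_sum_def core_op_def)
qed

text \<open>On each ray the summable part would be an affine function with slope c. Its increments
  equal c and tend to 0, so linear growth cannot hide in a constant plus a summable
  function.\<close>

lemma ray_lin_in_one_plus_l1:
  fixes c :: "'n::finite \<Rightarrow> complex"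
  assumes "0 \<le> s" and mem: "(\<Sum>\<alpha>\<in>UNIV. c \<alpha> *\<^sub>C ray_lin \<alpha>) \<in> (one_plus_l1 s :: ('a, 'n) gfun set)"
  shows "c = (\<lambda>_. 0)"
proof
  fix \<alpha>
  obtain d and w :: "('a, 'n) gfun" where w: "w \<in> l1_space s"
    and eq: "(\<Sum>\<alpha>\<in>UNIV. c \<alpha> *\<^sub>C ray_lin \<alpha>) = (\<Sum>\<alpha>\<in>UNIV. d \<alpha> *\<^sub>C ray_one \<alpha>) + w"
    using mem by (auto simp: one_plus_l1_def)
  have wn: "w (Ray \<alpha> n) = c \<alpha> * of_nat (Suc n) - d \<alpha>" for n
    using fun_cong[OF eq, of "Ray \<alpha> n"] unfolding plus_fun_apply ray_lin_sum_apply ray_one_sum_apply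
    by (simp only: add_diff_cancel_left')
  have "w \<in> l1_space 0"
    by (rule l1_spaceI_le[OF w]) (intro mult_right_mono weight_mono assms(1) norm_ge_zero)
  then have "(\<lambda>x. cmod (w x)) summable_on UNIV" by (simp add: l1_space_def)
  then have "(\<lambda>n. cmod (w (Ray \<alpha> n))) summable_on UNIV" by (rule summable_on_rayD)
  then have "(\<lambda>n. cmod (w (Ray \<alpha> n))) \<longlonglongrightarrow> 0"
    by (intro summable_LIMSEQ_zero summable_on_imp_summable)
  then have lim: "(\<lambda>n. w (Ray \<alpha> n)) \<longlonglongrightarrow> 0" by (rule tendsto_norm_zero_cancel)
  have "(\<lambda>n. w (Ray \<alpha> (Suc n)) - w (Ray \<alpha> n)) \<longlonglongrightarrow> 0 - 0"
    by (intro tendsto_diff lim LIMSEQ_Suc)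
  moreover have "w (Ray \<alpha> (Suc n)) - w (Ray \<alpha> n) = c \<alpha>" for n
    unfolding wn by (simp add: algebra_simps)
  ultimately show "c \<alpha> = 0" by (simp add: LIMSEQ_const_iff)
qed

section \<open>The kernel of the free resolvent on the whole graph\<close>

context ray_graph
begin

definition free_kernel :: "complex \<Rightarrow> ('a, 'n) vertex \<Rightarrow> ('a, 'n) vertex \<Rightarrow> complex" where
  "free_kernel \<kappa> = vertex_kernel (core_green \<kappa>) (ray_kernel (ray_root \<kappa>))"

lemma ray_root_0 [simp]: "ray_root 0 = 1"
  by (simp add: ray_root_def)

lemma free_kernel_hermitian: "free_kernel 0 y x = cnj (free_kernel 0 x y)"
proof (cases "\<exists>a b. x = Core a \<and> y = Core b")
  case True
  then show ?thesis by (auto simp: free_kernel_def intro: core_green_hermitian)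
next
  case False
  then show ?thesis
    by (cases x; cases y) (auto simp: free_kernel_def ray_kernel_1 min.commute)
qed

lemma free_green_eq: "free_green E0 att u = kernel_op (free_kernel 0) u"
proof
  fix z show "free_green E0 att u z = kernel_op (free_kernel 0) u z"
  proof (cases z)
    case (Core x)
    have "inv (core_op E0 att) (\<lambda>y. u (Core y)) = (\<lambda>x. \<Sum>y\<in>UNIV. core_green 0 x y * u (Core y))"
      using core_shift_green(2)[of 0 "\<lambda>y. u (Core y)"] bij_core_op by (simp only: core_shift_0)
    then show ?thesis
      by (simp add: Core free_green_def direct_sum_def free_kernel_def kernel_op_vertex_kernel)
  next
    case (Ray \<alpha> n)
    then show ?thesis
      by (simp add: free_green_def direct_sum_def free_kernel_def kernel_op_vertex_kernel
          ray_green_def ray_kernel_1)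
  qed
qed

text \<open>The recursions are hypotheses because they have different proofs: for \<kappa> in the
  right half-plane through the closed form, and at \<kappa> = 0, where 1 - z^2 vanishes, directly
  for the minimum kernel.\<close>

lemma free_op_free_kernel:
  assumes bij: "bij (core_shift \<kappa>)"
    and rec0: "\<And>m. (2 + \<kappa>\<^sup>2) * ray_kernel (ray_root \<kappa>) 0 m - ray_kernel (ray_root \<kappa>) 1 m = (if m = 0 then 1 else 0)"
    and rec: "\<And>n m. (2 + \<kappa>\<^sup>2) * ray_kernel (ray_root \<kappa>) (Suc n) m - ray_kernel (ray_root \<kappa>) (Suc (Suc n)) m -
      ray_kernel (ray_root \<kappa>) n m = (if m = Suc n then 1 else 0)"
    and summable: "\<And>x. (\<lambda>y. free_kernel \<kappa> x y * u y) summable_on UNIV"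
  shows "free_op E0 att (kernel_op (free_kernel \<kappa>) u) + \<kappa>\<^sup>2 *\<^sub>C kernel_op (free_kernel \<kappa>) u = u"
proof
  fix z show "(free_op E0 att (kernel_op (free_kernel \<kappa>) u) + \<kappa>\<^sup>2 *\<^sub>C kernel_op (free_kernel \<kappa>) u) z = u z"
  proof (cases z)
    case (Core x)
    then show ?thesis
      using fun_cong[OF core_shift_green(1)[OF bij, of "\<lambda>y. u (Core y)"], of x]
      by (simp add: free_op_def direct_sum_def free_kernel_def kernel_op_vertex_kernel core_shift_def)
  next
    case (Ray \<alpha> n)
    have "(\<lambda>m. ray_kernel (ray_root \<kappa>) n m * u (Ray \<alpha> m)) summable_on UNIV" for n
      using summable_on_rayD[OF summable[of "Ray \<alpha> n"], of \<alpha>] by (simp add: free_kernel_def)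
    from ray_op_kernel[OF rec0 rec this, of n] show ?thesis
      by (simp add: Ray free_op_def direct_sum_def free_kernel_def kernel_op_vertex_kernel)
  qed
qed

text \<open>Schur test block by block: the finite block has finitely many entries, the rays have
  exponential decay. Columns are rows of the kernel with the finite block transposed, since the
  half-line kernel is symmetric.\<close>

lemma free_kernel_l2:
  assumes "0 < Re \<kappa>"
  obtains A where "op_bound l2_space l2_norm l2_space l2_norm A (kernel_op (free_kernel \<kappa>))"
    "\<And>u x. u \<in> l2_space \<Longrightarrow> (\<lambda>y. free_kernel \<kappa> x y * u y) summable_on UNIV"
proof -
  define z where "z = ray_root \<kappa>"
  have z: "cmod z < 1" unfolding z_def by (rule ray_root_norm_less_1[OF assms])
  define K where "K = (\<Sum>x\<in>UNIV. \<Sum>y\<in>UNIV. cmod (core_green \<kappa> x y))"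
  \<comment> \<open>The prefactor of \<open>ray_kernel_decay\<close> times the bound for the
    two-sided geometric series.\<close>
  define L where "L = 2 / cmod (1 - z\<^sup>2) * (2 / (1 - cmod z))"
  have K: "0 \<le> K" unfolding K_def by (intro sum_nonneg) auto
  have L: "0 \<le> L" unfolding L_def using z by (intro mult_nonneg_nonneg) auto
  have core: "(\<Sum>y\<in>F. cmod (vertex_kernel c r (Core x) y)) \<le> (\<Sum>y\<in>UNIV. cmod (c x y))"
    if "finite F" for F :: "('a, 'n) vertex set" and x :: 'a and c r
  proof -
    have "(\<Sum>y\<in>F. cmod (vertex_kernel c r (Core x) y)) = (\<Sum>y\<in>F \<inter> range Core. cmod (vertex_kernel c r (Core x) y))"
    proof (rule sum.mono_neutral_right[OF that])
      show "\<forall>y\<in>F - F \<inter> range Core. cmod (vertex_kernel c r (Core x) y) = 0"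
      proof
        fix y assume "y \<in> F - F \<inter> range Core"
        then show "cmod (vertex_kernel c r (Core x) y) = 0" by (cases y) auto
      qed
    qed auto
    also have "\<dots> \<le> (\<Sum>y\<in>range Core. cmod (vertex_kernel c r (Core x :: ('a, 'n) vertex) y))"
      by (intro sum_mono2) auto
    also have "\<dots> = (\<Sum>y\<in>UNIV. cmod (c x y))" by (subst sum.reindex) (auto simp: inj_on_def)
    finally show ?thesis .
  qed
  have ray: "(\<Sum>y\<in>F. cmod (vertex_kernel c (ray_kernel z) (Ray \<alpha> n) y)) \<le> L"
    if F: "finite F" for F :: "('a, 'n) vertex set" and \<alpha> n c
  proof -
    define M where "M = {m. Ray \<alpha> m \<in> F}"
    have M: "finite M" unfolding M_def using finite_vimageI[OF F, of "Ray \<alpha>"]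
      by (simp add: vimage_def inj_on_def)
    have sub: "Ray \<alpha> ` M \<subseteq> F" by (auto simp: M_def)
    have "(\<Sum>y\<in>F. cmod (vertex_kernel c (ray_kernel z) (Ray \<alpha> n) y)) =
        (\<Sum>y\<in>Ray \<alpha> ` M. cmod (vertex_kernel c (ray_kernel z) (Ray \<alpha> n) y))"
    proof (rule sum.mono_neutral_right[OF F sub])
      show "\<forall>y\<in>F - Ray \<alpha> ` M. cmod (vertex_kernel c (ray_kernel z) (Ray \<alpha> n) y) = 0"
      proof
        fix y assume "y \<in> F - Ray \<alpha> ` M"
        then show "cmod (vertex_kernel c (ray_kernel z) (Ray \<alpha> n) y) = 0"
          by (cases y) (auto simp: M_def)
      qed
    qed
    also have "\<dots> = (\<Sum>m\<in>M. cmod (ray_kernel z n m))"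
      by (subst sum.reindex) (auto simp: inj_on_def)
    also have "\<dots> \<le> (\<Sum>m\<in>M. 2 / cmod (1 - z\<^sup>2) * cmod z ^ ((n - m) + (m - n)))"
      by (intro sum_mono ray_kernel_decay[OF z])
    also have "\<dots> \<le> L"
      unfolding L_def sum_distrib_left[symmetric] using z M
      by (intro mult_left_mono sum_ray_decay_le) auto
    finally show ?thesis .
  qed
  have rowK: "(\<Sum>y\<in>UNIV. cmod (core_green \<kappa> x y)) \<le> K" for x
    unfolding K_def by (rule member_le_sum) (auto intro!: sum_nonneg)
  have colK: "(\<Sum>x\<in>UNIV. cmod (core_green \<kappa> x y)) \<le> K" for y
  proof -
    have "K = (\<Sum>y\<in>UNIV. \<Sum>x\<in>UNIV. cmod (core_green \<kappa> x y))" unfolding K_def by (rule sum.swap)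
    then show ?thesis by (simp, intro member_le_sum) (auto intro!: sum_nonneg)
  qed
  have rows: "(\<Sum>y\<in>F. cmod (free_kernel \<kappa> x y)) \<le> K + L" if F: "finite F" for x F
  proof (cases x)
    case (Core a)
    then show ?thesis
      using core[OF F, of "core_green \<kappa>" "ray_kernel z" a] rowK[of a] L
      by (simp add: free_kernel_def z_def[symmetric])
  next
    case (Ray \<alpha> n)
    then show ?thesis using ray[OF F, of "core_green \<kappa>" \<alpha> n] K by (simp add: free_kernel_def z_def[symmetric])
  qed
  have swap: "free_kernel \<kappa> x y = vertex_kernel (\<lambda>a b. core_green \<kappa> b a) (ray_kernel z) y x" for x y
    by (cases x; cases y) (auto simp: free_kernel_def z_def ray_kernel_commute)
  have cols: "(\<Sum>x\<in>F. cmod (free_kernel \<kappa> x y)) \<le> K + L" if F: "finite F" for y F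
  proof (cases y)
    case (Core a)
    then show ?thesis unfolding swap
      using core[OF F, of "\<lambda>a b. core_green \<kappa> b a" "ray_kernel z" a] colK[of a] L by simp
  next
    case (Ray \<alpha> n)
    then show ?thesis unfolding swap using ray[OF F, of "\<lambda>a b. core_green \<kappa> b a" \<alpha> n] K by simp
  qed
  show ?thesis by (rule that[OF op_bound_kernel_l2[OF rows cols]])
qed

lemma free_resolvent_right_inverse:
  assumes "0 < Re \<kappa>" "bij (core_shift \<kappa>)" "u \<in> l2_space"
  shows "free_op E0 att (kernel_op (free_kernel \<kappa>) u) + \<kappa>\<^sup>2 *\<^sub>C kernel_op (free_kernel \<kappa>) u = u"
proof -
  define z where "z = ray_root \<kappa>"
  have "cmod z < 1" unfolding z_def by (rule ray_root_norm_less_1[OF assms(1)])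
  then have "(cmod z)\<^sup>2 < 1" by (simp add: power_less_one_iff)
  then have z2: "z\<^sup>2 \<noteq> 1" by (metis less_irrefl norm_one norm_power)
  have z0: "z \<noteq> 0" unfolding z_def by (rule ray_root_nonzero)
  have c: "z\<^sup>2 + 1 = (2 + \<kappa>\<^sup>2) * z" unfolding z_def by (rule ray_root_quadratic)
  obtain A where "\<And>u x. u \<in> l2_space \<Longrightarrow> (\<lambda>y. free_kernel \<kappa> x y * u y) summable_on UNIV"
    using free_kernel_l2[OF assms(1)] by blast
  then show ?thesis
    using ray_kernel_recurrence[OF z2 z0 c, unfolded z_def] assms(3)
    by (intro free_op_free_kernel assms(2)) auto
qed

lemma free_op_shift_injective:
  assumes "0 < Re \<kappa>" "bij (core_shift \<kappa>)" "u \<in> l2_space" "free_op E0 att u + \<kappa>\<^sup>2 *\<^sub>C u = 0"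
  shows "u = 0"
proof
  fix z show "u z = 0 z"
  proof (cases z)
    case (Core x)
    have "core_shift \<kappa> (\<lambda>x. u (Core x)) = 0"
      using fun_cong[OF assms(4), of "Core _"]
      by (simp add: fun_eq_iff core_shift_def free_op_def direct_sum_def)
    then have "(\<lambda>x. u (Core x)) = 0"
      using injD[OF bij_is_inj[OF assms(2)], of "\<lambda>x. u (Core x)" 0] by simp
    then show ?thesis using Core by (metis zero_fun_apply)
  next
    case (Ray \<alpha> n)
    have "(\<lambda>n. u (Ray \<alpha> n)) = (\<lambda>_. 0)"
    proof (rule bounded_ray_solution_zero)
      show "cmod (ray_root \<kappa>) < 1" by (rule ray_root_norm_less_1[OF assms(1)])
      show "ray_root \<kappa> \<noteq> 0" by (rule ray_root_nonzero)
      show "(ray_root \<kappa>)\<^sup>2 + 1 = (2 + \<kappa>\<^sup>2) * ray_root \<kappa>" by (rule ray_root_quadratic)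
      show "cmod (u (Ray \<alpha> n)) \<le> l2_norm u" for n by (rule l2_point_le[OF assms(3)])
      show "ray_op (\<lambda>n. u (Ray \<alpha> n)) n + \<kappa>\<^sup>2 * u (Ray \<alpha> n) = 0" for n
        using fun_cong[OF assms(4), of "Ray \<alpha> n"] by (simp add: free_op_def direct_sum_def)
    qed
    then show ?thesis using Ray by (metis zero_fun_apply)
  qed
qed

text \<open>No growth is prescribed: the Dirichlet recursion is determined by the first value on
  each ray, and the finite block is injective. Hence this kernel is spanned by the
  \<open>ray_lin\<close> alone.\<close>

lemma free_op_kernel:
  assumes "free_op E0 att u = 0"
  shows "u = (\<Sum>\<alpha>\<in>UNIV. u (Ray \<alpha> 0) *\<^sub>C ray_lin \<alpha>)"
proof
  fix z show "u z = (\<Sum>\<alpha>\<in>UNIV. u (Ray \<alpha> 0) *\<^sub>C ray_lin \<alpha>) z"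
  proof (cases z)
    case (Core x)
    have "core_op E0 att (\<lambda>x. u (Core x)) = 0"
      using fun_cong[OF assms, of "Core _"]
      by (simp add: fun_eq_iff free_op_def direct_sum_def)
    then have "(\<lambda>x. u (Core x)) = 0" by (rule core_op_injective)
    then show ?thesis unfolding Core ray_lin_sum_apply by (metis zero_fun_apply)
  next
    case (Ray \<alpha> n)
    have rec: "ray_op (\<lambda>n. u (Ray \<alpha> n)) n = 0" for n
      using fun_cong[OF assms, of "Ray \<alpha> n"] by (simp add: free_op_def direct_sum_def)
    have "u (Ray \<alpha> n) = u (Ray \<alpha> 0) * of_nat (Suc n) \<and>
        u (Ray \<alpha> (Suc n)) = u (Ray \<alpha> 0) * of_nat (Suc (Suc n))" for n
    proof (induction n)
      case 0
      then show ?case using rec[of 0] by (simp add: algebra_simps)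
    next
      case (Suc n)
      have "u (Ray \<alpha> (Suc (Suc n))) = 2 * u (Ray \<alpha> (Suc n)) - u (Ray \<alpha> n)"
        using rec[of "Suc n"] by (simp add: algebra_simps)
      then show ?case using Suc by (simp add: algebra_simps)
    qed
    then show ?thesis unfolding Ray ray_lin_sum_apply by blast
  qed
qed

end

subsection \<open>Expansion of the free resolvent at the threshold\<close>

definition core_index :: "('a, 'n) vertex \<Rightarrow> 'a" where
  "core_index z = (case z of Core x \<Rightarrow> x | Ray \<alpha> n \<Rightarrow> undefined)"

definition ray_index :: "('a, 'n) vertex \<Rightarrow> nat" where
  "ray_index z = (case z of Core x \<Rightarrow> 0 | Ray \<alpha> n \<Rightarrow> n)"

lemma ray_index_power_le: "real (Suc (ray_index z)) ^ b \<le> weight (real b) z"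
proof (cases z)
  case (Ray \<alpha> n)
  then show ?thesis using weight_ray_power_le[of n b \<alpha>] by (simp add: ray_index_def del: weight.simps)
qed (simp add: ray_index_def)

text \<open>The kernel of - sum_alpha |n^(alpha)><n^(alpha)|, the first-order coefficient of the
  free resolvent; the zero block reflects the dependence of the finite part on \<kappa>^2.\<close>

definition first_kernel :: "('a, 'n) vertex \<Rightarrow> ('a, 'n) vertex \<Rightarrow> complex" where
  "first_kernel = vertex_kernel (\<lambda>_ _. 0) (\<lambda>n m. - of_nat (Suc n * Suc m))"

lemma kernel_op_first_kernel:
  fixes u :: "('a::finite, 'n::finite) gfun"
  shows "kernel_op first_kernel u = - (\<Sum>\<alpha>\<in>UNIV. pairing (ray_lin \<alpha>) u *\<^sub>C ray_lin \<alpha>)"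
proof
  fix z
  show "kernel_op first_kernel u z = (- (\<Sum>\<alpha>\<in>UNIV. pairing (ray_lin \<alpha>) u *\<^sub>C ray_lin \<alpha>)) z"
  proof (cases z)
    case (Core x)
    then show ?thesis
      by (simp add: first_kernel_def kernel_op_vertex_kernel ray_lin_sum_apply)
  next
    case (Ray \<alpha> n)
    have p: "pairing (ray_lin \<alpha>) u = (\<Sum>\<^sub>\<infinity>m. of_nat (Suc m) * u (Ray \<alpha> m))"
      unfolding pairing_def by (subst infsum_supported_on_ray[of _ \<alpha>]) auto
    have "kernel_op first_kernel u (Ray \<alpha> n) = (\<Sum>\<^sub>\<infinity>m. - of_nat (Suc n) * (of_nat (Suc m) * u (Ray \<alpha> m)))"
      unfolding first_kernel_def kernel_op_vertex_kernel
      by (rule infsum_cong) (simp only: of_nat_mult mult_minus_left mult.assoc)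
    also have "\<dots> = - of_nat (Suc n) * pairing (ray_lin \<alpha>) u"
      unfolding p by (rule infsum_cmult_right')
    finally show ?thesis
      unfolding Ray uminus_apply ray_lin_sum_apply
      by (simp only: mult_minus_left mult_minus_right mult.commute)
  qed
qed

context ray_graph
begin

text \<open>The blocks are expanded separately and glued. The half-line block needs the weight
  exponent r + 1; the finite block needs no growth, as the weights are at least 1.\<close>

lemma fam_expands_free_kernel:
  "fam_expands r (\<lambda>(x, y). weight (real (Suc r)) x * weight (real (Suc r)) y)
     (\<lambda>\<kappa> (x :: ('a, 'n) vertex, y). free_kernel \<kappa> x y)"
proof -
  define W :: "('a, 'n) vertex \<times> ('a, 'n) vertex \<Rightarrow> real"
    where "W = (\<lambda>(x, y). weight (real (Suc r)) x * weight (real (Suc r)) y)"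
  have W0: "0 \<le> W i" for i by (auto simp: W_def split: prod.splits)
  have W1: "1 \<le> W i" for i
  proof -
    have "1 * 1 \<le> weight (real (Suc r)) x * weight (real (Suc r)) y" for x y :: "('a, 'n) vertex"
      by (intro mult_mono weight_ge_1) auto
    then show ?thesis by (auto simp: W_def split: prod.splits)
  qed
  have "fam_expands r (\<lambda>_. 1)
      (\<lambda>\<kappa> i. (\<lambda>(x, y). core_green \<kappa> x y) (core_index (fst i), core_index (snd i)))"
    by (rule fam_expands_reindex[OF fam_expands_core_green,
          where h = "\<lambda>i. (core_index (fst i), core_index (snd i))"])
  then have core: "fam_expands r W (\<lambda>\<kappa> i. core_green \<kappa> (core_index (fst i)) (core_index (snd i)))"
    by (intro fam_expands_weight[of 1 "\<lambda>_. 1" W]) (use W1 in auto)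
  have "fam_expands r (\<lambda>i. (\<lambda>(n, m). (real (Suc n) * real (Suc m)) ^ Suc r) (ray_index (fst i), ray_index (snd i)))
      (\<lambda>\<kappa> i. (\<lambda>(n, m). ray_kernel (ray_root \<kappa>) n m) (ray_index (fst i), ray_index (snd i)))"
    by (rule fam_expands_reindex[OF fam_expands_ray_kernel,
          where h = "\<lambda>i. (ray_index (fst i), ray_index (snd i))"])
  then have *: "fam_expands r (\<lambda>i. (real (Suc (ray_index (fst i))) * real (Suc (ray_index (snd i)))) ^ Suc r)
      (\<lambda>\<kappa> i. ray_kernel (ray_root \<kappa>) (ray_index (fst i)) (ray_index (snd i)))"
    by (simp only: prod.case)
  have "(real (Suc (ray_index (fst i))) * real (Suc (ray_index (snd i)))) ^ Suc r \<le> 1 * W i" for i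
    unfolding power_mult_distrib mult_1 W_def case_prod_beta
    by (intro mult_mono ray_index_power_le) auto
  from fam_expands_weight[OF zero_le_one this *]
  have ray: "fam_expands r W (\<lambda>\<kappa> i. ray_kernel (ray_root \<kappa>) (ray_index (fst i)) (ray_index (snd i)))" .
  have eq: "free_kernel \<kappa> (fst i) (snd i) =
      (if \<exists>a b. fst i = Core a \<and> snd i = Core b then core_green \<kappa> (core_index (fst i)) (core_index (snd i))
       else if \<exists>\<alpha> n m. fst i = Ray \<alpha> n \<and> snd i = Ray \<alpha> m
         then ray_kernel (ray_root \<kappa>) (ray_index (fst i)) (ray_index (snd i)) else 0)" for \<kappa> i
    by (cases "fst i"; cases "snd i") (auto simp: free_kernel_def core_index_def ray_index_def)
  show ?thesis
    unfolding W_def[symmetric] case_prod_beta eq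
    by (intro fam_expands_if core ray fam_expands_zero W0)
qed

lemma tendsto_free_kernel: "((\<lambda>\<kappa>. free_kernel \<kappa> x y) \<longlongrightarrow> free_kernel 0 x y) right_half_plane_0"
proof -
  have core: "((\<lambda>\<kappa>. core_green \<kappa> a b) \<longlongrightarrow> core_green 0 a b) right_half_plane_0" for a b
  proof (rule LIM_zero_cancel, rule Lim_transform_eventually)
    show "((\<lambda>\<kappa>. \<kappa> * ((core_green \<kappa> a b - core_green 0 a b) / \<kappa>)) \<longlongrightarrow> 0) right_half_plane_0"
      using tendsto_mult[OF tendsto_right_half_plane_0 tendsto_core_green_quotient[of a b]] by simp
    show "\<forall>\<^sub>F \<kappa> in right_half_plane_0. \<kappa> * ((core_green \<kappa> a b - core_green 0 a b) / \<kappa>) =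
        core_green \<kappa> a b - core_green 0 a b"
      using eventually_right_half_plane_0(1) by eventually_elim auto
  qed
  show ?thesis
    by (cases x; cases y) (auto simp: free_kernel_def core tendsto_ray_kernel)
qed

definition free_quotient :: "complex \<Rightarrow> ('a, 'n) vertex \<Rightarrow> ('a, 'n) vertex \<Rightarrow> complex" where
  "free_quotient \<kappa> x y = (free_kernel \<kappa> x y - free_kernel 0 x y) / \<kappa>"

lemma tendsto_free_quotient: "((\<lambda>\<kappa>. free_quotient \<kappa> x y) \<longlongrightarrow> first_kernel x y) right_half_plane_0"
  unfolding free_quotient_def
  by (cases x; cases y)
    (use tendsto_ray_kernel_quotient in \<open>auto simp: free_kernel_def first_kernel_def tendsto_core_green_quotient\<close>)

text \<open>The kernel is expanded to order r + 1, which explains the weight r + 2; the known limit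
  at 0 then turns the remainder into the quotient.\<close>

lemma fam_expands_free_quotient:
  "fam_expands r (\<lambda>(x, y). weight (real (Suc (Suc r))) x * weight (real (Suc (Suc r))) y)
     (\<lambda>\<kappa> (x, y). free_quotient \<kappa> x y)"
proof -
  let ?W = "\<lambda>(x :: ('a, 'n) vertex, y). weight (real (Suc (Suc r))) x * weight (real (Suc (Suc r))) y"
  have W: "0 \<le> ?W i" for i by (auto split: prod.splits)
  have lim: "((\<lambda>\<kappa>. case i of (x, y) \<Rightarrow> free_kernel \<kappa> x y) \<longlongrightarrow> (case i of (x, y) \<Rightarrow> free_kernel 0 x y))
      right_half_plane_0" for i
    by (cases i) (simp add: tendsto_free_kernel)
  obtain C f' where "0 \<le> C" "\<And>i. cmod (case i of (x, y) \<Rightarrow> free_kernel 0 x y) \<le> C * ?W i"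
    and f: "fam_expands r ?W f'"
    and eq: "\<forall>\<^sub>F \<kappa> in right_half_plane_0. \<forall>i. (case i of (x, y) \<Rightarrow> free_kernel \<kappa> x y) =
        (case i of (x, y) \<Rightarrow> free_kernel 0 x y) + \<kappa> * f' \<kappa> i"
    using fam_expands_Suc_limit[OF W fam_expands_free_kernel lim] by blast
  show ?thesis
  proof (rule fam_expands_cong[OF f])
    show "\<forall>\<^sub>F \<kappa> in right_half_plane_0. \<forall>i. f' \<kappa> i = (case i of (x, y) \<Rightarrow> free_quotient \<kappa> x y)"
      using eq eventually_right_half_plane_0(1)
    proof eventually_elim
      case (elim \<kappa>)
      then have "\<kappa> \<noteq> 0" by auto
      with elim(1) show ?case by (auto simp: free_quotient_def)
    qed
  qed
qed

text \<open>Since the minimum is at most its second argument, the growth can be charged to one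
  variable alone. This makes \<open>G u\<close> bounded without weight, the slack from which
  compactness comes.\<close>

lemma free_kernel_0_le:
  assumes "1 \<le> s"
  obtains C where "0 \<le> C" "\<And>x y. cmod (free_kernel 0 x y) \<le> C * weight s y"
proof -
  define K where "K = (\<Sum>x\<in>UNIV. \<Sum>y\<in>UNIV. cmod (core_green 0 x y))"
  have K0: "0 \<le> K" unfolding K_def by (intro sum_nonneg) auto
  have K: "cmod (core_green 0 x y) \<le> K" for x y
  proof -
    have "cmod (core_green 0 x y) \<le> (\<Sum>y\<in>UNIV. cmod (core_green 0 x y))" by (rule member_le_sum) auto
    also have "\<dots> \<le> K" unfolding K_def by (rule member_le_sum) (auto intro!: sum_nonneg)
    finally show ?thesis .
  qed
  have "cmod (free_kernel 0 x y) \<le> (K + 1) * weight s y" for x y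
  proof (cases "\<exists>a b. x = Core a \<and> y = Core b")
    case True
    then obtain a b where ab: "x = Core a" "y = Core b" by blast
    show ?thesis using order_trans[OF K[of a b], of "K + 1"] by (simp add: ab free_kernel_def)
  next
    case False
    have "cmod (free_kernel 0 x y) \<le> real (Suc (ray_index y)) ^ 1"
      using False by (cases x; cases y) (auto simp: free_kernel_def ray_kernel_1 ray_index_def norm_of_nat
          simp del: of_nat_Suc)
    also have "\<dots> \<le> weight (real 1) y" by (rule ray_index_power_le)
    also have "\<dots> \<le> weight s y" by (rule weight_mono) (use assms in simp)
    also have "\<dots> \<le> (K + 1) * weight s y" using K0 by (simp add: distrib_right)
    finally show ?thesis .
  qed
  then show ?thesis using K0 by (intro that[of "K + 1"]) auto
qed

lemma kernel_bound_free_kernel: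
  assumes "1 \<le> s"
  obtains C where "kernel_bound s C (free_kernel 0)"
proof -
  obtain C where C: "0 \<le> C" "\<And>x y. cmod (free_kernel 0 x y) \<le> C * weight s y"
    using free_kernel_0_le[OF assms] by blast
  have "C * weight s y \<le> C * (weight s x * weight s y)" for x y :: "('a, 'n) vertex"
    using mult_right_mono[OF weight_ge_1[of s x], of "weight s y"] assms C(1)
    by (intro mult_left_mono) auto
  then have "kernel_bound s C (free_kernel 0)"
    using C order_trans unfolding kernel_bound_def by blast
  then show ?thesis by (rule that)
qed

lemma free_op_green:
  assumes "1 \<le> s" "u \<in> l1_space s"
  shows "free_op E0 att (kernel_op (free_kernel 0) u) = u"
proof -
  obtain C where C: "kernel_bound s C (free_kernel 0)" by (rule kernel_bound_free_kernel[OF assms(1)])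
  have "free_op E0 att (kernel_op (free_kernel 0) u) + 0\<^sup>2 *\<^sub>C kernel_op (free_kernel 0) u = u"
  proof (rule free_op_free_kernel)
    show "bij (core_shift 0)" using bij_core_op by simp
    show "(2 + 0\<^sup>2) * ray_kernel (ray_root 0) 0 m - ray_kernel (ray_root 0) 1 m = (if m = 0 then 1 else 0)" for m
      by (cases m) (auto simp: ray_kernel_1)
    show "(2 + 0\<^sup>2) * ray_kernel (ray_root 0) (Suc n) m - ray_kernel (ray_root 0) (Suc (Suc n)) m -
      ray_kernel (ray_root 0) n m = (if m = Suc n then 1 else 0)" for n m
    proof -
      consider "m \<le> n" | "m = Suc n" | "Suc (Suc n) \<le> m" by linarith
      then show ?thesis by cases (auto simp: ray_kernel_1 min_def)
    qed
    show "(\<lambda>y. free_kernel 0 x y * u y) summable_on UNIV" for x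
      by (rule kernel_op_summable[OF C assms(2)])
  qed
  then show ?thesis by simp
qed

text \<open>On a ray, G u minus the first moment of u is minus the sum of (m - n) u(m) over m > n.
  Summing over n first, the weight at n < m is at most that at m, and m terms of size at most m cost
  a factor m^2: two units of the weight exponent.\<close>

lemma green_in_one_plus_l1:
  assumes s: "2 \<le> s" and u: "u \<in> l1_space s"
  shows "kernel_op (free_kernel 0) u \<in> one_plus_l1 (s - 2)"
proof -
  \<comment> \<open>The first moment of u on the ray, which is the value that G u approaches far
    out.\<close>
  define c where "c \<alpha> = (\<Sum>\<^sub>\<infinity>m. of_nat (Suc m) * u (Ray \<alpha> m))" for \<alpha>
  define w where "w = kernel_op (free_kernel 0) u - (\<Sum>\<alpha>\<in>UNIV. c \<alpha> *\<^sub>C ray_one \<alpha>)"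
  have "w \<in> l1_space (s - 2)"
    unfolding l1_space_def mem_Collect_eq
  proof (rule summable_on_vertexI)
    fix \<alpha>
    define a where "a m = cmod (u (Ray \<alpha> m))" for m
    define W where "W m = weight (s - 2) (Ray \<alpha> m :: ('a, 'n) vertex)" for m
    have W0: "0 \<le> W m" for m by (simp add: W_def)
    have a0: "0 \<le> a m" for m by (simp add: a_def)
    have Ws: "weight s (Ray \<alpha> m :: ('a, 'n) vertex) = W m * (1 + (real (Suc m))\<^sup>2)" for m
      using weight_plus_2[of "s - 2" \<alpha> m] by (simp add: W_def del: weight.simps of_nat_Suc)
    have W1: "1 \<le> W m" for m unfolding W_def by (rule weight_ge_1) (use s in simp)
    have total: "(\<lambda>m. (W m * (1 + (real (Suc m))\<^sup>2)) * a m) summable_on UNIV"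
      using summable_on_rayD[OF l1_spaceD[OF u], of \<alpha>] unfolding Ws a_def .
    have le: "real (m - n) * a m \<le> (W m * (1 + (real (Suc m))\<^sup>2)) * a m"
      and le': "real (Suc m) * a m \<le> (W m * (1 + (real (Suc m))\<^sup>2)) * a m" for n m
    proof -
      have "real (Suc m) * 1 \<le> (real (Suc m))\<^sup>2" unfolding power2_eq_square
        by (intro mult_left_mono) auto
      then have 1: "real (Suc m) \<le> 1 + (real (Suc m))\<^sup>2"
        unfolding mult_1_right by (rule order_trans) simp
      have 2: "1 + (real (Suc m))\<^sup>2 \<le> W m * (1 + (real (Suc m))\<^sup>2)"
        using mult_right_mono[OF W1, of "1 + (real (Suc m))\<^sup>2" m] by simp
      show "real (Suc m) * a m \<le> (W m * (1 + (real (Suc m))\<^sup>2)) * a m"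
        by (rule mult_right_mono[OF order_trans[OF 1 2] a0])
      have "real (m - n) \<le> real (Suc m)" by simp
      then show "real (m - n) * a m \<le> (W m * (1 + (real (Suc m))\<^sup>2)) * a m"
        by (intro mult_right_mono[OF order_trans[OF _ order_trans[OF 1 2]] a0])
    qed
    have sm: "(\<lambda>m. real (m - n) * a m) summable_on UNIV" for n
      by (rule summable_on_comparison_test[OF total le]) (auto simp: a0)
    have sc: "(\<lambda>m. of_nat (Suc m) * u (Ray \<alpha> m)) summable_on UNIV"
    proof -
      have "(\<lambda>m. norm (of_nat (Suc m) * u (Ray \<alpha> m))) summable_on UNIV"
        by (rule summable_on_comparison_test[OF total])
          (use le' in \<open>auto simp: norm_mult norm_of_nat a_def simp del: of_nat_Suc\<close>)
      then show ?thesis using summable_on_iff_abs_summable_on_complex by blast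
    qed
    have sk: "(\<lambda>m. of_nat (min (Suc n) (Suc m)) * u (Ray \<alpha> m)) summable_on UNIV" for n
    proof -
      have "(\<lambda>m. norm (of_nat (min (Suc n) (Suc m)) * u (Ray \<alpha> m))) summable_on UNIV"
      proof (rule summable_on_comparison_test[OF total])
        fix m
        have "real (min (Suc n) (Suc m)) * a m \<le> real (Suc m) * a m"
          by (intro mult_right_mono a0) simp
        then show "norm (of_nat (min (Suc n) (Suc m)) * u (Ray \<alpha> m)) \<le> W m * (1 + (real (Suc m))\<^sup>2) * a m"
          using order_trans[OF _ le'[of m]] unfolding norm_mult norm_of_nat a_def by blast
      qed auto
      then show ?thesis using summable_on_iff_abs_summable_on_complex by blast
    qed
    \<comment> \<open>The minimum of n + 1 and m + 1 falls short of m + 1 by the truncated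
      difference m - n, so only points beyond n contribute.\<close>
    have w_le: "cmod (w (Ray \<alpha> n)) \<le> (\<Sum>\<^sub>\<infinity>m. real (m - n) * a m)" for n
    proof -
      have "w (Ray \<alpha> n) = (\<Sum>\<^sub>\<infinity>m. of_nat (min (Suc n) (Suc m)) * u (Ray \<alpha> m)) - c \<alpha>"
        unfolding w_def minus_apply ray_one_sum_apply free_kernel_def kernel_op_vertex_kernel
          ray_root_0 ray_kernel_1 ..
      also have "\<dots> = (\<Sum>\<^sub>\<infinity>m. of_nat (min (Suc n) (Suc m)) * u (Ray \<alpha> m) - of_nat (Suc m) * u (Ray \<alpha> m))"
        unfolding c_def diff_conv_add_uminus
        by (rule infsumI[OF has_sum_add[OF has_sum_infsum[OF sk[of n]]
              has_sum_uminusI[OF has_sum_infsum[OF sc]]], symmetric])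
      also have "(\<lambda>m. of_nat (min (Suc n) (Suc m)) * u (Ray \<alpha> m) - of_nat (Suc m) * u (Ray \<alpha> m)) =
          (\<lambda>m. - of_nat (m - n) * u (Ray \<alpha> m))"
      proof
        fix m
        have "of_nat (min (Suc n) (Suc m)) + of_nat (m - n) = (of_nat (Suc m) :: complex)"
          unfolding of_nat_add[symmetric] by (rule arg_cong[of _ _ of_nat]) auto
        then have "of_nat (min (Suc n) (Suc m)) - of_nat (Suc m) = (- of_nat (m - n) :: complex)"
          by (simp only: eq_diff_eq[symmetric]) simp
        then show "of_nat (min (Suc n) (Suc m)) * u (Ray \<alpha> m) - of_nat (Suc m) * u (Ray \<alpha> m) =
            - of_nat (m - n) * u (Ray \<alpha> m)" unfolding left_diff_distrib[symmetric] by (simp only:)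
      qed
      finally have w: "w (Ray \<alpha> n) = (\<Sum>\<^sub>\<infinity>m. - of_nat (m - n) * u (Ray \<alpha> m))" .
      have "(\<lambda>m. norm (- of_nat (m - n) * u (Ray \<alpha> m))) = (\<lambda>m. real (m - n) * a m)"
        by (simp add: norm_mult a_def fun_eq_iff)
      then show ?thesis unfolding w using sm[of n] norm_infsum_bound[of "\<lambda>m. - of_nat (m - n) * u (Ray \<alpha> m)" UNIV]
        by (simp only:)
    qed
    show "(\<lambda>n. weight (s - 2) (Ray \<alpha> n :: ('a, 'n) vertex) * cmod (w (Ray \<alpha> n))) summable_on UNIV"
      unfolding W_def[symmetric]
    proof (rule nonneg_bdd_above_summable_on)
      show "bdd_above (sum (\<lambda>n. W n * cmod (w (Ray \<alpha> n))) ` {F. F \<subseteq> UNIV \<and> finite F})"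
      proof (rule bdd_aboveI2)
        fix F :: "nat set" assume "F \<in> {F. F \<subseteq> UNIV \<and> finite F}"
        then have F: "finite F" by simp
        have hs: "((\<lambda>m. \<Sum>n\<in>F. W n * (real (m - n) * a m)) has_sum (\<Sum>n\<in>F. W n * (\<Sum>\<^sub>\<infinity>m. real (m - n) * a m))) UNIV"
          by (intro has_sum_sum has_sum_cmult_right has_sum_infsum sm)
        have "(\<Sum>n\<in>F. W n * cmod (w (Ray \<alpha> n))) \<le> (\<Sum>n\<in>F. W n * (\<Sum>\<^sub>\<infinity>m. real (m - n) * a m))"
          by (intro sum_mono mult_left_mono w_le W0)
        also have "\<dots> \<le> (\<Sum>\<^sub>\<infinity>m. (W m * (1 + (real (Suc m))\<^sup>2)) * a m)"
        proof (rule has_sum_mono[OF hs has_sum_infsum[OF total]])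
          fix m
          \<comment> \<open>For fixed m only the indices n < m count; there are at most m of them
            and \<open>W\<close> is monotone.\<close>
          have "(\<Sum>n\<in>F. W n * real (m - n)) = (\<Sum>n\<in>F \<inter> {..<m}. W n * real (m - n))"
            by (rule sum.mono_neutral_right[OF F]) auto
          also have "\<dots> \<le> (\<Sum>n\<in>F \<inter> {..<m}. W m * real (Suc m))"
          proof (intro sum_mono mult_mono W0)
            fix n assume "n \<in> F \<inter> {..<m}"
            then show "W n \<le> W m" unfolding W_def by (intro weight_ray_mono) (use s in auto)
          qed auto
          also have "\<dots> = real (card (F \<inter> {..<m})) * (W m * real (Suc m))" by simp
          also have "\<dots> \<le> real (Suc m) * (W m * real (Suc m))"
          proof (intro mult_right_mono)
            have "card (F \<inter> {..<m}) \<le> card {..<m}" by (rule card_mono) auto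
            then show "real (card (F \<inter> {..<m})) \<le> real (Suc m)" by simp
          qed (use W0 in auto)
          also have "\<dots> \<le> W m * (1 + (real (Suc m))\<^sup>2)"
            using W0[of m] by (simp add: power2_eq_square algebra_simps)
          finally have "(\<Sum>n\<in>F. W n * real (m - n)) * a m \<le> (W m * (1 + (real (Suc m))\<^sup>2)) * a m"
            by (rule mult_right_mono[OF _ a0])
          then show "(\<Sum>n\<in>F. W n * (real (m - n) * a m)) \<le> (W m * (1 + (real (Suc m))\<^sup>2)) * a m"
            by (simp only: sum_distrib_right mult.assoc)
        qed
        finally show "(\<Sum>n\<in>F. W n * cmod (w (Ray \<alpha> n))) \<le> (\<Sum>\<^sub>\<infinity>m. (W m * (1 + (real (Suc m))\<^sup>2)) * a m)" .
      qed
    qed (use W0 in auto)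
  qed
  moreover have "kernel_op (free_kernel 0) u = (\<Sum>\<alpha>\<in>UNIV. c \<alpha> *\<^sub>C ray_one \<alpha>) + w"
    by (simp add: w_def)
  ultimately show ?thesis unfolding one_plus_l1_def by blast
qed

end

subsection \<open>The operator \<open>M\<^sub>0\<close> at a regular threshold\<close>

lemma seminormed_UNIV: "seminormed_space (UNIV :: 'k::complex_hilbert set) norm"
  by (auto simp: seminormed_space_def norm_triangle_ineq norm_scaleC)

lemma countable_vertex: "countable (UNIV :: ('a::finite, 'n::finite) vertex set)"
  unfolding vertex_UNIV by (intro countable_Un countable_UN countable_image) auto

lemma finite_weight_le:
  assumes "1 \<le> s"
  shows "finite {z :: ('a::finite, 'n::finite) vertex. weight s z \<le> R}"
proof (rule finite_subset)
  show "finite (range Core \<union> (\<Union>\<alpha>. Ray \<alpha> ` {..nat \<lceil>R\<rceil>}) :: ('a, 'n) vertex set)" by auto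
  show "{z :: ('a, 'n) vertex. weight s z \<le> R} \<subseteq> range Core \<union> (\<Union>\<alpha>. Ray \<alpha> ` {..nat \<lceil>R\<rceil>})"
  proof
    fix z :: "('a, 'n) vertex" assume "z \<in> {z. weight s z \<le> R}"
    then have z: "weight s z \<le> R" by simp
    show "z \<in> range Core \<union> (\<Union>\<alpha>. Ray \<alpha> ` {..nat \<lceil>R\<rceil>})"
    proof (cases z)
      case (Ray \<alpha> n)
      have "real (Suc n) ^ 1 \<le> weight (real 1) z" unfolding Ray by (rule weight_ray_power_le)
      also have "\<dots> \<le> weight s z" by (rule weight_mono) (use assms in simp)
      finally have "real (Suc n) \<le> R" using z by simp
      then have "n \<le> nat \<lceil>R\<rceil>" by linarith
      then show ?thesis using Ray by auto
    qed auto
  qed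
qed

text \<open>The weight tends to infinity along the rays, so a uniform bound handles all but finitely
  many vertices, and pointwise convergence handles these.\<close>

lemma linf_norm_tendsto_zero:
  fixes f :: "nat \<Rightarrow> ('a::finite, 'n::finite) gfun"
  assumes s: "1 \<le> s" and bnd: "\<And>n x. cmod (f n x) \<le> C"
    and lim: "\<And>x. (\<lambda>n. f n x) \<longlonglongrightarrow> 0"
  shows "(\<lambda>n. linf_norm s (f n)) \<longlonglongrightarrow> 0"
proof (rule LIMSEQ_I)
  fix e :: real assume e: "0 < e"
  have C: "0 \<le> C" using bnd[of 0 undefined] norm_ge_zero order_trans by blast
  \<comment> \<open>Outside \<open>S\<close> the uniform bound \<open>C\<close> is already below e /
    2 times the weight.\<close>
  define S where "S = {z :: ('a, 'n) vertex. weight s z \<le> 2 * C / e}"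
  have "finite S" unfolding S_def by (rule finite_weight_le[OF s])
  then have "\<forall>\<^sub>F n in sequentially. \<forall>x\<in>S. cmod (f n x) < e / 2"
  proof (subst eventually_ball_finite_distrib, simp, intro ballI)
    fix x
    have "(\<lambda>n. cmod (f n x)) \<longlonglongrightarrow> 0" using tendsto_norm_zero[OF lim] .
    then show "\<forall>\<^sub>F n in sequentially. cmod (f n x) < e / 2"
      using e by (intro order_tendstoD(2)) auto
  qed
  then obtain N where N: "\<And>n x. N \<le> n \<Longrightarrow> x \<in> S \<Longrightarrow> cmod (f n x) < e / 2"
    by (auto simp: eventually_sequentially)
  have "norm (linf_norm s (f n) - 0) < e" if "N \<le> n" for n
  proof -
    have le: "cmod (f n x) \<le> e / 2 * weight s x" for x
    proof (cases "x \<in> S")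
      case True
      have "cmod (f n x) \<le> e / 2 * 1" using N[OF that True] by simp
      also have "\<dots> \<le> e / 2 * weight s x"
        using e s by (intro mult_left_mono weight_ge_1) auto
      finally show ?thesis .
    next
      case False
      then have "2 * C / e \<le> weight s x" by (simp add: S_def)
      then have "C \<le> e / 2 * weight s x" using e by (simp add: field_simps)
      with bnd[of n x] show ?thesis by (rule order_trans)
    qed
    from linf_spaceI[OF le] have "linf_norm s (f n) \<le> e / 2" "0 \<le> linf_norm s (f n)"
      by (auto intro: linf_norm_nonneg)
    then show ?thesis using e by simp
  qed
  then show "\<exists>N. \<forall>n\<ge>N. norm (linf_norm s (f n) - 0) < e" by blast
qed

locale regular_perturbation = ray_graph E0 att
  for E0 :: "('a::finite \<times> 'a) set" and att :: "'n::finite \<Rightarrow> 'a" +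
  fixes v :: "'k::complex_hilbert \<Rightarrow> ('a, 'n) gfun" and U :: "'k \<Rightarrow> 'k"
    and V :: "('a, 'n) gfun \<Rightarrow> ('a, 'n) gfun" and \<beta> :: nat
  assumes beta: "2 \<le> \<beta>" and pert: "perturbation (real \<beta>) V v U"
    and regular: "regular_threshold (real \<beta>) (hamiltonian E0 att V)"
begin

section \<open>The operators \<open>v\<close>, its adjoint, \<open>U\<close> and the Green
  operator\<close>

abbreviation "L1 \<equiv> (l1_space (real \<beta>) :: ('a, 'n) gfun set)"
abbreviation "nL1 \<equiv> (l1_norm (real \<beta>) :: ('a, 'n) gfun \<Rightarrow> real)"
abbreviation "Linf \<equiv> (linf_space (real \<beta>) :: ('a, 'n) gfun set)"
abbreviation "nLinf \<equiv> (linf_norm (real \<beta>) :: ('a, 'n) gfun \<Rightarrow> real)"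
abbreviation "vs \<equiv> dual_adjoint v"
abbreviation "green \<equiv> (kernel_op (free_kernel 0) :: ('a, 'n) gfun \<Rightarrow> ('a, 'n) gfun)"
abbreviation "Ham \<equiv> hamiltonian E0 att V"

lemmas snL1 = seminormed_l1[of "real \<beta>", where 'a = 'a and 'n = 'n]
lemmas snLinf = seminormed_linf[of "real \<beta>", where 'a = 'a and 'n = 'n]

lemma beta_ge: "1 \<le> real \<beta>" "2 \<le> real \<beta>" "0 \<le> real \<beta>" "0 \<le> real \<beta> - 2"
  using beta by auto

lemma v_bounded: "\<exists>C. op_bound UNIV norm L1 nL1 C v"
proof -
  have "bounded_op UNIV norm L1 nL1 v" using pert by (simp add: perturbation_def)
  then show ?thesis by (simp only: bounded_op_iff[OF seminormed_UNIV])
qed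

lemma v_mem [simp]: "v \<phi> \<in> L1"
  using v_bounded by (elim exE) (erule op_boundD(2)[OF _ UNIV_I])

lemma v_linear: "linear_on UNIV v"
  using v_bounded by (elim exE) (rule op_boundD(3))

lemma v_eq_0: "v \<phi> = 0 \<longleftrightarrow> \<phi> = 0"
proof -
  have "inj v" using pert by (simp add: perturbation_def)
  moreover have "v 0 = 0" by (rule linear_on_zero[OF seminormed_UNIV v_linear])
  ultimately show ?thesis by (metis injD)
qed

text \<open>The description by \<open>THE\<close> denotes something: the representing vector exists
  by Riesz and is unique because the inner product separates points.\<close>

lemma vs_cinner:
  assumes u: "u \<in> Linf"
  shows "cinner (vs u) \<psi> = pairing u (v \<psi>)"
proof -
  obtain C where C: "op_bound UNIV norm L1 nL1 C v" using v_bounded by blast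
  have "\<exists>\<phi>. \<forall>\<psi>. cinner \<phi> \<psi> = pairing u (v \<psi>)"
  proof (rule riesz_representation)
    show "pairing u (v (x + y)) = pairing u (v x) + pairing u (v y)" for x y
      using linear_onD(1)[OF v_linear] pairing_add_right[OF u v_mem v_mem] by simp
    show "pairing u (v (c *\<^sub>C x)) = c * pairing u (v x)" for c x
      using linear_onD(2)[OF v_linear] by (simp add: pairing_scaleC_right)
    show "cmod (pairing u (v x)) \<le> (nLinf u * C) * norm x" for x
    proof -
      have "cmod (pairing u (v x)) \<le> nLinf u * nL1 (v x)" by (rule pairing_has_sum(2)[OF u v_mem])
      also have "\<dots> \<le> nLinf u * (C * norm x)"
        by (intro mult_left_mono op_boundD(4)[OF C] linf_norm_nonneg[OF u]) simp
      finally show ?thesis by (simp add: mult.assoc)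
    qed
  qed
  then obtain \<phi> where \<phi>: "\<forall>\<psi>. cinner \<phi> \<psi> = pairing u (v \<psi>)" by blast
  have "vs u = \<phi>" unfolding dual_adjoint_def
  proof (rule the_equality)
    show "\<forall>\<psi>. cinner \<phi> \<psi> = pairing u (v \<psi>)" by (rule \<phi>)
    show "\<phi>' = \<phi>" if "\<forall>\<psi>. cinner \<phi>' \<psi> = pairing u (v \<psi>)" for \<phi>'
      by (rule cinner_eqI) (simp only: that \<phi>)
  qed
  then show ?thesis using \<phi> by simp
qed

lemma vs_bounded: "\<exists>C. op_bound Linf nLinf UNIV norm C vs"
proof -
  obtain C where C: "op_bound UNIV norm L1 nL1 C v" using v_bounded by blast
  have "op_bound Linf nLinf UNIV norm C vs"
  proof (rule op_boundI[OF op_boundD(1)[OF C]])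
    fix u w c assume u: "u \<in> Linf"
    show "vs u \<in> UNIV" by simp
    show "vs (c *\<^sub>C u) = c *\<^sub>C vs u"
      by (rule cinner_eqI)
        (simp add: vs_cinner u seminormed_spaceD(4)[OF snLinf] cinner_scaleC_left pairing_scaleC_left)
    show "norm (vs u) \<le> C * nLinf u"
    proof (cases "vs u = 0")
      case True
      then show ?thesis using op_boundD(1)[OF C] linf_norm_nonneg[OF u] by simp
    next
      case False
      have "(norm (vs u))\<^sup>2 = cmod (cinner (vs u) (vs u))" by (simp add: cinner_self norm_power)
      also have "\<dots> \<le> nLinf u * nL1 (v (vs u))"
        unfolding vs_cinner[OF u] by (rule pairing_has_sum(2)[OF u v_mem])
      also have "\<dots> \<le> nLinf u * (C * norm (vs u))"
        by (intro mult_left_mono op_boundD(4)[OF C] linf_norm_nonneg[OF u]) simp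
      finally show ?thesis using False by (simp add: power2_eq_square mult_ac)
    qed
    assume w: "w \<in> Linf"
    show "vs (u + w) = vs u + vs w"
      by (rule cinner_eqI)
        (simp only: vs_cinner u w seminormed_spaceD(2)[OF snLinf u w] cinner_add_left pairing_add_left[OF u w v_mem])
  qed
  then show ?thesis by blast
qed

lemma vs_linear: "linear_on Linf vs"
  using vs_bounded by (elim exE) (rule op_boundD(3))

lemma U_facts: "selfadjoint_unitary U"
  using pert by (simp add: perturbation_def)

lemma U_bounded: "\<exists>C. op_bound UNIV norm UNIV norm C U"
proof -
  have "bounded_op UNIV norm UNIV norm U" using U_facts by (simp add: selfadjoint_unitary_def)
  then show ?thesis by (simp only: bounded_op_iff[OF seminormed_UNIV])
qed

lemma U_linear: "linear_on UNIV U"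
  using U_bounded by (elim exE) (rule op_boundD(3))

text \<open>Symmetric and isometric at once means involutive; this is what turns v^t \<Psi> = U
  \<phi> into V \<Psi> = v \<phi> later on.\<close>

lemma U_U [simp]: "U (U \<phi>) = \<phi>"
proof (rule cinner_eqI)
  fix \<psi>
  have "cinner (U (U \<phi>)) \<psi> = cinner (U \<phi>) (U \<psi>)"
    using U_facts unfolding selfadjoint_unitary_def by blast
  also have "\<dots> = cinner \<phi> \<psi>"
    using U_facts unfolding selfadjoint_unitary_def by blast
  finally show "cinner (U (U \<phi>)) \<psi> = cinner \<phi> \<psi>" .
qed

lemma V_eq: "u \<in> Linf \<Longrightarrow> V u = v (U (vs u))"
  using pert by (simp add: perturbation_def)

lemma green_bounded: "\<exists>C. op_bound L1 nL1 Linf nLinf C green"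
proof -
  obtain C where "kernel_bound (real \<beta>) C (free_kernel 0)"
    by (rule kernel_bound_free_kernel[OF beta_ge(1)])
  then show ?thesis by (intro exI op_bound_kernel)
qed

lemma green_mem [simp]: "u \<in> L1 \<Longrightarrow> green u \<in> Linf"
  using green_bounded by (elim exE) (erule op_boundD(2))

lemma green_linear: "linear_on L1 green"
  using green_bounded by (elim exE) (rule op_boundD(3))

lemma green_symmetric:
  assumes "u \<in> L1" "w \<in> L1"
  shows "pairing (green u) w = pairing u (green w)"
proof -
  obtain C where "kernel_bound (real \<beta>) C (free_kernel 0)"
    by (rule kernel_bound_free_kernel[OF beta_ge(1)])
  then show ?thesis by (rule kernel_op_symmetric[OF _ free_kernel_hermitian assms])
qed

abbreviation "M \<equiv> M0 E0 att v U"

lemma M_eq: "M \<phi> = U \<phi> + vs (green (v \<phi>))"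
  by (simp add: M0_def free_green_eq)

lemma M_bounded: "\<exists>C. op_bound UNIV norm UNIV norm C M"
proof -
  obtain C1 C2 C3 C4 where "op_bound UNIV norm L1 nL1 C1 v" "op_bound L1 nL1 Linf nLinf C2 green"
    "op_bound Linf nLinf UNIV norm C3 vs" "op_bound UNIV norm UNIV norm C4 U"
    using v_bounded green_bounded vs_bounded U_bounded by blast
  from op_bound_add[OF this(4) op_bound_comp[OF op_bound_comp[OF this(1,2)] this(3)] seminormed_UNIV]
  show ?thesis unfolding M_eq[abs_def] by blast
qed

lemma M_linear: "linear_on UNIV M"
  using M_bounded by (elim exE) (rule op_boundD(3))

lemma M_diff: "M (\<phi> - \<psi>) = M \<phi> - M \<psi>"
  by (rule linear_on_diff[OF seminormed_UNIV M_linear]) auto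

lemma M_symmetric: "cinner (M \<phi>) \<psi> = cinner \<phi> (M \<psi>)"
proof -
  have "cinner (U \<phi>) \<psi> = cinner \<phi> (U \<psi>)" using U_facts by (simp add: selfadjoint_unitary_def)
  moreover have "cinner (vs (green (v \<phi>))) \<psi> = cinner \<phi> (vs (green (v \<psi>)))"
  proof -
    have "cinner (vs (green (v \<phi>))) \<psi> = pairing (v \<phi>) (green (v \<psi>))"
      by (simp add: vs_cinner green_symmetric)
    also have "\<dots> = cnj (cinner (vs (green (v \<psi>))) \<phi>)"
      by (subst pairing_commute) (simp add: vs_cinner)
    also have "\<dots> = cinner \<phi> (vs (green (v \<psi>)))" by (rule cinner_commute[symmetric])
    finally show ?thesis .
  qed
  ultimately show ?thesis by (simp add: M_eq cinner_add_left cinner_add_right)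
qed

text \<open>A kernel element \<open>\<phi>\<close> produces the threshold eigenfunction \<open>- green (v \<phi>)\<close>.\<close>

lemma M_injective:
  assumes "M \<phi> = 0"
  shows "\<phi> = 0"
proof -
  define \<Psi> where "\<Psi> = - green (v \<phi>)"
  have \<Psi>: "\<Psi> \<in> Linf" unfolding \<Psi>_def by (rule seminormed_space_minus(1)[OF snLinf]) simp
  have "vs \<Psi> = - vs (green (v \<phi>))"
    unfolding \<Psi>_def by (rule linear_on_minus[OF vs_linear]) simp
  also have "\<dots> = U \<phi>" using assms minus_unique[of "vs (green (v \<phi>))" "U \<phi>"]
    by (simp add: M_eq add.commute)
  finally have V: "V \<Psi> = v \<phi>" by (simp add: V_eq[OF \<Psi>])
  have "free_op E0 att \<Psi> = - v \<phi>"
    using free_op_scale[of E0 att "-1" "green (v \<phi>)"] free_op_green[OF beta_ge(1), of "v \<phi>"]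
    unfolding \<Psi>_def scaleC_minus_one by simp
  then have H: "Ham \<Psi> = 0" using V by (simp add: hamiltonian_def fun_eq_iff)
  \<comment> \<open>This decomposition is what places \<Psi> in \<open>eigen_cal\<close>, the space
    that regularity makes trivial.\<close>
  obtain c w where cw: "w \<in> l1_space (real \<beta> - 2)"
    "green (v \<phi>) = (\<Sum>\<alpha>\<in>UNIV. c \<alpha> *\<^sub>C ray_one \<alpha>) + w"
    using green_in_one_plus_l1[OF beta_ge(2) v_mem[of \<phi>]] by (auto simp: one_plus_l1_def)
  have "(\<Sum>\<alpha>\<in>UNIV. (- c \<alpha>) *\<^sub>C ray_one \<alpha> :: ('a, 'n) gfun) = - (\<Sum>\<alpha>\<in>UNIV. c \<alpha> *\<^sub>C ray_one \<alpha>)"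
    unfolding scaleC_minus_left sum_negf ..
  then have "\<Psi> = (\<Sum>\<alpha>\<in>UNIV. (- c \<alpha>) *\<^sub>C ray_one \<alpha>) + - w"
    unfolding \<Psi>_def cw(2) minus_add_distrib by (simp only:)
  moreover have "- w \<in> l1_space (real \<beta> - 2)"
    by (rule seminormed_space_minus(1)[OF seminormed_l1 cw(1)])
  ultimately have "\<Psi> \<in> one_plus_l1 (real \<beta> - 2)"
    unfolding one_plus_l1_def by (intro CollectI exI[of _ "\<lambda>\<alpha>. - c \<alpha>"] exI[of _ "- w"]) simp
  then have "\<Psi> \<in> eigen_cal (real \<beta>) Ham" using \<Psi> H by (simp add: eigen_cal_def eigen_tilde_def)
  then have "\<Psi> = 0" using regular by (auto simp: regular_threshold_def)
  \<comment> \<open>Injectivity of \<open>v\<close> leads back from \<Psi> = 0 to \<phi> =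
    0.\<close>
  then have "v \<phi> = V 0" using V by simp
  also have "V 0 = 0"
    using linear_on_zero[OF snLinf vs_linear] linear_on_zero[OF seminormed_UNIV U_linear]
      V_eq[OF seminormed_spaceD(1)[OF snLinf]] v_eq_0 by simp
  finally show ?thesis using v_eq_0 by simp
qed

text \<open>Otherwise unit vectors exist with M \<phi> tending to 0. Compactness lets v^t G v \<phi>
  converge along a subsequence, hence also U \<phi>, hence \<phi> itself; the limit is a unit vector
  in the kernel.\<close>

lemma M_bounded_below: "\<exists>c>0. \<forall>\<phi>. c * norm \<phi> \<le> norm (M \<phi>)"
proof (rule ccontr)
  assume contr: "\<not> (\<exists>c>0. \<forall>\<phi>. c * norm \<phi> \<le> norm (M \<phi>))"
  obtain Cv where Cv: "op_bound UNIV norm L1 nL1 Cv v" using v_bounded by blast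
  obtain Cs where Cs: "op_bound Linf nLinf UNIV norm Cs vs" using vs_bounded by blast
  obtain CU where CU: "op_bound UNIV norm UNIV norm CU U" using U_bounded by blast
  obtain CM where CM: "op_bound UNIV norm UNIV norm CM M" using M_bounded by blast
  have "\<exists>\<phi>. norm \<phi> = 1 \<and> norm (M \<phi>) < inverse (Suc n)" for n
  proof -
    obtain \<phi> where \<phi>: "norm (M \<phi>) < inverse (Suc n) * norm \<phi>"
      using contr by (meson inverse_positive_iff_positive not_less of_nat_0_less_iff zero_less_Suc)
    then have \<phi>0: "0 < norm \<phi>" using norm_ge_zero[of "M \<phi>"] by (cases "\<phi> = 0") auto
    define \<psi> where "\<psi> = complex_of_real (inverse (norm \<phi>)) *\<^sub>C \<phi>"
    have "norm (M \<psi>) = inverse (norm \<phi>) * norm (M \<phi>)"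
      using linear_onD(2)[OF M_linear, of \<phi>] by (simp add: \<psi>_def norm_scaleC norm_inverse)
    also have "\<dots> < inverse (norm \<phi>) * (inverse (Suc n) * norm \<phi>)"
      using \<phi> \<phi>0 by (intro mult_strict_left_mono) auto
    also have "\<dots> = inverse (Suc n)" using \<phi>0 by simp
    finally have "norm (M \<psi>) < inverse (Suc n)" .
    moreover have "norm \<psi> = 1" using \<phi>0 by (simp add: \<psi>_def norm_scaleC norm_inverse)
    ultimately show ?thesis by blast
  qed
  then obtain \<phi> where \<phi>: "\<And>n. norm (\<phi> n) = 1" "\<And>n. norm (M (\<phi> n)) < inverse (Suc n)" by metis
  define u where "u n = green (v (\<phi> n))" for n
  \<comment> \<open>The one-sided bound gives G v \<phi> a bound uniform over all vertices, stronger
    than membership in the weighted dual.\<close>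
  obtain C where C: "0 \<le> C" "\<And>x y :: ('a, 'n) vertex. cmod (free_kernel 0 x y) \<le> C * weight (real \<beta>) y"
    using free_kernel_0_le[OF beta_ge(1)] by blast
  have u_le: "cmod (u n x) \<le> C * Cv" for n x
  proof -
    have le: "norm (free_kernel 0 x y * v (\<phi> n) y) \<le> C * (weight (real \<beta>) y * cmod (v (\<phi> n) y))" for y
      unfolding norm_mult using mult_right_mono[OF C(2)[of x y], of "cmod (v (\<phi> n) y)"]
      by (simp only: mult.assoc norm_ge_zero)
    have s: "(\<lambda>y. C * (weight (real \<beta>) y * cmod (v (\<phi> n) y))) summable_on UNIV"
      by (rule summable_on_cmult_right[OF l1_spaceD[OF v_mem]])
    have s': "(\<lambda>y. norm (free_kernel 0 x y * v (\<phi> n) y)) summable_on UNIV"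
      by (rule summable_on_comparison_test[OF s le]) auto
    have "cmod (u n x) \<le> (\<Sum>\<^sub>\<infinity>y. norm (free_kernel 0 x y * v (\<phi> n) y))"
      unfolding u_def kernel_op_def by (rule norm_infsum_bound[OF s'])
    also have "\<dots> \<le> (\<Sum>\<^sub>\<infinity>y. C * (weight (real \<beta>) y * cmod (v (\<phi> n) y)))"
      by (rule infsum_mono[OF s' s le])
    also have "\<dots> = C * nL1 (v (\<phi> n))" by (simp only: infsum_cmult_right' l1_norm_def)
    also have "\<dots> \<le> C * Cv"
      using op_boundD(4)[OF Cv, of "\<phi> n"] C(1) by (intro mult_left_mono) (auto simp: \<phi>(1))
    finally show ?thesis .
  qed
  \<comment> \<open>A diagonal subsequence: the vertices are countable and the values uniformly
    bounded.\<close>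
  obtain k where k: "strict_mono k" "\<And>x. \<exists>l. (\<lambda>n. u (k n) x) \<longlonglongrightarrow> l"
    using function_convergent_subsequence[OF countable_vertex, of u "C * Cv"] u_le by auto
  then obtain u0 where u0: "\<And>x. (\<lambda>n. u (k n) x) \<longlonglongrightarrow> u0 x" by metis
  have u0_le: "cmod (u0 x) \<le> C * Cv" for x
    using LIMSEQ_le_const2[OF tendsto_norm[OF u0[of x]], of "C * Cv"] u_le by blast
  have CC: "0 \<le> C * Cv" using C(1) op_boundD(1)[OF Cv] by simp
  have u0_mem: "u0 \<in> Linf"
  proof (rule linf_spaceI)
    show "cmod (u0 x) \<le> (C * Cv) * weight (real \<beta>) x" for x
      using u0_le[of x] mult_left_mono[OF weight_ge_1[OF beta_ge(3)] CC, of x] by simp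
  qed
  have u_mem: "u n \<in> Linf" for n by (simp add: u_def)
  \<comment> \<open>Pointwise convergence becomes norm convergence, as the weights tend to infinity;
    only then may the bounded operator \<open>vs\<close> be applied.\<close>
  have "(\<lambda>n. nLinf (u (k n) - u0)) \<longlonglongrightarrow> 0"
  proof (rule linf_norm_tendsto_zero[OF beta_ge(1)])
    show "cmod ((u (k n) - u0) x) \<le> 2 * (C * Cv)" for n x
      using norm_triangle_ineq4[of "u (k n) x" "u0 x"] u_le[of "k n" x] u0_le[of x] by simp
    show "(\<lambda>n. (u (k n) - u0) x) \<longlonglongrightarrow> 0" for x
      using tendsto_diff[OF u0[of x] tendsto_const[of "u0 x"]] by simp
  qed
  then have "(\<lambda>n. Cs * nLinf (u (k n) - u0)) \<longlonglongrightarrow> 0" by (rule tendsto_mult_right_zero)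
  then have "(\<lambda>n. vs (u (k n)) - vs u0) \<longlonglongrightarrow> 0"
  proof (rule Lim_null_comparison[rotated], intro always_eventually allI)
    fix n
    have "vs (u (k n)) - vs u0 = vs (u (k n) - u0)"
      by (rule linear_on_diff[OF snLinf vs_linear u_mem u0_mem, symmetric])
    then show "norm (vs (u (k n)) - vs u0) \<le> Cs * nLinf (u (k n) - u0)"
      using op_boundD(4)[OF Cs seminormed_space_diff(1)[OF snLinf u_mem u0_mem]] by simp
  qed
  then have vs_lim: "(\<lambda>n. vs (u (k n))) \<longlonglongrightarrow> vs u0" by (rule LIM_zero_cancel)
  have M_lim: "(\<lambda>n. M (\<phi> (k n))) \<longlonglongrightarrow> 0"
  proof (rule Lim_null_comparison, intro always_eventually allI)
    show "norm (M (\<phi> (k n))) \<le> inverse (Suc n)" for n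
    proof -
      have "inverse (real (Suc (k n))) \<le> inverse (real (Suc n))"
        using strict_mono_imp_increasing[OF k(1), of n] by (intro le_imp_inverse_le) auto
      then show ?thesis using \<phi>(2)[of "k n"] by (meson less_imp_le order_trans)
    qed
    show "(\<lambda>n. inverse (real (Suc n))) \<longlonglongrightarrow> 0" by (rule LIMSEQ_inverse_real_of_nat)
  qed
  have bl: "bounded_linear A" if A: "op_bound UNIV norm UNIV norm D A" for A :: "'k \<Rightarrow> 'k" and D
    using op_boundD(4)[OF A] linear_onD[OF op_boundD(3)[OF A]]
    by (intro bounded_linear_intro[of A D]) (auto simp: mult.commute simp flip: scaleC_of_real)
  \<comment> \<open>The sequence is U \<phi>; a further application of \<open>U\<close> gives strong
    convergence of \<phi> itself.\<close>
  have "(\<lambda>n. M (\<phi> (k n)) - vs (u (k n))) \<longlonglongrightarrow> 0 - vs u0" by (intro tendsto_diff M_lim vs_lim)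
  then have "(\<lambda>n. U (\<phi> (k n))) \<longlonglongrightarrow> - vs u0" by (simp add: M_eq u_def)
  then have "(\<lambda>n. U (U (\<phi> (k n)))) \<longlonglongrightarrow> U (- vs u0)"
    by (rule bounded_linear.tendsto[OF bl[OF CU]])
  then have \<phi>_lim: "(\<lambda>n. \<phi> (k n)) \<longlonglongrightarrow> U (- vs u0)" by simp
  have "(\<lambda>n. M (\<phi> (k n))) \<longlonglongrightarrow> M (U (- vs u0))" by (rule bounded_linear.tendsto[OF bl[OF CM] \<phi>_lim])
  then have "M (U (- vs u0)) = 0" using M_lim LIMSEQ_unique by blast
  then have "U (- vs u0) = 0" by (rule M_injective)
  moreover have "(\<lambda>n. norm (\<phi> (k n))) \<longlonglongrightarrow> norm (U (- vs u0))" by (rule tendsto_norm[OF \<phi>_lim])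
  ultimately show False using \<phi>(1) by (simp add: LIMSEQ_const_iff)
qed

text \<open>Since \<open>M\<close> is symmetric and bounded below, \<open>1 - t M\<^sup>2\<close> is a contraction for small \<open>t > 0\<close>.\<close>

lemma M_bij: "bij M"
proof (rule bijI)
  show "inj M"
  proof (rule injI)
    fix x y assume "M x = M y"
    then have "M (x - y) = 0" by (simp add: M_diff)
    then have "x - y = 0" by (rule M_injective)
    then show "x = y" by simp
  qed
  obtain c where c: "0 < c" "\<And>\<phi>. c * norm \<phi> \<le> norm (M \<phi>)" using M_bounded_below by blast
  obtain C0 where C0: "op_bound UNIV norm UNIV norm C0 M" using M_bounded by blast
  \<comment> \<open>The maximum with \<open>c\<close> keeps c^4 / C^4 at most 1, so that the root in
    \<open>q\<close> is real.\<close>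
  define C where "C = max C0 (max c 1)"
  have C: "0 < C" "c \<le> C" by (auto simp: C_def)
  have MC: "norm (M \<phi>) \<le> C * norm \<phi>" for \<phi>
    using op_boundD(4)[OF C0, of \<phi>] mult_right_mono[of C0 C "norm \<phi>"] by (simp add: C_def)
  \<comment> \<open>The minimiser of 1 - 2 t c^2 + t^2 C^4, with minimum 1 - c^4 / C^4, the square
    of \<open>q\<close>.\<close>
  define t where "t = c\<^sup>2 / C ^ 4"
  have t: "0 < t" using c C by (simp add: t_def)
  define A where "A \<phi> = complex_of_real t *\<^sub>C M (M \<phi>)" for \<phi>
  define q where "q = sqrt (1 - c ^ 4 / C ^ 4)"
  have "c ^ 4 \<le> C ^ 4" using c C by (intro power_mono) auto
  then have cC: "0 \<le> 1 - c ^ 4 / C ^ 4" "1 - c ^ 4 / C ^ 4 < 1" using c C by simp_all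
  have "bij A"
  proof (rule bij_if_near_identity[where q = q])
    show "A (x - y) = A x - A y" for x y by (simp add: A_def M_diff scaleC_diff_right)
    show "q < 1" unfolding q_def using cC real_sqrt_lt_1_iff by blast
    show "norm (x - A x) \<le> q * norm x" for x
    proof (rule power2_le_imp_le)
      \<comment> \<open>Symmetry makes the cross term t |M x|^2; it is nonnegative, which could fail
        with \<open>M\<close> in place of its square since \<open>M\<close> need not be
        positive.\<close>
      have "Re (cinner x (A x)) = t * (norm (M x))\<^sup>2"
        unfolding A_def by (simp add: cinner_scaleC_right cinner_self flip: M_symmetric)
      then have "(norm (x - A x))\<^sup>2 = (norm x)\<^sup>2 - 2 * (t * (norm (M x))\<^sup>2) + (norm (A x))\<^sup>2"
        by (simp add: norm_diff_square)
      also have "\<dots> \<le> (norm x)\<^sup>2 - 2 * (t * (c * norm x)\<^sup>2) + (t * (C * (C * norm x)))\<^sup>2"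
      proof (intro add_mono diff_left_mono mult_left_mono power_mono)
        have "norm (M (M x)) \<le> C * (C * norm x)"
          using MC[of "M x"] mult_left_mono[OF MC[of x], of C] C by linarith
        then show "norm (A x) \<le> t * (C * (C * norm x))" using t by (simp add: A_def norm_scaleC)
      qed (use c t in auto)
      also have "\<dots> = (1 - 2 * t * c\<^sup>2 + t\<^sup>2 * C ^ 4) * (norm x)\<^sup>2"
        by (simp add: power_mult_distrib algebra_simps flip: power_mult)
      also have "1 - 2 * t * c\<^sup>2 + t\<^sup>2 * C ^ 4 = 1 - c ^ 4 / C ^ 4"
        using C by (simp add: t_def power2_eq_square power4_eq_xxxx field_simps)
      also have "\<dots> * (norm x)\<^sup>2 = (q * norm x)\<^sup>2"
        unfolding q_def power_mult_distrib using cC by simp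
      finally show "(norm (x - A x))\<^sup>2 \<le> (q * norm x)\<^sup>2" .
      show "0 \<le> q * norm x" unfolding q_def using cC by simp
    qed
  qed
  show "surj M"
  proof (unfold surj_def, intro allI)
    fix y
    obtain x where "y = A x" using \<open>bij A\<close> by (metis bij_pointE)
    then have "y = M (complex_of_real t *\<^sub>C M x)"
      using linear_onD(2)[OF M_linear, of "M x"] by (simp add: A_def)
    then show "\<exists>x. y = M x" ..
  qed
qed

section \<open>The inverse of \<open>M\<close> and its identification with the
  pseudo-inverse\<close>

definition N :: "'k \<Rightarrow> 'k" where "N = inv M"

lemma M_N [simp]: "M (N \<phi>) = \<phi>"
  unfolding N_def by (rule surj_f_inv_f[OF bij_is_surj[OF M_bij]])

lemma N_M [simp]: "N (M \<phi>) = \<phi>"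
  unfolding N_def by (rule inv_f_f[OF bij_is_inj[OF M_bij]])

lemma N_bounded: "\<exists>C. op_bound UNIV norm UNIV norm C N"
proof -
  obtain c where c: "0 < c" "\<And>\<phi>. c * norm \<phi> \<le> norm (M \<phi>)" using M_bounded_below by blast
  have "op_bound UNIV norm UNIV norm (inverse c) N"
  proof (rule op_boundI)
    show "N (x + y) = N x + N y" for x y
      using linear_onD(1)[OF M_linear, of "N x" "N y"] N_M[of "N x + N y"] by simp
    show "N (a *\<^sub>C x) = a *\<^sub>C N x" for a x
      using linear_onD(2)[OF M_linear, of "N x" a] N_M[of "a *\<^sub>C N x"] by simp
    show "norm (N x) \<le> inverse c * norm x" for x
      using c(2)[of "N x"] c(1) by (simp add: field_simps)
  qed (use c in auto)
  then show ?thesis by blast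
qed

lemma N_linear: "linear_on UNIV N"
  using N_bounded by (elim exE) (rule op_boundD(3))

lemma N_symmetric: "cinner (N \<phi>) \<psi> = cinner \<phi> (N \<psi>)"
  using M_symmetric[of "N \<phi>" "N \<psi>"] unfolding M_N by (rule sym)

text \<open>The kernel is trivial and its orthogonal complement everything, so the defining
  conditions are those of a two-sided inverse; being a left inverse of the surjective
  \<open>M\<close> already determines it.\<close>

lemma pseudo_inverse_M: "pseudo_inverse M = N"
proof -
  have M0: "M 0 = 0" by (rule linear_on_zero[OF seminormed_UNIV M_linear])
  then have ker: "ker_op M = {0}" unfolding ker_op_def using M_injective by blast
  have ortho: "ortho {0 :: 'k} = UNIV" by (auto simp: ortho_def)
  show ?thesis unfolding pseudo_inverse_def ker ortho
  proof (rule the_equality)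
    show "linear_on UNIV N \<and> (\<forall>\<phi>\<in>{0}. N \<phi> = 0) \<and>
        (\<forall>\<phi>\<in>UNIV. N \<phi> \<in> UNIV \<and> M (N \<phi>) = \<phi> \<and> N (M \<phi>) = \<phi>)"
      using N_linear linear_on_zero[OF seminormed_UNIV N_linear] by simp
    fix N' assume "linear_on UNIV N' \<and> (\<forall>\<phi>\<in>{0}. N' \<phi> = 0) \<and>
        (\<forall>\<phi>\<in>UNIV. N' \<phi> \<in> UNIV \<and> M (N' \<phi>) = \<phi> \<and> N' (M \<phi>) = \<phi>)"
    then have "N' \<phi> = N \<phi>" for \<phi> by (metis N_M UNIV_I)
    then show "N' = N" by auto
  qed
qed

end

subsection \<open>The resolvent near the threshold\<close>

lemma free_op_l2:
  fixes u :: "('a::finite, 'n::finite) gfun"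
  assumes u: "u \<in> l2_space"
  shows "free_op E att u \<in> l2_space"
  unfolding l2_space_def mem_Collect_eq
proof (rule summable_on_vertexI)
  fix \<alpha>
  define f where "f n = u (Ray \<alpha> n)" for n
  have "(\<lambda>n. (cmod (f n))\<^sup>2) summable_on UNIV"
    using summable_on_rayD[of "\<lambda>x. (cmod (u x))\<^sup>2" \<alpha>] u by (simp add: l2_space_def f_def)
  then have s: "summable (\<lambda>n. (cmod (f n))\<^sup>2)" by (rule summable_on_imp_summable)
  \<comment> \<open>Three-term form of Cauchy-Schwarz; the coefficient 2 in \<open>ray_op\<close> is
    what becomes the 4 further down.\<close>
  have sq: "(cmod (a - b - c))\<^sup>2 \<le> 3 * ((cmod a)\<^sup>2 + (cmod b)\<^sup>2 + (cmod c)\<^sup>2)" for a b c :: complex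
  proof -
    have "cmod (a - b - c) \<le> cmod a + cmod b + cmod c"
      by (rule order_trans[OF norm_triangle_ineq4 add_right_mono[OF norm_triangle_ineq4]])
    then have "(cmod (a - b - c))\<^sup>2 \<le> (cmod a + cmod b + cmod c)\<^sup>2" by (intro power_mono) auto
    also have "\<dots> \<le> 3 * ((cmod a)\<^sup>2 + (cmod b)\<^sup>2 + (cmod c)\<^sup>2)"
      using sum_squares_bound[of "cmod a" "cmod b"] sum_squares_bound[of "cmod a" "cmod c"]
        sum_squares_bound[of "cmod b" "cmod c"]
      by (simp add: power2_eq_square algebra_simps)
    finally show ?thesis .
  qed
  have "summable (\<lambda>n. (cmod (ray_op f n))\<^sup>2)"
  proof (subst summable_Suc_iff[symmetric], rule summable_comparison_test)
    show "summable (\<lambda>n. 3 * (4 * (cmod (f (Suc n)))\<^sup>2 + (cmod (f (Suc (Suc n))))\<^sup>2 + (cmod (f n))\<^sup>2))"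
      using s summable_Suc_iff[of "\<lambda>n. (cmod (f n))\<^sup>2"] summable_Suc_iff[of "\<lambda>n. (cmod (f (Suc n)))\<^sup>2"]
      by (intro summable_mult summable_add) auto
    show "\<exists>N. \<forall>n\<ge>N. norm ((cmod (ray_op f (Suc n)))\<^sup>2) \<le>
        3 * (4 * (cmod (f (Suc n)))\<^sup>2 + (cmod (f (Suc (Suc n))))\<^sup>2 + (cmod (f n))\<^sup>2)"
      using sq[of "2 * f (Suc _)" "f (Suc (Suc _))" "f _"]
      by (auto simp: norm_mult power_mult_distrib)
  qed
  then have "(\<lambda>n. (cmod (ray_op f n))\<^sup>2) summable_on UNIV"
    by (subst summable_on_UNIV_nonneg_real_iff) auto
  then show "(\<lambda>n. (cmod (free_op E att u (Ray \<alpha> n)))\<^sup>2) summable_on UNIV"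
    by (simp add: free_op_def direct_sum_def f_def[abs_def])
qed

context regular_perturbation
begin

definition R0 :: "complex \<Rightarrow> ('a, 'n) gfun \<Rightarrow> ('a, 'n) gfun" where
  "R0 \<kappa> = kernel_op (free_kernel \<kappa>)"

definition D0 :: "complex \<Rightarrow> ('a, 'n) gfun \<Rightarrow> ('a, 'n) gfun" where
  "D0 \<kappa> = kernel_op (free_quotient \<kappa>)"

definition Mk :: "complex \<Rightarrow> 'k \<Rightarrow> 'k" where
  "Mk \<kappa> \<phi> = U \<phi> + vs (R0 \<kappa> (v \<phi>))"

definition Yk :: "complex \<Rightarrow> 'k \<Rightarrow> 'k" where
  "Yk \<kappa> = inv (Mk \<kappa>)"

text \<open>The candidate for the resolvent of H, as a formula on both \<open>L1\<close> and l^2;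
  the identification with \<open>resolvent\<close> on l^2 comes later.\<close>

definition Qk :: "complex \<Rightarrow> ('a, 'n) gfun \<Rightarrow> ('a, 'n) gfun" where
  "Qk \<kappa> u = R0 \<kappa> u - R0 \<kappa> (v (Yk \<kappa> (vs (R0 \<kappa> u))))"

definition Wk :: "complex \<Rightarrow> ('a, 'n) gfun \<Rightarrow> ('a, 'n) gfun" where
  "Wk \<kappa> u = u - v (Yk \<kappa> (vs (R0 \<kappa> u)))"

text \<open>\<open>P0\<close> acts on the dual space and \<open>W0\<close> on \<open>L1\<close>.
  They are adjoint to each other under the pairing, which is why the same functions appear on both
  sides of the first-order coefficient.\<close>

definition P0 :: "('a, 'n) gfun \<Rightarrow> ('a, 'n) gfun" where
  "P0 u = u - green (v (N (vs u)))"

definition W0 :: "('a, 'n) gfun \<Rightarrow> ('a, 'n) gfun" where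
  "W0 u = u - v (N (vs (green u)))"

definition coeff0 :: "('a, 'n) gfun \<Rightarrow> ('a, 'n) gfun" where
  "coeff0 u = green u - green (v (N (vs (green u))))"

lemma beta_Suc: "real (Suc (Suc (\<beta> - 2))) = real \<beta>" "\<beta> - 1 = Suc (\<beta> - 2)"
  using beta by (auto simp: of_nat_diff)

lemma R0_expands: "op_expands (\<beta> - 1) L1 nL1 Linf nLinf R0"
  using op_expands_kernel[OF _ fam_expands_free_kernel[of "\<beta> - 1"]] beta
  by (simp add: R0_def[abs_def] of_nat_diff)

lemma D0_expands: "op_expands (\<beta> - 2) L1 nL1 Linf nLinf D0"
  using op_expands_kernel[OF _ fam_expands_free_quotient[of "\<beta> - 2", unfolded beta_Suc]] beta
  by (simp add: D0_def[abs_def])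

text \<open>Exact on kernels for nonzero \<kappa>; a bound on the quotient kernel is needed only to
  split the infinite sum.\<close>

lemma R0_D0: "\<forall>\<^sub>F \<kappa> in right_half_plane_0. \<forall>u\<in>L1. R0 \<kappa> u = green u + \<kappa> *\<^sub>C D0 \<kappa> u"
proof -
  let ?W = "\<lambda>(x :: ('a, 'n) vertex, y :: ('a, 'n) vertex). weight (real \<beta>) x * weight (real \<beta>) y"
  have "fam_expands 0 ?W (\<lambda>\<kappa> (x, y). free_quotient \<kappa> x y)"
    by (rule fam_expands_bounded[OF _ fam_expands_free_quotient[of "\<beta> - 2", unfolded beta_Suc]])
      (auto split: prod.splits)
  then obtain C where C: "0 \<le> C" "\<forall>\<^sub>F \<kappa> in right_half_plane_0.
      \<forall>i. cmod (case i of (x, y) \<Rightarrow> free_quotient \<kappa> x y) \<le> C * ?W i"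
    by (rule fam_expands_0E)
  obtain G where G: "kernel_bound (real \<beta>) G (free_kernel 0)"
    by (rule kernel_bound_free_kernel[OF beta_ge(1)])
  show ?thesis
    using C(2) eventually_right_half_plane_0(1)
  proof eventually_elim
    case (elim \<kappa>)
    have B: "kernel_bound (real \<beta>) C (free_quotient \<kappa>)"
      using elim(1) C(1) by (auto simp: kernel_bound_def)
    have "\<kappa> \<noteq> 0" using elim(2) by auto
    then have eq: "free_kernel \<kappa> = (\<lambda>x y. free_kernel 0 x y + \<kappa> * free_quotient \<kappa> x y)"
      by (auto simp: free_quotient_def fun_eq_iff)
    show ?case unfolding R0_def D0_def by (subst (1) eq) (use kernel_op_add_scale[OF G B] in blast)
  qed
qed

lemma vDv_expands:
  "op_expands (\<beta> - 2) UNIV norm UNIV norm (\<lambda>\<kappa> \<phi>. vs (D0 \<kappa> (v \<phi>)))"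
proof -
  obtain Cv where Cv: "op_bound UNIV norm L1 nL1 Cv v" using v_bounded by blast
  obtain Cs where Cs: "op_bound Linf nLinf UNIV norm Cs vs" using vs_bounded by blast
  show ?thesis
    by (rule op_expands_comp[OF seminormed_UNIV snLinf seminormed_UNIV
          op_expands_comp[OF seminormed_UNIV snL1 snLinf op_expands_const[OF snL1 Cv] D0_expands]
          op_expands_const[OF seminormed_UNIV Cs]])
qed

lemma D0_bounded: "\<exists>C. \<forall>\<^sub>F \<kappa> in right_half_plane_0. op_bound L1 nL1 Linf nLinf C (D0 \<kappa>)"
  using op_expands_bounded[OF snL1 snLinf D0_expands] by simp

text \<open>M(\<kappa>) = M (1 + \<kappa> N v^t D(\<kappa>) v), and the bracket is close to the
  identity for small \<kappa>. The equation for the inverse comes from solving for the leading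
  term.\<close>

lemma Mk_eventually:
  obtains C where "\<forall>\<^sub>F \<kappa> in right_half_plane_0. bij (Mk \<kappa>) \<and> op_bound UNIV norm UNIV norm C (Yk \<kappa>) \<and>
    (\<forall>\<psi>. Yk \<kappa> \<psi> = N \<psi> - \<kappa> *\<^sub>C N (vs (D0 \<kappa> (v (Yk \<kappa> \<psi>)))))"
proof -
  obtain CN where CN: "op_bound UNIV norm UNIV norm CN N" using N_bounded by blast
  obtain KD where KD: "\<forall>\<^sub>F \<kappa> in right_half_plane_0. op_bound L1 nL1 Linf nLinf KD (D0 \<kappa>)"
    using D0_bounded by blast
  have "op_expands 0 UNIV norm UNIV norm (\<lambda>\<kappa> \<phi>. vs (D0 \<kappa> (v \<phi>)))"
    by (rule op_expands_bounded[OF seminormed_UNIV seminormed_UNIV vDv_expands])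
  then obtain K where K: "\<forall>\<^sub>F \<kappa> in right_half_plane_0. op_bound UNIV norm UNIV norm K (\<lambda>\<phi>. vs (D0 \<kappa> (v \<phi>)))"
    by auto
  \<comment> \<open>With 1/2, half of the norm of Y \<psi> is absorbed on the left, which produces
    the uniform bound 2 \<open>CN\<close>.\<close>
  have "\<forall>\<^sub>F \<kappa> in right_half_plane_0. cmod \<kappa> * (CN * K) < 1 / 2"
  proof (rule order_tendstoD(2))
    show "((\<lambda>\<kappa>. cmod \<kappa> * (CN * K)) \<longlongrightarrow> 0) right_half_plane_0"
      by (rule tendsto_mult_left_zero[OF tendsto_norm_zero[OF tendsto_right_half_plane_0]])
  qed simp
  with K R0_D0 KD have "\<forall>\<^sub>F \<kappa> in right_half_plane_0. bij (Mk \<kappa>) \<and> op_bound UNIV norm UNIV norm (2 * CN) (Yk \<kappa>) \<and>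
    (\<forall>\<psi>. Yk \<kappa> \<psi> = N \<psi> - \<kappa> *\<^sub>C N (vs (D0 \<kappa> (v (Yk \<kappa> \<psi>)))))"
  proof eventually_elim
    case (elim \<kappa>)
    define T where "T \<phi> = \<kappa> *\<^sub>C vs (D0 \<kappa> (v \<phi>))" for \<phi>
    have T: "op_bound UNIV norm UNIV norm (cmod \<kappa> * K) T"
      unfolding T_def by (rule op_bound_scale[OF elim(1) seminormed_UNIV])
    have NT: "op_bound UNIV norm UNIV norm (CN * (cmod \<kappa> * K)) (\<lambda>\<phi>. N (T \<phi>))"
      by (rule op_bound_comp[OF T CN])
    have "CN * (cmod \<kappa> * K) < 1 / 2" using elim(4) by (simp only: mult_ac)
    then have small: "CN * (cmod \<kappa> * K) \<le> 1 / 2" by (rule less_imp_le)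
    have NT_le: "norm (N (T \<phi>)) \<le> 1 / 2 * norm \<phi>" for \<phi>
      by (rule order_trans[OF op_boundD(4)[OF NT UNIV_I] mult_right_mono[OF small norm_ge_zero]])
    have Mk: "Mk \<kappa> \<phi> = M \<phi> + T \<phi>" for \<phi>
    proof -
      have D: "D0 \<kappa> (v \<phi>) \<in> Linf" by (rule op_boundD(2)[OF elim(3)]) simp
      have "R0 \<kappa> (v \<phi>) = green (v \<phi>) + \<kappa> *\<^sub>C D0 \<kappa> (v \<phi>)" using elim(2) by simp
      then have "vs (R0 \<kappa> (v \<phi>)) = vs (green (v \<phi>)) + T \<phi>"
        unfolding T_def using linear_onD(1)[OF vs_linear green_mem[OF v_mem] seminormed_spaceD(4)[OF snLinf D]]
          linear_onD(2)[OF vs_linear D] by (simp only:)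
      then show ?thesis by (simp only: Mk_def M_eq add.assoc)
    qed
    define A where "A \<phi> = \<phi> + N (T \<phi>)" for \<phi>
    have NT_diff: "N (T (x - y)) = N (T x) - N (T y)" for x y
      by (rule linear_on_diff[OF seminormed_UNIV op_boundD(3)[OF NT]]) auto
    have "bij A"
    proof (rule bij_if_near_identity[where q = "1 / 2"])
      show "A (x - y) = A x - A y" for x y by (simp add: A_def NT_diff)
      show "norm (x - A x) \<le> 1 / 2 * norm x" for x using NT_le[of x] by (simp add: A_def)
    qed simp
    have MkA: "Mk \<kappa> \<phi> = M (A \<phi>)" for \<phi>
      using linear_onD(1)[OF M_linear, of \<phi> "N (T \<phi>)"] by (simp add: A_def Mk)
    then have "Mk \<kappa> = M \<circ> A" by auto
    then have bij: "bij (Mk \<kappa>)" using bij_comp[OF \<open>bij A\<close> M_bij] by simp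
    have Y1: "Mk \<kappa> (Yk \<kappa> \<psi>) = \<psi>" for \<psi>
      unfolding Yk_def by (rule surj_f_inv_f[OF bij_is_surj[OF bij]])
    have Y2: "Yk \<kappa> (Mk \<kappa> \<phi>) = \<phi>" for \<phi>
      unfolding Yk_def by (rule inv_f_f[OF bij_is_inj[OF bij]])
    have Y: "Yk \<kappa> \<psi> = N \<psi> - N (T (Yk \<kappa> \<psi>))" for \<psi>
    proof -
      have "N \<psi> = N (M (A (Yk \<kappa> \<psi>)))" using Y1[of \<psi>] MkA[of "Yk \<kappa> \<psi>"] by simp
      then show ?thesis by (simp add: A_def)
    qed
    have Mk_lin: "linear_on UNIV (Mk \<kappa>)"
      using linear_onD[OF M_linear] linear_onD[OF op_boundD(3)[OF T]]
      by (simp add: linear_on_def Mk scaleC_add_right)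
    have "op_bound UNIV norm UNIV norm (2 * CN) (Yk \<kappa>)"
    proof (rule op_boundI)
      show "Yk \<kappa> (x + y) = Yk \<kappa> x + Yk \<kappa> y" for x y
        using linear_onD(1)[OF Mk_lin, of "Yk \<kappa> x" "Yk \<kappa> y"] Y2[of "Yk \<kappa> x + Yk \<kappa> y"] by (simp add: Y1)
      show "Yk \<kappa> (a *\<^sub>C x) = a *\<^sub>C Yk \<kappa> x" for a x
        using linear_onD(2)[OF Mk_lin, of "Yk \<kappa> x" a] Y2[of "a *\<^sub>C Yk \<kappa> x"] by (simp add: Y1)
      show "norm (Yk \<kappa> x) \<le> 2 * CN * norm x" for x
      proof -
        have "norm (Yk \<kappa> x) \<le> norm (N x) + norm (N (T (Yk \<kappa> x)))"
          by (subst Y) (rule norm_triangle_ineq4)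
        also have "\<dots> \<le> CN * norm x + 1 / 2 * norm (Yk \<kappa> x)"
          by (intro add_mono NT_le op_boundD(4)[OF CN]) simp
        finally show ?thesis by simp
      qed
    qed (use op_boundD(1)[OF CN] in auto)
    moreover have "N (T \<phi>) = \<kappa> *\<^sub>C N (vs (D0 \<kappa> (v \<phi>)))" for \<phi>
      unfolding T_def by (rule linear_onD(2)[OF N_linear UNIV_I])
    ultimately show ?case using bij Y by (simp only:) blast
  qed
  then show ?thesis by (rule that)
qed

lemma Yk_expands: "op_expands (\<beta> - 1) UNIV norm UNIV norm Yk"
proof -
  obtain C where C: "\<forall>\<^sub>F \<kappa> in right_half_plane_0. bij (Mk \<kappa>) \<and> op_bound UNIV norm UNIV norm C (Yk \<kappa>) \<and>
    (\<forall>\<psi>. Yk \<kappa> \<psi> = N \<psi> - \<kappa> *\<^sub>C N (vs (D0 \<kappa> (v (Yk \<kappa> \<psi>)))))"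
    by (rule Mk_eventually)
  obtain CN where CN: "op_bound UNIV norm UNIV norm CN N" using N_bounded by blast
  show ?thesis
  proof (rule op_expands_resolvent_eq[OF seminormed_UNIV CN vDv_expands])
    have "\<forall>\<^sub>F \<kappa> in right_half_plane_0. op_bound UNIV norm UNIV norm C (Yk \<kappa>)"
      using C by eventually_elim blast
    then show "op_expands 0 UNIV norm UNIV norm Yk" unfolding op_expands.simps by blast
    show "\<forall>\<^sub>F \<kappa> in right_half_plane_0. \<forall>u\<in>UNIV. Yk \<kappa> u = N u - \<kappa> *\<^sub>C N (vs (D0 \<kappa> (v (Yk \<kappa> u))))"
      using C by eventually_elim blast
  qed (use beta_Suc(2) in simp)
qed

text \<open>Unlike the resolvent, this factor stays in \<open>L1\<close>: every correction passes
  through \<open>v\<close>. Hence D(\<kappa>) can be applied to its values.\<close>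

lemma Wk_expands: "op_expands (\<beta> - 1) L1 nL1 L1 nL1 Wk"
proof -
  obtain Cv where Cv: "op_bound UNIV norm L1 nL1 Cv v" using v_bounded by blast
  obtain Cs where Cs: "op_bound Linf nLinf UNIV norm Cs vs" using vs_bounded by blast
  have "op_expands (\<beta> - 1) L1 nL1 UNIV norm (\<lambda>\<kappa> u. vs (R0 \<kappa> u))"
    by (rule op_expands_comp[OF snL1 snLinf seminormed_UNIV R0_expands op_expands_const[OF seminormed_UNIV Cs]])
  then have "op_expands (\<beta> - 1) L1 nL1 L1 nL1 (\<lambda>\<kappa> u. v (Yk \<kappa> (vs (R0 \<kappa> u))))"
    by (rule op_expands_comp[OF snL1 seminormed_UNIV snL1
          op_expands_comp[OF snL1 seminormed_UNIV seminormed_UNIV _ Yk_expands] op_expands_const[OF snL1 Cv]])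
  then show ?thesis unfolding Wk_def[abs_def]
    by (rule op_expands_diff[OF snL1 snL1 op_expands_const[OF snL1 op_bound_id]])
qed

lemma P0_bounded: "\<exists>C. op_bound Linf nLinf Linf nLinf C P0"
proof -
  obtain Cv Cs CN CG where "op_bound UNIV norm L1 nL1 Cv v" "op_bound Linf nLinf UNIV norm Cs vs"
    "op_bound UNIV norm UNIV norm CN N" "op_bound L1 nL1 Linf nLinf CG green"
    using v_bounded vs_bounded N_bounded green_bounded by blast
  from op_bound_diff[OF op_bound_id op_bound_comp[OF op_bound_comp[OF op_bound_comp[OF this(2,3)] this(1)] this(4)] snLinf]
  show ?thesis unfolding P0_def[abs_def] by blast
qed

lemma W0_bounded: "\<exists>C. op_bound L1 nL1 L1 nL1 C W0"
proof -
  obtain Cv Cs CN CG where "op_bound UNIV norm L1 nL1 Cv v" "op_bound Linf nLinf UNIV norm Cs vs"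
    "op_bound UNIV norm UNIV norm CN N" "op_bound L1 nL1 Linf nLinf CG green"
    using v_bounded vs_bounded N_bounded green_bounded by blast
  from op_bound_diff[OF op_bound_id op_bound_comp[OF op_bound_comp[OF op_bound_comp[OF this(4,2)] this(3)] this(1)] snL1]
  show ?thesis unfolding W0_def[abs_def] by blast
qed

lemma coeff0_bounded: "\<exists>C. op_bound L1 nL1 Linf nLinf C coeff0"
proof -
  obtain C CG where "op_bound Linf nLinf Linf nLinf C P0" "op_bound L1 nL1 Linf nLinf CG green"
    using P0_bounded green_bounded by blast
  from op_bound_comp[OF this(2,1)] show ?thesis unfolding P0_def coeff0_def[abs_def] by blast
qed

text \<open>The two identities behind the expansion: \<open>Y(\<kappa>) v\<^sup>* R\<^sub>0(\<kappa>) = N v\<^sup>* (G + \<kappa> D(\<kappa>) W(\<kappa>))\<close>, and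
  \<open>R(\<kappa>) - G\<^sub>0 = \<kappa> P D(\<kappa>) W(\<kappa>)\<close>, a two-sided second resolvent identity.\<close>

lemma resolvent_identity:
  "\<forall>\<^sub>F \<kappa> in right_half_plane_0. \<forall>u\<in>L1.
     Wk \<kappa> u = W0 u - \<kappa> *\<^sub>C v (N (vs (D0 \<kappa> (Wk \<kappa> u)))) \<and>
     Qk \<kappa> u = coeff0 u + \<kappa> *\<^sub>C P0 (D0 \<kappa> (Wk \<kappa> u))"
proof -
  obtain C where C: "\<forall>\<^sub>F \<kappa> in right_half_plane_0. bij (Mk \<kappa>) \<and> op_bound UNIV norm UNIV norm C (Yk \<kappa>) \<and>
    (\<forall>\<psi>. Yk \<kappa> \<psi> = N \<psi> - \<kappa> *\<^sub>C N (vs (D0 \<kappa> (v (Yk \<kappa> \<psi>)))))"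
    by (rule Mk_eventually)
  obtain KD where KD: "\<forall>\<^sub>F \<kappa> in right_half_plane_0. op_bound L1 nL1 Linf nLinf KD (D0 \<kappa>)"
    using D0_bounded by blast
  obtain CP where CP: "op_bound Linf nLinf Linf nLinf CP P0" using P0_bounded by blast
  show ?thesis
    using C KD R0_D0
  proof eventually_elim
    case (elim \<kappa>)
    show ?case
    proof
      fix u assume u: "u \<in> L1"
      define y where "y = Yk \<kappa> (vs (R0 \<kappa> u))"
      define w where "w = Wk \<kappa> u"
      define d where "d = \<kappa> *\<^sub>C D0 \<kappa> w"
      have w: "w = u - v y" by (simp only: w_def Wk_def y_def)
      have wL: "w \<in> L1" unfolding w by (rule seminormed_space_diff(1)[OF snL1 u v_mem])
      have DX: "D0 \<kappa> w \<in> Linf" by (rule op_boundD(2)[OF elim(2) wL])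
      have dX: "d \<in> Linf" unfolding d_def by (rule seminormed_spaceD(4)[OF snLinf DX])
      have RX: "R0 \<kappa> x \<in> Linf" if "x \<in> L1" for x
        using elim(3) that by (simp add: seminormed_spaceD(2,4)[OF snLinf] op_boundD(2)[OF elim(2)])
      have R_diff: "R0 \<kappa> (u - v y) = R0 \<kappa> u - R0 \<kappa> (v y)"
      proof -
        have 1: "u - v y \<in> L1" by (rule seminormed_space_diff(1)[OF snL1 u v_mem])
        show ?thesis
          using elim(3) u 1 linear_on_diff[OF snL1 green_linear u v_mem, of y]
            linear_on_diff[OF snL1 op_boundD(3)[OF elim(2)] u v_mem, of y]
          by (simp add: scaleC_diff_right)
      qed
      have Rw: "R0 \<kappa> w = green w + d" using elim(3) wL by (simp add: d_def)
      have gw: "green w = green u - green (v y)"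
        unfolding w by (rule linear_on_diff[OF snL1 green_linear u v_mem])
      have Mky: "U y + vs (R0 \<kappa> (v y)) = vs (R0 \<kappa> u)"
      proof -
        have "bij (Mk \<kappa>)" using elim(1) by blast
        from surj_f_inv_f[OF bij_is_surj[OF this]] have "Mk \<kappa> y = vs (R0 \<kappa> u)"
          unfolding y_def Yk_def .
        then show ?thesis by (simp only: Mk_def)
      qed
      \<comment> \<open>R_0 w with w = u - v y, written in two ways. After v^t is applied, the
        equation for y under \<open>Mk\<close> replaces the R_0 terms by U y, and the right-hand
        side becomes M y.\<close>
      have sum_eq: "d + green u = (R0 \<kappa> u - R0 \<kappa> (v y)) + green (v y)"
        unfolding Rw[unfolded gw, unfolded w R_diff] by (simp add: algebra_simps)
      have "vs d + vs (green u) = vs ((R0 \<kappa> u - R0 \<kappa> (v y)) + green (v y))"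
        using linear_onD(1)[OF vs_linear dX green_mem[OF u]] sum_eq by simp
      also have "\<dots> = vs (R0 \<kappa> u) - vs (R0 \<kappa> (v y)) + vs (green (v y))"
        by (simp only: linear_onD(1)[OF vs_linear seminormed_space_diff(1)[OF snLinf RX[OF u] RX[OF v_mem]]
              green_mem[OF v_mem]] linear_on_diff[OF snLinf vs_linear RX[OF u] RX[OF v_mem]])
      also have "\<dots> = M y" unfolding M_eq Mky[symmetric] by simp
      finally have "N (vs d + vs (green u)) = y" by simp
      then have y: "y = N (vs d) + N (vs (green u))"
        using linear_onD(1)[OF N_linear, of "vs d" "vs (green u)"] by simp
      have vy: "v y = v (N (vs d)) + v (N (vs (green u)))"
        unfolding y by (rule linear_onD(1)[OF v_linear]) auto
      have vNd: "v (N (vs d)) = \<kappa> *\<^sub>C v (N (vs (D0 \<kappa> w)))"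
        unfolding d_def by (simp only: linear_onD(2)[OF vs_linear DX] linear_onD(2)[OF N_linear UNIV_I]
            linear_onD(2)[OF v_linear UNIV_I])
      have "u - v y = W0 u - v (N (vs d))"
        unfolding W0_def vy by (simp add: algebra_simps)
      then have "w = W0 u - \<kappa> *\<^sub>C v (N (vs (D0 \<kappa> w)))"
        unfolding w[symmetric] vNd .
      moreover have "Qk \<kappa> u = coeff0 u + \<kappa> *\<^sub>C P0 (D0 \<kappa> w)"
      proof -
        have "Qk \<kappa> u = green w + d" unfolding Qk_def y_def[symmetric] R_diff[symmetric] w[symmetric] Rw ..
        also have "green w = green u - (green (v (N (vs d))) + green (v (N (vs (green u)))))"
          unfolding gw vy by (simp only: linear_onD(1)[OF green_linear v_mem v_mem])
        finally have q: "Qk \<kappa> u = green u - (green (v (N (vs d))) + green (v (N (vs (green u))))) + d" .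
        have "Qk \<kappa> u = coeff0 u + P0 d"
          unfolding q coeff0_def P0_def by (simp add: fun_eq_iff)
        also have "P0 d = \<kappa> *\<^sub>C P0 (D0 \<kappa> w)"
          unfolding d_def by (rule linear_onD(2)[OF op_boundD(3)[OF CP] DX])
        finally show ?thesis .
      qed
      ultimately show "Wk \<kappa> u = W0 u - \<kappa> *\<^sub>C v (N (vs (D0 \<kappa> (Wk \<kappa> u)))) \<and>
          Qk \<kappa> u = coeff0 u + \<kappa> *\<^sub>C P0 (D0 \<kappa> (Wk \<kappa> u))"
        unfolding w_def by blast
    qed
  qed
qed

lemma PDW_expands: "op_expands (\<beta> - 2) L1 nL1 Linf nLinf (\<lambda>\<kappa> u. P0 (D0 \<kappa> (Wk \<kappa> u)))"
proof -
  obtain CP where CP: "op_bound Linf nLinf Linf nLinf CP P0" using P0_bounded by blast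
  have W: "op_expands (\<beta> - 2) L1 nL1 L1 nL1 Wk"
    by (rule op_expands_mono[OF snL1 snL1 _ Wk_expands]) simp
  show ?thesis
    by (rule op_expands_comp[OF snL1 snLinf snLinf op_expands_comp[OF snL1 snL1 snLinf W D0_expands]
          op_expands_const[OF snLinf CP]])
qed

lemma Qk_expands: "op_expands (\<beta> - 1) L1 nL1 Linf nLinf Qk"
proof -
  obtain C where C: "op_bound L1 nL1 Linf nLinf C coeff0" using coeff0_bounded by blast
  show ?thesis unfolding beta_Suc(2)
    by (rule op_expands_SucI[OF C PDW_expands]) (use resolvent_identity in \<open>auto elim: eventually_mono\<close>)
qed

text \<open>The Birman-Schwinger correspondence. The equation M(\<kappa>) y = v^t R_0 u makes V Q u
  = v y, so Q is a right inverse; a null vector u of H + \<kappa>^2 gives the null vector U v^t u of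
  M(\<kappa>), so H + \<kappa>^2 is injective.\<close>

lemma resolvent_eq:
  assumes re: "0 < Re \<kappa>" and core: "bij (core_shift \<kappa>)" and bij: "bij (Mk \<kappa>)"
    and Y: "op_bound UNIV norm UNIV norm C (Yk \<kappa>)"
  shows "- \<kappa>\<^sup>2 \<notin> spectrum_l2 Ham" and "u \<in> l2_space \<Longrightarrow> resolvent Ham \<kappa> u = Qk \<kappa> u"
proof -
  note sn2 = seminormed_l2[where 'a = 'a and 'n = 'n]
  obtain A where A: "op_bound l2_space l2_norm l2_space l2_norm A (R0 \<kappa>)"
    using free_kernel_l2[OF re] unfolding R0_def by blast
  obtain Cv where Cv: "op_bound UNIV norm L1 nL1 Cv v" using v_bounded by blast
  obtain Cs where Cs: "op_bound Linf nLinf UNIV norm Cs vs" using vs_bounded by blast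
  note i2 = op_bound_l2_linf[OF beta_ge(3), where 'a = 'a and 'b = 'n]
  note i1 = op_bound_l1_l2[OF beta_ge(3), where 'a = 'a and 'b = 'n]
  have l2X: "x \<in> Linf" if "x \<in> l2_space" for x using op_boundD(2)[OF i2 that] .
  have vl2: "v \<phi> \<in> l2_space" for \<phi> using op_boundD(2)[OF i1 v_mem] .
  have R2: "R0 \<kappa> x \<in> l2_space" if "x \<in> l2_space" for x by (rule op_boundD(2)[OF A that])
  have RR: "free_op E0 att (R0 \<kappa> x) + \<kappa>\<^sup>2 *\<^sub>C R0 \<kappa> x = x" if "x \<in> l2_space" for x
    unfolding R0_def by (rule free_resolvent_right_inverse[OF re core that])
  have Q: "op_bound l2_space l2_norm l2_space l2_norm (A + A * (1 * (Cv * (C * (Cs * (1 * A)))))) (Qk \<kappa>)"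
    unfolding Qk_def[abs_def]
    by (rule op_bound_diff[OF A op_bound_comp[OF op_bound_comp[OF op_bound_comp[OF op_bound_comp[OF
        op_bound_comp[OF op_bound_comp[OF A i2] Cs] Y] Cv] i1] A] sn2])
  define B where "B u = Ham u + \<kappa>\<^sup>2 *\<^sub>C u" for u
  have B_free: "B x = (free_op E0 att x + \<kappa>\<^sup>2 *\<^sub>C x) + V x" for x
    by (simp add: B_def hamiltonian_def add_ac)
  have "bounded_l2 V" using pert by (simp add: perturbation_def)
  then obtain CV where CV: "op_bound l2_space l2_norm l2_space l2_norm CV V"
    unfolding bounded_op_iff[OF sn2] by blast
  have V2: "V x \<in> l2_space" if "x \<in> l2_space" for x by (rule op_boundD(2)[OF CV that])
  have V_diff: "V (x - y) = V x - V y" if "x \<in> l2_space" "y \<in> l2_space" for x y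
    by (rule linear_on_diff[OF sn2 op_boundD(3)[OF CV] that])
  have B2: "B x \<in> l2_space" if "x \<in> l2_space" for x
    unfolding B_free
    by (intro seminormed_spaceD(2,4)[OF sn2] free_op_l2 V2 that)
  have B_diff: "B (x - y) = B x - B y" if "x \<in> l2_space" "y \<in> l2_space" for x y
    unfolding B_free V_diff[OF that] free_op_diff scaleC_diff_right by (simp add: algebra_simps)
  have BQ: "B (Qk \<kappa> u) = u" if u: "u \<in> l2_space" for u
  proof -
    define y where "y = Yk \<kappa> (vs (R0 \<kappa> u))"
    have Mky: "U y + vs (R0 \<kappa> (v y)) = vs (R0 \<kappa> u)"
    proof -
      have "Mk \<kappa> y = vs (R0 \<kappa> u)"
        unfolding y_def Yk_def by (rule surj_f_inv_f[OF bij_is_surj[OF bij]])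
      then show ?thesis by (simp only: Mk_def)
    qed
    have Qy: "Qk \<kappa> u = R0 \<kappa> u - R0 \<kappa> (v y)" by (simp only: Qk_def y_def)
    have QX: "Qk \<kappa> u \<in> Linf" by (rule l2X[OF op_boundD(2)[OF Q u]])
    have "vs (Qk \<kappa> u) = U y"
      unfolding Qy linear_on_diff[OF snLinf vs_linear l2X[OF R2[OF u]] l2X[OF R2[OF vl2]]] Mky[symmetric]
      by simp
    then have V: "V (Qk \<kappa> u) = v y" by (simp add: V_eq[OF QX])
    have "free_op E0 att (Qk \<kappa> u) + \<kappa>\<^sup>2 *\<^sub>C Qk \<kappa> u =
        (free_op E0 att (R0 \<kappa> u) + \<kappa>\<^sup>2 *\<^sub>C R0 \<kappa> u) - (free_op E0 att (R0 \<kappa> (v y)) + \<kappa>\<^sup>2 *\<^sub>C R0 \<kappa> (v y))"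
      unfolding Qy free_op_diff scaleC_diff_right by (simp add: algebra_simps)
    also have "\<dots> = u - v y" unfolding RR[OF u] RR[OF vl2] ..
    finally show ?thesis unfolding B_free V by simp
  qed
  have B_inj: "u = 0" if u: "u \<in> l2_space" and Bu: "B u = 0" for u
  proof -
    \<comment> \<open>For a null vector u, V u = v \<phi>. Then u + R_0 v \<phi> solves the free
      equation on l^2 and vanishes, and applying v^t yields M(\<kappa>) \<phi> = 0.\<close>
    define \<phi> where "\<phi> = U (vs u)"
    have V: "V u = v \<phi>" unfolding \<phi>_def by (rule V_eq[OF l2X[OF u]])
    have sum2: "u + R0 \<kappa> (v \<phi>) \<in> l2_space" by (rule seminormed_spaceD(2)[OF sn2 u R2[OF vl2]])
    have "free_op E0 att (u + R0 \<kappa> (v \<phi>)) + \<kappa>\<^sup>2 *\<^sub>C (u + R0 \<kappa> (v \<phi>)) =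
        (free_op E0 att u + \<kappa>\<^sup>2 *\<^sub>C u) + (free_op E0 att (R0 \<kappa> (v \<phi>)) + \<kappa>\<^sup>2 *\<^sub>C R0 \<kappa> (v \<phi>))"
      unfolding free_op_add scaleC_add_right by (simp add: add_ac)
    also have "\<dots> = 0" unfolding RR[OF vl2] using Bu unfolding B_free V .
    finally have "u + R0 \<kappa> (v \<phi>) = 0" by (rule free_op_shift_injective[OF re core sum2])
    then have u_eq: "u = - R0 \<kappa> (v \<phi>)" by (rule eq_neg_iff_add_eq_0[THEN iffD2])
    have "vs u = - vs (R0 \<kappa> (v \<phi>))"
      by (subst u_eq) (rule linear_on_minus[OF vs_linear l2X[OF R2[OF vl2]]])
    moreover have "vs u = U \<phi>" by (simp add: \<phi>_def)
    ultimately have Mk0: "Mk \<kappa> \<phi> = 0" by (simp add: Mk_def)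
    have "Yk \<kappa> 0 = 0" by (rule linear_on_zero[OF seminormed_UNIV op_boundD(3)[OF Y]])
    moreover have "Yk \<kappa> (Mk \<kappa> \<phi>) = \<phi>" unfolding Yk_def by (rule inv_f_f[OF bij_is_inj[OF bij]])
    ultimately have "\<phi> = 0" using Mk0 by simp
    then have "v \<phi> = 0" by (simp add: v_eq_0)
    moreover have "R0 \<kappa> 0 = 0" by (rule linear_on_zero[OF sn2 op_boundD(3)[OF A]])
    ultimately show "u = 0" using u_eq by simp
  qed
  have inj: "inj_on B l2_space"
  proof (rule inj_onI)
    fix x y assume xy: "x \<in> l2_space" "y \<in> l2_space" "B x = B y"
    then have "B (x - y) = 0" by (simp add: B_diff)
    then have "x - y = 0" by (rule B_inj[OF seminormed_space_diff(1)[OF sn2 xy(1,2)]])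
    then show "x = y" by simp
  qed
  have bij_B: "bij_betw B l2_space l2_space"
  proof (rule bij_betw_imageI[OF inj])
    show "B ` l2_space = l2_space"
    proof
      show "B ` l2_space \<subseteq> l2_space" using B2 by blast
      show "l2_space \<subseteq> B ` l2_space"
      proof
        fix u :: "('a, 'n) gfun" assume u: "u \<in> l2_space"
        have "B (Qk \<kappa> u) \<in> B ` l2_space" by (rule imageI[OF op_boundD(2)[OF Q u]])
        then show "u \<in> B ` l2_space" unfolding BQ[OF u] .
      qed
    qed
  qed
  have inv: "the_inv_into l2_space B u = Qk \<kappa> u" if "u \<in> l2_space" for u
    by (rule the_inv_into_f_eq[OF inj BQ[OF that] op_boundD(2)[OF Q that]])
  then show "u \<in> l2_space \<Longrightarrow> resolvent Ham \<kappa> u = Qk \<kappa> u"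
    by (simp add: resolvent_def B_def[abs_def])
  have "op_bound l2_space l2_norm l2_space l2_norm (A + A * (1 * (Cv * (C * (Cs * (1 * A)))))) (the_inv_into l2_space B)"
    by (rule op_bound_cong[OF Q _ sn2]) (simp add: inv)
  then have "bounded_l2 (the_inv_into l2_space B)" by (rule op_bound_imp_bounded_op)
  moreover have "(\<lambda>u. Ham u - (- \<kappa>\<^sup>2) *\<^sub>C u) = B"
    by (simp only: B_def[abs_def] scaleC_minus_left diff_minus_eq_add)
  ultimately show "- \<kappa>\<^sup>2 \<notin> spectrum_l2 Ham" using bij_B by (simp add: spectrum_l2_def)
qed

lemma resolvent_eventually:
  "\<forall>\<^sub>F \<kappa> in right_half_plane_0. - \<kappa>\<^sup>2 \<notin> spectrum_l2 Ham \<and> (\<forall>u\<in>L1. resolvent Ham \<kappa> u = Qk \<kappa> u)"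
proof -
  obtain C where C: "\<forall>\<^sub>F \<kappa> in right_half_plane_0. bij (Mk \<kappa>) \<and> op_bound UNIV norm UNIV norm C (Yk \<kappa>) \<and>
    (\<forall>\<psi>. Yk \<kappa> \<psi> = N \<psi> - \<kappa> *\<^sub>C N (vs (D0 \<kappa> (v (Yk \<kappa> \<psi>)))))"
    by (rule Mk_eventually)
  obtain K where K: "\<forall>\<^sub>F \<kappa> in right_half_plane_0. bij (core_shift \<kappa>) \<and> (\<forall>x y. cmod (core_green \<kappa> x y) \<le> K)"
    using core_green_eventually by blast
  show ?thesis
    using C K eventually_right_half_plane_0(1)
  proof eventually_elim
    case (elim \<kappa>)
    have "L1 \<subseteq> l2_space" using op_boundD(2)[OF op_bound_l1_l2[OF beta_ge(3)]] by blast
    then show ?case using resolvent_eq[OF elim(3), of C] elim(1,2) by blast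
  qed
qed

end

subsection \<open>Coefficients of the expansion\<close>

text \<open>A supremum of reals controls its elements only when the set is bounded above;
  boundedness of the operator is what makes \<open>op_norm\<close> meaningful.\<close>

lemma op_norm_bounds:
  assumes S: "op_bound (l1_space s) (l1_norm s) (linf_space s) (linf_norm s) C T"
  shows "0 \<le> op_norm s T" "op_norm s T \<le> C"
    and "u \<in> l1_space s \<Longrightarrow> linf_norm s (T u) \<le> op_norm s T * (l1_norm s u + 1)"
proof -
  note sn = seminormed_l1[of s, where 'a = 'a and 'n = 'b]
  have le: "linf_norm s (T w) \<le> C" if w: "w \<in> l1_space s" "l1_norm s w \<le> 1" for w
    using op_boundD(4)[OF S w(1)] mult_left_mono[OF w(2) op_boundD(1)[OF S]] by simp
  have bdd: "bdd_above ((\<lambda>u. linf_norm s (T u)) ` {u \<in> l1_space s. l1_norm s u \<le> 1})"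
    by (rule bdd_aboveI2[where M = C]) (use le in auto)
  have upper: "linf_norm s (T w) \<le> op_norm s T" if w: "w \<in> l1_space s" "l1_norm s w \<le> 1" for w
    unfolding op_norm_def by (rule cSUP_upper[OF _ bdd]) (use w in simp)
  have zero: "(0 :: ('a, 'b) gfun) \<in> l1_space s" "l1_norm s (0 :: ('a, 'b) gfun) \<le> 1"
    using seminormed_spaceD(1)[OF sn] seminormed_space_zero[OF sn] by simp_all
  show nonneg: "0 \<le> op_norm s T"
    by (rule order_trans[OF linf_norm_nonneg[OF op_boundD(2)[OF S zero(1)]] upper[OF zero]])
  show "op_norm s T \<le> C" unfolding op_norm_def
    by (rule cSUP_least) (use zero le in auto)
  assume u: "u \<in> l1_space s"
  \<comment> \<open>Normalising by the norm plus 1 avoids a separate treatment of vectors with norm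
    0.\<close>
  define a where "a = l1_norm s u + 1"
  have n: "0 \<le> l1_norm s u" by (rule seminormed_spaceD(6)[OF sn u])
  have a: "0 < a" using n by (simp add: a_def)
  define w where "w = complex_of_real (inverse a) *\<^sub>C u"
  have w: "w \<in> l1_space s" unfolding w_def by (rule seminormed_spaceD(4)[OF sn u])
  have "l1_norm s w = inverse a * l1_norm s u"
    unfolding w_def using a by (simp add: seminormed_spaceD(5)[OF sn u] norm_inverse)
  also have "\<dots> \<le> 1" using a by (simp add: a_def field_simps)
  finally have w1: "l1_norm s w \<le> 1" .
  have "T w = complex_of_real (inverse a) *\<^sub>C T u"
    unfolding w_def by (rule linear_onD(2)[OF op_boundD(3)[OF S] u])
  then have "linf_norm s (T w) = inverse a * linf_norm s (T u)"
    using a seminormed_spaceD(5)[OF seminormed_linf op_boundD(2)[OF S u]] by (simp add: norm_inverse)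
  with upper[OF w w1] have "inverse a * linf_norm s (T u) \<le> op_norm s T" by simp
  then show "linf_norm s (T u) \<le> op_norm s T * (l1_norm s u + 1)"
    unfolding a_def[symmetric] using a by (simp add: field_simps)
qed

text \<open>The seminorm 0 records that only closure under linear operations is wanted.\<close>

lemma seminormed_one_plus_l1:
  "seminormed_space (one_plus_l1 s :: ('a, 'n::finite) gfun set) (\<lambda>_. 0)"
  unfolding seminormed_space_def
proof (intro conjI ballI allI)
  have mem: "(\<Sum>\<alpha>\<in>UNIV. c \<alpha> *\<^sub>C ray_one \<alpha>) + w \<in> one_plus_l1 s" if "w \<in> l1_space s"
    for c and w :: "('a, 'n) gfun"
    unfolding one_plus_l1_def using that by blast
  have "(\<Sum>\<alpha>\<in>UNIV. (0 :: complex) *\<^sub>C ray_one \<alpha>) + 0 = (0 :: ('a, 'n) gfun)"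
    by (simp only: scaleC_zero_left sum.neutral_const add_0_right)
  then show "(0 :: ('a, 'n) gfun) \<in> one_plus_l1 s"
    using mem[OF seminormed_spaceD(1)[OF seminormed_l1], of "\<lambda>_. 0"] by (simp only:)
  fix u :: "('a, 'n) gfun" assume "u \<in> one_plus_l1 s"
  then obtain c w where u: "u = (\<Sum>\<alpha>\<in>UNIV. c \<alpha> *\<^sub>C ray_one \<alpha>) + w" "w \<in> l1_space s"
    unfolding one_plus_l1_def by blast
  show "a *\<^sub>C u \<in> one_plus_l1 s" for a
  proof -
    have "a *\<^sub>C u = (\<Sum>\<alpha>\<in>UNIV. (a * c \<alpha>) *\<^sub>C ray_one \<alpha>) + a *\<^sub>C w"
      unfolding u(1) scaleC_add_right scaleC_sum_right scaleC_scaleC ..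
    then show ?thesis using mem[OF seminormed_spaceD(4)[OF seminormed_l1 u(2)], of "\<lambda>\<alpha>. a * c \<alpha>"]
      by (simp only:)
  qed
  fix u' :: "('a, 'n) gfun" assume "u' \<in> one_plus_l1 s"
  then obtain c' w' where u': "u' = (\<Sum>\<alpha>\<in>UNIV. c' \<alpha> *\<^sub>C ray_one \<alpha>) + w'" "w' \<in> l1_space s"
    unfolding one_plus_l1_def by blast
  have "u + u' = (\<Sum>\<alpha>\<in>UNIV. (c \<alpha> + c' \<alpha>) *\<^sub>C ray_one \<alpha>) + (w + w')"
    unfolding u(1) u'(1) scaleC_add_left sum.distrib by (simp only: add_ac)
  then show "u + u' \<in> one_plus_l1 s"
    using mem[OF seminormed_spaceD(2)[OF seminormed_l1 u(2) u'(2)], of "\<lambda>\<alpha>. c \<alpha> + c' \<alpha>"] by (simp only:)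
qed auto

section \<open>Existence, limits and uniqueness of the expansion coefficients\<close>

context regular_perturbation
begin

lemma resolvent_expansion_exists: "\<exists>G. resolvent_expansion \<beta> Ham G"
proof -
  obtain G C where G: "\<forall>j<\<beta> - 1. bounded_op L1 nL1 Linf nLinf (G j)"
    and C: "\<forall>\<^sub>F \<kappa> in right_half_plane_0.
      op_bound L1 nL1 Linf nLinf (C * cmod \<kappa> ^ (\<beta> - 1)) (\<lambda>u. Qk \<kappa> u - (\<Sum>j<\<beta> - 1. \<kappa> ^ j *\<^sub>C G j u))"
    using op_expands_coefficients[OF snL1 snLinf Qk_expands] by blast
  \<comment> \<open>Order \<beta> - 1 means that \<beta> - 2 is the last index of the Taylor
    polynomial, as in \<open>resolvent_expansion\<close>.\<close>
  have set: "{..<\<beta> - 1} = {..\<beta> - 2}" unfolding beta_Suc(2) lessThan_Suc_atMost ..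
  have "resolvent_expansion \<beta> Ham G"
    unfolding resolvent_expansion_def
  proof (intro conjI)
    show "\<forall>j\<le>\<beta> - 2. bounded_op L1 nL1 Linf nLinf (G j)" using G unfolding beta_Suc(2) less_Suc_eq_le .
    show "\<forall>\<^sub>F \<kappa> in right_half_plane_0. - \<kappa>\<^sup>2 \<notin> spectrum_l2 Ham"
      using resolvent_eventually by eventually_elim blast
    show "(\<lambda>\<kappa>. op_norm (real \<beta>) (\<lambda>u. resolvent Ham \<kappa> u - (\<Sum>j\<le>\<beta> - 2. \<kappa> ^ j *\<^sub>C G j u)))
        \<in> O[right_half_plane_0](\<lambda>\<kappa>. cmod \<kappa> ^ (\<beta> - 1))"
    proof (rule bigoI)
      show "\<forall>\<^sub>F \<kappa> in right_half_plane_0.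
          norm (op_norm (real \<beta>) (\<lambda>u. resolvent Ham \<kappa> u - (\<Sum>j\<le>\<beta> - 2. \<kappa> ^ j *\<^sub>C G j u)))
          \<le> C * norm (cmod \<kappa> ^ (\<beta> - 1))"
        using C resolvent_eventually
      proof eventually_elim
        case (elim \<kappa>)
        have "op_bound L1 nL1 Linf nLinf (C * cmod \<kappa> ^ (\<beta> - 1))
            (\<lambda>u. resolvent Ham \<kappa> u - (\<Sum>j\<le>\<beta> - 2. \<kappa> ^ j *\<^sub>C G j u))"
          by (rule op_bound_cong[OF elim(1) _ snL1]) (use elim(2) in \<open>simp only: set\<close>)
        from op_norm_bounds(1,2)[OF this] show ?case by (simp add: abs_of_nonneg)
      qed
    qed
  qed
  then show ?thesis by (rule exI[where x = G])
qed

lemma PDW_bounded: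
  "\<exists>C. \<forall>\<^sub>F \<kappa> in right_half_plane_0. op_bound L1 nL1 Linf nLinf C (\<lambda>u. P0 (D0 \<kappa> (Wk \<kappa> u)))"
  using op_expands_bounded[OF snL1 snLinf PDW_expands] by simp

lemma tendsto_right_half_plane_scaled:
  assumes "\<forall>\<^sub>F \<kappa> in right_half_plane_0. cmod (f \<kappa>) \<le> C"
  shows "((\<lambda>\<kappa>. \<kappa> * f \<kappa>) \<longlongrightarrow> 0) right_half_plane_0"
proof (rule Lim_null_comparison)
  show "\<forall>\<^sub>F \<kappa> in right_half_plane_0. norm (\<kappa> * f \<kappa>) \<le> cmod \<kappa> * C"
    using assms by eventually_elim (simp add: norm_mult mult_left_mono)
  show "((\<lambda>\<kappa>. cmod \<kappa> * C) \<longlongrightarrow> 0) right_half_plane_0"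
    by (rule tendsto_mult_left_zero[OF tendsto_norm_zero[OF tendsto_right_half_plane_0]])
qed

lemma op_bound_pointwise:
  assumes "\<forall>\<^sub>F \<kappa> in right_half_plane_0. op_bound L1 nL1 Linf nLinf C (F \<kappa>)" "u \<in> L1"
  shows "\<forall>\<^sub>F \<kappa> in right_half_plane_0. cmod (F \<kappa> u x) \<le> C * nL1 u * weight (real \<beta>) x"
  using assms(1)
proof eventually_elim
  case (elim \<kappa>)
  have "cmod (F \<kappa> u x) \<le> nLinf (F \<kappa> u) * weight (real \<beta>) x"
    by (rule linf_point_le[OF op_boundD(2)[OF elim assms(2)]])
  also have "\<dots> \<le> C * nL1 u * weight (real \<beta>) x"
    by (rule mult_right_mono[OF op_boundD(4)[OF elim assms(2)]]) simp
  finally show ?case .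
qed

lemma resolvent_eq_coeff0:
  assumes u: "u \<in> L1"
  shows "\<forall>\<^sub>F \<kappa> in right_half_plane_0.
    resolvent Ham \<kappa> u x = coeff0 u x + \<kappa> * P0 (D0 \<kappa> (Wk \<kappa> u)) x"
  using resolvent_eventually resolvent_identity
  by eventually_elim (use u in simp)

lemma tendsto_resolvent:
  assumes u: "u \<in> L1"
  shows "((\<lambda>\<kappa>. resolvent Ham \<kappa> u x) \<longlongrightarrow> coeff0 u x) right_half_plane_0"
proof (rule Lim_transform_eventually)
  obtain C where C: "\<forall>\<^sub>F \<kappa> in right_half_plane_0. op_bound L1 nL1 Linf nLinf C (\<lambda>u. P0 (D0 \<kappa> (Wk \<kappa> u)))"
    using PDW_bounded by blast
  show "((\<lambda>\<kappa>. coeff0 u x + \<kappa> * P0 (D0 \<kappa> (Wk \<kappa> u)) x) \<longlongrightarrow> coeff0 u x) right_half_plane_0"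
    using tendsto_add[OF tendsto_const tendsto_right_half_plane_scaled[OF op_bound_pointwise[OF C u]]]
    by simp
  show "\<forall>\<^sub>F \<kappa> in right_half_plane_0. coeff0 u x + \<kappa> * P0 (D0 \<kappa> (Wk \<kappa> u)) x = resolvent Ham \<kappa> u x"
    using resolvent_eq_coeff0[OF u, of x] by eventually_elim simp
qed

abbreviation "first \<equiv> (kernel_op first_kernel :: ('a, 'n) gfun \<Rightarrow> ('a, 'n) gfun)"

text \<open>The quotient has an expansion of order \<beta> - 2 in the given weights. For \<beta> >=
  3 this is at least 1, so its leading operator can be split off and identified through the
  pointwise limit.\<close>

lemma D0_first:
  assumes "3 \<le> \<beta>"
  obtains CF CE E where "op_bound L1 nL1 Linf nLinf CF first"
    "\<forall>\<^sub>F \<kappa> in right_half_plane_0. op_bound L1 nL1 Linf nLinf CE (E \<kappa>)"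
    "\<forall>\<^sub>F \<kappa> in right_half_plane_0. \<forall>u\<in>L1. D0 \<kappa> u = first u + \<kappa> *\<^sub>C E \<kappa> u"
proof -
  let ?W = "\<lambda>(x :: ('a, 'n) vertex, y :: ('a, 'n) vertex). weight (real \<beta>) x * weight (real \<beta>) y"
  have W: "0 \<le> ?W i" for i by (auto split: prod.splits)
  obtain r where r: "\<beta> - 2 = Suc r" using assms by (cases "\<beta> - 2") auto
  have fe: "fam_expands (Suc r) ?W (\<lambda>\<kappa> (x, y). free_quotient \<kappa> x y)"
    using fam_expands_free_quotient[of "\<beta> - 2", unfolded beta_Suc] unfolding r .
  have lim: "((\<lambda>\<kappa>. case i of (x, y) \<Rightarrow> free_quotient \<kappa> x y) \<longlongrightarrow> (case i of (x, y) \<Rightarrow> first_kernel x y))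
      right_half_plane_0" for i by (cases i) (simp add: tendsto_free_quotient)
  obtain C f' where C: "0 \<le> C" "\<And>i. cmod (case i of (x, y) \<Rightarrow> first_kernel x y) \<le> C * ?W i"
    and f: "fam_expands r ?W f'"
    and eq: "\<forall>\<^sub>F \<kappa> in right_half_plane_0. \<forall>i. (case i of (x, y) \<Rightarrow> free_quotient \<kappa> x y) =
        (case i of (x, y) \<Rightarrow> first_kernel x y) + \<kappa> * f' \<kappa> i"
    using fam_expands_Suc_limit[OF W fe lim] by blast
  have "fam_expands 0 ?W f'" by (rule fam_expands_bounded[OF W f])
  then obtain K where K: "0 \<le> K" "\<forall>\<^sub>F \<kappa> in right_half_plane_0. \<forall>i. cmod (f' \<kappa> i) \<le> K * ?W i"
    by (rule fam_expands_0E)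
  define e where "e \<kappa> x y = f' \<kappa> (x, y)" for \<kappa> x y
  have F: "kernel_bound (real \<beta>) C (first_kernel :: ('a, 'n) vertex \<Rightarrow> ('a, 'n) vertex \<Rightarrow> complex)" using C by (auto simp: kernel_bound_def split: prod.splits)
  have e: "\<forall>\<^sub>F \<kappa> in right_half_plane_0. kernel_bound (real \<beta>) K (e \<kappa>)"
    using K(2) by eventually_elim (use K(1) in \<open>auto simp: kernel_bound_def e_def split: prod.splits\<close>)
  show ?thesis
  proof (rule that[OF op_bound_kernel[OF F]])
    show "\<forall>\<^sub>F \<kappa> in right_half_plane_0. op_bound L1 nL1 Linf nLinf K (kernel_op (e \<kappa>))"
      using e by eventually_elim (rule op_bound_kernel)
    show "\<forall>\<^sub>F \<kappa> in right_half_plane_0. \<forall>u\<in>L1. D0 \<kappa> u = first u + \<kappa> *\<^sub>C kernel_op (e \<kappa>) u"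
      using e eq
    proof eventually_elim
      case (elim \<kappa>)
      have "free_quotient \<kappa> = (\<lambda>x y. first_kernel x y + \<kappa> * e \<kappa> x y)"
        using elim(2) by (auto simp: fun_eq_iff e_def)
      then show ?case unfolding D0_def using kernel_op_add_scale[OF F elim(1)] by simp
    qed
  qed
qed

text \<open>In P D(\<kappa>) W(\<kappa>) both D and W differ from their values at 0 by terms of
  order \<kappa>, so the product of the leading operators survives.\<close>

lemma tendsto_resolvent_quotient:
  assumes b3: "3 \<le> \<beta>" and u: "u \<in> L1"
  shows "((\<lambda>\<kappa>. (resolvent Ham \<kappa> u x - coeff0 u x) / \<kappa>) \<longlongrightarrow> P0 (first (W0 u)) x) right_half_plane_0"
proof -
  obtain CF CE E where CF: "op_bound L1 nL1 Linf nLinf CF first"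
    and CE: "\<forall>\<^sub>F \<kappa> in right_half_plane_0. op_bound L1 nL1 Linf nLinf CE (E \<kappa>)"
    and DE: "\<forall>\<^sub>F \<kappa> in right_half_plane_0. \<forall>u\<in>L1. D0 \<kappa> u = first u + \<kappa> *\<^sub>C E \<kappa> u"
    by (rule D0_first[OF b3])
  obtain CP where CP: "op_bound Linf nLinf Linf nLinf CP P0" using P0_bounded by blast
  obtain CW0 where CW0: "op_bound L1 nL1 L1 nL1 CW0 W0" using W0_bounded by blast
  obtain Cv where Cv: "op_bound UNIV norm L1 nL1 Cv v" using v_bounded by blast
  obtain Cs where Cs: "op_bound Linf nLinf UNIV norm Cs vs" using vs_bounded by blast
  obtain CN where CN: "op_bound UNIV norm UNIV norm CN N" using N_bounded by blast
  obtain CD where CD: "\<forall>\<^sub>F \<kappa> in right_half_plane_0. op_bound L1 nL1 Linf nLinf CD (D0 \<kappa>)"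
    using D0_bounded by blast
  have "op_expands 0 L1 nL1 L1 nL1 Wk" by (rule op_expands_bounded[OF snL1 snL1 Wk_expands])
  then obtain CW where CW: "\<forall>\<^sub>F \<kappa> in right_half_plane_0. op_bound L1 nL1 L1 nL1 CW (Wk \<kappa>)" by auto
  \<comment> \<open>The exact correction divided by \<kappa>: the first term stems from D = first +
    \<kappa> E, the second from the \<kappa>-term in the equation for W.\<close>
  define Z where "Z \<kappa> w = P0 (E \<kappa> (Wk \<kappa> w)) - P0 (first (v (N (vs (D0 \<kappa> (Wk \<kappa> w))))))" for \<kappa> w
  have Zb: "\<forall>\<^sub>F \<kappa> in right_half_plane_0. op_bound L1 nL1 Linf nLinf
      (CP * (CE * CW) + CP * (CF * (Cv * (CN * (Cs * (CD * CW)))))) (Z \<kappa>)"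
    using CE CD CW
  proof eventually_elim
    case (elim \<kappa>)
    show ?case unfolding Z_def
      by (rule op_bound_diff[OF op_bound_comp[OF op_bound_comp[OF elim(3,1)] CP]
            op_bound_comp[OF op_bound_comp[OF op_bound_comp[OF op_bound_comp[OF
              op_bound_comp[OF op_bound_comp[OF elim(3,2)] Cs] CN] Cv] CF] CP] snLinf])
  qed
  have 1: "((\<lambda>\<kappa>. P0 (first (W0 u)) x + \<kappa> * Z \<kappa> u x) \<longlongrightarrow> P0 (first (W0 u)) x) right_half_plane_0"
    using tendsto_add[OF tendsto_const tendsto_right_half_plane_scaled[OF op_bound_pointwise[OF Zb u]]]
    by simp
  have 2: "\<forall>\<^sub>F \<kappa> in right_half_plane_0. P0 (first (W0 u)) x + \<kappa> * Z \<kappa> u x = (resolvent Ham \<kappa> u x - coeff0 u x) / \<kappa>"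
    using resolvent_eq_coeff0[OF u, of x] resolvent_identity DE CE CW CD eventually_right_half_plane_0(1)
  proof eventually_elim
    case (elim \<kappa>)
    define w where "w = Wk \<kappa> u"
    have w: "w \<in> L1" unfolding w_def by (rule op_boundD(2)[OF elim(5) u])
    define t where "t = v (N (vs (D0 \<kappa> w)))"
    have tL: "t \<in> L1" by (simp add: t_def)
    have W0L: "W0 u \<in> L1" by (rule op_boundD(2)[OF CW0 u])
    have w_eq: "w = W0 u - \<kappa> *\<^sub>C t" using elim(2) u by (simp add: w_def t_def)
    have FX: "first y \<in> Linf" if "y \<in> L1" for y by (rule op_boundD(2)[OF CF that])
    have EX: "E \<kappa> w \<in> Linf" by (rule op_boundD(2)[OF elim(4) w])
    have "first w = first (W0 u) - \<kappa> *\<^sub>C first t"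
      unfolding w_eq using linear_on_diff[OF snL1 op_boundD(3)[OF CF] W0L seminormed_spaceD(4)[OF snL1 tL]]
        linear_onD(2)[OF op_boundD(3)[OF CF] tL] by simp
    then have "D0 \<kappa> w = first (W0 u) - \<kappa> *\<^sub>C first t + \<kappa> *\<^sub>C E \<kappa> w"
      using elim(3) w by simp
    also have "\<dots> = first (W0 u) + \<kappa> *\<^sub>C (E \<kappa> w - first t)"
      unfolding scaleC_diff_right by (simp add: algebra_simps)
    finally have "P0 (D0 \<kappa> w) = P0 (first (W0 u)) + P0 (\<kappa> *\<^sub>C (E \<kappa> w - first t))"
      using linear_onD(1)[OF op_boundD(3)[OF CP] FX[OF W0L]
          seminormed_spaceD(4)[OF snLinf seminormed_space_diff(1)[OF snLinf EX FX[OF tL]]]] by simp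
    also have "P0 (\<kappa> *\<^sub>C (E \<kappa> w - first t)) = \<kappa> *\<^sub>C (P0 (E \<kappa> w) - P0 (first t))"
      using linear_onD(2)[OF op_boundD(3)[OF CP] seminormed_space_diff(1)[OF snLinf EX FX[OF tL]]]
        linear_on_diff[OF snLinf op_boundD(3)[OF CP] EX FX[OF tL]] by simp
    finally have "P0 (D0 \<kappa> w) = P0 (first (W0 u)) + \<kappa> *\<^sub>C Z \<kappa> u" by (simp only: Z_def w_def t_def)
    then have "P0 (D0 \<kappa> (Wk \<kappa> u)) x = P0 (first (W0 u)) x + \<kappa> * Z \<kappa> u x" by (simp add: w_def)
    moreover have "\<kappa> \<noteq> 0" using elim(7) by auto
    ultimately show ?case using elim(1) by simp
  qed
  show ?thesis by (rule Lim_transform_eventually[OF 1 2])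
qed

text \<open>The hypothesis bounds a supremum. To read pointwise errors from it, the remainder must
  first be known to be a bounded operator, which follows from that of \<open>Qk\<close> and of the
  finitely many coefficients.\<close>

lemma expansion_error:
  assumes G: "resolvent_expansion \<beta> Ham G" and u: "u \<in> L1"
  obtains K where "\<forall>\<^sub>F \<kappa> in right_half_plane_0.
    cmod (resolvent Ham \<kappa> u x - (\<Sum>j\<le>\<beta> - 2. \<kappa> ^ j * G j u x)) \<le> K * cmod \<kappa> ^ (\<beta> - 1)"
proof -
  define T where "T \<kappa> u = resolvent Ham \<kappa> u - (\<Sum>j\<le>\<beta> - 2. \<kappa> ^ j *\<^sub>C G j u)" for \<kappa> u
  have "op_expands 0 L1 nL1 Linf nLinf Qk" by (rule op_expands_bounded[OF snL1 snLinf Qk_expands])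
  then obtain CQ where CQ: "\<forall>\<^sub>F \<kappa> in right_half_plane_0. op_bound L1 nL1 Linf nLinf CQ (Qk \<kappa>)" by auto
  have single: "\<exists>C. op_bound L1 nL1 Linf nLinf C (\<lambda>u. \<kappa> ^ j *\<^sub>C G j u)" if "j \<le> \<beta> - 2" for j \<kappa>
  proof -
    have "bounded_op L1 nL1 Linf nLinf (G j)" using G that by (simp add: resolvent_expansion_def)
    then obtain C where "op_bound L1 nL1 Linf nLinf C (G j)" unfolding bounded_op_iff[OF snL1] by blast
    then show ?thesis using op_bound_scale[OF _ snLinf] by blast
  qed
  have fin: "finite J \<Longrightarrow> J \<subseteq> {..\<beta> - 2} \<Longrightarrow>
      \<exists>C. op_bound L1 nL1 Linf nLinf C (\<lambda>u. \<Sum>j\<in>J. \<kappa> ^ j *\<^sub>C G j u)" for J \<kappa>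
  proof (induction J rule: finite_induct)
    case empty
    have "op_bound L1 nL1 Linf nLinf 0 (\<lambda>u. \<Sum>j\<in>{}. \<kappa> ^ j *\<^sub>C G j u)"
      unfolding sum.empty by (rule op_bound_zero[OF snLinf])
    then show ?case by blast
  next
    case (insert i J)
    have J: "J \<subseteq> {..\<beta> - 2}" and i: "i \<le> \<beta> - 2" using insert.prems by auto
    obtain C where C: "op_bound L1 nL1 Linf nLinf C (\<lambda>u. \<Sum>j\<in>J. \<kappa> ^ j *\<^sub>C G j u)"
      using insert.IH[OF J] by blast
    obtain D where D: "op_bound L1 nL1 Linf nLinf D (\<lambda>u. \<kappa> ^ i *\<^sub>C G i u)"
      using single[OF i] by blast
    from op_bound_add[OF D C snLinf] show ?case unfolding sum.insert[OF insert.hyps] by blast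
  qed
  have sums: "\<exists>C. op_bound L1 nL1 Linf nLinf C (\<lambda>u. \<Sum>j\<le>\<beta> - 2. \<kappa> ^ j *\<^sub>C G j u)" for \<kappa>
    by (rule fin) auto
  have T: "\<forall>\<^sub>F \<kappa> in right_half_plane_0. \<exists>C. op_bound L1 nL1 Linf nLinf C (T \<kappa>)"
    using CQ resolvent_eventually
  proof eventually_elim
    case (elim \<kappa>)
    obtain C where "op_bound L1 nL1 Linf nLinf C (\<lambda>u. \<Sum>j\<le>\<beta> - 2. \<kappa> ^ j *\<^sub>C G j u)" using sums by blast
    from op_bound_cong[OF op_bound_diff[OF elim(1) this snLinf] _ snL1, of "T \<kappa>"] elim(2)
    show ?case by (auto simp: T_def)
  qed
  have "(\<lambda>\<kappa>. op_norm (real \<beta>) (T \<kappa>)) \<in> O[right_half_plane_0](\<lambda>\<kappa>. cmod \<kappa> ^ (\<beta> - 1))"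
    using G by (simp add: resolvent_expansion_def T_def[abs_def])
  then obtain c where c: "0 < c" "\<forall>\<^sub>F \<kappa> in right_half_plane_0.
      norm (op_norm (real \<beta>) (T \<kappa>)) \<le> c * norm (cmod \<kappa> ^ (\<beta> - 1))" by (rule landau_o.bigE)
  have n: "0 \<le> nL1 u" by (rule seminormed_spaceD(6)[OF snL1 u])
  have "\<forall>\<^sub>F \<kappa> in right_half_plane_0.
    cmod (resolvent Ham \<kappa> u x - (\<Sum>j\<le>\<beta> - 2. \<kappa> ^ j * G j u x)) \<le>
      (c * (nL1 u + 1) * weight (real \<beta>) x) * cmod \<kappa> ^ (\<beta> - 1)"
    using T c(2)
  proof eventually_elim
    case (elim \<kappa>)
    from elim(1) obtain C where C: "op_bound L1 nL1 Linf nLinf C (T \<kappa>)" by blast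
    have "cmod (T \<kappa> u x) \<le> nLinf (T \<kappa> u) * weight (real \<beta>) x"
      by (rule linf_point_le[OF op_boundD(2)[OF C u]])
    also have "\<dots> \<le> (op_norm (real \<beta>) (T \<kappa>) * (nL1 u + 1)) * weight (real \<beta>) x"
      by (rule mult_right_mono[OF op_norm_bounds(3)[OF C u]]) simp
    also have "\<dots> \<le> ((c * cmod \<kappa> ^ (\<beta> - 1)) * (nL1 u + 1)) * weight (real \<beta>) x"
      using elim(2) n by (intro mult_right_mono) (auto simp: norm_power)
    finally show ?case by (simp add: T_def sum_fun_apply mult_ac)
  qed
  then show ?thesis by (rule that)
qed

text \<open>Asymptotic coefficients are unique: at each fixed u and x the same limits are computed
  once from the given expansion and once from the explicit formula for the resolvent.\<close>

lemma expansion_coefficients: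
  assumes G: "resolvent_expansion \<beta> Ham G" and u: "u \<in> L1"
  shows "G 0 u = coeff0 u" and "3 \<le> \<beta> \<Longrightarrow> G 1 u = P0 (first (W0 u))"
proof -
  have nt: "right_half_plane_0 \<noteq> bot" by (rule right_half_plane_0_nontrivial)
  define p where "p \<kappa> x = (\<Sum>j\<le>\<beta> - 2. \<kappa> ^ j * G j u x)" for \<kappa> x
  have pow0: "((\<lambda>\<kappa>. \<Sum>j\<le>m. \<kappa> ^ j * g j) \<longlongrightarrow> g 0) right_half_plane_0" for m and g :: "nat \<Rightarrow> complex"
  proof -
    have "((\<lambda>\<kappa>. \<Sum>j\<le>m. \<kappa> ^ j * g j) \<longlongrightarrow> (\<Sum>j\<le>m. 0 ^ j * g j)) right_half_plane_0"
      by (intro tendsto_intros tendsto_right_half_plane_0)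
    also have "(\<Sum>j\<le>m. 0 ^ j * g j) = g 0"
      by (subst sum.atMost_shift) simp
    finally show ?thesis .
  qed
  have err: "((\<lambda>\<kappa>. (resolvent Ham \<kappa> u x - p \<kappa> x) / \<kappa> ^ i) \<longlongrightarrow> 0) right_half_plane_0"
    if "i < \<beta> - 1" for x i
  proof -
    obtain K where K: "\<forall>\<^sub>F \<kappa> in right_half_plane_0.
        cmod (resolvent Ham \<kappa> u x - (\<Sum>j\<le>\<beta> - 2. \<kappa> ^ j * G j u x)) \<le> K * cmod \<kappa> ^ (\<beta> - 1)"
      by (rule expansion_error[OF G u])
    \<comment> \<open>As i < \<beta> - 1, at least one factor of \<kappa> remains after division by
      \<kappa>^i.\<close>
    have \<beta>: "\<beta> - 1 = Suc (\<beta> - 2 - i) + i" using that beta by simp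
    show ?thesis
    proof (rule Lim_null_comparison)
      show "\<forall>\<^sub>F \<kappa> in right_half_plane_0.
          norm ((resolvent Ham \<kappa> u x - p \<kappa> x) / \<kappa> ^ i) \<le> K * cmod \<kappa> ^ Suc (\<beta> - 2 - i)"
        using K eventually_right_half_plane_0(1)
      proof eventually_elim
        case (elim \<kappa>)
        then have "0 < cmod \<kappa>" by auto
        then show ?case using elim(1) unfolding \<beta> power_add
          by (simp add: p_def norm_divide norm_power field_simps)
      qed
      have "((\<lambda>\<kappa>. K * cmod \<kappa> ^ Suc (\<beta> - 2 - i)) \<longlongrightarrow> K * 0 ^ Suc (\<beta> - 2 - i)) right_half_plane_0"
        by (intro tendsto_intros tendsto_norm_zero tendsto_right_half_plane_0)
      then show "((\<lambda>\<kappa>. K * cmod \<kappa> ^ Suc (\<beta> - 2 - i)) \<longlongrightarrow> 0) right_half_plane_0" by simp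
    qed
  qed
  have G0: "G 0 u x = coeff0 u x" for x
  proof -
    have "((\<lambda>\<kappa>. resolvent Ham \<kappa> u x - p \<kappa> x) \<longlongrightarrow> coeff0 u x - G 0 u x) right_half_plane_0"
      unfolding p_def by (intro tendsto_diff tendsto_resolvent[OF u] pow0)
    moreover have "((\<lambda>\<kappa>. resolvent Ham \<kappa> u x - p \<kappa> x) \<longlongrightarrow> 0) right_half_plane_0"
      using err[of 0 x] beta by simp
    ultimately have "coeff0 u x - G 0 u x = 0" by (rule tendsto_unique[OF nt])
    then show ?thesis by simp
  qed
  then show "G 0 u = coeff0 u" by auto
  assume b3: "3 \<le> \<beta>"
  then obtain m where m: "\<beta> - 2 = Suc m" by (cases "\<beta> - 2") auto
  have "G 1 u x = P0 (first (W0 u)) x" for x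
  proof -
    have "((\<lambda>\<kappa>. (p \<kappa> x - G 0 u x) / \<kappa>) \<longlongrightarrow> G 1 u x) right_half_plane_0"
    proof (rule Lim_transform_eventually)
      show "((\<lambda>\<kappa>. \<Sum>j\<le>m. \<kappa> ^ j * G (Suc j) u x) \<longlongrightarrow> G 1 u x) right_half_plane_0"
        using pow0[where m = m and g = "\<lambda>j. G (Suc j) u x"] by simp
      show "\<forall>\<^sub>F \<kappa> in right_half_plane_0. (\<Sum>j\<le>m. \<kappa> ^ j * G (Suc j) u x) = (p \<kappa> x - G 0 u x) / \<kappa>"
        using eventually_right_half_plane_0(1)
      proof eventually_elim
        case (elim \<kappa>)
        then have "\<kappa> \<noteq> 0" by auto
        then show ?case unfolding p_def m sum.atMost_Suc_shift
          by (simp add: sum_divide_distrib mult.assoc)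
      qed
    qed
    then have "((\<lambda>\<kappa>. (resolvent Ham \<kappa> u x - coeff0 u x) / \<kappa> - (p \<kappa> x - G 0 u x) / \<kappa>) \<longlongrightarrow>
        P0 (first (W0 u)) x - G 1 u x) right_half_plane_0"
      by (intro tendsto_diff tendsto_resolvent_quotient[OF b3 u])
    moreover have "((\<lambda>\<kappa>. (resolvent Ham \<kappa> u x - coeff0 u x) / \<kappa> - (p \<kappa> x - G 0 u x) / \<kappa>) \<longlongrightarrow> 0) right_half_plane_0"
      using err[of 1 x] b3 unfolding G0 by (simp add: diff_divide_distrib)
    ultimately have "P0 (first (W0 u)) x - G 1 u x = 0" by (rule tendsto_unique[OF nt])
    then show ?thesis by simp
  qed
  then show "G 1 u = P0 (first (W0 u))" by auto
qed

end

subsection \<open>The non-resonance projection\<close>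

context regular_perturbation
begin

text \<open>The threshold solution with linear growth on the ray \<open>\<alpha>\<close> only.\<close>

definition psi :: "'n \<Rightarrow> ('a, 'n) gfun" where
  "psi \<alpha> = P0 (ray_lin \<alpha>)"

lemma ray_lin_mem [simp]: "ray_lin \<alpha> \<in> Linf"
  by (rule ray_lin_in_linf[OF beta_ge(1)])

lemma P0_linear: "linear_on Linf P0"
  using P0_bounded by (elim exE) (rule op_boundD(3))

lemma psi_mem: "psi \<alpha> \<in> Linf"
  unfolding psi_def using P0_bounded by (elim exE) (erule op_boundD(2)[OF _ ray_lin_mem])

lemma Ham_linear: "linear_on Linf Ham"
proof -
  have V: "V (u + w) = V u + V w" if "u \<in> Linf" "w \<in> Linf" for u w
    using linear_onD(1)[OF vs_linear that] linear_onD(1)[OF U_linear] linear_onD(1)[OF v_linear]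
      V_eq[OF seminormed_spaceD(2)[OF snLinf that]] V_eq[OF that(1)] V_eq[OF that(2)] by simp
  have Vc: "V (c *\<^sub>C u) = c *\<^sub>C V u" if "u \<in> Linf" for c u
    using linear_onD(2)[OF vs_linear that] linear_onD(2)[OF U_linear] linear_onD(2)[OF v_linear]
      V_eq[OF seminormed_spaceD(4)[OF snLinf that]] V_eq[OF that] by simp
  show ?thesis
    unfolding linear_on_def
  proof (intro conjI ballI allI)
    show "Ham (u + w) = Ham u + Ham w" if "u \<in> Linf" "w \<in> Linf" for u w
      unfolding hamiltonian_def V[OF that] free_op_add by (simp only: add_ac)
    show "Ham (c *\<^sub>C u) = c *\<^sub>C Ham u" if "u \<in> Linf" for c u
      unfolding hamiltonian_def Vc[OF that] free_op_scale scaleC_add_right ..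
  qed
qed

abbreviation "Etilde \<equiv> eigen_tilde (real \<beta>) Ham"

lemma seminormed_Etilde: "seminormed_space Etilde (\<lambda>_. 0)"
proof -
  have "Ham 0 = 0" by (rule linear_on_zero[OF snLinf Ham_linear])
  then show ?thesis unfolding seminormed_space_def eigen_tilde_def
    using linear_onD[OF Ham_linear] seminormed_spaceD(1,2,4)[OF snLinf] by simp
qed

lemma eigen_cal_zero: "eigen_cal (real \<beta>) Ham = {0}" and eigen_sf_zero: "eigen_sf (real \<beta>) Ham = {0}"
  using regular by (simp_all add: regular_threshold_def)

lemma Etilde_decaying: "\<Psi> \<in> Etilde \<Longrightarrow> \<Psi> \<in> one_plus_l1 (real \<beta> - 2) \<Longrightarrow> \<Psi> = 0"
  using eigen_cal_zero by (auto simp: eigen_cal_def)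

lemmas snO = seminormed_one_plus_l1[of "real \<beta> - 2", where 'a = 'a and 'n = 'n]

text \<open>With \<phi> = N v^t n^(\<alpha>), the equation M \<phi> = v^t n^(\<alpha>) says that v^t
  of this function is U \<phi>. Thus V maps it to v \<phi>, which cancels the contribution - v
  \<phi> of the free operator.\<close>

lemma psi_Etilde: "psi \<alpha> \<in> Etilde"
proof -
  define \<phi> where "\<phi> = N (vs (ray_lin \<alpha>))"
  have psi: "psi \<alpha> = ray_lin \<alpha> - green (v \<phi>)" by (simp only: psi_def P0_def \<phi>_def)
  have "vs (psi \<alpha>) = vs (ray_lin \<alpha>) - vs (green (v \<phi>))"
    unfolding psi by (rule linear_on_diff[OF snLinf vs_linear ray_lin_mem green_mem[OF v_mem]])
  also have "vs (ray_lin \<alpha>) = M \<phi>" by (simp add: \<phi>_def)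
  finally have "vs (psi \<alpha>) = U \<phi>" by (simp add: M_eq)
  then have V: "V (psi \<alpha>) = v \<phi>" by (simp add: V_eq[OF psi_mem])
  have "free_op E0 att (psi \<alpha>) = - v \<phi>"
    unfolding psi free_op_diff free_op_ray_lin free_op_green[OF beta_ge(1) v_mem] by simp
  then have "Ham (psi \<alpha>) = 0" by (simp add: hamiltonian_def V)
  then show ?thesis using psi_mem by (simp add: eigen_tilde_def)
qed

lemma psi_asymptotics: "psi \<alpha> - ray_lin \<alpha> \<in> one_plus_l1 (real \<beta> - 2)"
proof -
  have "psi \<alpha> - ray_lin \<alpha> = - green (v (N (vs (ray_lin \<alpha>))))" by (simp add: psi_def P0_def)
  then show ?thesis
    using seminormed_space_minus(1)[OF snO green_in_one_plus_l1[OF beta_ge(2) v_mem]] by simp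
qed

lemma psi_sum_asymptotics:
  "(\<Sum>\<alpha>\<in>UNIV. c \<alpha> *\<^sub>C psi \<alpha>) - (\<Sum>\<alpha>\<in>UNIV. c \<alpha> *\<^sub>C ray_lin \<alpha>) \<in> one_plus_l1 (real \<beta> - 2)"
proof -
  have "(\<Sum>\<alpha>\<in>UNIV. c \<alpha> *\<^sub>C (psi \<alpha> - ray_lin \<alpha>)) \<in> one_plus_l1 (real \<beta> - 2)"
    by (intro seminormed_space_sum[OF snO] seminormed_spaceD(4)[OF snO] psi_asymptotics)
  then show ?thesis by (simp only: scaleC_diff_right sum_subtractf)
qed

lemma psi_sum_Etilde: "(\<Sum>\<alpha>\<in>UNIV. c \<alpha> *\<^sub>C psi \<alpha>) \<in> Etilde"
  by (intro seminormed_space_sum[OF seminormed_Etilde] seminormed_spaceD(4)[OF seminormed_Etilde] psi_Etilde)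

text \<open>Up to C1 plus decaying terms a combination of the \<open>psi\<close> is the same
  combination of linear functions, and a nonzero one of these does not lie in that space.\<close>

lemma psi_independent:
  assumes "(\<Sum>\<alpha>\<in>UNIV. c \<alpha> *\<^sub>C psi \<alpha>) = (\<Sum>\<alpha>\<in>UNIV. d \<alpha> *\<^sub>C psi \<alpha>)"
  shows "c = d"
proof -
  have "(\<Sum>\<alpha>\<in>UNIV. (c \<alpha> - d \<alpha>) *\<^sub>C psi \<alpha>) = (\<Sum>\<alpha>\<in>UNIV. c \<alpha> *\<^sub>C psi \<alpha>) - (\<Sum>\<alpha>\<in>UNIV. d \<alpha> *\<^sub>C psi \<alpha>)"
    unfolding sum_subtractf[symmetric]
    by (intro sum.cong refl) (simp only: diff_conv_add_uminus scaleC_add_left scaleC_minus_left)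
  then have "(\<Sum>\<alpha>\<in>UNIV. (c \<alpha> - d \<alpha>) *\<^sub>C psi \<alpha>) = 0" unfolding assms by (simp only: diff_self)
  then have "- (\<Sum>\<alpha>\<in>UNIV. (c \<alpha> - d \<alpha>) *\<^sub>C ray_lin \<alpha>) \<in> (one_plus_l1 (real \<beta> - 2) :: ('a, 'n) gfun set)"
    using psi_sum_asymptotics[of "\<lambda>\<alpha>. c \<alpha> - d \<alpha>"] by (simp only: diff_0)
  from seminormed_space_minus(1)[OF snO this]
  have "(\<Sum>\<alpha>\<in>UNIV. (c \<alpha> - d \<alpha>) *\<^sub>C ray_lin \<alpha>) \<in> (one_plus_l1 (real \<beta> - 2) :: ('a, 'n) gfun set)"
    by (simp only: minus_minus)
  then have "(\<lambda>\<alpha>. c \<alpha> - d \<alpha>) = (\<lambda>_. 0)" by (rule ray_lin_in_one_plus_l1[OF beta_ge(4)])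
  then show ?thesis by (simp add: fun_eq_iff)
qed

text \<open>Two threshold solutions with equal linear growth differ by an element of
  \<open>eigen_cal\<close>, which is zero here: the growth coefficients determine the
  solution.\<close>

lemma Etilde_eq_psi_sum:
  assumes \<Psi>: "\<Psi> \<in> Etilde" and as: "\<Psi> - (\<Sum>\<alpha>\<in>UNIV. c \<alpha> *\<^sub>C ray_lin \<alpha>) \<in> one_plus_l1 (real \<beta> - 2)"
  shows "\<Psi> = (\<Sum>\<alpha>\<in>UNIV. c \<alpha> *\<^sub>C psi \<alpha>)"
proof -
  have "\<Psi> - (\<Sum>\<alpha>\<in>UNIV. c \<alpha> *\<^sub>C psi \<alpha>) \<in> Etilde"
    by (rule seminormed_space_diff(1)[OF seminormed_Etilde \<Psi> psi_sum_Etilde])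
  moreover have "(\<Psi> - (\<Sum>\<alpha>\<in>UNIV. c \<alpha> *\<^sub>C ray_lin \<alpha>)) -
      ((\<Sum>\<alpha>\<in>UNIV. c \<alpha> *\<^sub>C psi \<alpha>) - (\<Sum>\<alpha>\<in>UNIV. c \<alpha> *\<^sub>C ray_lin \<alpha>)) \<in> one_plus_l1 (real \<beta> - 2)"
    by (rule seminormed_space_diff(1)[OF snO as psi_sum_asymptotics])
  ultimately have "\<Psi> - (\<Sum>\<alpha>\<in>UNIV. c \<alpha> *\<^sub>C psi \<alpha>) = 0"
    by (intro Etilde_decaying) (simp_all only: diff_diff_eq2 diff_add_cancel)
  then show ?thesis by (simp only: right_minus_eq)
qed

text \<open>\<Psi> + G V \<Psi> is annihilated by the free operator, hence linear on the rays; G V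
  \<Psi> has no linear growth. So every threshold solution has growth coefficients.\<close>

lemma Etilde_psi_sum:
  assumes \<Psi>: "\<Psi> \<in> Etilde"
  obtains c where "\<Psi> = (\<Sum>\<alpha>\<in>UNIV. c \<alpha> *\<^sub>C psi \<alpha>)"
proof -
  have \<Psi>X: "\<Psi> \<in> Linf" and H: "Ham \<Psi> = 0" using \<Psi> by (simp_all add: eigen_tilde_def)
  define \<phi> where "\<phi> = U (vs \<Psi>)"
  have "V \<Psi> = v \<phi>" unfolding \<phi>_def by (rule V_eq[OF \<Psi>X])
  then have free: "free_op E0 att (\<Psi> + green (v \<phi>)) = 0"
    using H unfolding free_op_add free_op_green[OF beta_ge(1) v_mem] hamiltonian_def by (simp only:)
  define c where "c \<alpha> = (\<Psi> + green (v \<phi>)) (Ray \<alpha> 0)" for \<alpha>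
  have c: "\<Psi> + green (v \<phi>) = (\<Sum>\<alpha>\<in>UNIV. c \<alpha> *\<^sub>C ray_lin \<alpha>)"
    unfolding c_def by (rule free_op_kernel[OF free])
  have "\<Psi> - (\<Sum>\<alpha>\<in>UNIV. c \<alpha> *\<^sub>C ray_lin \<alpha>) = - green (v \<phi>)" unfolding c[symmetric] by simp
  then have "\<Psi> - (\<Sum>\<alpha>\<in>UNIV. c \<alpha> *\<^sub>C ray_lin \<alpha>) \<in> one_plus_l1 (real \<beta> - 2)"
    using seminormed_space_minus(1)[OF snO green_in_one_plus_l1[OF beta_ge(2) v_mem]] by simp
  from Etilde_eq_psi_sum[OF \<Psi> this] show ?thesis by (rule that)
qed

lemma psi_delta: "(\<Sum>\<gamma>\<in>UNIV. (if \<gamma> = \<alpha> then 1 else 0) *\<^sub>C psi \<gamma>) = psi \<alpha>"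
  by (subst sum.remove[of _ \<alpha>]) (simp_all add: scaleC_one)

text \<open>A basis is encoded as a set of functions, so passing from ray indices to
  \<open>range psi\<close> requires that no two rays share a function.\<close>

lemma inj_psi: "inj psi"
proof (rule injI)
  fix \<alpha> \<gamma> assume "psi \<alpha> = psi \<gamma>"
  then have "(\<lambda>\<delta>. if \<delta> = \<alpha> then 1 else 0) = (\<lambda>\<delta>. if \<delta> = \<gamma> then 1 else (0::complex))"
    by (intro psi_independent) (simp only: psi_delta)
  from fun_cong[OF this, of \<alpha>] show "\<alpha> = \<gamma>" by (simp split: if_splits)
qed

lemma nonresonance_basis_psi: "nonresonance_basis (real \<beta>) Ham (range psi)"
  unfolding nonresonance_basis_def eigen_cal_zero eigen_sf_zero
proof (intro conjI ballI allI impI)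
  have reindex: "(\<Sum>\<Psi>\<in>range psi. a \<Psi> *\<^sub>C \<Psi>) = (\<Sum>\<alpha>\<in>UNIV. a (psi \<alpha>) *\<^sub>C psi \<alpha>)" for a
    by (subst sum.reindex[OF inj_psi]) (simp only: o_def)
  show "finite (range psi)" by simp
  show "range psi \<subseteq> Etilde" using psi_Etilde by blast
  show "\<exists>a. \<Phi> - (\<Sum>\<Psi>\<in>range psi. a \<Psi> *\<^sub>C \<Psi>) \<in> {0}" if \<Phi>: "\<Phi> \<in> Etilde" for \<Phi>
  proof -
    obtain c where c: "\<Phi> = (\<Sum>\<alpha>\<in>UNIV. c \<alpha> *\<^sub>C psi \<alpha>)" by (rule Etilde_psi_sum[OF \<Phi>])
    have "\<Phi> - (\<Sum>\<Psi>\<in>range psi. c (inv psi \<Psi>) *\<^sub>C \<Psi>) = 0"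
      unfolding reindex inv_f_f[OF inj_psi] c by (simp only: diff_self)
    then show ?thesis by (intro exI[where x = "\<lambda>\<Psi>. c (inv psi \<Psi>)"]) (simp only: singleton_iff)
  qed
  show "a \<Psi> = 0" if a: "(\<Sum>\<Psi>\<in>range psi. a \<Psi> *\<^sub>C \<Psi>) \<in> {0}" and \<Psi>: "\<Psi> \<in> range psi" for a \<Psi>
  proof -
    have "(\<Sum>\<alpha>\<in>UNIV. a (psi \<alpha>) *\<^sub>C psi \<alpha>) = (\<Sum>\<alpha>\<in>UNIV. 0 *\<^sub>C psi \<alpha>)"
      using a unfolding reindex by (simp only: singleton_iff scaleC_zero_left sum.neutral_const)
    then have "(\<lambda>\<alpha>. a (psi \<alpha>)) = (\<lambda>_. 0)" by (rule psi_independent)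
    then show ?thesis using \<Psi> by (auto dest: fun_cong)
  qed
  show "(\<lambda>x. cnj (\<Psi> x) * \<Phi> x) \<in> l1_space 0" "pairing \<Psi> \<Phi> = 0" if "\<Psi> \<in> {0}" for \<Phi> \<Psi>
    using that by (auto simp: l1_space_def pairing_def)
  \<comment> \<open>The coefficients are attached to functions rather than to indices; by
    injectivity \<open>c (psi \<gamma>)\<close> is the unit vector of the ray \<gamma>.\<close>
  define c where "c \<Psi> \<alpha> = (if psi \<alpha> = \<Psi> then 1 else (0::complex))" for \<Psi> \<alpha>
  have cpsi: "c (psi \<gamma>) = (\<lambda>\<alpha>. if \<alpha> = \<gamma> then 1 else 0)" for \<gamma>
    unfolding c_def[abs_def] inj_eq[OF inj_psi] ..
  have "(\<Sum>\<alpha>\<in>UNIV. cnj (c \<Phi> \<alpha>) * c \<Psi> \<alpha>) = (if \<Phi> = \<Psi> then 1 else 0)"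
    if mem: "\<Phi> \<in> range psi" "\<Psi> \<in> range psi" for \<Phi> \<Psi>
  proof -
    obtain i where i: "\<Phi> = psi i" using mem(1) by (rule rangeE)
    obtain j where j: "\<Psi> = psi j" using mem(2) by (rule rangeE)
    note ij = i j
    have "(\<Sum>\<alpha>\<in>UNIV. cnj (c \<Phi> \<alpha>) * c \<Psi> \<alpha>) = (\<Sum>\<alpha>\<in>UNIV. if \<alpha> = i then (if i = j then 1 else 0) else 0)"
      unfolding ij cpsi by (intro sum.cong) auto
    also have "\<dots> = (if \<Phi> = \<Psi> then 1 else 0)" unfolding ij by (simp add: inj_eq[OF inj_psi])
    finally show ?thesis .
  qed
  moreover have "\<Psi> - (\<Sum>\<alpha>\<in>UNIV. c \<Psi> \<alpha> *\<^sub>C ray_lin \<alpha>) \<in> one_plus_l1 (real \<beta> - 2)"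
    if mem: "\<Psi> \<in> range psi" for \<Psi>
  proof -
    obtain j where j: "\<Psi> = psi j" using mem by (rule rangeE)
    show ?thesis using psi_sum_asymptotics[of "c \<Psi>"] unfolding j cpsi psi_delta .
  qed
  ultimately show "\<exists>c. (\<forall>\<Phi>\<in>range psi. \<forall>\<Psi>\<in>range psi.
        (\<Sum>\<alpha>\<in>UNIV. cnj (c \<Phi> \<alpha>) * c \<Psi> \<alpha>) = (if \<Phi> = \<Psi> then 1 else 0)) \<and>
      (\<forall>\<Psi>\<in>range psi. \<Psi> - (\<Sum>\<alpha>\<in>UNIV. c \<Psi> \<alpha> *\<^sub>C ray_lin \<alpha>) \<in> one_plus_l1 (real \<beta> - 2))"
    by (intro exI[of _ c] conjI ballI)
qed

text \<open>The growth coefficients of a non-resonance basis form an orthonormal basis of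
  \<open>\<complex>\<^sup>N\<close>, because the basis spans all of \<open>eigen_tilde\<close>.\<close>

lemma nonresonance_projection_eq:
  assumes B: "nonresonance_basis (real \<beta>) Ham B" and u: "u \<in> L1"
  shows "nonresonance_projection B u = (\<Sum>\<alpha>\<in>UNIV. pairing (psi \<alpha>) u *\<^sub>C psi \<alpha>)"
proof -
  have fin: "finite B" and sub: "B \<subseteq> Etilde"
    and span: "\<And>\<Phi>. \<Phi> \<in> Etilde \<Longrightarrow> \<exists>a. \<Phi> - (\<Sum>\<Psi>\<in>B. a \<Psi> *\<^sub>C \<Psi>) \<in> {0}"
    using B unfolding nonresonance_basis_def eigen_cal_zero by blast+
  obtain c :: "('a, 'n) gfun \<Rightarrow> 'n \<Rightarrow> complex"
    where orth: "\<And>\<Phi> \<Psi>. \<Phi> \<in> B \<Longrightarrow> \<Psi> \<in> B \<Longrightarrow> (\<Sum>\<alpha>\<in>UNIV. cnj (c \<Phi> \<alpha>) * c \<Psi> \<alpha>) = (if \<Phi> = \<Psi> then 1 else 0)"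
      and as: "\<And>\<Psi>. \<Psi> \<in> B \<Longrightarrow> \<Psi> - (\<Sum>\<alpha>\<in>UNIV. c \<Psi> \<alpha> *\<^sub>C ray_lin \<alpha>) \<in> one_plus_l1 (real \<beta> - 2)"
    using B unfolding nonresonance_basis_def by blast
  have rep: "\<Psi> = (\<Sum>\<alpha>\<in>UNIV. c \<Psi> \<alpha> *\<^sub>C psi \<alpha>)" if "\<Psi> \<in> B" for \<Psi>
    by (rule Etilde_eq_psi_sum[OF _ as[OF that]]) (use that sub in blast)
  \<comment> \<open>The completeness relation dual to \<open>orth\<close>: it holds because every
    \<open>psi \<alpha>\<close> lies in the span of \<open>B\<close>, with coefficients forced by
    orthonormality.\<close>
  have delta: "(\<Sum>\<Psi>\<in>B. cnj (c \<Psi> \<alpha>) * c \<Psi> \<gamma>) = (if \<gamma> = \<alpha> then 1 else 0)" for \<alpha> \<gamma>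
  proof -
    obtain a where "psi \<alpha> - (\<Sum>\<Psi>\<in>B. a \<Psi> *\<^sub>C \<Psi>) \<in> {0}" using span[OF psi_Etilde] by blast
    then have "psi \<alpha> = (\<Sum>\<Psi>\<in>B. a \<Psi> *\<^sub>C \<Psi>)" by (simp only: singleton_iff right_minus_eq)
    also have "\<dots> = (\<Sum>\<Psi>\<in>B. a \<Psi> *\<^sub>C (\<Sum>\<gamma>\<in>UNIV. c \<Psi> \<gamma> *\<^sub>C psi \<gamma>))"
      using rep by (intro sum.cong refl arg_cong[where f = "scaleC _"])
    also have "\<dots> = (\<Sum>\<gamma>\<in>UNIV. \<Sum>\<Psi>\<in>B. a \<Psi> *\<^sub>C c \<Psi> \<gamma> *\<^sub>C psi \<gamma>)"
      unfolding scaleC_sum_right by (rule sum.swap)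
    also have "\<dots> = (\<Sum>\<gamma>\<in>UNIV. (\<Sum>\<Psi>\<in>B. a \<Psi> * c \<Psi> \<gamma>) *\<^sub>C psi \<gamma>)"
      unfolding scaleC_sum_left scaleC_scaleC ..
    finally have "(\<Sum>\<gamma>\<in>UNIV. (if \<gamma> = \<alpha> then 1 else 0) *\<^sub>C psi \<gamma>) =
        (\<Sum>\<gamma>\<in>UNIV. (\<Sum>\<Psi>\<in>B. a \<Psi> * c \<Psi> \<gamma>) *\<^sub>C psi \<gamma>)" by (simp only: psi_delta)
    then have "(\<lambda>\<gamma>. if \<gamma> = \<alpha> then 1 else 0) = (\<lambda>\<gamma>. \<Sum>\<Psi>\<in>B. a \<Psi> * c \<Psi> \<gamma>)" by (rule psi_independent)
    then have d: "(\<Sum>\<Psi>\<in>B. a \<Psi> * c \<Psi> \<gamma>) = (if \<gamma> = \<alpha> then 1 else 0)" for \<gamma> by metis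
    \<comment> \<open>Pairing the coordinate vector of \<open>psi \<alpha>\<close> with that of
      \<Phi> isolates the coefficient of \<Phi>.\<close>
    have "a \<Phi> = cnj (c \<Phi> \<alpha>)" if \<Phi>: "\<Phi> \<in> B" for \<Phi>
    proof -
      have "cnj (c \<Phi> \<alpha>) = (\<Sum>\<gamma>\<in>UNIV. cnj (c \<Phi> \<gamma>) * (if \<gamma> = \<alpha> then 1 else 0))"
        by (simp add: if_distrib cong: if_cong)
      also have "\<dots> = (\<Sum>\<gamma>\<in>UNIV. \<Sum>\<Psi>\<in>B. cnj (c \<Phi> \<gamma>) * (a \<Psi> * c \<Psi> \<gamma>))"
        unfolding d[symmetric] sum_distrib_left ..
      also have "\<dots> = (\<Sum>\<Psi>\<in>B. \<Sum>\<gamma>\<in>UNIV. cnj (c \<Phi> \<gamma>) * (a \<Psi> * c \<Psi> \<gamma>))" by (rule sum.swap)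
      also have "\<dots> = (\<Sum>\<Psi>\<in>B. a \<Psi> * (\<Sum>\<gamma>\<in>UNIV. cnj (c \<Phi> \<gamma>) * c \<Psi> \<gamma>))"
        by (simp add: sum_distrib_left mult_ac)
      also have "\<dots> = (\<Sum>\<Psi>\<in>B. if \<Psi> = \<Phi> then a \<Phi> else 0)"
        by (intro sum.cong refl) (use orth[OF \<Phi>] in auto)
      also have "\<dots> = a \<Phi>" using \<Phi> fin by simp
      finally show ?thesis by simp
    qed
    then have "(\<Sum>\<Psi>\<in>B. cnj (c \<Psi> \<alpha>) * c \<Psi> \<gamma>) = (\<Sum>\<Psi>\<in>B. a \<Psi> * c \<Psi> \<gamma>)" by (intro sum.cong) auto
    then show ?thesis unfolding d .
  qed
  have pair: "pairing \<Psi> u = (\<Sum>\<alpha>\<in>UNIV. cnj (c \<Psi> \<alpha>) * pairing (psi \<alpha>) u)" if "\<Psi> \<in> B" for \<Psi>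
  proof -
    have "pairing \<Psi> u = pairing (\<Sum>\<alpha>\<in>UNIV. c \<Psi> \<alpha> *\<^sub>C psi \<alpha>) u" using rep[OF that] by (rule arg_cong)
    also have "\<dots> = (\<Sum>\<alpha>\<in>UNIV. pairing (c \<Psi> \<alpha> *\<^sub>C psi \<alpha>) u)"
      by (rule pairing_sum_left[OF u]) (rule seminormed_spaceD(4)[OF snLinf psi_mem])
    finally show ?thesis by (simp only: pairing_scaleC_left)
  qed
  have "nonresonance_projection B u =
      (\<Sum>\<Psi>\<in>B. (\<Sum>\<alpha>\<in>UNIV. cnj (c \<Psi> \<alpha>) * pairing (psi \<alpha>) u) *\<^sub>C (\<Sum>\<gamma>\<in>UNIV. c \<Psi> \<gamma> *\<^sub>C psi \<gamma>))"
    unfolding nonresonance_projection_def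
  proof (rule sum.cong[OF refl])
    fix \<Psi> assume \<Psi>: "\<Psi> \<in> B"
    show "pairing \<Psi> u *\<^sub>C \<Psi> =
        (\<Sum>\<alpha>\<in>UNIV. cnj (c \<Psi> \<alpha>) * pairing (psi \<alpha>) u) *\<^sub>C (\<Sum>\<gamma>\<in>UNIV. c \<Psi> \<gamma> *\<^sub>C psi \<gamma>)"
      unfolding pair[OF \<Psi>] by (rule arg_cong[OF rep[OF \<Psi>]])
  qed
  also have "\<dots> = (\<Sum>\<Psi>\<in>B. \<Sum>\<alpha>\<in>UNIV. \<Sum>\<gamma>\<in>UNIV. (pairing (psi \<alpha>) u * (cnj (c \<Psi> \<alpha>) * c \<Psi> \<gamma>)) *\<^sub>C psi \<gamma>)"
    unfolding scaleC_sum_left unfolding scaleC_sum_right scaleC_scaleC by (simp only: mult_ac)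
  also have "\<dots> = (\<Sum>\<alpha>\<in>UNIV. \<Sum>\<Psi>\<in>B. \<Sum>\<gamma>\<in>UNIV. (pairing (psi \<alpha>) u * (cnj (c \<Psi> \<alpha>) * c \<Psi> \<gamma>)) *\<^sub>C psi \<gamma>)"
    by (rule sum.swap)
  also have "\<dots> = (\<Sum>\<alpha>\<in>UNIV. \<Sum>\<gamma>\<in>UNIV. \<Sum>\<Psi>\<in>B. (pairing (psi \<alpha>) u * (cnj (c \<Psi> \<alpha>) * c \<Psi> \<gamma>)) *\<^sub>C psi \<gamma>)"
    by (intro sum.cong refl sum.swap)
  also have "\<dots> = (\<Sum>\<alpha>\<in>UNIV. \<Sum>\<gamma>\<in>UNIV. pairing (psi \<alpha>) u *\<^sub>C ((if \<gamma> = \<alpha> then 1 else 0) *\<^sub>C psi \<gamma>))"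
    unfolding scaleC_sum_left[symmetric] sum_distrib_left[symmetric] delta scaleC_scaleC ..
  also have "\<dots> = (\<Sum>\<alpha>\<in>UNIV. pairing (psi \<alpha>) u *\<^sub>C psi \<alpha>)"
    unfolding scaleC_sum_right[symmetric] psi_delta ..
  finally show ?thesis .
qed

text \<open>Symmetry of \<open>N\<close> and \<open>green\<close> moves \<open>W0\<close> across the
  pairing, where it becomes \<open>P0\<close> acting on n^(\<alpha>), that is
  \<open>psi \<alpha>\<close>; the outer \<open>P0\<close> turns the other factor n^(\<alpha>) into
  \<open>psi \<alpha>\<close> as well.\<close>

lemma coeff1_eq:
  assumes u: "u \<in> L1"
  shows "P0 (first (W0 u)) = - (\<Sum>\<alpha>\<in>UNIV. pairing (psi \<alpha>) u *\<^sub>C psi \<alpha>)"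
proof -
  have pair: "pairing (ray_lin \<alpha>) (W0 u) = pairing (psi \<alpha>) u" for \<alpha>
  proof -
    define \<phi> where "\<phi> = N (vs (ray_lin \<alpha>))"
    have "pairing (ray_lin \<alpha>) (v (N (vs (green u)))) = cinner (vs (ray_lin \<alpha>)) (N (vs (green u)))"
      by (simp only: vs_cinner[OF ray_lin_mem])
    also have "\<dots> = cinner \<phi> (vs (green u))" by (simp only: \<phi>_def N_symmetric)
    also have "\<dots> = cnj (cinner (vs (green u)) \<phi>)" by (rule cinner_commute)
    also have "\<dots> = cnj (pairing (green u) (v \<phi>))" by (simp only: vs_cinner[OF green_mem[OF u]])
    also have "\<dots> = pairing (v \<phi>) (green u)" by (rule pairing_commute[symmetric])
    also have "\<dots> = pairing (green (v \<phi>)) u" by (rule green_symmetric[OF v_mem u, symmetric])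
    finally have eq: "pairing (ray_lin \<alpha>) (v (N (vs (green u)))) = pairing (green (v \<phi>)) u" .
    have "pairing (ray_lin \<alpha>) (W0 u) = pairing (ray_lin \<alpha>) u - pairing (green (v \<phi>)) u"
      unfolding W0_def eq[symmetric] by (rule pairing_diff_right[OF ray_lin_mem u v_mem])
    also have "\<dots> = pairing (psi \<alpha>) u"
      unfolding psi_def P0_def \<phi>_def by (rule pairing_diff_left[OF ray_lin_mem green_mem[OF v_mem] u, symmetric])
    finally show ?thesis .
  qed
  have mem: "pairing (psi \<alpha>) u *\<^sub>C ray_lin \<alpha> \<in> Linf" for \<alpha>
    by (rule seminormed_spaceD(4)[OF snLinf ray_lin_mem])
  have "first (W0 u) = - (\<Sum>\<alpha>\<in>UNIV. pairing (psi \<alpha>) u *\<^sub>C ray_lin \<alpha>)"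
    unfolding kernel_op_first_kernel pair ..
  then have "P0 (first (W0 u)) = - P0 (\<Sum>\<alpha>\<in>UNIV. pairing (psi \<alpha>) u *\<^sub>C ray_lin \<alpha>)"
    using linear_on_minus[OF P0_linear seminormed_space_sum[OF snLinf mem]] by simp
  also have "P0 (\<Sum>\<alpha>\<in>UNIV. pairing (psi \<alpha>) u *\<^sub>C ray_lin \<alpha>) = (\<Sum>\<alpha>\<in>UNIV. P0 (pairing (psi \<alpha>) u *\<^sub>C ray_lin \<alpha>))"
    by (rule linear_on_sum[OF snLinf P0_linear mem])
  also have "\<dots> = (\<Sum>\<alpha>\<in>UNIV. pairing (psi \<alpha>) u *\<^sub>C psi \<alpha>)"
    unfolding psi_def linear_onD(2)[OF P0_linear ray_lin_mem] ..
  finally show ?thesis .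
qed

end

text \<open>The two existence clauses ensure that the clauses quantified over expansions and bases
  are not vacuous.\<close>

theorem theoremB2:
  fixes E0 :: "('a::finite \<times> 'a) set"
    and att :: "'n::finite \<Rightarrow> 'a"
    and v :: "'k::complex_hilbert \<Rightarrow> ('a, 'n) gfun"
    and U :: "'k \<Rightarrow> 'k"
    and V :: "('a, 'n) gfun \<Rightarrow> ('a, 'n) gfun"
    and \<beta> :: nat
  assumes "sym E0" and "irrefl E0" and "\<forall>x y. (x, y) \<in> E0\<^sup>*"
    and "\<beta> \<ge> 2"
    and "perturbation (real \<beta>) V v U"
    and "regular_threshold (real \<beta>) (hamiltonian E0 att V)"
  shows "(\<exists>G. resolvent_expansion \<beta> (hamiltonian E0 att V) G)
    \<and> (\<exists>B. nonresonance_basis (real \<beta>) (hamiltonian E0 att V) B)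
    \<and> (\<forall>B B'. nonresonance_basis (real \<beta>) (hamiltonian E0 att V) B \<longrightarrow>
          nonresonance_basis (real \<beta>) (hamiltonian E0 att V) B' \<longrightarrow>
          (\<forall>u\<in>l1_space (real \<beta>).
             nonresonance_projection B u = nonresonance_projection B' u))
    \<and> (\<forall>G. resolvent_expansion \<beta> (hamiltonian E0 att V) G \<longrightarrow>
          (\<forall>u\<in>l1_space (real \<beta>).
             G 0 u = free_green E0 att u
               - free_green E0 att
                   (v (pseudo_inverse (M0 E0 att v U) (dual_adjoint v (free_green E0 att u))))) \<and>
          (\<beta> \<ge> 3 \<longrightarrow>
             (\<forall>B. nonresonance_basis (real \<beta>) (hamiltonian E0 att V) B \<longrightarrow>
                (\<forall>u\<in>l1_space (real \<beta>). G 1 u = - nonresonance_projection B u))))"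
proof -
  interpret regular_perturbation E0 att v U V \<beta>
    using assms by unfold_locales auto
  have "nonresonance_projection B u = nonresonance_projection B' u"
    if "nonresonance_basis (real \<beta>) Ham B" "nonresonance_basis (real \<beta>) Ham B'" "u \<in> L1" for B B' u
    using that by (simp only: nonresonance_projection_eq)
  moreover have "G 0 u = free_green E0 att u
      - free_green E0 att (v (pseudo_inverse M (vs (free_green E0 att u))))"
    if "resolvent_expansion \<beta> Ham G" "u \<in> L1" for G u
    unfolding expansion_coefficients(1)[OF that] coeff0_def pseudo_inverse_M free_green_eq ..
  moreover have "G 1 u = - nonresonance_projection B u"
    if "resolvent_expansion \<beta> Ham G" "3 \<le> \<beta>" "nonresonance_basis (real \<beta>) Ham B" "u \<in> L1" for G B u
    using expansion_coefficients(2)[OF that(1,4,2)] coeff1_eq[OF that(4)]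
      nonresonance_projection_eq[OF that(3,4)] by (simp only:)
  ultimately show ?thesis
    using resolvent_expansion_exists nonresonance_basis_psi by blast
qed

end
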